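(* Let $s_0>\tfrac12$, let $p\ge1$ be an integer, and suppose the kernel $\beta$ satisfies the ellipticity condition $0<C_1\le\widehat\beta(\xi)\le C_2$ for all $\xi\in\mathbb{R}$, for some constants $C_1,C_2$. Let $D>3$, $P>P_{\min}$ where $$P_{\min}=3+\frac{D}{D-3}\big(\sqrt3+\sqrt{2D}\big)^2,$$ and let $s\ge s_0+3$. Let $(u_0^\epsilon,w_0^\epsilon)$ be a family, indexed by the small parameter $\epsilon>0$, that is bounded in $H^{s+P}\times H^{s+P}$. Then there exist some $\epsilon_0>0$, $T>0$ and a unique family $(u^\epsilon)_{0<\epsilon<\epsilon_0}$ bounded in $C\big([0,\tfrac{T}{\epsilon^p}];H^{s+D}\big)\cap C^1\big([0,\tfrac{T}{\epsilon^p}];H^{s+D-1}\big)$ and such that for each $\epsilon\in(0,\epsilon_0)$ the function $u=u^\epsilon$ satisfies $$u_{tt}=\beta*\big(u+\epsilon^pu^{p+1}\big)_{xx},\qquad x\in\mathbb{R},\ t\in[0,\tfrac{T}{\epsilon^p}],$$ with initial values $u(x,0)=u_0^\epsilon(x)$, $u_t(x,0)=\big(w_0^\epsilon(x)\big)_x$.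
   Context: $H^s=H^s(\mathbb{R})$ is the $L^2$-based Sobolev space with norm $\|u\|_{H^s}=\big(\int_{\mathbb{R}}(1+\xi^2)^s|\widehat u(\xi)|^2d\xi\big)^{1/2}$, where $\widehat u(\xi)=\int_{\mathbb{R}}u(x)e^{-i\xi x}dx$; functions are real-valued. The kernel $\beta$ is an integrable function on $\mathbb{R}$ or more generally a finite measure on $\mathbb{R}$, and $*$ denotes convolution in $x$. A family indexed by $\epsilon$ is bounded in a normed space (possibly depending on $\epsilon$) if each member lies in the space and the norms are bounded uniformly in $\epsilon$; for the initial data the index $\epsilon$ ranges over some interval of positive numbers with left endpoint $0$. The norm on $C([0,T/\epsilon^p];H^{s+D})\cap C^1([0,T/\epsilon^p];H^{s+D-1})$ is $\sup_{t\in[0,T/\epsilon^p]}\big(\|u(t)\|_{H^{s+D}}+\|u_t(t)\|_{H^{s+D-1}}\big)$. The time $T$ does not depend on $\epsilon$. *)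

theory Defs
  imports "HOL-Analysis.Analysis" "HOL-Probability.Characteristic_Functions"
begin

text \<open>
  The Fourier transform with kernel \<open>exp (- \<i> \<xi> x)\<close> on square integrable functions. As the
  defining integral need not converge absolutely, \<open>g\<close> is the transform of \<open>u\<close> if the transforms
  of the truncations of \<open>u\<close> to \<open>{-R..R}\<close> tend to \<open>g\<close> in the square mean (Plancherel). The
  transform is determined up to a null set.
\<close>

definition has_fourier_transform :: "(real \<Rightarrow> real) \<Rightarrow> (real \<Rightarrow> complex) \<Rightarrow> bool" where
  "has_fourier_transform u g \<longleftrightarrow>
     g \<in> borel_measurable borel \<and>
     integrable lborel (\<lambda>\<xi>. (cmod (g \<xi>))\<^sup>2) \<and>
     ((\<lambda>R. \<integral>\<^sup>+\<xi>. ennreal ((cmod ((LINT x:{-R..R}|lborel.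
               complex_of_real (u x) * exp (- \<i> * complex_of_real (\<xi> * x))) - g \<xi>))\<^sup>2) \<partial>lborel)
       \<longlongrightarrow> 0) at_top"

definition fourier :: "(real \<Rightarrow> real) \<Rightarrow> real \<Rightarrow> complex" where
  "fourier u = (SOME g. has_fourier_transform u g)"

definition sobolev_norm :: "real \<Rightarrow> (real \<Rightarrow> real) \<Rightarrow> real" where
  "sobolev_norm r u = sqrt (LINT \<xi>|lborel. (1 + \<xi>\<^sup>2) powr r * (cmod (fourier u \<xi>))\<^sup>2)"

text \<open>
  For \<open>r > 1/2\<close> every class in the Sobolev space of order \<open>r\<close> contains exactly one continuous
  function, and we take that function as the element of the space. Equality of elements is then
  equality of functions, and for larger \<open>r\<close> the derivatives are classical ones. The definition is
  intended for \<open>r > 1/2\<close> only.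
\<close>

definition sobolev :: "real \<Rightarrow> (real \<Rightarrow> real) set" where
  "sobolev r = {u. continuous_on UNIV u \<and>
     integrable lborel (\<lambda>x. (u x)\<^sup>2) \<and>
     integrable lborel (\<lambda>\<xi>. (1 + \<xi>\<^sup>2) powr r * (cmod (fourier u \<xi>))\<^sup>2)}"

text \<open>
  Functions of time and space are written \<open>u t x\<close>. The time derivative on \<open>{0..a}\<close> is one-sided
  at the endpoints.
\<close>

definition time_deriv :: "real \<Rightarrow> (real \<Rightarrow> real \<Rightarrow> real) \<Rightarrow> real \<Rightarrow> real \<Rightarrow> real" where
  "time_deriv a u t x = vector_derivative (\<lambda>\<tau>. u \<tau> x) (at t within {0..a})"

definition C0_sobolev :: "real \<Rightarrow> real \<Rightarrow> (real \<Rightarrow> real \<Rightarrow> real) set" where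
  "C0_sobolev a r = {u. \<forall>t\<in>{0..a}. u t \<in> sobolev r \<and>
     ((\<lambda>\<tau>. sobolev_norm r (\<lambda>x. u \<tau> x - u t x)) \<longlongrightarrow> 0) (at t within {0..a})}"

text \<open>
  The derivative of a \<open>C\<^sup>1\<close> curve is the limit of the difference quotients in the Sobolev norm.
  Convergence in that norm implies uniform convergence in \<open>x\<close>, so that the limit can only be
  the pointwise time derivative.
\<close>

definition C1_sobolev :: "real \<Rightarrow> real \<Rightarrow> (real \<Rightarrow> real \<Rightarrow> real) set" where
  "C1_sobolev a r = {u. u \<in> C0_sobolev a r \<and> time_deriv a u \<in> C0_sobolev a r \<and>
     (\<forall>t\<in>{0..a}.
        ((\<lambda>\<tau>. sobolev_norm r (\<lambda>x. (u \<tau> x - u t x) / (\<tau> - t) - time_deriv a u t x)) \<longlongrightarrow> 0)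
          (at t within {0..a}))}"

definition C0_C1_norm :: "real \<Rightarrow> real \<Rightarrow> (real \<Rightarrow> real \<Rightarrow> real) \<Rightarrow> real" where
  "C0_C1_norm a r u =
     (SUP t\<in>{0..a}. sobolev_norm r (u t) + sobolev_norm (r - 1) (time_deriv a u t))"

text \<open>
  A finite signed Borel measure is given by a pair \<open>(\<mu>, \<nu>)\<close> of finite measures, standing for
  \<open>\<mu> - \<nu>\<close>; by the Jordan decomposition every finite signed measure is of this form. An integrable
  function \<open>b\<close> is the pair of the measures with densities \<open>max b 0\<close> and \<open>max (- b) 0\<close>.
\<close>

type_synonym kernel = "real measure \<times> real measure"

definition is_kernel :: "kernel \<Rightarrow> bool" where
  "is_kernel \<beta> \<longleftrightarrow> finite_measure (fst \<beta>) \<and> sets (fst \<beta>) = sets borel \<and>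
                  finite_measure (snd \<beta>) \<and> sets (snd \<beta>) = sets borel"

text \<open>The library's \<^const>\<open>char\<close> has \<open>exp (\<i> \<xi> x)\<close> as its kernel, hence the sign.\<close>

definition kernel_fourier :: "kernel \<Rightarrow> real \<Rightarrow> complex" where
  "kernel_fourier \<beta> \<xi> = char (fst \<beta>) (- \<xi>) - char (snd \<beta>) (- \<xi>)"

definition kernel_conv :: "kernel \<Rightarrow> (real \<Rightarrow> real) \<Rightarrow> real \<Rightarrow> real" where
  "kernel_conv \<beta> f x = (LINT y|fst \<beta>. f (x - y)) - (LINT y|snd \<beta>. f (x - y))"

definition elliptic :: "kernel \<Rightarrow> real \<Rightarrow> real \<Rightarrow> bool" where
  "elliptic \<beta> C1 C2 \<longleftrightarrow> 0 < C1 \<and>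
     (\<forall>\<xi>. kernel_fourier \<beta> \<xi> \<in> \<real> \<and> C1 \<le> Re (kernel_fourier \<beta> \<xi>) \<and> Re (kernel_fourier \<beta> \<xi>) \<le> C2)"

definition solves_nonlocal_wave ::
    "kernel \<Rightarrow> nat \<Rightarrow> real \<Rightarrow> real \<Rightarrow> (real \<Rightarrow> real \<Rightarrow> real) \<Rightarrow> bool" where
  "solves_nonlocal_wave \<beta> p \<epsilon> a u \<longleftrightarrow>
     (\<forall>x. \<forall>t\<in>{0..a}.
        ((\<lambda>\<tau>. time_deriv a u \<tau> x) has_real_derivative
           kernel_conv \<beta> (deriv (deriv (\<lambda>y. u t y + \<epsilon> ^ p * u t y ^ (p + 1)))) x)
          (at t within {0..a}))"

text \<open>
  Families \<open>u \<epsilon> t x\<close> of solutions for \<open>0 < \<epsilon> < \<epsilon>0\<close>, bounded in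
  \<open>C([0, T / \<epsilon>^p]; H^r) \<inter> C\<^sup>1([0, T / \<epsilon>^p]; H^(r-1))\<close>.
\<close>

definition bounded_solution_family ::
    "kernel \<Rightarrow> nat \<Rightarrow> real \<Rightarrow> (real \<Rightarrow> real \<Rightarrow> real) \<Rightarrow> (real \<Rightarrow> real \<Rightarrow> real) \<Rightarrow> real \<Rightarrow> real \<Rightarrow>
     (real \<Rightarrow> real \<Rightarrow> real \<Rightarrow> real) \<Rightarrow> bool" where
  "bounded_solution_family \<beta> p r u0 w0 \<epsilon>0 T u \<longleftrightarrow>
     (\<forall>\<epsilon>\<in>{0<..<\<epsilon>0}. u \<epsilon> \<in> C0_sobolev (T / \<epsilon> ^ p) r \<inter> C1_sobolev (T / \<epsilon> ^ p) (r - 1)) \<and>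
     (\<exists>M. \<forall>\<epsilon>\<in>{0<..<\<epsilon>0}. C0_C1_norm (T / \<epsilon> ^ p) r (u \<epsilon>) \<le> M) \<and>
     (\<forall>\<epsilon>\<in>{0<..<\<epsilon>0}.
        solves_nonlocal_wave \<beta> p \<epsilon> (T / \<epsilon> ^ p) (u \<epsilon>) \<and>
        (\<forall>x. u \<epsilon> 0 x = u0 \<epsilon> x) \<and>
        (\<forall>x. time_deriv (T / \<epsilon> ^ p) (u \<epsilon>) 0 x = deriv (w0 \<epsilon>) x))"

end

theory Submission
 imports Defs "HOL-Probability.Sinc_Integral"
begin

text \<open>
 With \<open>\<delta> = \<epsilon>\<^sup>p\<close>, \<open>K = \<beta> *\<close> and \<open>F u = u + \<delta> u\<^bsup>p+1\<^esup>\<close> the equation is the first order system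
 \<open>u\<^sub>t = K v\<^sub>x\<close>, \<open>v\<^sub>t = (F u)\<^sub>x\<close>, where \<open>K v = w\<^sub>0\<close> at time \<open>0\<close>. As \<open>K\<close> is symmetric and coercive,
 \<open>\<langle>K v, v\<rangle> + \<langle>F' u u, u\<rangle>\<close>, summed over the spatial derivatives of \<open>u\<close> and \<open>v\<close>, grows at a rate proportional
 to \<open>\<delta>\<close> as long as it is bounded, whence the life span of order \<open>1 / \<delta>\<close>. Derivatives are lost only in the
 inversion of \<open>K\<close> on the initial data and in the comparison below; at most 9 derivatives are spent, fewer than \<open>P - D\<close>.
 Solutions are limits of the explicit Euler scheme with centred differences of width \<open>h\<close> and time steps
 \<open>\<tau> \<le> \<delta> h\<^sup>2\<close>, for which the same energy estimate holds uniformly in \<open>h\<close>. Sequences that satisfy the scheme up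
 to small errors stay close to it in \<open>L\<^sup>2\<close>. Applied to two grids this shows convergence; applied to the samples of an
 arbitrary solution it shows uniqueness.
\<close>

section \<open>Square integrable functions\<close>

text \<open>The condition \<open>\<tau> \<le> \<delta> * h\<^sup>2\<close> is what makes an explicit
  scheme usable over times of order 1 / \<delta>. A centred difference is bounded only by 1 / h, so
  the square of one step adds about (\<tau> / h)^2 times the energy, and the condition turns this
  into \<tau> \<delta>, the rate of the nonlinear terms. All iterates exist trivially and keep the
  order of the data, so no local existence theory precedes the energy estimate. Uniformity in
  \<epsilon> is demanded of the energy bound alone: the constants that compare two grids may depend
  on \<epsilon>, since for fixed \<epsilon> they only serve to let h tend to 0. The scheme works
  with sums of L2 norms of classical derivatives of integer order. The Fourier transform enters in
  two places: symmetry and coercivity of \<open>K\<close>, which rest on its symbol being real and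
  bounded below, and the comparison of these norms with Sobolev norms of real order. As the
  transform is given as a limit over truncations, Plancherel's theorem is first proved for it in
  that form.\<close>

definition sq :: "(real => real) => bool" where
 "sq f \<longleftrightarrow> f \<in> borel_measurable borel \<and> integrable lborel (\<lambda>x. (f x)\<^sup>2)"

definition ip :: "(real => real) => (real => real) => real" where
 "ip f g = (LINT x|lborel. f x * g x)"

definition nm :: "(real => real) => real" where
 "nm f = sqrt (LINT x|lborel. (f x)\<^sup>2)"

lemma nm_nonneg [simp]: "0 \<le> nm f"
 by (simp add: nm_def)

lemma nm_squared: "(nm f)\<^sup>2 = (LINT x|lborel. (f x)\<^sup>2)"
 by (simp add: nm_def)

lemma ip_self: "ip f f = (nm f)\<^sup>2"
 unfolding nm_squared ip_def by (simp add: power2_eq_square)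

lemma ip_commute: "ip f g = ip g f"
 by (simp add: ip_def mult.commute)

lemma sq_measurable [measurable_dest]: "sq f ==> f \<in> borel_measurable borel"
 by (simp add: sq_def)

lemma sq_measurable_lborel [measurable_dest]: "sq f ==> f \<in> borel_measurable lborel"
 by (simp add: sq_def)

lemma sq_integrable: "sq f ==> integrable lborel (\<lambda>x. (f x)\<^sup>2)"
 by (simp add: sq_def)

lemma sq_integrable_mult:
 assumes f: "sq f" and g: "sq g"
 shows "integrable lborel (\<lambda>x. f x * g x)"
proof (rule Bochner_Integration.integrable_bound)
 show "integrable lborel (\<lambda>x. (f x)\<^sup>2 + (g x)\<^sup>2)"
  using f g by (simp add: sq_def)
 show "(\<lambda>x. f x * g x) \<in> borel_measurable lborel"
  using f g by measurable
 have "\<bar>f x * g x\<bar> \<le> (f x)\<^sup>2 + (g x)\<^sup>2" for x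
 proof -
  have "0 \<le> (f x + g x)\<^sup>2" "0 \<le> (f x - g x)\<^sup>2" by simp_all
  then have "2 * \<bar>f x * g x\<bar> \<le> (f x)\<^sup>2 + (g x)\<^sup>2"
   unfolding power2_sum power2_diff by linarith
  then show ?thesis by linarith
 qed
 then show "AE x in lborel. norm (f x * g x) \<le> norm ((f x)\<^sup>2 + (g x)\<^sup>2)"
  by (intro AE_I2) (simp add: order_trans)
qed

lemma sq_bounded_mult:
 assumes f: "sq f" and b: "b \<in> borel_measurable borel" and B: "!!x. \<bar>b x\<bar> \<le> B"
 shows "sq (\<lambda>x. b x * f x)" "nm (\<lambda>x. b x * f x) \<le> B * nm f"
proof -
 have B0: "0 \<le> B" using B[of 0] by linarith
 have le: "(b x * f x)\<^sup>2 \<le> B\<^sup>2 * (f x)\<^sup>2" for x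
  using B[of x] by (simp add: power_mult_distrib mult_right_mono abs_le_square_iff[symmetric])
 show s: "sq (\<lambda>x. b x * f x)"
  unfolding sq_def
 proof
  show "(\<lambda>x. b x * f x) \<in> borel_measurable borel"
   using borel_measurable_times[OF b sq_measurable[OF f]] .
  then show "integrable lborel (\<lambda>x. (b x * f x)\<^sup>2)"
   using f le by (intro Bochner_Integration.integrable_bound[of lborel "\<lambda>x. B\<^sup>2 * (f x)\<^sup>2" "\<lambda>x. (b x * f x)\<^sup>2"]
     AE_I2) (simp_all add: sq_def)
 qed
 have "(LINT x|lborel. (b x * f x)\<^sup>2) \<le> (LINT x|lborel. B\<^sup>2 * (f x)\<^sup>2)"
  by (rule integral_mono[OF sq_integrable[OF s] integrable_mult_right[OF sq_integrable[OF f]] le])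
 then have "(nm (\<lambda>x. b x * f x))\<^sup>2 \<le> (B * nm f)\<^sup>2"
  unfolding power_mult_distrib nm_squared by simp
 then show "nm (\<lambda>x. b x * f x) \<le> B * nm f"
  by (rule power2_le_imp_le) (simp add: B0)
qed

lemma sq_cmult [simp, intro]: "sq f ==> sq (\<lambda>x. c * f x)"
 using sq_bounded_mult(1)[of f "\<lambda>_. c" "\<bar>c\<bar>"] by simp

lemma nm_cmult: "nm (\<lambda>x. c * f x) = \<bar>c\<bar> * nm f"
 by (simp add: nm_def power_mult_distrib real_sqrt_mult)

lemma nm_uminus [simp]: "nm (\<lambda>x. - f x) = nm f"
 by (simp add: nm_def)

lemma nm_minus_commute: "nm (\<lambda>x. f x - g x) = nm (\<lambda>x. g x - f x)"
 by (simp add: nm_def power2_commute)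

lemma sq_add [simp, intro]:
 assumes f: "sq f" and g: "sq g"
 shows "sq (\<lambda>x. f x + g x)"
 using borel_measurable_add[OF sq_measurable[OF f] sq_measurable[OF g]]
  sq_integrable[OF f] sq_integrable[OF g] sq_integrable_mult[OF f g]
 unfolding sq_def by (simp add: power2_sum mult.assoc)

lemma sq_diff [simp, intro]: "sq f ==> sq g ==> sq (\<lambda>x. f x - g x)"
 using sq_add[of f "\<lambda>x. (-1) * g x"] sq_cmult[of g "-1"] by simp

lemma sq_uminus [simp, intro]: "sq f ==> sq (\<lambda>x. - f x)"
 using sq_cmult[of f "-1"] by simp

lemma sq_zero [simp, intro]: "sq (\<lambda>x. 0)"
 by (simp add: sq_def)

lemma nm_zero [simp]: "nm (\<lambda>x. 0) = 0"
 by (simp add: nm_def)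

lemma ip_add_left: "sq f ==> sq g ==> sq h ==> ip (\<lambda>x. f x + g x) h = ip f h + ip g h"
 by (simp add: ip_def distrib_right sq_integrable_mult)

lemma ip_diff_left: "sq f ==> sq g ==> sq h ==> ip (\<lambda>x. f x - g x) h = ip f h - ip g h"
 by (simp add: ip_def left_diff_distrib sq_integrable_mult)

lemma ip_cmult_left: "ip (\<lambda>x. c * f x) h = c * ip f h"
 by (simp add: ip_def mult.assoc)

lemma ip_add_right: "sq f ==> sq g ==> sq h ==> ip h (\<lambda>x. f x + g x) = ip h f + ip h g"
 by (simp add: ip_commute[of h] ip_add_left)

lemma ip_diff_right: "sq f ==> sq g ==> sq h ==> ip h (\<lambda>x. f x - g x) = ip h f - ip h g"
 by (simp add: ip_commute[of h] ip_diff_left)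

lemma ip_cmult_right: "ip h (\<lambda>x. c * f x) = c * ip h f"
 by (simp add: ip_commute[of h] ip_cmult_left)

lemmas ip_linear = ip_add_left ip_diff_left ip_cmult_left ip_add_right ip_diff_right ip_cmult_right

lemma nm_add_squared:
 "sq f ==> sq g ==> (nm (\<lambda>x. f x + g x))\<^sup>2 = (nm f)\<^sup>2 + 2 * ip f g + (nm g)\<^sup>2"
 by (simp add: ip_self[symmetric] ip_linear ip_commute[of g f])

abbreviation ndist :: "(real => real) => (real => real) => real" where
 "ndist f g \<equiv> nm (\<lambda>x. f x - g x)"

lemma nm_eq_0_AE: "sq f ==> nm f = 0 ==> AE x in lborel. f x = 0"
 using integral_nonneg_eq_0_iff_AE[of lborel "\<lambda>x. (f x)\<^sup>2"]
 by (simp add: nm_def sq_def)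

text \<open>The squared norm of \<open>f\<close> minus its projection on \<open>g\<close> is
  nonnegative. If \<open>nm g = 0\<close> there is no projection, but then \<open>g\<close> vanishes
  almost everywhere and so does the product.\<close>

lemma Cauchy_Schwarz_ip:
 assumes f: "sq f" and g: "sq g"
 shows "\<bar>ip f g\<bar> \<le> nm f * nm g"
proof (cases "nm g = 0")
 case True
 have "ip f g = (LINT x|(lborel :: real measure). 0)"
  unfolding ip_def
 proof (rule Bochner_Integration.integral_cong_AE)
  show "(\<lambda>x. f x * g x) \<in> borel_measurable lborel" using f g by measurable
  show "AE x in lborel. f x * g x = 0" using nm_eq_0_AE[OF g True] by eventually_elim simp
 qed simp
 then show ?thesis using True by simp
next
 case False
 define c where "c = ip f g / (nm g)\<^sup>2"
 have s: "sq (\<lambda>x. - c * g x)" using g by blast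
 have "0 \<le> (nm (\<lambda>x. f x + (- c * g x)))\<^sup>2" by simp
 also have "... = (nm f)\<^sup>2 - 2 * c * ip f g + c\<^sup>2 * (nm g)\<^sup>2"
  by (simp only: nm_add_squared[OF f s] ip_cmult_right nm_cmult) (simp add: power_mult_distrib)
 also have "... = (nm f)\<^sup>2 - (ip f g)\<^sup>2 / (nm g)\<^sup>2"
  using False by (simp add: c_def field_simps power2_eq_square)
 finally have "(ip f g)\<^sup>2 \<le> (nm f * nm g)\<^sup>2"
  using False by (simp add: divide_simps power_mult_distrib split: if_splits)
 then show ?thesis
  by (metis abs_le_square_iff abs_of_nonneg mult_nonneg_nonneg nm_nonneg)
qed

lemma nm_triangle:
 assumes f: "sq f" and g: "sq g"
 shows "nm (\<lambda>x. f x + g x) \<le> nm f + nm g"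
proof (rule power2_le_imp_le)
 show "(nm (\<lambda>x. f x + g x))\<^sup>2 \<le> (nm f + nm g)\<^sup>2"
  using Cauchy_Schwarz_ip[OF f g] by (simp add: nm_add_squared[OF f g] power2_sum)
qed simp

lemma nm_triangle_diff:
 "sq f ==> sq g ==> ndist f g \<le> nm f + nm g"
 using nm_triangle[of f "\<lambda>x. - g x"] by simp

lemma nm_diff_le:
 assumes "sq f" "sq g"
 shows "\<bar>nm f - nm g\<bar> \<le> ndist f g"
 using nm_triangle[of "\<lambda>x. f x - g x" g] nm_triangle[of "\<lambda>x. g x - f x" f] assms
 by (simp add: nm_minus_commute[of g f] sq_diff)

lemma nm_mono:
 assumes g: "sq g" and f: "f \<in> borel_measurable borel" and le: "!!x. \<bar>f x\<bar> \<le> \<bar>g x\<bar>"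
 shows "sq f" "nm f \<le> nm g"
proof -
 have le2: "(f x)\<^sup>2 \<le> (g x)\<^sup>2" for x using le[of x] by (simp add: abs_le_square_iff)
 show s: "sq f"
  using f g le2 unfolding sq_def
  by (auto intro!: Bochner_Integration.integrable_bound[of lborel "\<lambda>x. (g x)\<^sup>2" "\<lambda>x. (f x)\<^sup>2"])
 show "nm f \<le> nm g"
  unfolding nm_def using s g le2 by (auto simp: sq_def intro!: integral_mono)
qed

lemma sq_shift:
 assumes "sq f" shows "sq (\<lambda>x. f (x + c))" "nm (\<lambda>x. f (x + c)) = nm f"
proof -
 have "integrable lborel (\<lambda>x. (f (c + 1 * x))\<^sup>2)"
  using assms lborel_integrable_real_affine[of "\<lambda>x. (f x)\<^sup>2" 1 c] by (simp add: sq_def)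
 moreover have [measurable]: "f \<in> borel_measurable borel" using assms by (simp add: sq_def)
 have "(\<lambda>x. f (x + c)) \<in> borel_measurable borel"
  by measurable
 ultimately show "sq (\<lambda>x. f (x + c))"
  by (simp add: sq_def add.commute)
 show "nm (\<lambda>x. f (x + c)) = nm f"
  unfolding nm_def
  using lborel_integral_real_affine[of 1 "\<lambda>x. (f x)\<^sup>2" c] by (simp add: add.commute)
qed

lemma ip_shift: "ip (\<lambda>x. f (x + c)) g = ip f (\<lambda>x. g (x - c))"
 unfolding ip_def
 using lborel_integral_real_affine[of 1 "\<lambda>x. f x * g (x - c)" c] by (simp add: add.commute)

text \<open>Fatou's lemma transfers norm bounds to pointwise limits without any convergence in norm.
  Most limits below obtain their square integrability in this way.\<close>

lemma nm_Fatou: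
 assumes f: "!!n::nat. sq (f n)" and M: "!!n. nm (f n) \<le> M"
  and lim: "!!x. (\<lambda>n. f n x) \<longlonglongrightarrow> g x"
 shows "sq g" "nm g \<le> M"
proof -
 have M0: "0 \<le> M" using M[of 0] nm_nonneg[of "f 0"] by linarith
 have [measurable]: "!!n. f n \<in> borel_measurable borel" using f by (simp add: sq_def)
 have g [measurable]: "g \<in> borel_measurable borel"
  using borel_measurable_LIMSEQ_real[of borel f g] lim by simp
 have e: "(\<integral>\<^sup>+x. ennreal ((f n x)\<^sup>2) \<partial>lborel) \<le> ennreal (M\<^sup>2)" for n
 proof -
  have "(\<integral>\<^sup>+x. ennreal ((f n x)\<^sup>2) \<partial>lborel) = ennreal ((nm (f n))\<^sup>2)"
   using f by (simp add: nn_integral_eq_integral sq_def nm_squared)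
  also have "... \<le> ennreal (M\<^sup>2)" using M by (intro ennreal_leI power_mono) auto
  finally show ?thesis .
 qed
 have "(\<integral>\<^sup>+x. ennreal ((g x)\<^sup>2) \<partial>lborel) = (\<integral>\<^sup>+x. liminf (\<lambda>n. ennreal ((f n x)\<^sup>2)) \<partial>lborel)"
 proof (rule nn_integral_cong)
  fix x
  have "(\<lambda>n. ennreal ((f n x)\<^sup>2)) \<longlonglongrightarrow> ennreal ((g x)\<^sup>2)"
   by (intro tendsto_intros lim)
  then show "ennreal ((g x)\<^sup>2) = liminf (\<lambda>n. ennreal ((f n x)\<^sup>2))"
   by (rule lim_imp_Liminf[OF sequentially_bot, symmetric])
 qed
 also have "... \<le> liminf (\<lambda>n. \<integral>\<^sup>+x. ennreal ((f n x)\<^sup>2) \<partial>lborel)"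
  by (intro nn_integral_liminf) measurable
 also have "... \<le> ennreal (M\<^sup>2)"
  using e by (metis (no_types, lifting) Liminf_le eventually_sequentiallyI order.trans
    sequentially_bot trivial_limit_sequentially)
 finally have le: "(\<integral>\<^sup>+x. ennreal ((g x)\<^sup>2) \<partial>lborel) \<le> ennreal (M\<^sup>2)" .
 then have i: "integrable lborel (\<lambda>x. (g x)\<^sup>2)"
  by (intro integrableI_bounded) (auto simp: le_less_trans)
 then show "sq g" by (simp add: sq_def)
 have "ennreal (LINT x|lborel. (g x)\<^sup>2) \<le> ennreal (M\<^sup>2)"
  using le i by (simp add: nn_integral_eq_integral)
 then have "(nm g)\<^sup>2 \<le> M\<^sup>2" by (simp add: nm_squared)
 then show "nm g \<le> M" using M0 by (rule power2_le_imp_le)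
qed

text \<open>For every \<open>e > 0\<close> a tail of the sequence is bounded by
  \<open>L + e\<close>, and the previous lemma applies to tails.\<close>

lemma nm_Fatou_tendsto:
 assumes f: "!!n::nat. sq (f n)" and M: "(\<lambda>n. M n) \<longlonglongrightarrow> L" "!!n. nm (f n) \<le> M n"
  and lim: "!!x. (\<lambda>n. f n x) \<longlonglongrightarrow> g x"
 shows "sq g" "nm g \<le> L"
proof -
 have ev: "sq g \<and> nm g \<le> L + e" if e: "e > 0" for e
 proof -
  obtain n0 where n0: "!!n. n \<ge> n0 ==> M n < L + e"
   using order_tendstoD(2)[OF M(1), of "L + e"] e by (auto simp: eventually_sequentially)
  have n: "nm (f (n + n0)) \<le> L + e" for n using M(2)[of "n + n0"] n0[of "n + n0"] by simp
  have l: "(\<lambda>n. f (n + n0) x) \<longlonglongrightarrow> g x" for x using lim[of x] LIMSEQ_ignore_initial_segment by fast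
  show ?thesis using nm_Fatou[of "\<lambda>n. f (n + n0)" "L + e" g, OF f n l] by simp
 qed
 show "sq g" using ev[of 1] by simp
 show "nm g \<le> L" by (rule field_le_epsilon) (use ev in blast)
qed

text \<open>Jensen's inequality for the square. Integrating the square of \<open>m * f - I\<close>
  instead of \<open>f - I / m\<close> avoids a division by the total mass.\<close>

lemma (in finite_measure) square_integral_le:
 fixes f :: "'a => real"
 assumes f: "integrable M f" and f2: "integrable M (\<lambda>x. (f x)\<^sup>2)"
 shows "(\<integral>x. f x \<partial>M)\<^sup>2 \<le> measure M (space M) * (\<integral>x. (f x)\<^sup>2 \<partial>M)"
proof -
 define m I where "m = measure M (space M)" and "I = (\<integral>x. f x \<partial>M)"
 show ?thesis
 proof (cases "m = 0")
  case True
  then have "emeasure M (space M) = 0" by (simp add: m_def emeasure_eq_measure)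
  then have "AE x in M. f x = 0" by (intro AE_I[of _ _ "space M"]) auto
  then have "I = 0" unfolding I_def using integral_cong_AE[of f M "\<lambda>_. 0"] f by simp
  then show ?thesis by (simp add: I_def[symmetric])
 next
  case False
  then have m: "m > 0" by (simp add: m_def zero_less_measure_iff)
  have "0 \<le> (\<integral>x. (m * f x - I)\<^sup>2 \<partial>M)" by simp
  also have "... = (\<integral>x. m\<^sup>2 * (f x)\<^sup>2 - (2 * m * I) * f x + I\<^sup>2 \<partial>M)"
   by (intro Bochner_Integration.integral_cong refl) (simp add: power2_diff power_mult_distrib)
  also have "... = m\<^sup>2 * (\<integral>x. (f x)\<^sup>2 \<partial>M) - (2 * m * I) * I + m * I\<^sup>2"
   using f f2 by (simp add: m_def I_def)
  also have "... = m * (m * (\<integral>x. (f x)\<^sup>2 \<partial>M) - I\<^sup>2)"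
   by (simp add: algebra_simps power2_eq_square)
  finally show ?thesis using m by (simp add: zero_le_mult_iff m_def I_def)
 qed
qed

text \<open>A weak form of Minkowski's integral inequality with one bound \<open>w\<close> for all
  fibres: \<open>square_integral_le\<close> under the integral, then Tonelli. It is applied to
  Lebesgue measure on an interval in the mean value inequality and to the measures of the kernel in
  convolutions.\<close>

lemma nm_integral_le:
 fixes \<psi> :: "'a => real => real"
 assumes fin: "finite_measure M"
  and [measurable]: "case_prod \<psi> \<in> borel_measurable (M \<Otimes>\<^sub>M borel)"
  and \<psi>: "!!t. t \<in> space M ==> sq (\<psi> t)" "!!t. t \<in> space M ==> nm (\<psi> t) \<le> w"
  and int: "!!x. integrable M (\<lambda>t. \<psi> t x)" "!!x. integrable M (\<lambda>t. (\<psi> t x)\<^sup>2)"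
  and w: "0 \<le> w"
 shows "sq (\<lambda>x. \<integral>t. \<psi> t x \<partial>M)" "nm (\<lambda>x. \<integral>t. \<psi> t x \<partial>M) \<le> measure M (space M) * w"
proof -
 interpret finite_measure M by (rule fin)
 have psf: "pair_sigma_finite M (lborel :: real measure)"
  by (rule pair_sigma_finite.intro[OF sigma_finite_measure_axioms sigma_finite_lborel])
 define m where "m = measure M (space M)"
 have m: "0 \<le> m" by (simp add: m_def)
 define \<phi> where "\<phi> x = (\<integral>t. \<psi> t x \<partial>M)" for x
 have mb [measurable]: "(\<lambda>(x, t). \<psi> t x) \<in> borel_measurable (borel \<Otimes>\<^sub>M M)"
  using measurable_pair_swap[OF assms(2)] by (simp add: case_prod_beta)
 have ms [measurable]: "\<phi> \<in> borel_measurable borel"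
  unfolding \<phi>_def by (rule sigma_finite_measure.borel_measurable_lebesgue_integral[OF _ mb]) unfold_locales
 have e1: "ennreal ((\<phi> x)\<^sup>2) \<le> ennreal m * (\<integral>\<^sup>+t. ennreal ((\<psi> t x)\<^sup>2) \<partial>M)" for x
 proof -
  have "ennreal ((\<phi> x)\<^sup>2) \<le> ennreal (m * (\<integral>t. (\<psi> t x)\<^sup>2 \<partial>M))"
   unfolding \<phi>_def m_def using int by (intro ennreal_leI square_integral_le)
  also have "... = ennreal m * (\<integral>\<^sup>+t. ennreal ((\<psi> t x)\<^sup>2) \<partial>M)"
   using int m by (simp add: nn_integral_eq_integral ennreal_mult)
  finally show ?thesis .
 qed
 have "(\<integral>\<^sup>+x. (\<integral>\<^sup>+t. ennreal ((\<psi> t x)\<^sup>2) \<partial>M) \<partial>lborel)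
   = (\<integral>\<^sup>+t. (\<integral>\<^sup>+x. ennreal ((\<psi> t x)\<^sup>2) \<partial>lborel) \<partial>M)"
  by (rule pair_sigma_finite.Fubini'[OF psf]) measurable
 also have "... \<le> (\<integral>\<^sup>+t. ennreal (w\<^sup>2) \<partial>M)"
 proof (rule nn_integral_mono)
  fix t assume t: "t \<in> space M"
  have "(\<integral>\<^sup>+x. ennreal ((\<psi> t x)\<^sup>2) \<partial>lborel) = ennreal ((nm (\<psi> t))\<^sup>2)"
   using \<psi>(1)[OF t] by (simp add: nn_integral_eq_integral sq_def nm_squared)
  also have "... \<le> ennreal (w\<^sup>2)" using \<psi>(2)[OF t] by (intro ennreal_leI power_mono) auto
  finally show "(\<integral>\<^sup>+x. ennreal ((\<psi> t x)\<^sup>2) \<partial>lborel) \<le> ennreal (w\<^sup>2)" .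
 qed
 also have "... = ennreal (w\<^sup>2) * ennreal m" by (simp add: m_def emeasure_eq_measure)
 finally have inner: "(\<integral>\<^sup>+x. (\<integral>\<^sup>+t. ennreal ((\<psi> t x)\<^sup>2) \<partial>M) \<partial>lborel)
   \<le> ennreal (w\<^sup>2) * ennreal m" .
 have mb2 [measurable]: "(\<lambda>x. \<integral>\<^sup>+t. ennreal ((\<psi> t x)\<^sup>2) \<partial>M) \<in> borel_measurable lborel"
  by measurable
 have "(\<integral>\<^sup>+x. ennreal ((\<phi> x)\<^sup>2) \<partial>lborel)
   \<le> (\<integral>\<^sup>+x. ennreal m * (\<integral>\<^sup>+t. ennreal ((\<psi> t x)\<^sup>2) \<partial>M) \<partial>lborel)"
  by (intro nn_integral_mono e1)
 also have "... = ennreal m * (\<integral>\<^sup>+x. (\<integral>\<^sup>+t. ennreal ((\<psi> t x)\<^sup>2) \<partial>M) \<partial>lborel)"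
  by (rule nn_integral_cmult[OF mb2])
 also have "... \<le> ennreal m * (ennreal (w\<^sup>2) * ennreal m)"
  by (rule mult_left_mono[OF inner]) simp
 also have "... = ennreal ((m * w)\<^sup>2)"
  using m w by (simp add: ennreal_mult[symmetric] power2_eq_square ac_simps)
 finally have le: "(\<integral>\<^sup>+x. ennreal ((\<phi> x)\<^sup>2) \<partial>lborel) \<le> ennreal ((m * w)\<^sup>2)" .
 then have i: "integrable lborel (\<lambda>x. (\<phi> x)\<^sup>2)"
  by (intro integrableI_bounded) (auto simp: le_less_trans)
 then show "sq (\<lambda>x. \<integral>t. \<psi> t x \<partial>M)"
  using ms unfolding sq_def \<phi>_def by simp
 have "(nm \<phi>)\<^sup>2 \<le> (m * w)\<^sup>2"
  using le i by (simp add: nn_integral_eq_integral nm_squared)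
 then show "nm (\<lambda>x. \<integral>t. \<psi> t x \<partial>M) \<le> measure M (space M) * w"
  unfolding \<phi>_def[symmetric] m_def[symmetric] by (rule power2_le_imp_le) (simp add: m w)
qed

text \<open>The fundamental theorem of calculus at each \<open>x\<close>, then
  \<open>nm_integral_le\<close> for Lebesgue measure on \<open>{a..b}\<close>. The lemma controls
  shifts, difference quotients and increments in time alike.\<close>

lemma nm_mean_value:
 fixes \<phi> \<psi> :: "real => real => real"
 assumes ab: "a \<le> b"
  and der: "!!t x. t \<in> {a..b} ==> ((\<lambda>s. \<phi> s x) has_real_derivative \<psi> t x) (at t within {a..b})"
  and cont: "continuous_on ({a..b} \<times> UNIV) (\<lambda>(t, x). \<psi> t x)"
  and \<psi>: "!!t. t \<in> {a..b} ==> sq (\<psi> t)" "!!t. t \<in> {a..b} ==> nm (\<psi> t) \<le> w"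
 shows "sq (\<lambda>x. \<phi> b x - \<phi> a x)" "ndist (\<phi> b) (\<phi> a) \<le> (b - a) * w"
proof -
 define M where "M = restrict_space lborel {a..b}"
 have fin: "finite_measure M"
  unfolding M_def using emeasure_lborel_Icc[OF ab]
  by (intro finite_measureI) (simp add: emeasure_restrict_space space_restrict_space)
 have w: "0 \<le> w" using order_trans[OF nm_nonneg \<psi>(2)[of a]] ab by simp
 have sp: "space M = {a..b}" by (simp add: M_def space_restrict_space)
 have mm: "measure M (space M) = b - a"
  unfolding sp M_def using ab by (simp add: measure_restrict_space)
 have contx: "continuous_on {a..b} (\<lambda>t. \<psi> t x)" for x
 proof -
  have "continuous_on {a..b} ((\<lambda>(t, x). \<psi> t x) \<circ> (\<lambda>t. (t, x)))"
   by (rule continuous_on_compose[OF _ continuous_on_subset[OF cont]])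
    (auto intro!: continuous_intros)
  then show ?thesis by (simp add: o_def)
 qed
 have contcx: "continuous_on {a..b} (\<lambda>t. \<psi> (max a (min b t)) x)" for x
  by (rule continuous_on_compose2[OF contx]) (use ab in \<open>auto intro!: continuous_intros\<close>)
 have i: "integrable M (\<lambda>t. g t)" if "continuous_on {a..b} g" for g :: "real => real"
  using borel_integrable_compact[of "{a..b}" g] that unfolding M_def
  by (simp add: integrable_restrict_space indicator_scaleR_eq_if[symmetric] 
    set_integrable_def real_scaleR_def)
 \<comment> \<open>Clamping the time to \<open>{a..b}\<close> extends \<open>\<psi>\<close>
   continuously to the whole plane, which yields joint measurability.\<close>
 define c where "c t = max a (min b t)" for t
 have c: "c t \<in> {a..b}" "t \<in> {a..b} ==> c t = t" for t using ab by (auto simp: c_def)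
 have "continuous_on UNIV ((\<lambda>(t, x). \<psi> t x) \<circ> (\<lambda>(t, x). (c t, x)))"
  by (rule continuous_on_compose[OF _ continuous_on_subset[OF cont]])
   (use c in \<open>auto simp: case_prod_beta c_def intro!: continuous_intros\<close>)
 then have "(\<lambda>(t, x). \<psi> (c t) x) \<in> borel_measurable (borel \<Otimes>\<^sub>M borel)"
  by (simp add: borel_prod o_def case_prod_beta borel_measurable_continuous_onI)
 moreover have "(\<lambda>(t, x). (t, x)) \<in> (M \<Otimes>\<^sub>M borel) \<rightarrow>\<^sub>M (borel \<Otimes>\<^sub>M (borel :: real measure))"
  unfolding M_def case_prod_beta
  by (intro measurable_Pair measurable_compose[OF measurable_fst] measurable_restrict_space1) auto
 ultimately have "(\<lambda>(t, x). \<psi> (c t) x) \<circ> (\<lambda>(t, x). (t, x)) \<in> borel_measurable (M \<Otimes>\<^sub>M borel)"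
  by (rule measurable_comp[rotated])
 then have jm: "case_prod (\<lambda>t x. \<psi> (c t) x) \<in> borel_measurable (M \<Otimes>\<^sub>M borel)"
  by (simp add: o_def case_prod_beta)
 have eq: "(\<integral>t. \<psi> (c t) x \<partial>M) = \<phi> b x - \<phi> a x" for x
 proof -
  have "(\<integral>t. \<psi> (c t) x \<partial>M) = (\<integral>t. \<psi> t x \<partial>M)"
   by (intro Bochner_Integration.integral_cong refl) (simp add: sp c)
  also have "(\<integral>t. \<psi> t x \<partial>M) = (\<integral>t. indicator {a..b} t *\<^sub>R \<psi> t x \<partial>lborel)"
   unfolding M_def by (rule integral_restrict_space) simp
  also have "... = \<phi> b x - \<phi> a x"
   using ab der contx
   by (intro integral_FTC_Icc) (auto simp: has_real_derivative_iff_has_vector_derivative)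
  finally show ?thesis .
 qed
 have i2: "integrable M (\<lambda>t. (\<psi> (c t) x)\<^sup>2)" for x
  using i[OF continuous_on_power[OF contcx[folded c_def]]] .
 show "sq (\<lambda>x. \<phi> b x - \<phi> a x)" "ndist (\<phi> b) (\<phi> a) \<le> (b - a) * w"
  using nm_integral_le[OF fin jm, of w] \<psi> c(1) w i contcx[folded c_def]
  unfolding mm eq by (auto simp: i2)
qed

section \<open>Functions with bounded square integrable derivatives\<close>

text \<open>The common domain of the operators below: continuity makes equality of functions
  pointwise, and boundedness lets convolution with a finite measure converge at every point.\<close>

definition bcl :: "(real => real) => bool" where
 "bcl f \<longleftrightarrow> continuous_on UNIV f \<and> bounded (range f) \<and> integrable lborel (\<lambda>x. (f x)\<^sup>2)"

text \<open>\<open>bsob k\<close> is a classical replacement for \<open>H\<^sup>k\<close>; \<open>deriv f\<close> is arbitrary where \<open>f\<close> is not differentiable.\<close>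

primrec bsob :: "nat => (real => real) => bool" where
 "bsob 0 f \<longleftrightarrow> bcl f"
| "bsob (Suc k) f \<longleftrightarrow> bcl f \<and> (\<forall>x. (f has_real_derivative deriv f x) (at x)) \<and> bsob k (deriv f)"

primrec bnorm :: "nat => (real => real) => real" where
 "bnorm 0 f = nm f"
| "bnorm (Suc k) f = nm f + bnorm k (deriv f)"

lemma bcl_sq: "bcl f ==> sq f"
 by (simp add: bcl_def sq_def borel_measurable_continuous_onI)

lemma bcl_continuous: "bcl f ==> continuous_on UNIV f"
 by (simp add: bcl_def)

lemma bcl_isCont: "bcl f ==> isCont f x"
 by (simp add: bcl_def continuous_on_eq_continuous_at)

lemma bcl_bound:
 assumes "bcl f" obtains B where "B > 0" "!!x. \<bar>f x\<bar> \<le> B"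
proof -
 obtain B where "!!x. \<bar>f x\<bar> \<le> B" using assms by (auto simp: bcl_def bounded_iff)
 then have "!!x. \<bar>f x\<bar> \<le> max B 1" by (meson le_max_iff_disj)
 then show thesis using that[of "max B 1"] by simp
qed

lemma bclI:
 assumes "continuous_on UNIV f" "!!x. \<bar>f x\<bar> \<le> B" "sq f"
 shows "bcl f"
 using assms by (auto simp: bcl_def sq_def bounded_iff)

lemma bcl_add [intro]:
 assumes "bcl f" "bcl g" shows "bcl (\<lambda>x. f x + g x)"
proof -
 obtain B where B: "!!x. \<bar>f x\<bar> \<le> B" using bcl_bound[OF assms(1)] by metis
 obtain C where C: "!!x. \<bar>g x\<bar> \<le> C" using bcl_bound[OF assms(2)] by metis
 show ?thesis
 proof (rule bclI)
  show "\<bar>f x + g x\<bar> \<le> B + C" for x using B[of x] C[of x] by linarith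
 qed (use assms in \<open>auto intro: continuous_on_add bcl_continuous sq_add bcl_sq\<close>)
qed

lemma bcl_mult [intro]:
 assumes "bcl f" "bcl g" shows "bcl (\<lambda>x. f x * g x)"
proof -
 obtain B where B: "!!x. \<bar>f x\<bar> \<le> B" using bcl_bound[OF assms(1)] by metis
 obtain C where C: "!!x. \<bar>g x\<bar> \<le> C" using bcl_bound[OF assms(2)] by metis
 show ?thesis
 proof (rule bclI)
  show "\<bar>f x * g x\<bar> \<le> B * C" for x
   using B[of x] C[of x] by (simp add: abs_mult mult_mono')
  show "sq (\<lambda>x. f x * g x)"
   by (rule sq_bounded_mult(1)[OF bcl_sq[OF assms(2)] sq_measurable[OF bcl_sq[OF assms(1)]] B])
 qed (rule continuous_on_mult[OF bcl_continuous[OF assms(1)] bcl_continuous[OF assms(2)]])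
qed

lemma bcl_cmult [intro]:
 assumes "bcl f" shows "bcl (\<lambda>x. c * f x)"
proof -
 obtain B where B: "!!x. \<bar>f x\<bar> \<le> B" using bcl_bound[OF assms(1)] by metis
 show ?thesis
 proof (rule bclI)
  show "\<bar>c * f x\<bar> \<le> \<bar>c\<bar> * B" for x
   using B[of x] by (simp add: abs_mult mult_left_mono)
 qed (auto intro!: continuous_on_mult continuous_on_const bcl_continuous[OF assms] sq_cmult bcl_sq[OF assms])
qed

lemma bcl_shift [intro]:
 assumes "bcl f" shows "bcl (\<lambda>x. f (x + c))"
proof -
 obtain B where B: "!!x. \<bar>f x\<bar> \<le> B" using bcl_bound[OF assms(1)] by metis
 show ?thesis
 proof (rule bclI)
  show "continuous_on UNIV (\<lambda>x. f (x + c))"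
   by (rule continuous_on_compose2[OF bcl_continuous[OF assms]]) (auto intro!: continuous_intros)
 qed (use B sq_shift(1)[OF bcl_sq[OF assms]] in auto)
qed

lemma bsob_bcl: "bsob k f ==> bcl f"
 by (cases k) auto

lemma bsob_sq: "bsob k f ==> sq f"
 using bsob_bcl bcl_sq by blast

lemma bsob_SucI:
 assumes "bcl f" "!!x. (f has_real_derivative g x) (at x)" "bsob k g"
 shows "bsob (Suc k) f" "deriv f = g" "bnorm (Suc k) f = nm f + bnorm k g"
proof -
 show d: "deriv f = g" using assms(2) by (auto intro!: DERIV_imp_deriv)
 show "bsob (Suc k) f" "bnorm (Suc k) f = nm f + bnorm k g" using assms by (auto simp: d)
qed

lemma bsob_SucD:
 assumes "bsob (Suc k) f"
 shows "bcl f" "(f has_real_derivative deriv f x) (at x)" "bsob k (deriv f)"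
 using assms by auto

lemma bnorm_nonneg [simp]: "0 \<le> bnorm k f"
 by (induction k arbitrary: f) auto

lemma bsob_Suc: "bsob (Suc k) f ==> bsob k f"
 by (induction k arbitrary: f) auto

lemma bnorm_Suc_mono: "bnorm k f \<le> bnorm (Suc k) f"
 by (induction k arbitrary: f) (auto simp del: bnorm.simps(2) simp: bnorm.simps)

lemma bsob_mono: "bsob k f ==> j \<le> k ==> bsob j f"
 by (induction k) (auto simp del: bsob.simps simp: le_Suc_eq dest: bsob_Suc)

lemma bnorm_mono: "j \<le> k ==> bnorm j f \<le> bnorm k f"
 by (rule lift_Suc_mono_le[of "\<lambda>k. bnorm k f"]) (rule bnorm_Suc_mono)

lemma nm_le_bnorm: "nm f \<le> bnorm k f"
 using bnorm_mono[of 0 k f] by simp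

lemma bnorm_deriv_le: "bnorm k (deriv f) \<le> bnorm (Suc k) f"
 by simp

lemma bsob_funpow:
 assumes "bsob (j + k) f"
 shows "bsob k ((deriv ^^ j) f)" "bnorm k ((deriv ^^ j) f) \<le> bnorm (j + k) f"
proof -
 have "bsob k ((deriv ^^ j) f) \<and> bnorm k ((deriv ^^ j) f) \<le> bnorm (j + k) f"
  using assms
 proof (induction j arbitrary: f)
  case (Suc j)
  have "bsob (j + k) (deriv f)" using Suc.prems by simp
  from Suc.IH[OF this] show ?case
   using bnorm_deriv_le[of "j + k" f] by (simp del: bnorm.simps funpow.simps add: funpow_Suc_right)
 qed simp
 then show "bsob k ((deriv ^^ j) f)" "bnorm k ((deriv ^^ j) f) \<le> bnorm (j + k) f" by auto
qed

lemma bnorm_sum: "bnorm k f = (\<Sum>j\<le>k. nm ((deriv ^^ j) f))"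
proof (induction k arbitrary: f)
 case (Suc k)
 show ?case
  by (subst sum.atMost_Suc_shift) (simp add: Suc.IH funpow_Suc_right del: funpow.simps(2))
qed simp

lemma bsob_add:
 assumes "bsob k f" "bsob k g"
 shows "bsob k (\<lambda>x. f x + g x)" "bnorm k (\<lambda>x. f x + g x) \<le> bnorm k f + bnorm k g"
proof -
 have "bsob k (\<lambda>x. f x + g x) \<and> bnorm k (\<lambda>x. f x + g x) \<le> bnorm k f + bnorm k g"
  using assms
 proof (induction k arbitrary: f g)
  case 0
  then show ?case by (auto intro: nm_triangle bcl_sq)
 next
  case (Suc k)
  have s: "bcl (\<lambda>x. f x + g x)" using Suc.prems by auto
  have d: "((\<lambda>x. f x + g x) has_real_derivative deriv f x + deriv g x) (at x)" for x
   using Suc.prems by (auto intro!: DERIV_add)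
  have i: "bsob k (\<lambda>x. deriv f x + deriv g x)"
    "bnorm k (\<lambda>x. deriv f x + deriv g x) \<le> bnorm k (deriv f) + bnorm k (deriv g)"
   using Suc.IH[of "deriv f" "deriv g"] Suc.prems by auto
  show ?case
   using bsob_SucI[OF s d i(1)] i(2) nm_triangle[of f g] Suc.prems
   by (auto simp: bcl_sq)
 qed
 then show "bsob k (\<lambda>x. f x + g x)" "bnorm k (\<lambda>x. f x + g x) \<le> bnorm k f + bnorm k g" by auto
qed

lemma deriv_add_bsob:
 "bsob (Suc k) f ==> bsob (Suc k) g ==> deriv (\<lambda>x. f x + g x) = (\<lambda>x. deriv f x + deriv g x)"
 by (auto intro!: DERIV_imp_deriv DERIV_add)

text \<open>Commuting with differentiation reduces every order to the L2 bound, with the same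
  constant. Multiples, difference quotients, convolution and the contraction behind the Neumann
  series are all treated by this one induction.\<close>

lemma bsob_operator:
 assumes T: "!!f. bcl f ==> bcl (T f)" "!!f. bcl f ==> nm (T f) \<le> C * nm f"
  and D: "!!f x. bcl f ==> bcl (deriv f) ==> (!!y. (f has_real_derivative deriv f y) (at y)) ==>
      (T f has_real_derivative T (deriv f) x) (at x)"
 shows "bsob k f ==> bsob k (T f)" "bsob k f ==> bnorm k (T f) \<le> C * bnorm k f"
  "bsob (Suc k) f ==> deriv (T f) = T (deriv f)"
proof -
 have d: "(T f has_real_derivative T (deriv f) x) (at x)" if "bsob (Suc k) f" for k f x
  using D[of f x] that bsob_bcl by auto
 show "deriv (T f) = T (deriv f)" if "bsob (Suc k) f" for k
  using d[OF that] by (auto intro!: DERIV_imp_deriv)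
 have *: "bsob k (T f) \<and> bnorm k (T f) \<le> C * bnorm k f" if "bsob k f"
  using that
 proof (induction k arbitrary: f)
  case 0
  then show ?case using T by simp
 next
  case (Suc k)
  have i: "bsob k (T (deriv f))" "bnorm k (T (deriv f)) \<le> C * bnorm k (deriv f)"
   using Suc by auto
  have t: "bcl (T f)" using Suc.prems T by simp
  show ?case
   using bsob_SucI[OF t d[OF Suc.prems] i(1)] i(2) T(2)[of f] Suc.prems by (auto simp: distrib_left)
 qed
 show "bsob k f ==> bsob k (T f)" "bsob k f ==> bnorm k (T f) \<le> C * bnorm k f" using * by auto
qed

lemma deriv_cmult_has:
 "(!!y. (f has_real_derivative deriv f y) (at y)) ==>
  ((\<lambda>x. c * f x) has_real_derivative c * deriv f x) (at x)" for c :: real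
 by (auto intro!: DERIV_cmult)

lemma bsob_cmult:
 shows "bsob k f ==> bsob k (\<lambda>x. c * f x)" "bsob k f ==> bnorm k (\<lambda>x. c * f x) \<le> \<bar>c\<bar> * bnorm k f"
  "bsob (Suc k) f ==> deriv (\<lambda>x. c * f x) = (\<lambda>x. c * deriv f x)"
 using bsob_operator[of "\<lambda>f x. c * f x" "\<bar>c\<bar>"] deriv_cmult_has bcl_cmult nm_cmult order_refl
 by auto

lemma bsob_uminus:
 "bsob k f ==> bsob k (\<lambda>x. - f x)" "bsob k f ==> bnorm k (\<lambda>x. - f x) \<le> bnorm k f"
 using bsob_cmult(1,2)[of k f "-1"] by simp_all

lemma bsob_diff:
 assumes "bsob k f" "bsob k g"
 shows "bsob k (\<lambda>x. f x - g x)" "bnorm k (\<lambda>x. f x - g x) \<le> bnorm k f + bnorm k g"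
 using bsob_add[of k f "\<lambda>x. - g x"] bsob_uminus[of k g] assms by auto

lemma bnorm_minus_commute:
 assumes "bsob k f" "bsob k g"
 shows "bnorm k (\<lambda>x. f x - g x) = bnorm k (\<lambda>x. g x - f x)"
 using bsob_uminus(2)[OF bsob_diff(1)[OF assms]] bsob_uminus(2)[OF bsob_diff(1)[OF assms(2,1)]]
 by simp

lemma bnorm_le_add_diff:
 assumes "bsob k f" "bsob k g"
 shows "bnorm k f \<le> bnorm k g + bnorm k (\<lambda>x. f x - g x)"
 using bsob_add(2)[OF assms(2) bsob_diff(1)[OF assms]] by simp

lemma bnorm_diff_triangle:
 assumes "bsob k f" "bsob k g" "bsob k h"
 shows "bnorm k (\<lambda>x. f x - h x) \<le> bnorm k (\<lambda>x. f x - g x) + bnorm k (\<lambda>x. g x - h x)"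
 using bsob_add(2)[OF bsob_diff(1)[OF assms(1,2)] bsob_diff(1)[OF assms(2,3)]] by simp

lemma deriv_diff_bsob:
 "bsob (Suc k) f ==> bsob (Suc k) g ==> deriv (\<lambda>x. f x - g x) = (\<lambda>x. deriv f x - deriv g x)"
 by (auto intro!: DERIV_imp_deriv DERIV_diff)

abbreviation bdist :: "nat => (real => real) => (real => real) => real" where
 "bdist k f g \<equiv> bnorm k (\<lambda>x. f x - g x)"

lemma bsob_zero [simp]: "bsob k (\<lambda>x. 0)" "bnorm k (\<lambda>x. 0) = 0"
proof -
 have d: "deriv (\<lambda>x::real. 0 :: real) = (\<lambda>x. 0)" by simp
 have b: "bcl (\<lambda>x. 0)" by (simp add: bcl_def)
 show "bsob k (\<lambda>x. 0)" by (induction k) (auto simp: d b)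
 show "bnorm k (\<lambda>x. 0) = 0" by (induction k) (auto simp: d)
qed

lemma bsob_sum:
 assumes "finite A" "!!i. i \<in> A ==> bsob k (f i)"
 shows "bsob k (\<lambda>x. \<Sum>i\<in>A. f i x)" "bnorm k (\<lambda>x. \<Sum>i\<in>A. f i x) \<le> (\<Sum>i\<in>A. bnorm k (f i))"
proof -
 have "bsob k (\<lambda>x. \<Sum>i\<in>A. f i x) \<and> bnorm k (\<lambda>x. \<Sum>i\<in>A. f i x) \<le> (\<Sum>i\<in>A. bnorm k (f i))"
  using assms
 proof (induction A rule: finite_induct)
  case (insert a A)
  then have "bsob k (\<lambda>x. \<Sum>i\<in>A. f i x)" "bsob k (f a)"
   "bnorm k (\<lambda>x. \<Sum>i\<in>A. f i x) \<le> (\<Sum>i\<in>A. bnorm k (f i))" by auto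
  then show ?case using insert.hyps bsob_add[of k "f a" "\<lambda>x. \<Sum>i\<in>A. f i x"] by simp
 qed simp
 then show "bsob k (\<lambda>x. \<Sum>i\<in>A. f i x)" "bnorm k (\<lambda>x. \<Sum>i\<in>A. f i x) \<le> (\<Sum>i\<in>A. bnorm k (f i))" by auto
qed

lemma nm_shift_diff:
 assumes "bsob (Suc 0) f"
 shows "nm (\<lambda>x. f (x + s) - f x) \<le> \<bar>s\<bar> * nm (deriv f)"
proof -
 have d: "bcl (deriv f)" using assms by simp
 have pos: "nm (\<lambda>x. f (x + s) - f x) \<le> s * nm (deriv f)" if s: "s \<ge> 0" for s
 proof -
  have "((\<lambda>s. f (x + s)) has_real_derivative deriv f (x + t)) (at t within {0..s})" for x t
   using bsob_SucD(2)[OF assms, of "t + x"] DERIV_shift[of f _ t x]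
   by (simp add: add.commute has_field_derivative_at_within)
  moreover have "continuous_on ({0..s} \<times> UNIV) (\<lambda>(t, x). deriv f (x + t))"
   unfolding case_prod_beta
   by (rule continuous_on_compose2[OF bcl_continuous[OF d]]) (auto intro!: continuous_intros)
  ultimately show ?thesis
   using nm_mean_value(2)[of 0 s "\<lambda>s x. f (x + s)" "\<lambda>s x. deriv f (x + s)" "nm (deriv f)"]
    s sq_shift[OF bcl_sq[OF d]] by simp
 qed
 show ?thesis
 proof (cases "s \<ge> 0")
  case True
  then show ?thesis using pos by simp
 next
  case False
  have sf: "sq (\<lambda>x. f (x + s) - f x)"
   by (intro sq_diff sq_shift(1) bsob_sq[OF assms])
  \<comment> \<open>Translation by \<open>- s\<close> exchanges the two terms and so turns a
    negative shift into a positive one.\<close>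
  have "nm (\<lambda>x. f (x + s) - f x) = nm (\<lambda>x. f (x + (- s)) - f x)"
   using sq_shift(2)[OF sf, of "- s"] by (simp add: nm_minus_commute)
  then show ?thesis using pos[of "- s"] False by simp
 qed
qed

section \<open>Centred difference quotients\<close>

definition cdiff :: "real => (real => real) => real => real" where
 "cdiff h f x = (f (x + h) - f (x - h)) / (2 * h)"

lemma bcl_cdiff [intro]: "bcl f ==> bcl (cdiff h f)"
proof -
 assume f: "bcl f"
 have "cdiff h f = (\<lambda>x. 1 / (2 * h) * (f (x + h) + (- 1) * f (x + (- h))))"
  by (auto simp: cdiff_def)
 moreover have "bcl (\<lambda>x. 1 / (2 * h) * (f (x + h) + (- 1) * f (x + (- h))))"
  using f by (intro bcl_cmult bcl_add bcl_shift)
 ultimately show ?thesis by simp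
qed

lemma nm_cdiff_le:
 assumes f: "sq f" and h: "h > 0"
 shows "nm (cdiff h f) \<le> 1 / h * nm f"
proof -
 have "cdiff h f = (\<lambda>x. 1 / (2 * h) * (f (x + h) - f (x + (- h))))" by (auto simp: cdiff_def)
 then have "nm (cdiff h f) = \<bar>1 / (2 * h)\<bar> * nm (\<lambda>x. f (x + h) - f (x + (- h)))"
  by (simp only: nm_cmult)
 also have "... \<le> \<bar>1 / (2 * h)\<bar> * (nm f + nm f)"
  using nm_triangle_diff[OF sq_shift(1)[OF f] sq_shift(1)[OF f], of h "- h"] h
  by (intro mult_left_mono) (simp_all only: sq_shift(2)[OF f] abs_ge_zero)
 finally show ?thesis using h by simp
qed

lemma cdiff_has_derivative:
 assumes "!!y. (f has_real_derivative f' y) (at y)"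
 shows "(cdiff h f has_real_derivative cdiff h f' x) (at x)"
proof -
 have "((\<lambda>x. f (x + h)) has_real_derivative f' (x + h)) (at x)"
  "((\<lambda>x. f (x + (- h))) has_real_derivative f' (x + (- h))) (at x)"
  using assms DERIV_shift by blast+
 then have "((\<lambda>x. (f (x + h) - f (x - h)) / (2 * h)) has_real_derivative
   (f' (x + h) - f' (x - h)) / (2 * h)) (at x)"
  by (auto intro!: DERIV_cdivide DERIV_diff)
 then show ?thesis by (simp add: cdiff_def[abs_def])
qed

lemma bsob_cdiff:
 assumes "h > 0"
 shows "bsob k f ==> bsob k (cdiff h f)" "bsob k f ==> bnorm k (cdiff h f) \<le> 1 / h * bnorm k f"
  "bsob (Suc k) f ==> deriv (cdiff h f) = cdiff h (deriv f)"
 using bsob_operator[of "cdiff h" "1 / h" k f, OF bcl_cdiff nm_cdiff_le[OF bcl_sq assms]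
   cdiff_has_derivative] by auto

text \<open>The path runs from \<open>- h\<close> to \<open>h\<close> along
  \<open>f (x + s) - s * (c * deriv f x)\<close>. With \<open>c = 0\<close> this bounds the quotient
  by the derivative, with \<open>c = 1\<close> it bounds the consistency error.\<close>

lemma cdiff_nm_mean_value:
 assumes f: "bsob (Suc 0) f" and h: "h > 0"
  and c: "!!s. s \<in> {-h..h} ==> nm (\<lambda>x. deriv f (x + s) - c * deriv f x) \<le> w"
 shows "nm (\<lambda>x. cdiff h f x - c * deriv f x) \<le> w"
proof -
 have d: "bcl (deriv f)" using f by simp
 have "((\<lambda>s. f (x + s) - s * (c * deriv f x)) has_real_derivative deriv f (x + t) - c * deriv f x)
   (at t within {-h..h})" for x t
  using bsob_SucD(2)[OF f, of "t + x"] DERIV_shift[of f _ t x]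
  by (auto intro!: derivative_eq_intros simp: add.commute has_field_derivative_at_within)
 moreover have "continuous_on ({-h..h} \<times> UNIV) (\<lambda>(t, x). deriv f (x + t) - c * deriv f x)"
  unfolding case_prod_beta
  by (intro continuous_intros continuous_on_compose2[OF bcl_continuous[OF d]]) auto
 moreover have "sq (\<lambda>x. deriv f (x + s) - c * deriv f x)" for s
  by (intro sq_diff sq_shift(1) sq_cmult bcl_sq d)
 ultimately have le: "nm (\<lambda>x. (f (x + h) - h * (c * deriv f x)) - (f (x + - h) - (- h) * (c * deriv f x)))
   \<le> (h - (- h)) * w"
  using nm_mean_value(2)[of "-h" h "\<lambda>s x. f (x + s) - s * (c * deriv f x)"
    "\<lambda>s x. deriv f (x + s) - c * deriv f x" w] h c by simp
 have "nm (\<lambda>x. cdiff h f x - c * deriv f x) = nm (\<lambda>x. 1 / (2 * h) *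
   ((f (x + h) - h * (c * deriv f x)) - (f (x + - h) - (- h) * (c * deriv f x))))"
  using h by (intro arg_cong[where f = nm] ext) (simp add: cdiff_def field_simps)
 also have "... \<le> \<bar>1 / (2 * h)\<bar> * ((h - (- h)) * w)"
  unfolding nm_cmult by (rule mult_left_mono[OF le]) simp
 finally show ?thesis using h by simp
qed

lemma nm_cdiff_le_deriv:
 assumes "bsob (Suc 0) f" "h > 0"
 shows "nm (cdiff h f) \<le> nm (deriv f)"
proof -
 have d: "sq (deriv f)" using assms bcl_sq by simp
 show ?thesis using cdiff_nm_mean_value[OF assms, of 0 "nm (deriv f)"] by (simp add: sq_shift(2)[OF d])
qed

text \<open>First order in \<open>h\<close>, although centred quotients are of second order: this
  spends only two derivatives, and any rate of convergence will do.\<close>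

lemma nm_cdiff_diff_le:
 assumes "bsob (Suc (Suc 0)) f" "h > 0"
 shows "ndist (cdiff h f) (deriv f) \<le> h * nm (deriv (deriv f))"
proof -
 have "nm (\<lambda>x. deriv f (x + s) - 1 * deriv f x) \<le> h * nm (deriv (deriv f))" if "s \<in> {-h..h}" for s
 proof -
  have "nm (\<lambda>x. deriv f (x + s) - deriv f x) \<le> \<bar>s\<bar> * nm (deriv (deriv f))"
   using nm_shift_diff[of "deriv f" s] assms by simp
  also have "... \<le> h * nm (deriv (deriv f))" using that by (intro mult_right_mono) auto
  finally show ?thesis by simp
 qed
 then show ?thesis using cdiff_nm_mean_value[of f h 1] assms bsob_Suc[of "Suc 0" f] by simp
qed

lemma bnorm_cdiff_le_deriv:
 assumes "bsob (Suc k) f" "h > 0"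
 shows "bnorm k (cdiff h f) \<le> bnorm k (deriv f)"
 using assms
proof (induction k arbitrary: f)
 case 0
 then show ?case using nm_cdiff_le_deriv[of f h] by simp
next
 case (Suc k)
 have "nm (cdiff h f) \<le> nm (deriv f)"
  using nm_cdiff_le_deriv[of f h] Suc.prems bsob_mono[of "Suc (Suc k)" f "Suc 0"] by simp
 moreover have "bnorm k (cdiff h (deriv f)) \<le> bnorm k (deriv (deriv f))"
  using Suc.IH[of "deriv f"] Suc.prems by simp
 moreover have "deriv (cdiff h f) = cdiff h (deriv f)" using Suc.prems bsob_cdiff(3) by blast
 ultimately show ?case by simp
qed

lemma bnorm_cdiff_le_Suc:
 assumes "bsob (Suc k) f" "h > 0"
 shows "bnorm k (cdiff h f) \<le> bnorm (Suc k) f"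
 using bnorm_cdiff_le_deriv[OF assms] bnorm_deriv_le[of k f] by linarith

lemma bnorm_cdiff_diff_le:
 assumes "bsob (Suc (Suc k)) f" "h > 0"
 shows "bdist k (cdiff h f) (deriv f) \<le> h * bnorm (Suc (Suc k)) f"
proof -
 have "bdist k (cdiff h f) (deriv f) \<le> h * bnorm k (deriv (deriv f))"
  using assms
 proof (induction k arbitrary: f)
  case 0
  then show ?case using nm_cdiff_diff_le[of f h] by simp
 next
  case (Suc k)
  have "ndist (cdiff h f) (deriv f) \<le> h * nm (deriv (deriv f))"
   using nm_cdiff_diff_le[of f h] Suc.prems bsob_mono[of "Suc (Suc (Suc k))" f "Suc (Suc 0)"] by simp
  moreover have "bdist k (cdiff h (deriv f)) (deriv (deriv f)) \<le> h * bnorm k (deriv (deriv (deriv f)))"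
   using Suc.IH[of "deriv f"] Suc.prems by simp
  moreover have "deriv (\<lambda>x. cdiff h f x - deriv f x) = (\<lambda>x. cdiff h (deriv f) x - deriv (deriv f) x)"
  proof -
   have f: "bsob (Suc (Suc k)) f" using Suc.prems(1) bsob_Suc by blast
   have "bsob (Suc k) (cdiff h f)" "bsob (Suc k) (deriv f)"
    using bsob_cdiff(1)[OF Suc.prems(2) bsob_Suc[OF f]] f by auto
   then have "deriv (\<lambda>x. cdiff h f x - deriv f x) = (\<lambda>x. deriv (cdiff h f) x - deriv (deriv f) x)"
    by (rule deriv_diff_bsob)
   then show ?thesis using bsob_cdiff(3)[OF Suc.prems(2) f] by simp
  qed
  ultimately show ?case by (simp add: distrib_left)
 qed
 also have "... \<le> h * bnorm (Suc (Suc k)) f"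
  using assms bnorm_deriv_le[of k "deriv f"] bnorm_deriv_le[of "Suc k" f]
  by (intro mult_left_mono) linarith+
 finally show ?thesis .
qed

text \<open>Summation by parts. This antisymmetry is the reason for centred quotients: the leading
  terms of the energy balance cancel at every \<open>h\<close>, up to a commutator with the
  coefficient.\<close>

lemma ip_cdiff:
 assumes f: "sq f" and g: "sq g"
 shows "ip (cdiff h f) g = - ip f (cdiff h g)"
proof -
 have s: "sq (\<lambda>x. f (x + c))" "sq (\<lambda>x. g (x + c))" for c using f g sq_shift by blast+
 have e: "cdiff h f = (\<lambda>x. 1 / (2 * h) * (f (x + h) - f (x + - h)))"
  "cdiff h g = (\<lambda>x. 1 / (2 * h) * (g (x + h) - g (x + - h)))" by (auto simp: cdiff_def)
 show ?thesis
  unfolding e ip_cmult_left ip_cmult_right ip_diff_left[OF s(1) s(1) g] ip_diff_right[OF s(2) s(2) f]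
  by (simp add: ip_shift[of f h] ip_shift[of f "- h", simplified] algebra_simps)
qed

text \<open>The fundamental theorem of calculus for \<open>(t - 1) * f (x + t)\<close> on
  \<open>{0..1}\<close> leaves exactly \<open>f x\<close>, since the weight is 0 at one end and -1
  at the other. Both terms of the integrand are then paired with functions of norm at most 1, which
  gives the embedding with constant 1.\<close>

lemma sup_le_bnorm:
 assumes f: "bsob (Suc 0) f"
 shows "\<bar>f x\<bar> \<le> bnorm (Suc 0) f"
proof -
 have s: "sq (\<lambda>t. f (x + t))" "sq (\<lambda>t. deriv f (x + t))"
  using sq_shift(1)[of _ x] f bcl_sq by (simp_all add: add.commute)
 have n: "nm (\<lambda>t. f (x + t)) = nm f" "nm (\<lambda>t. deriv f (x + t)) = nm (deriv f)"
  using sq_shift(2)[of _ x] f bcl_sq by (simp_all add: add.commute)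
 define i1 i2 :: "real => real" where
  "i1 = indicator {0..1}" and "i2 = (\<lambda>t. (t - 1) * indicator {0..1} t)"
 have si1: "sq i1" unfolding sq_def i1_def by (auto simp: power2_eq_square indicator_inter_arith[symmetric])
 have n1: "nm i1 = 1"
  unfolding nm_def i1_def by (simp add: power2_eq_square indicator_inter_arith[symmetric])
 have "\<bar>i2 t\<bar> \<le> \<bar>i1 t\<bar>" for t by (auto simp: i1_def i2_def indicator_def)
 then have si2: "sq i2" and n2: "nm i2 \<le> 1"
  using nm_mono[OF si1, of i2] n1 by (auto simp: i2_def)
 have "((\<lambda>t. (t - 1) * f (x + t)) has_real_derivative f (x + t) + (t - 1) * deriv f (x + t))
   (at t within {0..1})" for t
  using bsob_SucD(2)[OF f, of "t + x"] DERIV_shift[of f _ t x]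
  by (auto intro!: derivative_eq_intros simp: add.commute has_field_derivative_at_within)
 moreover have "continuous_on {0..1} (\<lambda>t. f (x + t) + (t - 1) * deriv f (x + t))"
  using f by (intro continuous_intros continuous_on_compose2[OF bcl_continuous[of f]]
    continuous_on_compose2[OF bcl_continuous[of "deriv f"]]) auto
 ultimately have "(LBINT t. indicator {0..1} t *\<^sub>R (f (x + t) + (t - 1) * deriv f (x + t)))
   = (1 - 1) * f (x + 1) - (0 - 1) * f (x + 0)"
  by (intro integral_FTC_Icc) (auto simp: has_real_derivative_iff_has_vector_derivative)
 moreover have "(LBINT t. indicator {0..1} t *\<^sub>R (f (x + t) + (t - 1) * deriv f (x + t)))
   = (LBINT t. f (x + t) * i1 t + deriv f (x + t) * i2 t)"
  by (intro Bochner_Integration.integral_cong refl) (simp add: i1_def i2_def algebra_simps)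
 moreover have "... = ip (\<lambda>t. f (x + t)) i1 + ip (\<lambda>t. deriv f (x + t)) i2"
  unfolding ip_def using s si1 si2
  by (intro Bochner_Integration.integral_add sq_integrable_mult)
 ultimately have "f x = ip (\<lambda>t. f (x + t)) i1 + ip (\<lambda>t. deriv f (x + t)) i2" by simp
 then have "\<bar>f x\<bar> \<le> \<bar>ip (\<lambda>t. f (x + t)) i1\<bar> + \<bar>ip (\<lambda>t. deriv f (x + t)) i2\<bar>" by linarith
 also have "... \<le> nm f * 1 + nm (deriv f) * nm i2"
  using Cauchy_Schwarz_ip[OF s(1) si1] Cauchy_Schwarz_ip[OF s(2) si2] n n1 by simp
 also have "... \<le> nm f * 1 + nm (deriv f) * 1"
  using n2 by (intro add_left_mono mult_left_mono) auto
 finally show ?thesis by simp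
qed

lemma sup_le_bnorm': "bsob k f ==> 1 \<le> k ==> \<bar>f x\<bar> \<le> bnorm k f"
 using sup_le_bnorm[of f x] bnorm_mono[of "Suc 0" k f] bsob_mono[of k f "Suc 0"] by fastforce

section \<open>Products and powers\<close>

lemma nm_mult_le:
 assumes "bsob m f" "1 \<le> m" "sq g"
 shows "nm (\<lambda>x. f x * g x) \<le> bnorm m f * nm g" "sq (\<lambda>x. f x * g x)"
 using sq_bounded_mult[OF assms(3) sq_measurable[OF bsob_sq[OF assms(1)]], of "bnorm m f"]
  sup_le_bnorm'[OF assms(1,2)] by auto

lemma bsob_mult:
 assumes "bsob k f" "bsob k g"
 shows "bsob k (\<lambda>x. f x * g x)"
 using assms
proof (induction k arbitrary: f g)
 case (Suc k)
 have s: "bcl (\<lambda>x. f x * g x)" using Suc.prems by auto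
 have d: "((\<lambda>x. f x * g x) has_real_derivative deriv f x * g x + f x * deriv g x) (at x)" for x
  using DERIV_mult[OF bsob_SucD(2)[OF Suc.prems(1)] bsob_SucD(2)[OF Suc.prems(2)], of x]
  by (simp add: algebra_simps)
 have "bsob k (\<lambda>x. deriv f x * g x + f x * deriv g x)"
  using Suc.IH[of "deriv f" g] Suc.IH[of f "deriv g"] Suc.prems bsob_Suc bsob_add(1) by auto
 then show ?case using bsob_SucI(1)[OF s d] by simp
qed auto

lemma deriv_mult_bsob:
 assumes "bsob (Suc k) f" "bsob (Suc k) g"
 shows "deriv (\<lambda>x. f x * g x) = (\<lambda>x. deriv f x * g x + f x * deriv g x)"
 using DERIV_mult[OF bsob_SucD(2)[OF assms(1)] bsob_SucD(2)[OF assms(2)]]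
 by (intro ext DERIV_imp_deriv) (simp add: algebra_simps)

text \<open>Each derivative falls on one of the factors. The factor of higher order \<open>m\<close>
  has room for a supremum bound, and keeping \<open>m\<close> and \<open>l\<close> apart lets the
  induction lower both. The constant solves \<open>c (Suc l) = 1 + 2 * c l\<close> with
  \<open>c 0 = 1\<close>.\<close>

lemma bnorm_mult_le:
 assumes "bsob m f" "bsob l g" "l \<le> m" "1 \<le> m"
 shows "bnorm l (\<lambda>x. f x * g x) \<le> (2 ^ Suc l - 1) * (bnorm m f * bnorm l g)"
 using assms
proof (induction l arbitrary: f g m)
 case 0
 then show ?case using nm_mult_le(1)[of m f g] bcl_sq by simp
next
 case (Suc l)
 let ?P = "bnorm m f * bnorm (Suc l) g"
 have fl: "bsob (Suc l) f" using Suc.prems bsob_mono by blast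
 have P: "0 \<le> ?P" by (intro mult_nonneg_nonneg bnorm_nonneg)
 have df: "bsob l (deriv f)" and dg: "bsob l (deriv g)" and gl: "bsob l g"
  using fl Suc.prems bsob_Suc by auto
 have b0: "nm (\<lambda>x. f x * g x) \<le> ?P"
  using nm_mult_le(1)[OF Suc.prems(1,4) bsob_sq[OF Suc.prems(2)]] nm_le_bnorm[of g "Suc l"]
  by (meson bnorm_nonneg mult_left_mono order_trans)
 have b2: "bnorm l (\<lambda>x. f x * deriv g x) \<le> (2 ^ Suc l - 1) * ?P"
 proof -
  have "bnorm l (\<lambda>x. f x * deriv g x) \<le> (2 ^ Suc l - 1) * (bnorm m f * bnorm l (deriv g))"
   using Suc.IH[OF Suc.prems(1) dg] Suc.prems by simp
  also have "... \<le> (2 ^ Suc l - 1) * ?P"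
   using bnorm_deriv_le[of l g] by (intro mult_left_mono) (simp_all del: power_Suc)
  finally show ?thesis .
 qed
 have b1: "bnorm l (\<lambda>x. deriv f x * g x) \<le> (2 ^ Suc l - 1) * ?P"
 proof (cases "m = 1")
  \<comment> \<open>With \<open>m = 1\<close> the derivative of \<open>f\<close> has no supremum
    bound left. But then \<open>l = 0\<close>, and the supremum bound can be put on
    \<open>g\<close>.\<close>
  case True
  then have l0: "l = 0" using Suc.prems by simp
  have "nm (\<lambda>x. g x * deriv f x) \<le> bnorm (Suc 0) g * nm (deriv f)"
   using nm_mult_le(1)[of "Suc 0" g "deriv f"] Suc.prems df bcl_sq unfolding l0 by simp
  also have "... \<le> bnorm (Suc 0) g * bnorm m f"
   unfolding True by (intro mult_left_mono) (simp_all add: add_increasing)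
  finally show ?thesis unfolding l0 by (simp add: mult.commute)
 next
  case False
  have m: "m = Suc (m - 1)" "1 \<le> m - 1" "l \<le> m - 1" using False Suc.prems by auto
  have dm: "bsob (m - 1) (deriv f)" "bnorm (m - 1) (deriv f) \<le> bnorm m f"
   using Suc.prems(1) bnorm_deriv_le[of "m - 1" f] bsob_SucD(3)[of "m - 1" f] m(1) by auto
  have "bnorm l (\<lambda>x. deriv f x * g x) \<le> (2 ^ Suc l - 1) * (bnorm (m - 1) (deriv f) * bnorm l g)"
   using Suc.IH[OF dm(1) gl] m by simp
  also have "... \<le> (2 ^ Suc l - 1) * ?P"
   using dm bnorm_Suc_mono[of l g] by (intro mult_left_mono mult_mono) (simp_all del: power_Suc bnorm.simps)
  finally show ?thesis .
 qed
 have "bnorm (Suc l) (\<lambda>x. f x * g x) = nm (\<lambda>x. f x * g x) + bnorm l (\<lambda>x. deriv f x * g x + f x * deriv g x)"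
  using deriv_mult_bsob[OF fl Suc.prems(2)] by simp
 also have "... \<le> nm (\<lambda>x. f x * g x) + (bnorm l (\<lambda>x. deriv f x * g x) + bnorm l (\<lambda>x. f x * deriv g x))"
  using bsob_add(2)[OF bsob_mult[OF df gl] bsob_mult[OF bsob_Suc[OF fl] dg]] by simp
 also have "... \<le> ?P + ((2 ^ Suc l - 1) * ?P + (2 ^ Suc l - 1) * ?P)"
  using b0 b1 b2 by (intro add_mono) auto
 also have "... = (2 ^ Suc (Suc l) - 1) * ?P" by (simp add: algebra_simps)
 finally show ?case .
qed

lemma bnorm_mult_le':
 assumes "bsob k f" "bsob k g" "1 \<le> k"
 shows "bnorm k (\<lambda>x. f x * g x) \<le> 2 ^ Suc k * (bnorm k f * bnorm k g)"
proof -
 have "0 \<le> bnorm k f * bnorm k g" by simp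
 then show ?thesis using bnorm_mult_le[OF assms(1,2) order_refl assms(3)]
  unfolding left_diff_distrib by linarith
qed

lemma bsob_power:
 assumes "bsob k f" "1 \<le> p"
 shows "bsob k (\<lambda>x. f x ^ p)" "1 \<le> k ==> bnorm k (\<lambda>x. f x ^ p) \<le> 2 ^ (Suc k * p) * bnorm k f ^ p"
proof -
 have "bsob k (\<lambda>x. f x ^ Suc n) \<and>
  (1 \<le> k \<longrightarrow> bnorm k (\<lambda>x. f x ^ Suc n) \<le> 2 ^ (Suc k * Suc n) * bnorm k f ^ Suc n)" for n
 proof (induction n)
  case 0
  have "1 * bnorm k f \<le> 2 ^ Suc k * bnorm k f"
   by (intro mult_right_mono) (auto simp del: power_Suc)
  then show ?case using assms(1) by simp
 next
  case (Suc n)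
  have "bnorm k (\<lambda>x. f x * f x ^ Suc n) \<le> 2 ^ (Suc k * Suc (Suc n)) * bnorm k f ^ Suc (Suc n)"
   if k: "1 \<le> k"
  proof -
   have "bnorm k (\<lambda>x. f x * f x ^ Suc n) \<le> 2 ^ Suc k * (bnorm k f * bnorm k (\<lambda>x. f x ^ Suc n))"
    using bnorm_mult_le'[OF assms(1) _ k] Suc.IH by blast
   also have "... \<le> 2 ^ Suc k * (bnorm k f * (2 ^ (Suc k * Suc n) * bnorm k f ^ Suc n))"
    using Suc.IH k by (intro mult_left_mono) (auto simp del: power_Suc)
   also have "... = 2 ^ (Suc k * Suc (Suc n)) * bnorm k f ^ Suc (Suc n)"
    by (simp only: mult_Suc_right power_add power_Suc[of "bnorm k f"]) (simp only: ac_simps)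
   finally show ?thesis .
  qed
  then show ?case using bsob_mult[OF assms(1) conjunct1[OF Suc.IH]] by simp
 qed
 from this[of "p - 1"] show "bsob k (\<lambda>x. f x ^ p)"
  "1 \<le> k ==> bnorm k (\<lambda>x. f x ^ p) \<le> 2 ^ (Suc k * p) * bnorm k f ^ p" using assms(2) by simp_all
qed

section \<open>Interpolation between orders and completeness\<close>

lemma nm_deriv_interpolation:
 assumes "bsob (Suc (Suc 0)) f" "h > 0"
 shows "nm (deriv f) \<le> 1 / h * nm f + h * nm (deriv (deriv f))"
proof -
 have d: "sq (deriv f)" "sq (cdiff h f)"
  using assms(1) bcl_sq[of "deriv f"] bsob_sq[OF bsob_cdiff(1)[OF assms(2,1)]] by auto
 have "nm (deriv f) \<le> nm (cdiff h f) + ndist (deriv f) (cdiff h f)"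
  using nm_triangle[OF d(2) sq_diff[OF d]] by simp
 then show ?thesis
  using nm_cdiff_le[OF bsob_sq[OF assms(1)] assms(2)] nm_cdiff_diff_le[OF assms]
  by (simp add: nm_minus_commute[of "deriv f"])
qed

text \<open>Ehrling's inequality in qualitative form. A derivative is a difference quotient, small
  when \<open>f\<close> is small in L2, plus an error of size \<open>h\<close> times the second
  derivative. The induction uses this for the first derivative and then passes to
  \<open>deriv f\<close>.\<close>

lemma bnorm_interpolation:
 assumes "e > 0"
 shows "\<exists>d>0. \<forall>f. bsob (Suc k) f \<and> bnorm (Suc k) f \<le> M \<and> nm f \<le> d \<longrightarrow> bnorm k f \<le> e"
 using assms
proof (induction k arbitrary: e)
 case 0
 then show ?case by (auto intro!: exI[of _ e])
next
 case (Suc k)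
 obtain d where d: "d > 0" "!!f. bsob (Suc k) f ==> bnorm (Suc k) f \<le> M ==> nm f \<le> d ==> bnorm k f \<le> e / 2"
  using Suc.IH[of "e / 2"] Suc.prems by auto
 \<comment> \<open>First \<open>h\<close> brings the error term to at most \<open>d / 2\<close>,
   then \<open>d'\<close> brings \<open>1 / h * nm f\<close> to at most
   \<open>d / 2\<close>.\<close>
 define h where "h = d / (2 * (\<bar>M\<bar> + 1))"
 have h: "h > 0" using d by (simp add: h_def)
 have hM: "h * \<bar>M\<bar> \<le> d / 2"
 proof -
  have "h * \<bar>M\<bar> \<le> h * (\<bar>M\<bar> + 1)" using h by simp
  also have "... = d / 2" by (simp add: h_def field_simps)
  finally show ?thesis .
 qed
 define d' where "d' = min (e / 2) (h * (d / 2))"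
 have "d' > 0" using h d Suc.prems by (simp add: d'_def)
 moreover have "bnorm (Suc k) f \<le> e"
  if f: "bsob (Suc (Suc k)) f" "bnorm (Suc (Suc k)) f \<le> M" "nm f \<le> d'" for f
 proof -
  have f2: "bsob (Suc (Suc 0)) f" using f(1) bsob_mono[of "Suc (Suc k)" f "Suc (Suc 0)"] by simp
  have "nm (deriv (deriv f)) \<le> bnorm k (deriv (deriv f))" by (rule nm_le_bnorm)
  also have "... \<le> M"
   using f(2) nm_nonneg[of f] nm_nonneg[of "deriv f"] unfolding bnorm.simps by linarith
  finally have "h * nm (deriv (deriv f)) \<le> h * \<bar>M\<bar>" using h by (intro mult_left_mono) auto
  moreover have "1 / h * nm f \<le> d / 2"
   using f(3) h by (simp add: d'_def field_simps)
  ultimately have "nm (deriv f) \<le> d" using nm_deriv_interpolation[OF f2 h] hM by linarith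
  moreover have "bsob (Suc k) (deriv f)" "bnorm (Suc k) (deriv f) \<le> M"
   using f(1,2) nm_nonneg[of f] unfolding bnorm.simps(2)[of "Suc k" f] by (simp, linarith)
  ultimately have "bnorm k (deriv f) \<le> e / 2" by (intro d(2))
  then show ?thesis using f(3) by (simp add: d'_def)
 qed
 ultimately show ?case by blast
qed

text \<open>One order is lost because uniform convergence of a derivative is read off from the norm
  one order higher, by \<open>sup_le_bnorm\<close>. Uniform convergence makes the limits continuous
  and identifies the limit of the derivatives as the derivative of the limit.\<close>

lemma bsob_Cauchy_limit:
 fixes f :: "nat => real => real"
 assumes "!!n. bsob (Suc k) (f n)"
  and "!!e. e > 0 ==> \<exists>n0. \<forall>m\<ge>n0. \<forall>n\<ge>n0. bdist (Suc k) (f m) (f n) \<le> e"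
 shows "\<exists>g. bsob k g \<and> (\<lambda>n. bdist k (f n) g) \<longlonglongrightarrow> 0 \<and> uniform_limit UNIV f g sequentially"
 using assms
proof (induction k arbitrary: f)
 case 0
 have "uniformly_Cauchy_on UNIV f"
 proof (rule uniformly_Cauchy_onI)
  fix e :: real assume "e > 0"
  then obtain n0 where n0: "!!m n. m \<ge> n0 ==> n \<ge> n0 ==> bdist (Suc 0) (f m) (f n) \<le> e / 2"
   using 0(2)[of "e / 2"] by auto
  have bd: "bsob (Suc 0) (\<lambda>x. f m x - f n x)" for m n by (rule bsob_diff(1)[OF 0(1) 0(1)])
  have "dist (f m x) (f n x) < e" if "m \<ge> n0" "n \<ge> n0" for m n x
   using sup_le_bnorm[OF bd[of m n], of x] n0[OF that] \<open>e > 0\<close>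
   by (simp add: dist_real_def del: bnorm.simps)
  then show "\<exists>M. \<forall>x\<in>UNIV. \<forall>m\<ge>M. \<forall>n\<ge>M. dist (f m x) (f n x) < e" by blast
 qed
 then obtain g where g: "uniform_limit UNIV f g sequentially"
  using uniformly_convergent_eq_Cauchy uniformly_convergent_on_def by blast
 have b: "bcl (f n)" for n using 0(1)[of n] by simp
 have cont: "continuous_on UNIV g"
  by (rule uniform_limit_theorem[OF _ g]) (use b bcl_continuous in auto)
 have pt: "(\<lambda>n. f n x) \<longlonglongrightarrow> g x" for x using tendsto_uniform_limitI[OF g] by simp
 \<comment> \<open>Only the second index tends to infinity; Fatou turns the Cauchy condition into a
   bound for the distance to \<open>g\<close>.\<close>
 have F: "sq (\<lambda>x. f n x - g x) \<and> ndist (f n) g \<le> e"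
  if n0: "!!m n. m \<ge> n0 ==> n \<ge> n0 ==> bdist (Suc 0) (f m) (f n) \<le> e" and n: "n \<ge> n0" for n n0 e
 proof -
  have s: "sq (\<lambda>x. f n x - f (m + n0) x)" for m using b bcl_sq by blast
  have le: "ndist (f n) (f (m + n0)) \<le> e" for m
   using order_trans[OF nm_le_bnorm n0[OF n, of "m + n0"]] by simp
  have "(\<lambda>m. f n x - f (m + n0) x) \<longlonglongrightarrow> f n x - g x" for x
   using LIMSEQ_ignore_initial_segment[OF pt] by (intro tendsto_diff tendsto_const)
  from nm_Fatou[OF s le this] show ?thesis by blast
 qed
 have lim: "(\<lambda>n. ndist (f n) g) \<longlonglongrightarrow> 0"
 proof (rule LIMSEQ_I)
  fix e :: real assume "e > 0"
  then obtain n0 where n0: "!!m n. m \<ge> n0 ==> n \<ge> n0 ==> bdist (Suc 0) (f m) (f n) \<le> e / 2"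
   using 0(2)[of "e / 2"] by auto
  have "norm (ndist (f n) g - 0) < e" if "n \<ge> n0" for n
   using F[OF n0 that] \<open>e > 0\<close> by auto
  then show "\<exists>n0. \<forall>n\<ge>n0. norm (ndist (f n) g - 0) < e" by blast
 qed
 obtain n0 where n0: "!!m n. m \<ge> n0 ==> n \<ge> n0 ==> bdist (Suc 0) (f m) (f n) \<le> 1"
  using 0(2)[of 1] by auto
 have "sq (\<lambda>x. f n0 x - g x)" using F[OF n0 order_refl] by blast
 then have "sq (\<lambda>x. f n0 x - (f n0 x - g x))" by (rule sq_diff[OF bcl_sq[OF b]])
 then have sg: "sq g" by simp
 obtain n1 where n1: "!!x. dist (f n1 x) (g x) < 1"
  using uniform_limitD[OF g, of 1] by (auto simp: eventually_sequentially)
 obtain B where B: "!!x. \<bar>f n1 x\<bar> \<le> B" using bcl_bound[OF b] by metis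
 have "\<bar>g x\<bar> \<le> B + 1" for x using n1[of x] B[of x] by (simp add: dist_real_def)
 then have "bcl g" by (rule bclI[OF cont _ sg])
 then show ?case using lim g by auto
next
 case (Suc k)
 have b: "bsob (Suc k) (f n)" "bsob (Suc k) (deriv (f n))" for n using Suc.prems(1)[of n] bsob_Suc by auto
 have C: "\<exists>n0. \<forall>m\<ge>n0. \<forall>n\<ge>n0. bdist (Suc k) (f m) (f n) \<le> e" if "e > 0" for e
  using Suc.prems(2)[OF that] bnorm_Suc_mono order_trans by metis
 obtain g where g: "bsob k g" "uniform_limit UNIV f g sequentially" "(\<lambda>n. bdist k (f n) g) \<longlonglongrightarrow> 0"
  using Suc.IH[OF b(1) C] by blast
 have C': "\<exists>n0. \<forall>m\<ge>n0. \<forall>n\<ge>n0. bdist (Suc k) (deriv (f m)) (deriv (f n)) \<le> e" if e: "e > 0" for e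
 proof -
  obtain n0 where n0: "!!m n. m \<ge> n0 ==> n \<ge> n0 ==> bdist (Suc (Suc k)) (f m) (f n) \<le> e"
   using Suc.prems(2)[OF e] by auto
  have "bdist (Suc k) (deriv (f m)) (deriv (f n)) \<le> e" if "m \<ge> n0" "n \<ge> n0" for m n
   using order_trans[OF bnorm_deriv_le n0[OF that]]
   unfolding deriv_diff_bsob[OF Suc.prems(1) Suc.prems(1)] .
  then show ?thesis by blast
 qed
 obtain g1 where g1: "bsob k g1" "(\<lambda>n. bdist k (deriv (f n)) g1) \<longlonglongrightarrow> 0"
  "uniform_limit UNIV (\<lambda>n. deriv (f n)) g1 sequentially"
  using Suc.IH[OF b(2) C'] by blast
 have pt: "(\<lambda>n. f n x) \<longlonglongrightarrow> g x" for x using tendsto_uniform_limitI[OF g(2)] by simp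
 have "\<exists>G. \<forall>x\<in>UNIV. (\<lambda>n. f n x) \<longlonglongrightarrow> G x \<and> (G has_derivative (\<lambda>h. g1 x * h)) (at x within UNIV)"
 proof (rule has_derivative_sequence)
  show "convex (UNIV :: real set)" by simp
  show "(f n has_derivative (\<lambda>h. deriv (f n) x * h)) (at x within UNIV)" for n x
   using bsob_SucD(2)[OF b(1)[of n], of x] by (simp add: has_field_derivative_def)
  show "\<forall>\<^sub>F n in sequentially. \<forall>x\<in>UNIV. \<forall>h. norm (deriv (f n) x * h - g1 x * h) \<le> e * norm h"
   if "e > 0" for e
   using uniform_limitD[OF g1(3) that]
  proof eventually_elim
   case (elim n)
   show ?case
   proof (intro ballI allI)
    fix x h :: real
    have "norm (deriv (f n) x * h - g1 x * h) = \<bar>deriv (f n) x - g1 x\<bar> * \<bar>h\<bar>"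
     by (simp add: left_diff_distrib[symmetric] abs_mult)
    also have "... \<le> e * \<bar>h\<bar>"
     using elim by (intro mult_right_mono) (auto simp: dist_real_def less_imp_le)
    finally show "norm (deriv (f n) x * h - g1 x * h) \<le> e * norm h" by simp
   qed
  qed
  show "(\<lambda>n. f n 0) \<longlonglongrightarrow> g 0" by (rule pt)
 qed simp
 then obtain G where G: "!!x. (\<lambda>n. f n x) \<longlonglongrightarrow> G x" "!!x. (G has_derivative (\<lambda>h. g1 x * h)) (at x)" by auto
 have "G = g" using LIMSEQ_unique[OF G(1) pt] by blast
 then have d: "(g has_real_derivative g1 x) (at x)" for x using G(2)[of x] by (simp add: has_field_derivative_def)
 note S = bsob_SucI[OF bsob_bcl[OF g(1)] d g1(1)]
 have eq: "bdist (Suc k) (f n) g = ndist (f n) g + bdist k (deriv (f n)) g1" for n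
  using deriv_diff_bsob[OF b(1) S(1), of n] S(2) by simp
 have "(\<lambda>n. ndist (f n) g) \<longlonglongrightarrow> 0"
 proof -
  show ?thesis
   by (rule tendsto_sandwich[OF _ _ tendsto_const g(3)]) (auto simp: nm_le_bnorm)
 qed
 from tendsto_add[OF this g1(2)] have "(\<lambda>n. bdist (Suc k) (f n) g) \<longlonglongrightarrow> 0"
  unfolding eq by simp
 then show ?case using S(1) g(2) by blast
qed

text \<open>A bound at order \<open>k + 2\<close> and the Cauchy property in L2 interpolate to the
  Cauchy property at order \<open>k + 1\<close>, and the limit then has order \<open>k\<close>. This
  is the source of the two extra orders in the inversion of the kernel and in the convergence of the
  scheme.\<close>

lemma bsob_limit:
 fixes f :: "nat => real => real"
 assumes f: "!!n. bsob (k + 2) (f n)" and M: "!!n. bnorm (k + 2) (f n) \<le> M"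
  and C: "!!e. e > 0 ==> \<exists>n0. \<forall>m\<ge>n0. \<forall>n\<ge>n0. ndist (f m) (f n) \<le> e"
 obtains g where "bsob k g" "(\<lambda>n. bdist k (f n) g) \<longlonglongrightarrow> 0" "bnorm k g \<le> M"
  "uniform_limit UNIV f g sequentially"
proof -
 have f': "bsob (Suc k) (f n)" for n using f[of n] bsob_Suc by simp
 have "\<exists>n0. \<forall>m\<ge>n0. \<forall>n\<ge>n0. bdist (Suc k) (f m) (f n) \<le> e" if e: "e > 0" for e
 proof -
  obtain d where d: "d > 0" "!!f. bsob (Suc (Suc k)) f ==> bnorm (Suc (Suc k)) f \<le> 2 * M ==> nm f \<le> d ==> bnorm (Suc k) f \<le> e"
   using bnorm_interpolation[OF e, of "Suc k" "2 * M"] by auto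
  obtain n0 where n0: "!!m n. m \<ge> n0 ==> n \<ge> n0 ==> ndist (f m) (f n) \<le> d" using C[OF d(1)] by auto
  have "bdist (Suc (Suc k)) (f m) (f n) \<le> 2 * M" for m n
   using bsob_diff(2)[OF f f, of m n] M[of m] M[of n] by (simp del: bnorm.simps)
  then have "bdist (Suc k) (f m) (f n) \<le> e" if "m \<ge> n0" "n \<ge> n0" for m n
   using d(2)[of "\<lambda>x. f m x - f n x"] n0[OF that] bsob_diff(1)[OF f f, of m n] by (simp del: bnorm.simps bsob.simps)
  then show ?thesis by blast
 qed
 from bsob_Cauchy_limit[OF f' this] obtain g where g: "bsob k g" "(\<lambda>n. bdist k (f n) g) \<longlonglongrightarrow> 0"
  "uniform_limit UNIV f g sequentially" by blast
 have "bnorm k g \<le> M + bdist k (f n) g" for n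
  using bnorm_le_add_diff[OF g(1) bsob_mono[OF f, of k n]] bnorm_mono[of k "k + 2" "f n"] M[of n]
   bnorm_minus_commute[OF g(1) bsob_mono[OF f, of k n]] by simp
 then have "bnorm k g \<le> M + 0"
  by (intro tendsto_lowerbound[OF tendsto_add[OF tendsto_const g(2)]]) auto
 then show thesis using that g by auto
qed

lemma bnorm_tendsto_le:
 assumes f: "!!n. bsob k (f n)" and g: "bsob k g" and lim: "(\<lambda>n::nat. bdist k (f n) g) \<longlonglongrightarrow> 0"
  and le: "!!n. bnorm k (f n) \<le> M n" and M: "M \<longlonglongrightarrow> L"
 shows "bnorm k g \<le> L"
proof -
 have "bnorm k g \<le> M n + bdist k (f n) g" for n
  using bnorm_le_add_diff[OF g f] le[of n] bnorm_minus_commute[OF g f] by (metis add_right_mono order_trans)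
 then have "bnorm k g \<le> L + 0"
  by (intro tendsto_lowerbound[OF tendsto_add[OF M lim]]) auto
 then show ?thesis by simp
qed

section \<open>Convolution with finite measures\<close>

definition mconv :: "real measure => (real => real) => real => real" where
 "mconv \<mu> f x = (LINT y|\<mu>. f (x - y))"

context
 fixes \<mu> :: "real measure"
 assumes fin: "finite_measure \<mu>" and sets_\<mu> [measurable_cong]: "sets \<mu> = sets borel"
begin

interpretation finite_measure \<mu> by (rule fin)

lemma mconv_integrable:
 fixes f :: "real => real"
 assumes "f \<in> borel_measurable borel" "!!x. \<bar>f x\<bar> \<le> B"
 shows "integrable \<mu> (\<lambda>y. f (x - y))"
proof (rule integrable_const_bound[of _ B])
 show "(\<lambda>y. f (x - y)) \<in> borel_measurable \<mu>" using assms(1) by measurable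
qed (use assms(2) in auto)

lemma mconv_tendsto:
 fixes g :: "real => real"
 assumes f: "!!n. f n \<in> borel_measurable borel" "!!n x. \<bar>f n x\<bar> \<le> B"
  and g: "g \<in> borel_measurable borel" and lim: "!!y. (\<lambda>n::nat. f n y) \<longlonglongrightarrow> g y"
 shows "(\<lambda>n. LINT y|\<mu>. f n y) \<longlonglongrightarrow> (LINT y|\<mu>. g y)"
 by (rule integral_dominated_convergence[where w = "\<lambda>_. B"])
  (use assms in \<open>auto simp: measurable_cong_sets[OF sets_\<mu> refl]\<close>)

lemma bcl_mconv:
 assumes f: "bcl f"
 shows "bcl (mconv \<mu> f)" "nm (mconv \<mu> f) \<le> measure \<mu> UNIV * nm f"
proof -
 obtain B where B: "B > 0" "!!x. \<bar>f x\<bar> \<le> B" using bcl_bound[OF f] by metis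
 have [measurable]: "f \<in> borel_measurable borel" using bcl_sq[OF f] by (simp add: sq_def)
 have U: "space \<mu> = UNIV" using sets_eq_imp_space_eq[OF sets_\<mu>] by simp
 have cont: "continuous_on UNIV (mconv \<mu> f)"
  unfolding continuous_on_sequentially
 proof (intro allI ballI impI)
  fix X :: "nat => real" and x assume X: "(\<forall>n. X n \<in> UNIV) \<and> X \<longlonglongrightarrow> x"
  show "(mconv \<mu> f \<circ> X) \<longlonglongrightarrow> mconv \<mu> f x"
   unfolding o_def mconv_def
  proof (rule mconv_tendsto[where B = B])
   show "(\<lambda>n. f (X n - y)) \<longlonglongrightarrow> f (x - y)" for y
    using X by (intro isCont_tendsto_compose[OF bcl_isCont[OF f]] tendsto_diff) auto
  qed (use B in measurable)
 qed
 have jm: "case_prod (\<lambda>y x. f (x - y)) \<in> borel_measurable (\<mu> \<Otimes>\<^sub>M borel)"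
  by measurable
 have s: "sq (\<lambda>x. f (x - y))" "nm (\<lambda>x. f (x - y)) \<le> nm f" for y
  using sq_shift[OF bcl_sq[OF f], of "- y"] by simp_all
 have i2: "integrable \<mu> (\<lambda>y. (f (x - y))\<^sup>2)" for x
  using mconv_integrable[of "\<lambda>x. (f x)\<^sup>2" "B\<^sup>2" x] B by (simp add: abs_le_square_iff[symmetric])
 note L = nm_integral_le[OF fin jm, of "nm f", OF s mconv_integrable[OF _ B(2)] i2]
 show "nm (mconv \<mu> f) \<le> measure \<mu> UNIV * nm f"
  using L(2) by (simp add: mconv_def[abs_def] U)
 have "\<bar>mconv \<mu> f x\<bar> \<le> B * measure \<mu> UNIV" for x
 proof -
  have "\<bar>mconv \<mu> f x\<bar> \<le> (LINT y|\<mu>. \<bar>f (x - y)\<bar>)" unfolding mconv_def by (rule integral_abs_bound)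
  also have "... \<le> (LINT y|\<mu>. B)"
   using B by (intro integral_mono integrable_abs mconv_integrable[OF _ B(2)]) auto
  finally show ?thesis by (simp add: U mult.commute)
 qed
 then show "bcl (mconv \<mu> f)"
  by (rule bclI[OF cont]) (use L(1) in \<open>simp add: mconv_def[abs_def]\<close>)
qed

text \<open>The difference quotients of \<open>f\<close> are bounded by the supremum of
  \<open>f'\<close>, and constants are integrable for a finite measure, so dominated convergence
  applies.\<close>

lemma mconv_has_derivative:
 assumes f: "bcl f" and d: "!!x. (f has_real_derivative f' x) (at x)" and f': "bcl f'"
 shows "(mconv \<mu> f has_real_derivative mconv \<mu> f' x) (at x)"
proof -
 obtain B where B: "B > 0" "!!x. \<bar>f x\<bar> \<le> B" using bcl_bound[OF f] by metis
 obtain B' where B': "B' > 0" "!!x. \<bar>f' x\<bar> \<le> B'" using bcl_bound[OF f'] by metis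
 have [measurable]: "f \<in> borel_measurable borel" "f' \<in> borel_measurable borel"
  using bcl_sq[OF f] bcl_sq[OF f'] by (auto simp: sq_def)
 have lip: "\<bar>f (z + h) - f z\<bar> \<le> B' * \<bar>h\<bar>" for z h
  using field_differentiable_bound[of UNIV f f' B' "z + h" z] d B'
  by (auto simp: has_field_derivative_at_within)
 show ?thesis
  unfolding has_field_derivative_iff tendsto_at_iff_sequentially
 proof (intro allI impI)
  fix X assume X: "\<forall>i. X i \<in> UNIV - {x}" "X \<longlonglongrightarrow> x"
  have "(\<lambda>n. LINT y|\<mu>. (f (X n - y) - f (x - y)) / (X n - x)) \<longlonglongrightarrow> (LINT y|\<mu>. f' (x - y))"
  proof (rule mconv_tendsto[where B = B'])
   show "\<bar>(f (X n - y) - f (x - y)) / (X n - x)\<bar> \<le> B'" for n y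
    using lip[of "x - y" "X n - x"] X(1) by (auto simp: abs_divide divide_simps)
   show "(\<lambda>n. (f (X n - y) - f (x - y)) / (X n - x)) \<longlonglongrightarrow> f' (x - y)" for y
   proof -
    have "((\<lambda>z. f (z - y)) has_real_derivative f' (x - y)) (at x)"
     using d[of "x - y"] DERIV_shift[of f _ x "- y"] by simp
    then show ?thesis
     using X unfolding has_field_derivative_iff tendsto_at_iff_sequentially o_def by blast
   qed
  qed measurable
  moreover have "(mconv \<mu> f (X n) - mconv \<mu> f x) / (X n - x) = (LINT y|\<mu>. (f (X n - y) - f (x - y)) / (X n - x))" for n
  proof -
   have "integrable \<mu> (\<lambda>y. f (z - y))" for z by (rule mconv_integrable[OF _ B(2)]) measurable
   then show ?thesis unfolding mconv_def by simp
  qed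
  ultimately show "((\<lambda>y. (mconv \<mu> f y - mconv \<mu> f x) / (y - x)) \<circ> X) \<longlonglongrightarrow> mconv \<mu> f' x"
   unfolding o_def by (simp only: mconv_def[of \<mu> f'])
 qed
qed

lemma mconv_linear:
 assumes "bcl f" "bcl g"
 shows "mconv \<mu> (\<lambda>x. f x + g x) = (\<lambda>x. mconv \<mu> f x + mconv \<mu> g x)"
proof -
 have "integrable \<mu> (\<lambda>y. f (x - y))" if "bcl f" for f x
  using mconv_integrable bcl_bound[OF that] sq_measurable[OF bcl_sq[OF that]] by metis
 then show ?thesis using assms by (simp add: mconv_def[abs_def])
qed

end

text \<open>The total mass bounds the operator; the summand 1 makes the bound at least 1, so that
  its powers increase with the exponent.\<close>

definition kmass :: "kernel => real" where
 "kmass \<beta> = measure (fst \<beta>) UNIV + measure (snd \<beta>) UNIV + 1"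

lemma kmass_ge_1: "1 \<le> kmass \<beta>"
 by (simp add: kmass_def)

lemma kernel_conv_mconv: "kernel_conv \<beta> f = (\<lambda>x. mconv (fst \<beta>) f x - mconv (snd \<beta>) f x)"
 by (auto simp: kernel_conv_def mconv_def)

context
 fixes \<beta> :: kernel
 assumes ker: "is_kernel \<beta>"
begin

lemma ker_parts: "finite_measure (fst \<beta>)" "sets (fst \<beta>) = sets borel"
 "finite_measure (snd \<beta>)" "sets (snd \<beta>) = sets borel"
 using ker by (auto simp: is_kernel_def)

lemma bcl_kernel_conv:
 assumes "bcl f"
 shows "bcl (kernel_conv \<beta> f)" "nm (kernel_conv \<beta> f) \<le> kmass \<beta> * nm f"
proof -
 note b = bcl_mconv[OF ker_parts(1,2) assms] bcl_mconv[OF ker_parts(3,4) assms]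
 have "bcl (\<lambda>x. mconv (fst \<beta>) f x + (- 1) * mconv (snd \<beta>) f x)" by (intro bcl_add bcl_cmult b)
 then show "bcl (kernel_conv \<beta> f)" by (simp add: kernel_conv_mconv)
 have "nm (kernel_conv \<beta> f) \<le> nm (mconv (fst \<beta>) f) + nm (mconv (snd \<beta>) f)"
  unfolding kernel_conv_mconv by (rule nm_triangle_diff[OF bcl_sq[OF b(1)] bcl_sq[OF b(3)]])
 also have "... \<le> kmass \<beta> * nm f" using b(2,4) nm_nonneg[of f] unfolding kmass_def distrib_right by linarith
 finally show "nm (kernel_conv \<beta> f) \<le> kmass \<beta> * nm f" .
qed

lemma kernel_conv_has_derivative:
 assumes "bcl f" "!!x. (f has_real_derivative f' x) (at x)" "bcl f'"
 shows "(kernel_conv \<beta> f has_real_derivative kernel_conv \<beta> f' x) (at x)"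
 unfolding kernel_conv_mconv
 by (intro DERIV_diff mconv_has_derivative ker_parts assms)

lemma bsob_kernel_conv:
 shows "bsob k f ==> bsob k (kernel_conv \<beta> f)" "bsob k f ==> bnorm k (kernel_conv \<beta> f) \<le> kmass \<beta> * bnorm k f"
  "bsob (Suc k) f ==> deriv (kernel_conv \<beta> f) = kernel_conv \<beta> (deriv f)"
proof -
 have D: "(kernel_conv \<beta> f has_real_derivative kernel_conv \<beta> (deriv f) x) (at x)"
  if "bcl f" "bcl (deriv f)" "!!y. (f has_real_derivative deriv f y) (at y)" for f x
  by (rule kernel_conv_has_derivative[OF that(1,3,2)])
 note op = bsob_operator[of "kernel_conv \<beta>" "kmass \<beta>", OF bcl_kernel_conv D]
 show "bsob k f ==> bsob k (kernel_conv \<beta> f)" "bsob k f ==> bnorm k (kernel_conv \<beta> f) \<le> kmass \<beta> * bnorm k f"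
  "bsob (Suc k) f ==> deriv (kernel_conv \<beta> f) = kernel_conv \<beta> (deriv f)"
  using op by blast+
qed

lemma kernel_conv_add:
 assumes "bcl f" "bcl g"
 shows "kernel_conv \<beta> (\<lambda>x. f x + g x) = (\<lambda>x. kernel_conv \<beta> f x + kernel_conv \<beta> g x)"
 unfolding kernel_conv_mconv by (simp add: mconv_linear ker_parts assms algebra_simps)

lemma kernel_conv_cmult: "kernel_conv \<beta> (\<lambda>x. c * f x) = (\<lambda>x. c * kernel_conv \<beta> f x)"
 by (auto simp: kernel_conv_def algebra_simps)

lemma kernel_conv_diff:
 assumes "bcl f" "bcl g"
 shows "kernel_conv \<beta> (\<lambda>x. f x - g x) = (\<lambda>x. kernel_conv \<beta> f x - kernel_conv \<beta> g x)"
 using kernel_conv_add[OF assms(1) bcl_cmult[OF assms(2), of "-1"]] kernel_conv_cmult[of "-1" g] by simp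

lemma kernel_conv_cdiff:
 assumes f: "bcl f"
 shows "kernel_conv \<beta> (cdiff h f) = cdiff h (kernel_conv \<beta> f)"
proof -
 have s: "bcl (\<lambda>x. f (x + h))" "bcl (\<lambda>x. f (x + - h))" using f by blast+
 have "cdiff h f = (\<lambda>x. 1 / (2 * h) * (f (x + h) - f (x + - h)))" by (auto simp: cdiff_def)
 then have "kernel_conv \<beta> (cdiff h f) =
   (\<lambda>x. 1 / (2 * h) * (kernel_conv \<beta> (\<lambda>x. f (x + h)) x - kernel_conv \<beta> (\<lambda>x. f (x + - h)) x))"
  by (simp only: kernel_conv_cmult kernel_conv_diff[OF s])
 also have "... = cdiff h (kernel_conv \<beta> f)"
 proof
  fix x
  have e: "x + h - y = x - y + h" "x - h - y = x - y - h" for y by simp_all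
  show "1 / (2 * h) * (kernel_conv \<beta> (\<lambda>x. f (x + h)) x - kernel_conv \<beta> (\<lambda>x. f (x + - h)) x)
    = cdiff h (kernel_conv \<beta> f) x"
   unfolding cdiff_def kernel_conv_def e by simp
 qed
 finally show ?thesis .
qed

end

section \<open>Plancherel theorem\<close>

definition fexp :: "real => real => complex" where
 "fexp \<xi> x = exp (- \<i> * complex_of_real (\<xi> * x))"

definition ft :: "(real => real) => real => complex" where
 "ft \<phi> \<xi> = (LINT x|lborel. complex_of_real (\<phi> x) * fexp \<xi> x)"

lemma fexp_iexp: "fexp \<xi> x = iexp (- (\<xi> * x))"
 by (simp add: fexp_def)

lemma cmod_fexp [simp]: "cmod (fexp \<xi> x) = 1"
 unfolding fexp_iexp by (rule norm_exp_i_times)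

lemma fexp_add: "fexp \<xi> (x + y) = fexp \<xi> x * fexp \<xi> y"
 by (simp add: fexp_def exp_add[symmetric] algebra_simps)

lemma cnj_fexp: "cnj (fexp \<xi> x) = fexp \<xi> (- x)"
 by (simp add: fexp_def exp_cnj)

lemma fexp_0 [simp]: "fexp \<xi> 0 = 1" "fexp 0 x = 1"
 by (simp_all add: fexp_def)

lemma fexp_minus: "fexp \<xi> (- x) = fexp (- \<xi>) x"
 by (simp add: fexp_def)

lemma continuous_fexp: "continuous_on UNIV (\<lambda>p. fexp (fst p) (snd p))"
 unfolding fexp_def by (intro continuous_intros)

lemma fexp_measurable [measurable]:
 assumes [measurable]: "f \<in> borel_measurable M" "g \<in> borel_measurable M"
 shows "(\<lambda>x. fexp (f x) (g x)) \<in> borel_measurable M"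
 unfolding fexp_def by measurable

lemma integrable_pair_bound:
 fixes f :: "real \<times> real => 'b :: {banach, second_countable_topology}" and g h :: "real => real"
 assumes f: "f \<in> borel_measurable (lborel \<Otimes>\<^sub>M lborel)" and g: "integrable lborel g" and h: "integrable lborel h"
  and le: "!!x y. norm (f (x, y)) \<le> g x * h y"
 shows "integrable (lborel \<Otimes>\<^sub>M lborel) f"
proof -
 have [measurable]: "g \<in> borel_measurable borel" "h \<in> borel_measurable borel"
  using g h borel_measurable_integrable by auto
 have "integrable (lborel \<Otimes>\<^sub>M lborel) (\<lambda>p. g (fst p) * h (snd p))"
  by (rule lborel_pair.Fubini_integrable)
   (use g h in \<open>auto simp: abs_mult\<close>)
 then show ?thesis
 proof (rule Bochner_Integration.integrable_bound[OF _ f], intro AE_I2)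
  fix p :: "real \<times> real"
  show "norm (f p) \<le> norm (g (fst p) * h (snd p))"
   using le[of "fst p" "snd p"] by simp
 qed
qed

text \<open>Contains the truncations of continuous functions. Boundedness and compact support make
  all integrals absolutely convergent, and finiteness of the set of discontinuities makes the
  autocorrelation continuous at 0 by dominated convergence, without an approximation by smooth
  functions.\<close>

definition tame :: "(real => real) => bool" where
 "tame \<phi> \<longleftrightarrow> \<phi> \<in> borel_measurable borel \<and> (\<exists>B. \<forall>x. \<bar>\<phi> x\<bar> \<le> B) \<and> (\<exists>R. \<forall>x. R < \<bar>x\<bar> \<longrightarrow> \<phi> x = 0)
   \<and> (\<exists>S. finite S \<and> (\<forall>x. x \<notin> S \<longrightarrow> isCont \<phi> x))"

lemma tame_bounds:
 assumes "tame \<phi>"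
 obtains B R where "0 < B" "0 < R" "!!x. \<bar>\<phi> x\<bar> \<le> B * indicator {-R..R} x"
proof -
 obtain B R where B: "!!x. \<bar>\<phi> x\<bar> \<le> B" and R: "!!x. R < \<bar>x\<bar> ==> \<phi> x = 0"
  using assms by (auto simp: tame_def)
 have "\<bar>\<phi> x\<bar> \<le> max B 1 * indicator {- max R 1..max R 1} x" for x
  using B[of x] R[of x] by (auto simp: indicator_def abs_le_iff not_le max_def)
 then show thesis using that[of "max B 1" "max R 1"] by simp
qed

lemma tame_measurable [measurable_dest]: "tame \<phi> ==> \<phi> \<in> borel_measurable borel"
 by (simp add: tame_def)

lemma tame_integrable:
 assumes "tame \<phi>"
 shows "integrable lborel \<phi>" "sq \<phi>"
proof -
 obtain B R where B: "0 < B" "0 < R" "!!x. \<bar>\<phi> x\<bar> \<le> B * indicator {-R..R} x"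
  using tame_bounds[OF assms] by metis
 have [measurable]: "\<phi> \<in> borel_measurable borel" by (rule tame_measurable[OF assms])
 have I: "integrable lborel (\<lambda>x. c * indicator {-R..R} x :: real)" for c
  using B(2) by (intro integrable_mult_right) auto
 show "integrable lborel \<phi>"
  by (rule Bochner_Integration.integrable_bound[OF I[of B]]) (use B in \<open>auto simp: abs_mult\<close>)
 have "(\<phi> x)\<^sup>2 \<le> B\<^sup>2 * indicator {-R..R} x" for x
  using power_mono[OF B(3)[of x], of 2] by (cases "x \<in> {-R..R}") (simp_all add: power_mult_distrib)
 then have "integrable lborel (\<lambda>x. (\<phi> x)\<^sup>2)"
  by (intro Bochner_Integration.integrable_bound[OF I[of "B\<^sup>2"]]) (auto simp: abs_mult)
 then show "sq \<phi>" by (simp add: sq_def)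
qed

lemma tame_add:
 assumes "tame f" "tame g" shows "tame (\<lambda>x. f x + g x)"
proof -
 obtain B R S where B: "!!x. \<bar>f x\<bar> \<le> B" "!!x. R < \<bar>x\<bar> ==> f x = 0" "finite S" "!!x. x \<notin> S ==> isCont f x"
  using assms(1) by (auto simp: tame_def)
 obtain B' R' S' where B': "!!x. \<bar>g x\<bar> \<le> B'" "!!x. R' < \<bar>x\<bar> ==> g x = 0" "finite S'" "!!x. x \<notin> S' ==> isCont g x"
  using assms(2) by (auto simp: tame_def)
 have [measurable]: "f \<in> borel_measurable borel" "g \<in> borel_measurable borel"
  using assms tame_measurable by auto
 have "\<bar>f x + g x\<bar> \<le> B + B'" for x using B(1)[of x] B'(1)[of x] by linarith
 moreover have "max R R' < \<bar>x\<bar> ==> f x + g x = 0" for x using B(2)[of x] B'(2)[of x] by simp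
 moreover have "x \<notin> S \<union> S' ==> isCont (\<lambda>x. f x + g x) x" for x using B(4) B'(4) by (simp add: continuous_add)
 moreover have "finite (S \<union> S')" using B B' by simp
 ultimately show ?thesis unfolding tame_def by (intro conjI exI[of _ "S \<union> S'"]) (measurable, blast+)
qed

lemma tame_cmult:
 assumes "tame f" shows "tame (\<lambda>x. c * f x)"
proof -
 obtain B R S where B: "!!x. \<bar>f x\<bar> \<le> B" "!!x. R < \<bar>x\<bar> ==> f x = 0" "finite S" "!!x. x \<notin> S ==> isCont f x"
  using assms(1) by (auto simp: tame_def)
 have [measurable]: "f \<in> borel_measurable borel" using assms tame_measurable by auto
 have "\<bar>c * f x\<bar> \<le> \<bar>c\<bar> * B" for x using B(1)[of x] by (simp add: abs_mult mult_left_mono)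
 moreover have "R < \<bar>x\<bar> ==> c * f x = 0" for x using B(2)[of x] by simp
 moreover have "x \<notin> S ==> isCont (\<lambda>x. c * f x) x" for x using B(4) by (simp add: continuous_mult)
 ultimately show ?thesis using B(3) unfolding tame_def by (intro conjI exI[of _ S]) (measurable, blast+)
qed

lemma tame_shift:
 assumes "tame f" shows "tame (\<lambda>x. f (x + c))"
proof -
 obtain B R S where B: "!!x. \<bar>f x\<bar> \<le> B" "!!x. R < \<bar>x\<bar> ==> f x = 0" "finite S" "!!x. x \<notin> S ==> isCont f x"
  using assms(1) by (auto simp: tame_def)
 have [measurable]: "f \<in> borel_measurable borel" using assms tame_measurable by auto
 have "R + \<bar>c\<bar> < \<bar>x\<bar> ==> f (x + c) = 0" for x by (rule B(2)) linarith
 moreover have "x \<notin> (\<lambda>x. x - c) ` S ==> isCont (\<lambda>x. f (x + c)) x" for x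
 proof -
  assume x: "x \<notin> (\<lambda>x. x - c) ` S"
  have "x + c \<notin> S" using x by (metis add_diff_cancel_right' image_eqI)
  then have f: "isCont f (x + c)" by (rule B(4))
  show ?thesis by (rule isCont_o2[where g = f and f = "\<lambda>x. x + c", OF _ f]) (intro continuous_intros)
 qed
 moreover have "finite ((\<lambda>x. x - c) ` S)" using B(3) by simp
 moreover have "\<forall>x. \<bar>f (x + c)\<bar> \<le> B" using B(1) by blast
 ultimately show ?thesis unfolding tame_def by (intro conjI exI[of _ "(\<lambda>x. x - c) ` S"]) (measurable, blast+)
qed

lemma tame_indicator:
 assumes cont: "continuous_on UNIV f"
 shows "tame (\<lambda>x. indicator {a..b} x * f x)"
proof -
 have [measurable]: "f \<in> borel_measurable borel" using cont by (rule borel_measurable_continuous_onI)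
 have "bounded (f ` {a..b})"
  by (intro compact_imp_bounded compact_continuous_image continuous_on_subset[OF cont]) auto
 then obtain B where "\<forall>y\<in>f ` {a..b}. norm y \<le> B" unfolding bounded_iff by blast
 then have B: "\<bar>f x\<bar> \<le> B" if "x \<in> {a..b}" for x using that by auto
 have "\<bar>indicator {a..b} x * f x\<bar> \<le> max B 0" for x
  using B[of x] by (cases "x \<in> {a..b}") auto
 moreover have "max \<bar>a\<bar> \<bar>b\<bar> < \<bar>x\<bar> ==> indicator {a..b} x * f x = 0" for x by (auto simp: indicator_def)
 moreover have "x \<notin> {a, b} ==> isCont (\<lambda>x. indicator {a..b} x * f x) x" for x
 proof -
  assume x: "x \<notin> {a, b}"
  have "isCont (indicator {a..b} :: real => real) x"
   using x by (auto simp: isCont_indicator frontier_def)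
  then show ?thesis using cont by (intro continuous_mult) (auto simp: continuous_on_eq_continuous_at)
 qed
 moreover have "finite {a, b}" by simp
 ultimately show ?thesis unfolding tame_def by (intro conjI exI[of _ "{a, b}"]) (measurable, blast+)
qed

section \<open>Plancherel's theorem for bounded functions of compact support\<close>

lemma gauss_transform:
 assumes s: "0 < s"
 shows "(LINT \<xi>|lborel. complex_of_real (std_normal_density (s * \<xi>)) * fexp \<xi> w)
   = complex_of_real (exp (- (w / s)\<^sup>2 / 2) / s)"
proof -
 have "complex_of_real (exp (- (- w / s)\<^sup>2 / 2)) = char std_normal_distribution (- w / s)"
  by (simp add: char_std_normal_distribution)
 also have "... = (LINT z|lborel. std_normal_density z *\<^sub>R iexp ((- w / s) * z))"
  unfolding char_def by (subst integral_density) (auto)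
 also have "... = \<bar>s\<bar> *\<^sub>R (LINT \<xi>|lborel. std_normal_density (0 + s * \<xi>) *\<^sub>R iexp ((- w / s) * (0 + s * \<xi>)))"
  using s by (intro lborel_integral_real_affine) simp
 also have "(LINT \<xi>|lborel. std_normal_density (0 + s * \<xi>) *\<^sub>R iexp ((- w / s) * (0 + s * \<xi>)))
   = (LINT \<xi>|lborel. complex_of_real (std_normal_density (s * \<xi>)) * fexp \<xi> w)"
  using s by (intro Bochner_Integration.integral_cong refl) (simp add: fexp_iexp scaleR_conv_of_real mult.commute)
 finally show ?thesis using s by (simp add: scaleR_conv_of_real field_simps)
qed

text \<open>The autocorrelation: its transform is the squared modulus of the transform of
  \<open>\<phi>\<close>, and its value at 0 is the squared norm.\<close>

definition autocor :: "(real => real) => real => real" where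
 "autocor \<phi> w = (LINT x|lborel. \<phi> x * \<phi> (x - w))"

lemma autocor_measurable:
 assumes "tame \<phi>" shows "autocor \<phi> \<in> borel_measurable borel"
proof -
 have [measurable]: "\<phi> \<in> borel_measurable borel" by (rule tame_measurable[OF assms])
 have "(\<lambda>(w, x). \<phi> x * \<phi> (x - w)) \<in> borel_measurable (borel \<Otimes>\<^sub>M lborel)" by measurable
 then show ?thesis
  unfolding autocor_def[abs_def] by (rule lborel.borel_measurable_lebesgue_integral)
qed

lemma autocor_bounds:
 assumes "tame \<phi>"
 obtains B R where "0 < B" "0 < R" "!!w. \<bar>autocor \<phi> w\<bar> \<le> B * indicator {-R..R} w"
proof -
 obtain B R where B: "0 < B" "0 < R" "!!x. \<bar>\<phi> x\<bar> \<le> B * indicator {-R..R} x"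
  using tame_bounds[OF assms] by metis
 have s: "sq \<phi>" "sq (\<lambda>x. \<phi> (x - w))" "nm (\<lambda>x. \<phi> (x - w)) = nm \<phi>" for w
  using tame_integrable(2)[OF assms] sq_shift[of \<phi> "- w"] by auto
 \<comment> \<open>For \<open>w\<close> beyond \<open>2 * R\<close> in modulus the supports of the
   two factors are disjoint.\<close>
 have "\<bar>autocor \<phi> w\<bar> \<le> ((nm \<phi>)\<^sup>2 + 1) * indicator {-(2*R)..2*R} w" for w
 proof (cases "w \<in> {-(2*R)..2*R}")
  case True
  then show ?thesis
   using Cauchy_Schwarz_ip[OF s(1) s(2)[of w]] s(3)[of w] unfolding ip_def autocor_def
   by (simp add: power2_eq_square)
 next
  case False
  have "\<phi> x * \<phi> (x - w) = 0" for x
   using B(3)[of x] B(3)[of "x - w"] False by (cases "x \<in> {-R..R}"; cases "x - w \<in> {-R..R}") auto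
  then have "autocor \<phi> w = 0" unfolding autocor_def by (simp only: integral_zero)
  then show ?thesis by simp
 qed
 then show thesis using that[of "(nm \<phi>)\<^sup>2 + 1" "2 * R"] B(2) by (simp add: add_nonneg_pos)
qed

lemma autocor_tendsto:
 assumes t: "tame \<phi>" and X: "X \<longlonglongrightarrow> 0"
 shows "(\<lambda>n. autocor \<phi> (X n)) \<longlonglongrightarrow> (nm \<phi>)\<^sup>2"
proof -
 obtain B R where B: "0 < B" "0 < R" "!!x. \<bar>\<phi> x\<bar> \<le> B * indicator {-R..R} x"
  using tame_bounds[OF t] by metis
 obtain S where S: "finite S" "!!x. x \<notin> S ==> isCont \<phi> x" using t by (auto simp: tame_def)
 have [measurable]: "\<phi> \<in> borel_measurable borel" by (rule tame_measurable[OF t])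
 have "(\<lambda>n. LINT x|lborel. \<phi> x * \<phi> (x - X n)) \<longlonglongrightarrow> (LINT x|lborel. \<phi> x * \<phi> x)"
 proof (rule integral_dominated_convergence[where w = "\<lambda>x. B * B * indicator {-R..R} x"])
  show "integrable lborel (\<lambda>x. B * B * indicator {-R..R} x :: real)"
   using B(2) by (intro integrable_mult_right) auto
  have "AE x in lborel. x \<notin> S" using S(1) by (intro AE_not_in finite_imp_null_set_lborel)
  then show "AE x in lborel. (\<lambda>n. \<phi> x * \<phi> (x - X n)) \<longlonglongrightarrow> \<phi> x * \<phi> x"
  proof eventually_elim
   case (elim x)
   have "(\<lambda>n. x - X n) \<longlonglongrightarrow> x - 0" by (intro tendsto_intros X)
   then show ?case
    by (intro tendsto_mult tendsto_const isCont_tendsto_compose[OF S(2)[OF elim]]) simp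
  qed
  show "AE x in lborel. norm (\<phi> x * \<phi> (x - X n)) \<le> B * B * indicator {-R..R} x" for n
  proof (intro AE_I2)
   fix x
   have "\<bar>\<phi> (x - X n)\<bar> \<le> B"
    using B(3)[of "x - X n"] B(1) by (cases "x - X n \<in> {-R..R}") auto
   then have "\<bar>\<phi> x\<bar> * \<bar>\<phi> (x - X n)\<bar> \<le> B * indicator {-R..R} x * B"
    using B(1,3) by (intro mult_mono) auto
   then show "norm (\<phi> x * \<phi> (x - X n)) \<le> B * B * indicator {-R..R} x"
    by (simp add: abs_mult mult.commute mult.left_commute)
  qed
 qed auto
 then show ?thesis unfolding nm_squared autocor_def by (simp add: power2_eq_square)
qed

lemma ft_measurable [measurable]:
 assumes "tame \<phi>" shows "ft \<phi> \<in> borel_measurable borel"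
proof -
 have [measurable]: "\<phi> \<in> borel_measurable borel" by (rule tame_measurable[OF assms])
 have "(\<lambda>(\<xi>, x). complex_of_real (\<phi> x) * fexp \<xi> x) \<in> borel_measurable (borel \<Otimes>\<^sub>M lborel)" by measurable
 then show ?thesis
  unfolding ft_def[abs_def] by (rule lborel.borel_measurable_lebesgue_integral)
qed

lemma ft_integrable:
 assumes "tame \<phi>" shows "integrable lborel (\<lambda>x. complex_of_real (\<phi> x) * fexp \<xi> x)"
proof (rule Bochner_Integration.integrable_bound[OF tame_integrable(1)[OF assms]])
 have [measurable]: "\<phi> \<in> borel_measurable borel" by (rule tame_measurable[OF assms])
 show "(\<lambda>x. complex_of_real (\<phi> x) * fexp \<xi> x) \<in> borel_measurable lborel" by measurable
qed (simp add: norm_mult)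

text \<open>The Wiener-Khinchin identity. The substitution \<open>y = x - w\<close> in the conjugate
  factor combines the phases to \<open>fexp \<xi> w\<close>; then Fubini lets the integral over
  \<open>x\<close> come first.\<close>

lemma ft_squared:
 assumes t: "tame \<phi>"
 shows "complex_of_real ((cmod (ft \<phi> \<xi>))\<^sup>2) = (LINT w|lborel. complex_of_real (autocor \<phi> w) * fexp \<xi> w)"
proof -
 obtain B R where B: "0 < B" "0 < R" "!!x. \<bar>\<phi> x\<bar> \<le> B * indicator {-R..R} x"
  using tame_bounds[OF t] by metis
 have [measurable]: "\<phi> \<in> borel_measurable borel" by (rule tame_measurable[OF t])
 let ?f = "\<lambda>x w. complex_of_real (\<phi> x * \<phi> (x - w)) * fexp \<xi> w"
 have c: "cnj (ft \<phi> \<xi>) = (LINT y|lborel. complex_of_real (\<phi> y) * fexp \<xi> (- y))"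
  unfolding ft_def Bochner_Integration.integral_cnj[symmetric] complex_cnj_mult complex_cnj_complex_of_real cnj_fexp by (rule refl)
 have c2: "cnj (ft \<phi> \<xi>) = (LINT w|lborel. complex_of_real (\<phi> (x - w)) * fexp \<xi> (w - x))" for x
  unfolding c by (subst lborel_integral_real_affine[of "-1" _ x]) simp_all
 have "complex_of_real ((cmod (ft \<phi> \<xi>))\<^sup>2) = ft \<phi> \<xi> * cnj (ft \<phi> \<xi>)"
  by (rule complex_norm_square)
 also have "... = (LINT x|lborel. complex_of_real (\<phi> x) * fexp \<xi> x * cnj (ft \<phi> \<xi>))"
  unfolding ft_def[of \<phi>] by simp
 also have "... = (LINT x|lborel. LINT w|lborel. ?f x w)"
 proof (intro Bochner_Integration.integral_cong refl)
  fix x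
  have "complex_of_real (\<phi> x) * fexp \<xi> x * cnj (ft \<phi> \<xi>)
    = (LINT w|lborel. complex_of_real (\<phi> x) * fexp \<xi> x * (complex_of_real (\<phi> (x - w)) * fexp \<xi> (w - x)))"
   unfolding c2[of x] by simp
  also have "... = (LINT w|lborel. ?f x w)"
  proof (intro Bochner_Integration.integral_cong refl)
   fix w
   have "fexp \<xi> x * fexp \<xi> (w - x) = fexp \<xi> w" by (simp add: fexp_add[symmetric])
   then show "complex_of_real (\<phi> x) * fexp \<xi> x * (complex_of_real (\<phi> (x - w)) * fexp \<xi> (w - x)) = ?f x w"
    by (metis (no_types, lifting) mult.assoc mult.left_commute of_real_mult)
  qed
  finally show "complex_of_real (\<phi> x) * fexp \<xi> x * cnj (ft \<phi> \<xi>) = (LINT w|lborel. ?f x w)" .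
 qed
 also have "... = (LINT w|lborel. LINT x|lborel. ?f x w)"
 proof (rule lborel_pair.Fubini_integral[symmetric])
  show "integrable (lborel \<Otimes>\<^sub>M lborel) (\<lambda>(x, w). ?f x w)"
  proof (rule integrable_pair_bound[where g = "\<lambda>x. B * indicator {-R..R} x" and h = "\<lambda>w. B * indicator {-(2*R)..2*R} w"])
   show "norm (case (x, w) of (x, w) => ?f x w) \<le> B * indicator {-R..R} x * (B * indicator {-(2*R)..2*R} w)" for x w
   proof -
    have "\<bar>\<phi> x\<bar> * \<bar>\<phi> (x - w)\<bar> \<le> B * indicator {-R..R} x * (B * indicator {-R..R} (x - w))"
     using B by (intro mult_mono) auto
    also have "... \<le> B * indicator {-R..R} x * (B * indicator {-(2*R)..2*R} w)"
     using B by (auto simp: indicator_def)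
    finally show ?thesis by (simp add: norm_mult)
   qed
  qed (use B in \<open>auto intro!: integrable_mult_right\<close>)
 qed
 also have "... = (LINT w|lborel. complex_of_real (autocor \<phi> w) * fexp \<xi> w)"
  unfolding autocor_def by (simp add: of_real_mult[symmetric] del: of_real_mult)
 finally show ?thesis .
qed

text \<open>The Gaussian weight makes the double integral absolutely convergent while nothing is
  known yet about the integrability of the transform. The transform of the weight is an explicit
  Gaussian that concentrates at \<open>w = 0\<close> as \<open>s\<close> tends to 0.\<close>

lemma Plancherel_tame_weighted:
 assumes t: "tame \<phi>" and s: "0 < s"
 shows "integrable lborel (\<lambda>\<xi>. (cmod (ft \<phi> \<xi>))\<^sup>2 * std_normal_density (s * \<xi>))"
  "(LINT \<xi>|lborel. (cmod (ft \<phi> \<xi>))\<^sup>2 * std_normal_density (s * \<xi>))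
   = sqrt (2 * pi) * (LINT z|lborel. autocor \<phi> (s * z) * std_normal_density z)"
proof -
 obtain B R where B: "0 < B" "0 < R" "!!w. \<bar>autocor \<phi> w\<bar> \<le> B * indicator {-R..R} w"
  using autocor_bounds[OF t] by metis
 have [measurable]: "autocor \<phi> \<in> borel_measurable borel" by (rule autocor_measurable[OF t])
 have [measurable]: "ft \<phi> \<in> borel_measurable borel" by (rule ft_measurable[OF t])
 have nd: "integrable lborel (\<lambda>\<xi>. std_normal_density (s * \<xi>))"
  using lborel_integrable_real_affine[of std_normal_density s 0] s integrable_normal_density[of 1 0] by simp
 let ?f = "\<lambda>w \<xi>. complex_of_real (autocor \<phi> w) * (complex_of_real (std_normal_density (s * \<xi>)) * fexp \<xi> w)"
 have int: "integrable (lborel \<Otimes>\<^sub>M lborel) (\<lambda>(w, \<xi>). ?f w \<xi>)"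
 proof (rule integrable_pair_bound[OF _ _ nd, where g = "\<lambda>w. B * indicator {-R..R} w"])
  show "norm (case (w, \<xi>) of (w, \<xi>) => ?f w \<xi>) \<le> B * indicator {-R..R} w * std_normal_density (s * \<xi>)" for w \<xi>
   using B(3)[of w] by (simp add: norm_mult mult_right_mono)
 qed (use B in \<open>auto intro!: integrable_mult_right\<close>)
 have eq: "(LINT w|lborel. ?f w \<xi>) = complex_of_real ((cmod (ft \<phi> \<xi>))\<^sup>2 * std_normal_density (s * \<xi>))" for \<xi>
 proof -
  have "(LINT w|lborel. ?f w \<xi>)
   = (LINT w|lborel. complex_of_real (std_normal_density (s * \<xi>)) * (complex_of_real (autocor \<phi> w) * fexp \<xi> w))"
   by (intro Bochner_Integration.integral_cong refl) simp
  also have "... = complex_of_real (std_normal_density (s * \<xi>)) * complex_of_real ((cmod (ft \<phi> \<xi>))\<^sup>2)"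
   unfolding ft_squared[OF t] by simp
  finally show ?thesis by simp
 qed
 have "integrable lborel (\<lambda>\<xi>. LINT w|lborel. ?f w \<xi>)"
  using lborel_pair.integrable_snd[OF int] by simp
 then have "integrable lborel (\<lambda>\<xi>. complex_of_real ((cmod (ft \<phi> \<xi>))\<^sup>2 * std_normal_density (s * \<xi>)))"
  unfolding eq .
 then show i: "integrable lborel (\<lambda>\<xi>. (cmod (ft \<phi> \<xi>))\<^sup>2 * std_normal_density (s * \<xi>))"
  using complex_of_real_integrable_eq by blast
 have "complex_of_real (LINT \<xi>|lborel. (cmod (ft \<phi> \<xi>))\<^sup>2 * std_normal_density (s * \<xi>))
   = (LINT \<xi>|lborel. LINT w|lborel. ?f w \<xi>)"
  unfolding eq by (rule integral_complex_of_real[symmetric])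
 also have "... = (LINT w|lborel. LINT \<xi>|lborel. ?f w \<xi>)"
  by (rule lborel_pair.Fubini_integral[OF int])
 also have "... = (LINT w|lborel. complex_of_real (autocor \<phi> w * (exp (- (w / s)\<^sup>2 / 2) / s)))"
  using gauss_transform[OF s] by simp
 also have "... = complex_of_real (LINT w|lborel. autocor \<phi> w * (exp (- (w / s)\<^sup>2 / 2) / s))"
  by (rule integral_complex_of_real)
 also have "(LINT w|lborel. autocor \<phi> w * (exp (- (w / s)\<^sup>2 / 2) / s))
   = \<bar>s\<bar> *\<^sub>R (LINT z|lborel. autocor \<phi> (0 + s * z) * (exp (- ((0 + s * z) / s)\<^sup>2 / 2) / s))"
  using s by (intro lborel_integral_real_affine) simp
 also have "... = (LINT z|lborel. \<bar>s\<bar> *\<^sub>R (autocor \<phi> (0 + s * z) * (exp (- ((0 + s * z) / s)\<^sup>2 / 2) / s)))"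
  by (rule integral_scaleR_right[symmetric])
 also have "... = (LINT z|lborel. sqrt (2 * pi) * (autocor \<phi> (s * z) * std_normal_density z))"
  using s by (intro Bochner_Integration.integral_cong refl) (simp add: std_normal_density_def)
 finally show "(LINT \<xi>|lborel. (cmod (ft \<phi> \<xi>))\<^sup>2 * std_normal_density (s * \<xi>))
   = sqrt (2 * pi) * (LINT z|lborel. autocor \<phi> (s * z) * std_normal_density z)"
  by (simp del: of_real_mult)
qed

text \<open>Let the weight tend to 1. On the frequency side it increases, so monotone convergence
  delivers integrability together with the value. On the other side
  \<open>autocor \<phi> (s n * z)\<close> tends to the squared norm, dominated by a constant times
  the Gaussian density.\<close>

theorem Plancherel_tame:
 assumes t: "tame \<phi>"
 shows "sq (\<lambda>\<xi>. cmod (ft \<phi> \<xi>))" "(nm (\<lambda>\<xi>. cmod (ft \<phi> \<xi>)))\<^sup>2 = 2 * pi * (nm \<phi>)\<^sup>2"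
proof -
 obtain B R where B: "0 < B" "0 < R" "!!w. \<bar>autocor \<phi> w\<bar> \<le> B * indicator {-R..R} w"
  using autocor_bounds[OF t] by metis
 have [measurable]: "autocor \<phi> \<in> borel_measurable borel" by (rule autocor_measurable[OF t])
 have [measurable]: "ft \<phi> \<in> borel_measurable borel" by (rule ft_measurable[OF t])
 define s where "s n = 1 / real (Suc n)" for n
 have s: "0 < s n" "s \<longlonglongrightarrow> 0" for n
  using LIMSEQ_inverse_real_of_nat by (auto simp: s_def[abs_def] inverse_eq_divide)
 \<comment> \<open>The factor \<open>sqrt (2 * pi)\<close> normalises the Gaussian to the value 1 at
   0.\<close>
 define F where "F n \<xi> = sqrt (2 * pi) * ((cmod (ft \<phi> \<xi>))\<^sup>2 * std_normal_density (s n * \<xi>))" for n \<xi>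
 have F_eq: "F n \<xi> = (cmod (ft \<phi> \<xi>))\<^sup>2 * exp (- (s n * \<xi>)\<^sup>2 / 2)" for n \<xi>
  by (simp add: F_def std_normal_density_def)
 have iF: "integrable lborel (F n)" for n
  unfolding F_def by (intro integrable_mult_right Plancherel_tame_weighted(1)[OF t s(1)])
 have B1: "\<bar>autocor \<phi> w\<bar> \<le> B" for w
  using B(1) B(3)[of w] by (cases "w \<in> {-R..R}") auto
 have lim: "(\<lambda>n. LINT z|lborel. autocor \<phi> (s n * z) * std_normal_density z)
   \<longlonglongrightarrow> (LINT z|lborel. (nm \<phi>)\<^sup>2 * std_normal_density z)"
 proof (rule integral_dominated_convergence[where w = "\<lambda>z. B * std_normal_density z"])
  show "AE z in lborel. (\<lambda>n. autocor \<phi> (s n * z) * std_normal_density z) \<longlonglongrightarrow> (nm \<phi>)\<^sup>2 * std_normal_density z"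
   using tendsto_mult_left_zero[OF s(2)] by (intro AE_I2 tendsto_mult tendsto_const autocor_tendsto[OF t])
  show "AE z in lborel. norm (autocor \<phi> (s n * z) * std_normal_density z) \<le> B * std_normal_density z" for n
   using B1 by (intro AE_I2) (simp add: abs_mult mult_right_mono)
 qed auto
 have ilim: "(\<lambda>n. integral\<^sup>L lborel (F n)) \<longlonglongrightarrow> sqrt (2 * pi) * (sqrt (2 * pi) * ((nm \<phi>)\<^sup>2 * 1))"
  using tendsto_mult_left[OF lim, of "sqrt (2 * pi) * sqrt (2 * pi)"]
  unfolding F_def integral_mult_right_zero Plancherel_tame_weighted(2)[OF t s(1)]
  by (simp add: mult.assoc integral_normal_density[of 1 0, simplified])
 have mono: "AE \<xi> in lborel. mono (\<lambda>n. F n \<xi>)"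
 proof (intro AE_I2 monoI)
  fix \<xi> and m n :: nat assume mn: "m \<le> n"
  have "s n \<le> s m" using mn by (simp add: s_def frac_le)
  then have "(s n)\<^sup>2 * \<xi>\<^sup>2 \<le> (s m)\<^sup>2 * \<xi>\<^sup>2" using s(1)[of n] by (intro mult_right_mono power_mono) auto
  then show "F m \<xi> \<le> F n \<xi>" unfolding F_eq power_mult_distrib by (intro mult_left_mono) auto
 qed
 have pt: "AE \<xi> in lborel. (\<lambda>n. F n \<xi>) \<longlonglongrightarrow> (cmod (ft \<phi> \<xi>))\<^sup>2"
 proof (intro AE_I2)
  fix \<xi>
  have "(\<lambda>n. (cmod (ft \<phi> \<xi>))\<^sup>2 * exp (- (s n * \<xi>)\<^sup>2 / 2)) \<longlonglongrightarrow> (cmod (ft \<phi> \<xi>))\<^sup>2 * exp (- (0 * \<xi>)\<^sup>2 / 2)"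
   by (intro tendsto_intros s(2)) simp
  then show "(\<lambda>n. F n \<xi>) \<longlonglongrightarrow> (cmod (ft \<phi> \<xi>))\<^sup>2" by (simp add: F_eq)
 qed
 have pos: "AE \<xi> in lborel. 0 \<le> F n \<xi>" for n by (simp add: F_eq)
 note M = integral_monotone_convergence_nonneg[OF iF mono pos pt ilim]
 show "sq (\<lambda>\<xi>. cmod (ft \<phi> \<xi>))" unfolding sq_def using M(1) by simp
 show "(nm (\<lambda>\<xi>. cmod (ft \<phi> \<xi>)))\<^sup>2 = 2 * pi * (nm \<phi>)\<^sup>2"
  unfolding nm_squared[of "\<lambda>\<xi>. cmod (ft \<phi> \<xi>)"] using M(2) by (simp add: mult.assoc[symmetric])
qed

section \<open>Complex square integrable functions\<close>

definition cnm :: "(real => complex) => real" where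
 "cnm g = nm (\<lambda>\<xi>. cmod (g \<xi>))"

definition csq :: "(real => complex) => bool" where
 "csq g \<longleftrightarrow> g \<in> borel_measurable borel \<and> integrable lborel (\<lambda>\<xi>. (cmod (g \<xi>))\<^sup>2)"

lemma csq_measurable [measurable_dest]: "csq g ==> g \<in> borel_measurable borel"
 by (simp add: csq_def)

lemma csq_sq: "csq g ==> sq (\<lambda>\<xi>. cmod (g \<xi>))"
 unfolding csq_def sq_def by (auto intro: borel_measurable_norm)

lemma csqI: "g \<in> borel_measurable borel ==> sq (\<lambda>\<xi>. cmod (g \<xi>)) ==> csq g"
 by (simp add: csq_def sq_def)

lemma cnm_nonneg [simp]: "0 \<le> cnm g"
 by (simp add: cnm_def)

lemma cnm_squared: "(cnm g)\<^sup>2 = (LINT \<xi>|lborel. (cmod (g \<xi>))\<^sup>2)"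
 by (simp add: cnm_def nm_squared)

lemma cnm_mono:
 assumes h: "csq h" and g: "g \<in> borel_measurable borel" and le: "!!\<xi>. cmod (g \<xi>) \<le> cmod (h \<xi>)"
 shows "csq g" "cnm g \<le> cnm h"
proof -
 have m: "(\<lambda>\<xi>. cmod (g \<xi>)) \<in> borel_measurable borel" using g by measurable
 note n = nm_mono[OF csq_sq[OF h] m]
 show "csq g" using n(1) le by (intro csqI g) auto
 show "cnm g \<le> cnm h" unfolding cnm_def using n(2) le by auto
qed

lemma cnm_mono_real:
 assumes h: "sq h" and g: "g \<in> borel_measurable borel" and le: "!!\<xi>. cmod (g \<xi>) \<le> h \<xi>"
 shows "csq g" "cnm g \<le> nm h"
proof -
 have m: "(\<lambda>\<xi>. cmod (g \<xi>)) \<in> borel_measurable borel" using g by measurable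
 have le': "\<bar>cmod (g \<xi>)\<bar> \<le> \<bar>h \<xi>\<bar>" for \<xi> using le[of \<xi>] by simp
 note n = nm_mono[OF h m le']
 show "csq g" using n(1) by (intro csqI g)
 show "cnm g \<le> nm h" unfolding cnm_def by (rule n(2))
qed

lemma csq_add:
 assumes g: "csq g" and h: "csq h"
 shows "csq (\<lambda>\<xi>. g \<xi> + h \<xi>)" "cnm (\<lambda>\<xi>. g \<xi> + h \<xi>) \<le> cnm g + cnm h"
proof -
 have m: "(\<lambda>\<xi>. g \<xi> + h \<xi>) \<in> borel_measurable borel" using g h by measurable
 note n = cnm_mono_real[OF sq_add[OF csq_sq[OF g] csq_sq[OF h]] m norm_triangle_ineq]
 show "csq (\<lambda>\<xi>. g \<xi> + h \<xi>)" by (rule n(1))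
 show "cnm (\<lambda>\<xi>. g \<xi> + h \<xi>) \<le> cnm g + cnm h"
  using n(2) nm_triangle[OF csq_sq[OF g] csq_sq[OF h]] by (simp add: cnm_def)
qed

lemma csq_bounded_mult:
 assumes g: "csq g" and m: "m \<in> borel_measurable borel" and B: "!!\<xi>. cmod (m \<xi>) \<le> B"
 shows "csq (\<lambda>\<xi>. m \<xi> * g \<xi>)" "cnm (\<lambda>\<xi>. m \<xi> * g \<xi>) \<le> B * cnm g"
proof -
 have mm: "(\<lambda>\<xi>. cmod (m \<xi>)) \<in> borel_measurable borel" using m by measurable
 have meas: "(\<lambda>\<xi>. m \<xi> * g \<xi>) \<in> borel_measurable borel"
  by (rule borel_measurable_times[OF m csq_measurable[OF g]])
 have B': "\<bar>cmod (m \<xi>)\<bar> \<le> B" for \<xi> using B[of \<xi>] by simp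
 note n = sq_bounded_mult[OF csq_sq[OF g] mm B']
 show "csq (\<lambda>\<xi>. m \<xi> * g \<xi>)" by (rule csqI[OF meas]) (use n(1) in \<open>simp add: norm_mult\<close>)
 show "cnm (\<lambda>\<xi>. m \<xi> * g \<xi>) \<le> B * cnm g" using n(2) by (simp add: cnm_def norm_mult)
qed

lemma csq_cmult:
 assumes g: "csq g" shows "csq (\<lambda>\<xi>. c * g \<xi>)" "cnm (\<lambda>\<xi>. c * g \<xi>) = cmod c * cnm g"
 using csq_bounded_mult(1)[OF g, of "\<lambda>_. c" "cmod c"] nm_cmult[of "cmod c"]
 by (auto simp: cnm_def norm_mult)

lemma csq_diff:
 assumes g: "csq g" and h: "csq h"
 shows "csq (\<lambda>\<xi>. g \<xi> - h \<xi>)" "cnm (\<lambda>\<xi>. g \<xi> - h \<xi>) \<le> cnm g + cnm h"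
 using csq_add[OF g csq_cmult(1)[OF h, of "-1"]] csq_cmult(2)[OF h, of "-1"] by auto

lemma cnm_minus_commute: "cnm (\<lambda>\<xi>. g \<xi> - h \<xi>) = cnm (\<lambda>\<xi>. h \<xi> - g \<xi>)"
 by (simp add: cnm_def norm_minus_commute)

lemma cnm_triangle3:
 assumes "csq f" "csq g" "csq h"
 shows "cnm (\<lambda>\<xi>. f \<xi> - h \<xi>) \<le> cnm (\<lambda>\<xi>. f \<xi> - g \<xi>) + cnm (\<lambda>\<xi>. g \<xi> - h \<xi>)"
 using csq_add(2)[OF csq_diff(1)[OF assms(1,2)] csq_diff(1)[OF assms(2,3)]] by simp

lemma cnm_diff_le:
 assumes g: "csq g" and h: "csq h"
 shows "\<bar>cnm g - cnm h\<bar> \<le> cnm (\<lambda>\<xi>. g \<xi> - h \<xi>)"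
 using csq_add(2)[OF csq_diff(1)[OF g h] h] csq_add(2)[OF csq_diff(1)[OF h g] g]
  cnm_minus_commute[of g h] by simp

lemma cnm_eq_0_AE: "csq g ==> cnm g = 0 ==> AE \<xi> in lborel. g \<xi> = 0"
 using nm_eq_0_AE[OF csq_sq] by (simp add: cnm_def)

lemma csq_integrable_mult_cnj:
 assumes g: "csq g" and h: "csq h"
 shows "integrable lborel (\<lambda>\<xi>. g \<xi> * cnj (h \<xi>))"
proof (rule Bochner_Integration.integrable_bound[OF sq_integrable_mult[OF csq_sq[OF g] csq_sq[OF h]]])
 have [measurable]: "g \<in> borel_measurable borel" "h \<in> borel_measurable borel"
  using g h by (auto simp: csq_def)
 have [measurable]: "(\<lambda>\<xi>. cnj (h \<xi>)) \<in> borel_measurable borel"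
  by (rule borel_measurable_continuous_on[OF continuous_on_cnj[OF continuous_on_id]]) measurable
 show "(\<lambda>\<xi>. g \<xi> * cnj (h \<xi>)) \<in> borel_measurable lborel" by measurable
qed (simp add: norm_mult)

lemma cnm_add_squared:
 assumes g: "csq g" and h: "csq h"
 shows "(cnm (\<lambda>\<xi>. g \<xi> + h \<xi>))\<^sup>2 = (cnm g)\<^sup>2 + 2 * Re (LINT \<xi>|lborel. g \<xi> * cnj (h \<xi>)) + (cnm h)\<^sup>2"
proof -
 have i: "integrable lborel (\<lambda>\<xi>. (cmod (g \<xi>))\<^sup>2)" "integrable lborel (\<lambda>\<xi>. (cmod (h \<xi>))\<^sup>2)"
  "integrable lborel (\<lambda>\<xi>. Re (g \<xi> * cnj (h \<xi>)))"
  using g h integrable_Re[OF csq_integrable_mult_cnj[OF g h]] by (auto simp: csq_def)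
 have pt: "(cmod (a + b))\<^sup>2 = (cmod a)\<^sup>2 + 2 * Re (a * cnj b) + (cmod b)\<^sup>2" for a b
  unfolding cmod_power2 by (simp add: power2_eq_square algebra_simps)
 define r where "r \<xi> = Re (g \<xi> * cnj (h \<xi>))" for \<xi>
 have "(cnm (\<lambda>\<xi>. g \<xi> + h \<xi>))\<^sup>2
   = (LINT \<xi>|lborel. (cmod (g \<xi>))\<^sup>2 + 2 * r \<xi> + (cmod (h \<xi>))\<^sup>2)"
  unfolding cnm_squared pt r_def ..
 also have "... = (LINT \<xi>|lborel. (cmod (g \<xi>))\<^sup>2) + 2 * (LINT \<xi>|lborel. r \<xi>)
   + (LINT \<xi>|lborel. (cmod (h \<xi>))\<^sup>2)"
  using i unfolding r_def[symmetric] by simp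
 finally show ?thesis
  unfolding cnm_squared r_def integral_Re[OF csq_integrable_mult_cnj[OF g h]] .
qed

text \<open>The limit holds only off a null set; multiplication by the indicator of the complement
  reduces this to the pointwise version.\<close>

lemma cnm_Fatou:
 assumes f: "!!n::nat. csq (f n)" and M: "!!n. cnm (f n) \<le> M n" "M \<longlonglongrightarrow> L"
  and g: "g \<in> borel_measurable borel" and lim: "AE \<xi> in lborel. (\<lambda>n. f n \<xi>) \<longlonglongrightarrow> g \<xi>"
 shows "csq g" "cnm g \<le> L"
proof -
 obtain N where N: "N \<in> null_sets lborel" "{\<xi>. \<not> (\<lambda>n. f n \<xi>) \<longlonglongrightarrow> g \<xi>} \<subseteq> N"
  using lim unfolding eventually_ae_filter by auto
 have [measurable]: "N \<in> sets borel" using N(1) by auto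
 have [measurable]: "f n \<in> borel_measurable borel" for n using f[of n] by (simp add: csq_def)
 define F where "F n \<xi> = indicator (- N) \<xi> * f n \<xi>" for n \<xi>
 have ind: "cmod (indicator (- N) \<xi>) \<le> 1" for \<xi> by (simp add: indicator_def)
 have im: "(\<lambda>\<xi>. indicator (- N) \<xi> :: complex) \<in> borel_measurable borel" by measurable
 note Fb = csq_bounded_mult[OF f im ind]
 have p: "(\<lambda>n. cmod (F n \<xi>)) \<longlonglongrightarrow> cmod (indicator (- N) \<xi> * g \<xi>)" for \<xi>
 proof (cases "\<xi> \<in> N")
  case False
  then have "(\<lambda>n. f n \<xi>) \<longlonglongrightarrow> g \<xi>" using N(2) by blast
  then show ?thesis unfolding F_def by (intro tendsto_intros)
 qed (simp add: F_def)
 have sF: "sq (\<lambda>\<xi>. cmod (F n \<xi>))" "nm (\<lambda>\<xi>. cmod (F n \<xi>)) \<le> M n" for n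
  using csq_sq[OF Fb(1), of n] Fb(2)[of n] M(1)[of n] by (simp_all add: F_def cnm_def)
 note G = nm_Fatou_tendsto[OF sF(1) M(2) sF(2) p]
 have ae: "AE \<xi> in lborel. indicator (- N) \<xi> * g \<xi> = g \<xi>"
  using AE_not_in[OF N(1)] by eventually_elim simp
 have m: "(\<lambda>\<xi>. indicator (- N) \<xi> * g \<xi>) \<in> borel_measurable borel" using g im by measurable
 have "integrable lborel (\<lambda>\<xi>. (cmod (indicator (- N) \<xi> * g \<xi>))\<^sup>2)"
  using G(1) by (simp add: sq_def)
 then have i: "integrable lborel (\<lambda>\<xi>. (cmod (g \<xi>))\<^sup>2)"
  by (rule integrable_cong_AE_imp) (use ae g in \<open>auto elim: eventually_mono\<close>)
 show "csq g" using i g by (simp add: csq_def)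
 have "(LINT \<xi>|lborel. (cmod (indicator (- N) \<xi> * g \<xi>))\<^sup>2) = (LINT \<xi>|lborel. (cmod (g \<xi>))\<^sup>2)"
  by (rule Bochner_Integration.integral_cong_AE) (use ae g m in \<open>auto elim: eventually_mono\<close>)
 then show "cnm g \<le> L" using G(2) by (simp add: cnm_def nm_def)
qed

text \<open>The Riesz-Fischer theorem for a rapidly Cauchy sequence. With the weights 2^n the
  integrals of \<open>2 ^ n * (d n \<xi>)\<^sup>2\<close> still have a finite sum, and
  \<open>d \<le> 1 / 2 ^ n + 2 ^ n * d\<^sup>2\<close> then makes the increments absolutely summable
  almost everywhere. Fatou gives the rate for the pointwise limit.\<close>

lemma csq_complete:
 assumes f: "!!n::nat. csq (f n)" and C: "!!m n. n \<le> m ==> cnm (\<lambda>\<xi>. f m \<xi> - f n \<xi>) \<le> (1 / 2) ^ n"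
 obtains g where "csq g" "!!n. cnm (\<lambda>\<xi>. g \<xi> - f n \<xi>) \<le> (1 / 2) ^ n"
proof -
 have [measurable]: "f n \<in> borel_measurable borel" for n using f[of n] by (simp add: csq_def)
 define d where "d n \<xi> = cmod (f (Suc n) \<xi> - f n \<xi>)" for n \<xi>
 have [measurable]: "d n \<in> borel_measurable borel" for n unfolding d_def by measurable
 have "(\<integral>\<^sup>+\<xi>. ennreal (2 ^ n * (d n \<xi>)\<^sup>2) \<partial>lborel) \<le> ennreal ((1 / 2) ^ n)" for n
 proof -
  have i: "integrable lborel (\<lambda>\<xi>. (d n \<xi>)\<^sup>2)"
   using csq_diff(1)[OF f f, of "Suc n" n] by (simp add: csq_def d_def)
  have "(LINT \<xi>|lborel. (d n \<xi>)\<^sup>2) = (cnm (\<lambda>\<xi>. f (Suc n) \<xi> - f n \<xi>))\<^sup>2"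
   unfolding cnm_squared d_def ..
  also have "... \<le> ((1 / 2) ^ n)\<^sup>2" by (intro power_mono C) auto
  finally have "2 ^ n * (LINT \<xi>|lborel. (d n \<xi>)\<^sup>2) \<le> 2 ^ n * ((1 / 2) ^ n)\<^sup>2" by simp
  also have "... = (1 / 2 :: real) ^ n" by (simp add: power2_eq_square power_divide)
  finally have "2 ^ n * (LINT \<xi>|lborel. (d n \<xi>)\<^sup>2) \<le> (1 / 2) ^ n" .
  moreover have "(\<integral>\<^sup>+\<xi>. ennreal (2 ^ n * (d n \<xi>)\<^sup>2) \<partial>lborel) = ennreal (LINT \<xi>|lborel. 2 ^ n * (d n \<xi>)\<^sup>2)"
   using i by (intro nn_integral_eq_integral) auto
  ultimately show ?thesis by (simp add: ennreal_leI)
 qed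
 then have "(\<Sum>n. \<integral>\<^sup>+\<xi>. ennreal (2 ^ n * (d n \<xi>)\<^sup>2) \<partial>lborel) \<le> (\<Sum>n. ennreal ((1 / 2) ^ n))"
  by (intro suminf_le) auto
 also have "(\<Sum>n. ennreal ((1 / 2 :: real) ^ n)) = ennreal (\<Sum>n. (1 / 2) ^ n)"
  by (intro suminf_ennreal2) (auto intro: summable_geometric)
 also have "... < \<infinity>" by simp
 finally have "(\<integral>\<^sup>+\<xi>. (\<Sum>n. ennreal (2 ^ n * (d n \<xi>)\<^sup>2)) \<partial>lborel) \<noteq> \<infinity>"
  by (subst nn_integral_suminf) auto
 then have "AE \<xi> in lborel. (\<Sum>n. ennreal (2 ^ n * (d n \<xi>)\<^sup>2)) \<noteq> \<infinity>"
  by (intro nn_integral_noteq_infinite) auto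
 then have conv: "AE \<xi> in lborel. convergent (\<lambda>n. f n \<xi>)"
 proof eventually_elim
  case (elim \<xi>)
  have s2: "summable (\<lambda>n. 2 ^ n * (d n \<xi>)\<^sup>2)"
   by (rule summable_suminf_not_top) (use elim in auto)
  have bd: "norm (f (Suc n) \<xi> - f n \<xi>) \<le> (1 / 2) ^ n + 2 ^ n * (d n \<xi>)\<^sup>2" for n
  proof -
   have "0 \<le> (1 - 2 ^ n * d n \<xi>)\<^sup>2 + (2 ^ n * d n \<xi>)\<^sup>2 + 1" by simp
   then have "2 ^ n * d n \<xi> \<le> 1 + (2 ^ n * d n \<xi>)\<^sup>2" by (simp add: power2_diff)
   then have "(1 / 2) ^ n * (2 ^ n * d n \<xi>) \<le> (1 / 2) ^ n * (1 + (2 ^ n * d n \<xi>)\<^sup>2)"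
    by (intro mult_left_mono) auto
   then show ?thesis by (simp add: d_def power_divide power_mult_distrib distrib_left power2_eq_square ac_simps)
  qed
  have "summable (\<lambda>n. (1 / 2) ^ n + 2 ^ n * (d n \<xi>)\<^sup>2)"
   by (rule summable_add[OF summable_geometric s2]) simp
  then have "summable (\<lambda>n. f (Suc n) \<xi> - f n \<xi>)"
   by (rule summable_comparison_test') (rule bd)
  then have "convergent (\<lambda>n. f n \<xi> - f 0 \<xi>)"
   unfolding summable_iff_convergent sum_lessThan_telescope[of "\<lambda>i. f i \<xi>"] .
  then have "convergent (\<lambda>n. (f n \<xi> - f 0 \<xi>) + f 0 \<xi>)"
   by (intro convergent_add convergent_const)
  then show ?case by simp
 qed
 define g where "g \<xi> = lim (\<lambda>n. f n \<xi>)" for \<xi>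
 have gm: "g \<in> borel_measurable borel" unfolding g_def by measurable
 have glim: "AE \<xi> in lborel. (\<lambda>m. f m \<xi>) \<longlonglongrightarrow> g \<xi>"
  using conv by eventually_elim (simp add: g_def convergent_LIMSEQ_iff)
 have D: "csq (\<lambda>\<xi>. g \<xi> - f n \<xi>) \<and> cnm (\<lambda>\<xi>. g \<xi> - f n \<xi>) \<le> (1 / 2) ^ n" for n
 proof -
  have 1: "csq (\<lambda>\<xi>. f (m + n) \<xi> - f n \<xi>)" for m by (rule csq_diff(1)[OF f f])
  have 2: "cnm (\<lambda>\<xi>. f (m + n) \<xi> - f n \<xi>) \<le> (1 / 2) ^ n" for m by (rule C) simp
  have 3: "(\<lambda>\<xi>. g \<xi> - f n \<xi>) \<in> borel_measurable borel" using gm by measurable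
  have 4: "AE \<xi> in lborel. (\<lambda>m. f (m + n) \<xi> - f n \<xi>) \<longlonglongrightarrow> g \<xi> - f n \<xi>"
   using glim
  proof eventually_elim
   case (elim \<xi>)
   then show ?case by (intro tendsto_diff tendsto_const LIMSEQ_ignore_initial_segment)
  qed
  show ?thesis using cnm_Fatou[OF 1 2 tendsto_const 3 4] by blast
 qed
 have "csq (\<lambda>\<xi>. (g \<xi> - f 0 \<xi>) + f 0 \<xi>)" using D[of 0] by (intro csq_add(1) f) auto
 then show thesis using that[of g] D by simp
qed

text \<open>A class closed under linear combinations and shifts that contains both the continuous
  square integrable functions and the normalised indicators used for Fourier inversion.\<close>

definition ltame :: "(real => real) => bool" where
 "ltame u \<longleftrightarrow> sq u \<and> (\<forall>a b. tame (\<lambda>x. indicator {a..b} x * u x))"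

lemma ltame_sq: "ltame u ==> sq u"
 by (simp add: ltame_def)

lemma ltame_tame: "ltame u ==> tame (\<lambda>x. indicator {a..b} x * u x)"
 by (simp add: ltame_def)

lemma ltame_continuous: "continuous_on UNIV u ==> integrable lborel (\<lambda>x. (u x)\<^sup>2) ==> ltame u"
 by (simp add: ltame_def tame_indicator sq_def borel_measurable_continuous_onI)

lemma ltame_bcl: "bcl u ==> ltame u"
 by (simp add: ltame_continuous bcl_def)

lemma ltame_add:
 assumes "ltame u" "ltame v" shows "ltame (\<lambda>x. u x + v x)"
 using assms tame_add[OF ltame_tame[OF assms(1)] ltame_tame[OF assms(2)]] 
 by (auto simp: ltame_def distrib_left)

lemma ltame_cmult: "ltame u ==> ltame (\<lambda>x. c * u x)"
 using tame_cmult[OF ltame_tame[of u], of c] by (auto simp: ltame_def mult.left_commute)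

lemma ltame_diff: "ltame u ==> ltame v ==> ltame (\<lambda>x. u x - v x)"
 using ltame_add[of u "\<lambda>x. (-1) * v x"] ltame_cmult[of v "-1"] by simp

lemma ltame_shift:
 assumes u: "ltame u" shows "ltame (\<lambda>x. u (x + c))"
 unfolding ltame_def
proof (intro conjI allI)
 show "sq (\<lambda>x. u (x + c))" using sq_shift(1)[OF ltame_sq[OF u]] .
 fix a b
 have "tame (\<lambda>x. (\<lambda>y. indicator {a + c..b + c} y * u y) (x + c))"
  by (rule tame_shift[OF ltame_tame[OF u]])
 then show "tame (\<lambda>x. indicator {a..b} x * u (x + c))"
  by (simp add: indicator_def)
qed

section \<open>The transform as a limit of truncated transforms\<close>

abbreviation trunc :: "real => real => (real => real) => real => real" where
 "trunc a b u \<equiv> (\<lambda>x. indicator {a..b} x * u x)"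

text \<open>The windows are centred at \<open>c\<close> because truncating a translate amounts to
  translating a truncation to a moved window.\<close>

lemma trunc_tendsto:
 assumes u: "sq u"
 shows "((\<lambda>R. ndist u (trunc (- R + c) (R + c) u)) \<longlongrightarrow> 0) at_top"
proof -
 have [measurable]: "u \<in> borel_measurable borel" using u by (rule sq_measurable)
 have "((\<lambda>R. LINT x|lborel. (u x - trunc (- R + c) (R + c) u x)\<^sup>2) \<longlongrightarrow> (LINT x|(lborel :: real measure). (0::real))) at_top"
 proof (rule integral_dominated_convergence_at_top[where w = "\<lambda>x. (u x)\<^sup>2"])
  show "integrable lborel (\<lambda>x. (u x)\<^sup>2)" using u by (rule sq_integrable)
  show "AE x in lborel. ((\<lambda>R. (u x - trunc (- R + c) (R + c) u x)\<^sup>2) \<longlongrightarrow> 0) at_top"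
  proof (intro AE_I2)
   fix x
   have "\<forall>\<^sub>F R in at_top. R \<ge> \<bar>x - c\<bar>" by (rule eventually_ge_at_top)
   then have "\<forall>\<^sub>F R in at_top. (u x - trunc (- R + c) (R + c) u x)\<^sup>2 = 0"
    by eventually_elim (auto simp: indicator_def abs_le_iff)
   then show "((\<lambda>R. (u x - trunc (- R + c) (R + c) u x)\<^sup>2) \<longlongrightarrow> 0) at_top"
    by (rule tendsto_eventually)
  qed
  show "\<forall>\<^sub>F R in at_top. AE x in lborel. norm ((u x - trunc (- R + c) (R + c) u x)\<^sup>2) \<le> (u x)\<^sup>2"
   by (intro always_eventually allI AE_I2) (auto simp: indicator_def)
 qed measurable
 then have "((\<lambda>R. LINT x|lborel. (u x - trunc (- R + c) (R + c) u x)\<^sup>2) \<longlongrightarrow> 0) at_top" by simp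
 from tendsto_real_sqrt[OF this] show ?thesis by (simp add: nm_def)
qed

lemma sq_trunc: "sq u ==> sq (trunc a b u)"
 by (rule sq_bounded_mult(1)[where B = 1]) (auto simp: indicator_def)

lemma ft_add:
 assumes "tame f" "tame g" shows "ft (\<lambda>x. f x + g x) = (\<lambda>\<xi>. ft f \<xi> + ft g \<xi>)"
 using ft_integrable[OF assms(1)] ft_integrable[OF assms(2)] by (auto simp: ft_def distrib_right)

lemma ft_cmult: "ft (\<lambda>x. c * f x) = (\<lambda>\<xi>. complex_of_real c * ft f \<xi>)"
 by (auto simp: ft_def mult.assoc)

lemma ft_diff:
 assumes "tame f" "tame g" shows "ft (\<lambda>x. f x - g x) = (\<lambda>\<xi>. ft f \<xi> - ft g \<xi>)"
 using ft_add[OF assms(1) tame_cmult[OF assms(2), of "-1"]] ft_cmult[of "-1" g] by simp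

lemma ft_csq:
 assumes "tame f" shows "csq (ft f)" "cnm (ft f) = sqrt (2 * pi) * nm f"
proof -
 show "csq (ft f)" by (rule csqI[OF ft_measurable[OF assms] Plancherel_tame(1)[OF assms]])
 have "(cnm (ft f))\<^sup>2 = (sqrt (2 * pi) * nm f)\<^sup>2"
  using Plancherel_tame(2)[OF assms] by (simp add: cnm_def power_mult_distrib)
 then show "cnm (ft f) = sqrt (2 * pi) * nm f" by (simp add: power2_eq_iff_nonneg)
qed

lemma has_fourier_transform_iff:
 assumes u: "ltame u"
 shows "has_fourier_transform u g \<longleftrightarrow>
  csq g \<and> ((\<lambda>R. cnm (\<lambda>\<xi>. ft (trunc (- R) R u) \<xi> - g \<xi>)) \<longlongrightarrow> 0) at_top"
proof (cases "csq g")
 case False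
 then show ?thesis by (auto simp: has_fourier_transform_def csq_def)
next
 case True
 have eq: "(LINT x:{-R..R}|lborel. complex_of_real (u x) * exp (- \<i> * complex_of_real (\<xi> * x)))
   = ft (trunc (- R) R u) \<xi>" for R \<xi>
  unfolding set_lebesgue_integral_def ft_def fexp_def
  by (intro Bochner_Integration.integral_cong refl) (auto simp: indicator_def)
 have nn: "(\<integral>\<^sup>+\<xi>. ennreal ((cmod (ft (trunc (- R) R u) \<xi> - g \<xi>))\<^sup>2) \<partial>lborel)
   = ennreal ((cnm (\<lambda>\<xi>. ft (trunc (- R) R u) \<xi> - g \<xi>))\<^sup>2)" for R
  unfolding cnm_squared
  using csq_diff(1)[OF ft_csq(1)[OF ltame_tame[OF u]] True, of "- R" R]
  by (intro nn_integral_eq_integral) (auto simp: csq_def)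
 have "((\<lambda>R. (c R)\<^sup>2) \<longlongrightarrow> 0) F \<longleftrightarrow> (c \<longlongrightarrow> 0) F" for c :: "real => real" and F
  using tendsto_power[of c 0 F 2] tendsto_real_sqrt[of "\<lambda>R. (c R)\<^sup>2" 0 F] tendsto_rabs_zero_iff[of c F]
  by auto
 then have "((\<lambda>R. ennreal ((cnm (\<lambda>\<xi>. ft (trunc (- R) R u) \<xi> - g \<xi>))\<^sup>2)) \<longlongrightarrow> 0) at_top
   \<longleftrightarrow> ((\<lambda>R. cnm (\<lambda>\<xi>. ft (trunc (- R) R u) \<xi> - g \<xi>)) \<longlongrightarrow> 0) at_top"
  using tendsto_ennreal_iff[where F = at_top and f = "\<lambda>R. (cnm (\<lambda>\<xi>. ft (trunc (- R) R u) \<xi> - g \<xi>))\<^sup>2" and x = 0] by simp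
 then show ?thesis
  unfolding has_fourier_transform_def eq nn using True by (simp add: csq_def)
qed

lemma has_fourier_transform_csq: "ltame u ==> has_fourier_transform u g ==> csq g"
 by (simp add: has_fourier_transform_iff)

text \<open>Plancherel for tame functions makes the truncated transforms Cauchy as \<open>R\<close>
  grows. A rapidly Cauchy sequence of radii has a limit, and all larger radii stay close to
  it.\<close>

lemma has_fourier_transform_exists:
 assumes u: "ltame u" shows "has_fourier_transform u (fourier u)"
proof -
 note T = ltame_tame[OF u] and s = ltame_sq[OF u]
 define F where "F R = ft (trunc (- R) R u)" for R
 define e where "e R = sqrt (2 * pi) * (2 * ndist u (trunc (- R) R u))" for R
 have cF: "csq (F R)" for R unfolding F_def by (rule ft_csq(1)[OF T])
 have lim: "(e \<longlongrightarrow> 0) at_top"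
  using tendsto_mult_right_zero[OF tendsto_mult_right_zero[OF trunc_tendsto[OF s, of 0], of 2], of "sqrt (2 * pi)"]
  by (simp add: e_def[abs_def])
 have dF: "cnm (\<lambda>\<xi>. F R' \<xi> - F R \<xi>) \<le> e R" if "R \<le> R'" for R R'
 proof -
  have "F R' \<xi> - F R \<xi> = ft (\<lambda>x. trunc (- R') R' u x - trunc (- R) R u x) \<xi>" for \<xi>
   unfolding F_def ft_diff[OF T T] ..
  then have "cnm (\<lambda>\<xi>. F R' \<xi> - F R \<xi>) = sqrt (2 * pi) * ndist (trunc (- R') R' u) (trunc (- R) R u)"
   using ft_csq(2)[OF tame_add[OF T tame_cmult[OF T, where c = "-1"]]] by simp
  also have "ndist (trunc (- R') R' u) (trunc (- R) R u) \<le> ndist u (trunc (- R) R u)"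
   by (rule nm_mono(2)) (use that sq_measurable[OF s] s sq_trunc in \<open>auto simp: indicator_def\<close>)
  also have "sqrt (2 * pi) * ndist u (trunc (- R) R u) \<le> e R"
   unfolding e_def by (intro mult_left_mono) (simp_all only: mult_2 le_add_same_cancel1 nm_nonneg real_sqrt_ge_zero pi_ge_zero zero_le_mult_iff, auto)
  finally show ?thesis by simp
 qed
 have "\<exists>r. \<forall>R\<ge>r. e R < (1 / 2) ^ n" for n
  using order_tendstoD(2)[OF lim, of "(1 / 2) ^ n"] by (simp add: eventually_at_top_linorder)
 then obtain r where r: "!!n R. r n \<le> R ==> e R < (1 / 2) ^ n" by metis
 \<comment> \<open>Partial sums make the radii increasing while keeping each of them at least
   \<open>r n\<close>.\<close>
 define r' where "r' n = (\<Sum>i\<le>n. \<bar>r i\<bar>)" for n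
 have r'_mono: "n \<le> m ==> r' n \<le> r' m" for m n unfolding r'_def by (intro sum_mono2) auto
 have "r n \<le> r' n" for n
  using member_le_sum[of n "{..n}" "\<lambda>i. \<bar>r i\<bar>"] by (simp add: r'_def)
 then have r': "e (r' n) < (1 / 2) ^ n" for n using r by blast
 have "cnm (\<lambda>\<xi>. F (r' m) \<xi> - F (r' n) \<xi>) \<le> (1 / 2) ^ n" if "n \<le> m" for m n
  using dF[OF r'_mono[OF that]] r'[of n] by linarith
 from csq_complete[OF cF this] obtain g where g: "csq g" "!!n. cnm (\<lambda>\<xi>. g \<xi> - F (r' n) \<xi>) \<le> (1 / 2) ^ n"
  by blast
 have "cnm (\<lambda>\<xi>. F R \<xi> - g \<xi>) \<le> 2 * (1 / 2) ^ n" if "r' n \<le> R" for n R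
  using cnm_triangle3[OF cF cF g(1), of R "r' n"] dF[OF that] r'[of n] g(2)[of n]
  by (simp add: cnm_minus_commute[of "F (r' n)"])
 then have ev: "\<forall>\<^sub>F R in at_top. cnm (\<lambda>\<xi>. F R \<xi> - g \<xi>) \<le> 2 * (1 / 2) ^ n" for n
  by (auto simp: eventually_at_top_linorder)
 have "((\<lambda>R. cnm (\<lambda>\<xi>. F R \<xi> - g \<xi>)) \<longlongrightarrow> 0) at_top"
 proof (rule tendstoI)
  fix d :: real assume "d > 0"
  then obtain n where "(1 / 2 :: real) ^ n < d / 2" using real_arch_pow_inv[of "d / 2" "1 / 2"] by auto
  then show "\<forall>\<^sub>F R in at_top. dist (cnm (\<lambda>\<xi>. F R \<xi> - g \<xi>)) 0 < d"
   using ev[of n] by (auto elim!: eventually_mono simp: dist_real_def)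
 qed
 then have "has_fourier_transform u g" using g(1) by (simp add: has_fourier_transform_iff[OF u] F_def)
 then show ?thesis unfolding fourier_def by (rule someI[of "has_fourier_transform u"])
qed

lemma has_fourier_transform_linear:
 assumes u: "ltame u" "has_fourier_transform u g" and v: "ltame v" "has_fourier_transform v h"
 shows "has_fourier_transform (\<lambda>x. a * u x + b * v x) (\<lambda>\<xi>. complex_of_real a * g \<xi> + complex_of_real b * h \<xi>)"
proof -
 have w: "ltame (\<lambda>x. a * u x + b * v x)" using u v by (intro ltame_add ltame_cmult)
 have g: "csq g" "((\<lambda>R. cnm (\<lambda>\<xi>. ft (trunc (- R) R u) \<xi> - g \<xi>)) \<longlongrightarrow> 0) at_top"
  using u by (auto simp: has_fourier_transform_iff)
 have h: "csq h" "((\<lambda>R. cnm (\<lambda>\<xi>. ft (trunc (- R) R v) \<xi> - h \<xi>)) \<longlongrightarrow> 0) at_top"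
  using v by (auto simp: has_fourier_transform_iff)
 have c: "csq (\<lambda>\<xi>. complex_of_real a * g \<xi> + complex_of_real b * h \<xi>)"
  using g h by (intro csq_add(1) csq_cmult(1))
 have eq: "ft (trunc (- R) R (\<lambda>x. a * u x + b * v x)) \<xi>
   = complex_of_real a * ft (trunc (- R) R u) \<xi> + complex_of_real b * ft (trunc (- R) R v) \<xi>" for R \<xi>
 proof -
  have e: "trunc (- R) R (\<lambda>x. a * u x + b * v x) = (\<lambda>x. a * trunc (- R) R u x + b * trunc (- R) R v x)"
   by (auto simp: algebra_simps)
  show ?thesis
   unfolding e ft_add[OF tame_cmult[OF ltame_tame[OF u(1)]] tame_cmult[OF ltame_tame[OF v(1)]]] ft_cmult ..
 qed
 have le: "cnm (\<lambda>\<xi>. ft (trunc (- R) R (\<lambda>x. a * u x + b * v x)) \<xi> - (complex_of_real a * g \<xi> + complex_of_real b * h \<xi>))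
   \<le> \<bar>a\<bar> * cnm (\<lambda>\<xi>. ft (trunc (- R) R u) \<xi> - g \<xi>) + \<bar>b\<bar> * cnm (\<lambda>\<xi>. ft (trunc (- R) R v) \<xi> - h \<xi>)" for R
 proof -
  have d: "csq (\<lambda>\<xi>. ft (trunc (- R) R u) \<xi> - g \<xi>)" "csq (\<lambda>\<xi>. ft (trunc (- R) R v) \<xi> - h \<xi>)"
   using g h csq_diff(1) ft_csq(1)[OF ltame_tame] u v by blast+
  have e: "complex_of_real a * p + complex_of_real b * q - (complex_of_real a * p' + complex_of_real b * q')
    = complex_of_real a * (p - p') + complex_of_real b * (q - q')" for p q p' q'
   by (simp add: algebra_simps)
  show ?thesis
   using csq_add(2)[OF csq_cmult(1)[OF d(1), of "complex_of_real a"] csq_cmult(1)[OF d(2), of "complex_of_real b"]]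
   unfolding csq_cmult(2)[OF d(1)] csq_cmult(2)[OF d(2)] eq e norm_of_real .
 qed
 have "((\<lambda>R. \<bar>a\<bar> * cnm (\<lambda>\<xi>. ft (trunc (- R) R u) \<xi> - g \<xi>) + \<bar>b\<bar> * cnm (\<lambda>\<xi>. ft (trunc (- R) R v) \<xi> - h \<xi>)) \<longlongrightarrow> \<bar>a\<bar> * 0 + \<bar>b\<bar> * 0) at_top"
  by (intro tendsto_intros g h)
 then have lim: "((\<lambda>R. \<bar>a\<bar> * cnm (\<lambda>\<xi>. ft (trunc (- R) R u) \<xi> - g \<xi>) + \<bar>b\<bar> * cnm (\<lambda>\<xi>. ft (trunc (- R) R v) \<xi> - h \<xi>)) \<longlongrightarrow> 0) at_top"
  by simp
 have "((\<lambda>R. cnm (\<lambda>\<xi>. ft (trunc (- R) R (\<lambda>x. a * u x + b * v x)) \<xi> - (complex_of_real a * g \<xi> + complex_of_real b * h \<xi>))) \<longlongrightarrow> 0) at_top"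
  by (rule tendsto_sandwich[OF _ _ tendsto_const lim]) (use le in auto)
 then show ?thesis using c by (simp add: has_fourier_transform_iff[OF w])
qed

text \<open>Both sides are limits of the identity for the truncations, as norms are continuous in
  the distance.\<close>

theorem Plancherel:
 assumes u: "ltame u" and g: "has_fourier_transform u g"
 shows "cnm g = sqrt (2 * pi) * nm u"
proof -
 note T = ltame_tame[OF u]
 have c: "csq g" and lim: "((\<lambda>R. cnm (\<lambda>\<xi>. ft (trunc (- R) R u) \<xi> - g \<xi>)) \<longlongrightarrow> 0) at_top"
  using g by (auto simp: has_fourier_transform_iff[OF u])
 have 1: "((\<lambda>R. cnm (ft (trunc (- R) R u))) \<longlongrightarrow> cnm g) at_top"
  by (rule Lim_transform_bound[OF _ lim, where f = "\<lambda>R. cnm (ft (trunc (- R) R u)) - cnm g", THEN LIM_zero_cancel])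
   (use cnm_diff_le[OF ft_csq(1)[OF T] c] in auto)
 have "((\<lambda>R. nm (trunc (- R) R u) - nm u) \<longlongrightarrow> 0) at_top"
  by (rule Lim_transform_bound[OF _ trunc_tendsto[OF ltame_sq[OF u], of 0]])
   (use nm_diff_le[OF sq_trunc ltame_sq[OF u]] ltame_sq[OF u] in \<open>auto simp: nm_minus_commute[of u]\<close>)
 then have "((\<lambda>R. nm (trunc (- R) R u)) \<longlongrightarrow> nm u) at_top" by (rule LIM_zero_cancel)
 then have 2: "((\<lambda>R. cnm (ft (trunc (- R) R u))) \<longlongrightarrow> sqrt (2 * pi) * nm u) at_top"
  unfolding ft_csq(2)[OF T] by (intro tendsto_intros)
 show ?thesis by (rule tendsto_unique[OF _ 1 2]) simp
qed

text \<open>The difference of two transforms of \<open>u\<close> is a transform of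
  \<open>u - u\<close>, so Plancherel gives it norm 0.\<close>

lemma has_fourier_transform_unique:
 assumes u: "ltame u" and g: "has_fourier_transform u g" and h: "has_fourier_transform u h"
 shows "AE \<xi> in lborel. g \<xi> = h \<xi>"
proof -
 have d: "has_fourier_transform (\<lambda>x. 1 * u x + (-1) * u x) (\<lambda>\<xi>. complex_of_real 1 * g \<xi> + complex_of_real (-1) * h \<xi>)"
  by (rule has_fourier_transform_linear[OF u g u h])
 have "ltame (\<lambda>x. 1 * u x + (-1) * u x)" using u by (intro ltame_add ltame_cmult)
 from Plancherel[OF this d] have "cnm (\<lambda>\<xi>. g \<xi> - h \<xi>) = 0" by simp
 moreover have "csq (\<lambda>\<xi>. g \<xi> - h \<xi>)"
  using u g h has_fourier_transform_csq by (intro csq_diff(1)) auto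
 ultimately show ?thesis using cnm_eq_0_AE by fastforce
qed

text \<open>Truncation and translation commute only up to a move of the window. Both windows exhaust
  the line, so the two truncations of \<open>u\<close> approach each other in norm, and so do their
  transforms.\<close>

lemma has_fourier_transform_shift:
 assumes u: "ltame u" and g: "has_fourier_transform u g"
 shows "has_fourier_transform (\<lambda>x. u (x + c)) (\<lambda>\<xi>. fexp \<xi> (- c) * g \<xi>)"
proof -
 note T = ltame_tame[OF u] and s = ltame_sq[OF u]
 have c: "csq g" and lim: "((\<lambda>R. cnm (\<lambda>\<xi>. ft (trunc (- R) R u) \<xi> - g \<xi>)) \<longlongrightarrow> 0) at_top"
  using g by (auto simp: has_fourier_transform_iff[OF u])
 have eq: "ft (trunc (- R) R (\<lambda>x. u (x + c))) \<xi> = fexp \<xi> (- c) * ft (trunc (- R + c) (R + c) u) \<xi>" for R \<xi>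
 proof -
  have "ft (trunc (- R + c) (R + c) u) \<xi> = \<bar>1\<bar> *\<^sub>R (LINT x|lborel.
    complex_of_real (trunc (- R + c) (R + c) u (c + 1 * x)) * fexp \<xi> (c + 1 * x))"
   unfolding ft_def by (rule lborel_integral_real_affine) simp
  then have "fexp \<xi> (- c) * ft (trunc (- R + c) (R + c) u) \<xi> = (LINT x|lborel. fexp \<xi> (- c) *
    (complex_of_real (trunc (- R + c) (R + c) u (c + x)) * fexp \<xi> (c + x)))"
   by simp
  also have "... = ft (trunc (- R) R (\<lambda>x. u (x + c))) \<xi>"
   unfolding ft_def
  proof (intro Bochner_Integration.integral_cong refl)
   fix x
   have "fexp \<xi> (- c) * fexp \<xi> (c + x) = fexp \<xi> x" by (simp add: fexp_add[symmetric])
   then have "fexp \<xi> (- c) * (complex_of_real (u (c + x)) * fexp \<xi> (c + x)) = complex_of_real (u (c + x)) * fexp \<xi> x"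
    by (metis mult.left_commute)
   then show "fexp \<xi> (- c) * (complex_of_real (trunc (- R + c) (R + c) u (c + x)) * fexp \<xi> (c + x))
     = complex_of_real (trunc (- R) R (\<lambda>x. u (x + c)) x) * fexp \<xi> x"
    by (simp add: indicator_def add.commute)
  qed
  finally show ?thesis by simp
 qed
 have le: "cnm (\<lambda>\<xi>. ft (trunc (- R) R (\<lambda>x. u (x + c))) \<xi> - fexp \<xi> (- c) * g \<xi>)
   \<le> sqrt (2 * pi) * (ndist u (trunc (- R + c) (R + c) u) + ndist u (trunc (- R + 0) (R + 0) u))
    + cnm (\<lambda>\<xi>. ft (trunc (- R) R u) \<xi> - g \<xi>)" for R
 proof -
  have "cnm (\<lambda>\<xi>. ft (trunc (- R) R (\<lambda>x. u (x + c))) \<xi> - fexp \<xi> (- c) * g \<xi>)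
    = cnm (\<lambda>\<xi>. ft (trunc (- R + c) (R + c) u) \<xi> - g \<xi>)"
   unfolding eq right_diff_distrib[symmetric] by (simp add: cnm_def norm_mult)
  also have "... \<le> cnm (\<lambda>\<xi>. ft (trunc (- R + c) (R + c) u) \<xi> - ft (trunc (- R) R u) \<xi>)
    + cnm (\<lambda>\<xi>. ft (trunc (- R) R u) \<xi> - g \<xi>)"
   by (rule cnm_triangle3[OF ft_csq(1)[OF T] ft_csq(1)[OF T] c])
  also have "cnm (\<lambda>\<xi>. ft (trunc (- R + c) (R + c) u) \<xi> - ft (trunc (- R) R u) \<xi>)
    = sqrt (2 * pi) * ndist (trunc (- R + c) (R + c) u) (trunc (- R) R u)"
   using ft_csq(2)[OF tame_add[OF T tame_cmult[OF T, where c = "-1"]]] by (simp add: ft_diff[OF T T, symmetric])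
  also have "ndist (trunc (- R + c) (R + c) u) (trunc (- R) R u)
    \<le> ndist u (trunc (- R + c) (R + c) u) + ndist u (trunc (- R + 0) (R + 0) u)"
   using nm_triangle_diff[OF sq_diff[OF s sq_trunc[OF s]] sq_diff[OF s sq_trunc[OF s]], of "-R" R "- R + c" "R + c"] by simp
  finally show ?thesis by simp
 qed
 have "((\<lambda>R. sqrt (2 * pi) * (ndist u (trunc (- R + c) (R + c) u) + ndist u (trunc (- R + 0) (R + 0) u))
    + cnm (\<lambda>\<xi>. ft (trunc (- R) R u) \<xi> - g \<xi>)) \<longlongrightarrow> sqrt (2 * pi) * (0 + 0) + 0) at_top"
  by (intro tendsto_add tendsto_mult tendsto_const trunc_tendsto[OF s] lim)
 then have L: "((\<lambda>R. sqrt (2 * pi) * (ndist u (trunc (- R + c) (R + c) u) + ndist u (trunc (- R + 0) (R + 0) u))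
    + cnm (\<lambda>\<xi>. ft (trunc (- R) R u) \<xi> - g \<xi>)) \<longlongrightarrow> 0) at_top" by simp
 have "((\<lambda>R. cnm (\<lambda>\<xi>. ft (trunc (- R) R (\<lambda>x. u (x + c))) \<xi> - fexp \<xi> (- c) * g \<xi>)) \<longlongrightarrow> 0) at_top"
  by (rule tendsto_sandwich[OF _ _ tendsto_const L]) (use le in auto)
 moreover have "csq (\<lambda>\<xi>. fexp \<xi> (- c) * g \<xi>)"
  by (rule csq_bounded_mult(1)[OF c, where B = 1]) auto
 ultimately show ?thesis by (simp add: has_fourier_transform_iff[OF ltame_shift[OF u]])
qed

text \<open>Polarisation of Plancherel with the sum alone, which determines the real part. This
  suffices for the inner products of real functions below.\<close>

theorem Parseval:
 assumes u: "ltame u" "has_fourier_transform u g" and v: "ltame v" "has_fourier_transform v h"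
 shows "Re (LINT \<xi>|lborel. g \<xi> * cnj (h \<xi>)) = 2 * pi * ip u v"
proof -
 have c: "csq g" "csq h" using u v has_fourier_transform_csq by auto
 have "has_fourier_transform (\<lambda>x. u x + v x) (\<lambda>\<xi>. g \<xi> + h \<xi>)"
  using has_fourier_transform_linear[OF u v, of 1 1] by simp
 from Plancherel[OF ltame_add[OF u(1) v(1)] this]
 have "(cnm (\<lambda>\<xi>. g \<xi> + h \<xi>))\<^sup>2 = 2 * pi * (nm (\<lambda>x. u x + v x))\<^sup>2"
  by (simp add: power_mult_distrib)
 moreover have "(cnm g)\<^sup>2 = 2 * pi * (nm u)\<^sup>2" "(cnm h)\<^sup>2 = 2 * pi * (nm v)\<^sup>2"
  using Plancherel[OF u] Plancherel[OF v] by (simp_all add: power_mult_distrib)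
 ultimately show ?thesis
  unfolding cnm_add_squared[OF c] nm_add_squared[OF ltame_sq[OF u(1)] ltame_sq[OF v(1)]]
  by (simp add: algebra_simps)
qed

section \<open>Sobolev spaces\<close>

text \<open>The Fourier symbol of \<open>cdiff h\<close>, written with phases so that the rule for
  shifts applies directly.\<close>

definition csym :: "real => real => complex" where
 "csym h \<xi> = (fexp \<xi> (- h) - fexp \<xi> h) / (2 * complex_of_real h)"

lemma csym_eq: "csym h \<xi> = \<i> * complex_of_real (sin (h * \<xi>) / h)"
proof -
 have "fexp \<xi> (- h) = cis (h * \<xi>)" "fexp \<xi> h = cis (- (h * \<xi>))"
  by (simp_all add: fexp_def cis_conv_exp mult.commute)
 then have "fexp \<xi> (- h) - fexp \<xi> h = 2 * \<i> * complex_of_real (sin (h * \<xi>))"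
  by (simp add: complex_eq_iff)
 then show ?thesis by (simp add: csym_def)
qed

lemma cmod_csym_le: "cmod (csym h \<xi>) \<le> \<bar>\<xi>\<bar>"
proof (cases "h = 0")
 case False
 then show ?thesis
  using abs_sin_x_le_abs_x[of "h * \<xi>"] by (simp add: csym_eq norm_mult norm_divide divide_simps abs_mult mult.commute)
qed (simp add: csym_eq)

lemma csym_tendsto:
 assumes X: "X \<longlonglongrightarrow> 0" "!!n. X n \<noteq> (0::real)"
 shows "(\<lambda>n. csym (X n) \<xi>) \<longlonglongrightarrow> \<i> * complex_of_real \<xi>"
proof -
 have "((\<lambda>h. sin (h * \<xi>)) has_real_derivative \<xi>) (at 0)"
  by (auto intro!: derivative_eq_intros)
 then have "((\<lambda>h. (sin (h * \<xi>) - sin (0 * \<xi>)) / (h - 0)) \<longlongrightarrow> \<xi>) (at 0)"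
  by (simp add: has_field_derivative_iff)
 then have "(\<lambda>n. sin (X n * \<xi>) / X n) \<longlonglongrightarrow> \<xi>"
  using X unfolding tendsto_at_iff_sequentially o_def by auto
 then show ?thesis unfolding csym_eq by (intro tendsto_intros)
qed

lemma csym_measurable [measurable]: "csym h \<in> borel_measurable borel"
 unfolding csym_def[abs_def] by measurable

lemma fourier_csq: "ltame u ==> csq (fourier u)"
 using has_fourier_transform_csq has_fourier_transform_exists by blast

lemma fourier_AE: "ltame u ==> has_fourier_transform u g ==> AE \<xi> in lborel. fourier u \<xi> = g \<xi>"
 using has_fourier_transform_unique has_fourier_transform_exists by blast

lemma ltame_cdiff: "ltame u ==> ltame (cdiff h u)"
proof -
 assume u: "ltame u"
 have "cdiff h u = (\<lambda>x. 1 / (2 * h) * (u (x + h) - u (x + - h)))" by (auto simp: cdiff_def)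
 then show ?thesis using u by (simp only: ltame_cmult ltame_diff ltame_shift)
qed

lemma has_fourier_transform_cdiff:
 assumes u: "ltame u" and g: "has_fourier_transform u g"
 shows "has_fourier_transform (cdiff h u) (\<lambda>\<xi>. csym h \<xi> * g \<xi>)"
proof -
 have e: "cdiff h u = (\<lambda>x. 1 / (2 * h) * u (x + h) + (- 1 / (2 * h)) * u (x + - h))"
  by (auto simp: cdiff_def diff_divide_distrib)
 have e2: "csym h \<xi> * g \<xi> = complex_of_real (1 / (2 * h)) * (fexp \<xi> (- h) * g \<xi>)
   + complex_of_real (- 1 / (2 * h)) * (fexp \<xi> (- (- h)) * g \<xi>)" for \<xi>
  by (simp add: csym_def diff_divide_distrib left_diff_distrib)
 show ?thesis
  unfolding e e2
  by (intro has_fourier_transform_linear ltame_shift has_fourier_transform_shift u g)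
qed

text \<open>The difference quotients are bounded by the derivative, and their symbols by \<open>\<bar>\<xi>\<bar>\<close>.\<close>

lemma fourier_deriv:
 assumes u: "ltame u" and f': "continuous_on UNIV u'" and d: "!!x. (u has_real_derivative u' x) (at x)"
  and i: "csq (\<lambda>\<xi>. complex_of_real \<xi> * fourier u \<xi>)"
 shows "sq u'" "AE \<xi> in lborel. fourier u' \<xi> = \<i> * complex_of_real \<xi> * fourier u \<xi>"
proof -
 define X where "X n = 1 / real (Suc n)" for n
 have X: "X \<longlonglongrightarrow> 0" "X n \<noteq> 0" "0 < X n" for n
  using LIMSEQ_inverse_real_of_nat by (auto simp: X_def[abs_def] inverse_eq_divide)
 let ?F = "fourier u"
 have cF: "csq ?F" by (rule fourier_csq[OF u])
 have [measurable]: "?F \<in> borel_measurable borel" using cF by (simp add: csq_def)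
 define W where "W = (\<lambda>\<xi>. complex_of_real \<xi> * ?F \<xi>)"
 have W: "csq W" using i by (simp add: W_def)
 note D = ltame_cdiff[OF u] and T = has_fourier_transform_cdiff[OF u has_fourier_transform_exists[OF u]]
 have pt: "(\<lambda>n. cdiff (X n) u x) \<longlonglongrightarrow> u' x" for x
 proof -
  have "((\<lambda>h. u (x + h) - u (x - h)) has_real_derivative u' (x + 0) * (0 + 1) - u' (x - 0) * (0 - 1)) (at 0)"
   by (intro DERIV_diff DERIV_chain2[where f = u] DERIV_add DERIV_const DERIV_ident d)
  then have "((\<lambda>h. u (x + h) - u (x - h)) has_real_derivative 2 * u' x) (at 0)" by simp
  then have "(\<lambda>n. (u (x + X n) - u (x - X n)) / X n) \<longlonglongrightarrow> 2 * u' x"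
   using X(1,2) unfolding has_field_derivative_iff tendsto_at_iff_sequentially o_def by auto
  from tendsto_mult_left[OF this, of "1 / 2"] show ?thesis by (simp add: cdiff_def mult.commute)
 qed
 have m_le: "cmod (csym (X n) \<xi> * ?F \<xi>) \<le> cmod (W \<xi>)" for n \<xi>
  using cmod_csym_le[of "X n" \<xi>] by (simp add: W_def norm_mult mult_right_mono)
 have cm: "csq (\<lambda>\<xi>. csym (X n) \<xi> * ?F \<xi>)" for n
  by (rule cnm_mono(1)[OF W _ m_le]) measurable
 have ciW: "csq (\<lambda>\<xi>. \<i> * W \<xi>)" using csq_cmult(1)[OF W] .
 have nD: "nm (cdiff (X n) u) \<le> 1 / sqrt (2 * pi) * cnm W" for n
 proof -
  have "sqrt (2 * pi) * nm (cdiff (X n) u) \<le> cnm W"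
   unfolding Plancherel[OF D T, symmetric] by (rule cnm_mono(2)[OF W _ m_le]) measurable
  then show ?thesis by (simp add: field_simps)
 qed
 show su: "sq u'" by (rule nm_Fatou(1)[OF ltame_sq[OF D] nD pt])
 have lu': "ltame u'" using f' su by (auto simp: sq_def intro: ltame_continuous)
 define e where "e n = cnm (\<lambda>\<xi>. csym (X n) \<xi> * ?F \<xi> - \<i> * W \<xi>)" for n
 \<comment> \<open>Dominated convergence on the frequency side: the symbols converge to
   \<open>\<i> * \<xi>\<close> and their products with the transform stay below
   \<open>cmod (W \<xi>)\<close>.\<close>
 have e_lim: "e \<longlonglongrightarrow> 0"
 proof -
  have W2: "integrable lborel (\<lambda>\<xi>. (2 * cmod (W \<xi>))\<^sup>2)"
   using W by (simp add: csq_def power_mult_distrib)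
  have [measurable]: "W \<in> borel_measurable borel" using W by (simp add: csq_def)
  have "(\<lambda>n. LINT \<xi>|lborel. (cmod (csym (X n) \<xi> * ?F \<xi> - \<i> * W \<xi>))\<^sup>2) \<longlonglongrightarrow> (LINT \<xi>|(lborel::real measure). (0::real))"
  proof (rule integral_dominated_convergence[OF _ _ W2])
   show "AE \<xi> in lborel. (\<lambda>n. (cmod (csym (X n) \<xi> * ?F \<xi> - \<i> * W \<xi>))\<^sup>2) \<longlonglongrightarrow> 0"
   proof (intro AE_I2)
    fix \<xi>
    have "(\<lambda>n. csym (X n) \<xi> * ?F \<xi> - \<i> * W \<xi>) \<longlonglongrightarrow> \<i> * complex_of_real \<xi> * ?F \<xi> - \<i> * W \<xi>"
     by (intro tendsto_intros csym_tendsto X)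
    then have "(\<lambda>n. csym (X n) \<xi> * ?F \<xi> - \<i> * W \<xi>) \<longlonglongrightarrow> 0" by (simp add: W_def)
    from tendsto_power[OF tendsto_norm[OF this], of 2]
    show "(\<lambda>n. (cmod (csym (X n) \<xi> * ?F \<xi> - \<i> * W \<xi>))\<^sup>2) \<longlonglongrightarrow> 0" by simp
   qed
   show "AE \<xi> in lborel. norm ((cmod (csym (X n) \<xi> * ?F \<xi> - \<i> * W \<xi>))\<^sup>2) \<le> (2 * cmod (W \<xi>))\<^sup>2" for n
   proof (intro AE_I2)
    fix \<xi>
    have "cmod (csym (X n) \<xi> * ?F \<xi> - \<i> * W \<xi>) \<le> 2 * cmod (W \<xi>)"
     using norm_triangle_ineq4[of "csym (X n) \<xi> * ?F \<xi>" "\<i> * W \<xi>"] m_le[of n \<xi>] by (simp add: norm_mult)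
    from power_mono[OF this, of 2]
    show "norm ((cmod (csym (X n) \<xi> * ?F \<xi> - \<i> * W \<xi>))\<^sup>2) \<le> (2 * cmod (W \<xi>))\<^sup>2" by simp
   qed
  qed measurable
  then have "(\<lambda>n. (e n)\<^sup>2) \<longlonglongrightarrow> 0" by (simp add: e_def cnm_squared)
  from tendsto_real_sqrt[OF this] show ?thesis by (simp add: e_def[abs_def])
 qed
 have e_bound: "cnm (\<lambda>\<xi>. csym (X m) \<xi> * ?F \<xi> - csym (X n) \<xi> * ?F \<xi>) \<le> e m + e n" for m n
  using cnm_triangle3[OF cm[of m] ciW cm[of n]] cnm_minus_commute[of "\<lambda>\<xi>. \<i> * W \<xi>"] by (simp add: e_def)
 \<comment> \<open>Plancherel makes the quotients close to each other in L2, and Fatou replaces one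
   of them by its pointwise limit \<open>u'\<close>.\<close>
 have nd: "ndist (cdiff (X n) u) u' \<le> 1 / sqrt (2 * pi) * (e n + 0)" for n
 proof (rule nm_Fatou_tendsto(2))
  show "sq (\<lambda>x. cdiff (X n) u x - cdiff (X m) u x)" for m
   by (intro sq_diff ltame_sq[OF D])
  show "(\<lambda>m. 1 / sqrt (2 * pi) * (e n + e m)) \<longlonglongrightarrow> 1 / sqrt (2 * pi) * (e n + 0)"
   by (intro tendsto_intros e_lim)
  show "ndist (cdiff (X n) u) (cdiff (X m) u) \<le> 1 / sqrt (2 * pi) * (e n + e m)" for m
  proof -
   have "has_fourier_transform (\<lambda>x. 1 * cdiff (X n) u x + (-1) * cdiff (X m) u x)
     (\<lambda>\<xi>. complex_of_real 1 * (csym (X n) \<xi> * ?F \<xi>) + complex_of_real (-1) * (csym (X m) \<xi> * ?F \<xi>))"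
    by (intro has_fourier_transform_linear D T)
   then have "has_fourier_transform (\<lambda>x. cdiff (X n) u x - cdiff (X m) u x)
     (\<lambda>\<xi>. csym (X n) \<xi> * ?F \<xi> - csym (X m) \<xi> * ?F \<xi>)" by simp
   from Plancherel[OF ltame_diff[OF D D] this] e_bound[of n m]
   show ?thesis by (simp add: field_simps)
  qed
  show "(\<lambda>m. cdiff (X n) u x - cdiff (X m) u x) \<longlonglongrightarrow> cdiff (X n) u x - u' x" for x
   by (intro tendsto_intros pt)
 qed
 have cu': "csq (fourier u')" by (rule fourier_csq[OF lu'])
 have "cnm (\<lambda>\<xi>. fourier u' \<xi> - \<i> * W \<xi>) \<le> e n + e n" for n
 proof -
  have "has_fourier_transform (\<lambda>x. 1 * u' x + (-1) * cdiff (X n) u x)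
    (\<lambda>\<xi>. complex_of_real 1 * fourier u' \<xi> + complex_of_real (-1) * (csym (X n) \<xi> * ?F \<xi>))"
   by (intro has_fourier_transform_linear D T lu' has_fourier_transform_exists)
  then have "has_fourier_transform (\<lambda>x. u' x - cdiff (X n) u x) (\<lambda>\<xi>. fourier u' \<xi> - csym (X n) \<xi> * ?F \<xi>)" by simp
  from Plancherel[OF ltame_diff[OF lu' D] this] nd[of n]
  have "cnm (\<lambda>\<xi>. fourier u' \<xi> - csym (X n) \<xi> * ?F \<xi>) \<le> e n"
   by (simp add: nm_minus_commute[of u'] field_simps)
  then show ?thesis using cnm_triangle3[OF cu' cm[of n] ciW] by (simp add: e_def)
 qed
 then have "cnm (\<lambda>\<xi>. fourier u' \<xi> - \<i> * W \<xi>) \<le> 0 + 0"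
  by (intro tendsto_lowerbound[OF tendsto_add[OF e_lim e_lim]]) auto
 then have "cnm (\<lambda>\<xi>. fourier u' \<xi> - \<i> * W \<xi>) = 0" by (intro order_antisym cnm_nonneg) simp
 from cnm_eq_0_AE[OF csq_diff(1)[OF cu' ciW] this]
 show "AE \<xi> in lborel. fourier u' \<xi> = \<i> * complex_of_real \<xi> * fourier u \<xi>"
  by (simp add: W_def mult.assoc)
qed

text \<open>The converse direction: a square integrable derivative bounds the quotients in L2,
  Plancherel bounds their transforms, and Fatou passes to the limit of the symbols.\<close>

lemma bsob_fourier_weight:
 assumes f: "bsob (Suc 0) f"
 shows "csq (\<lambda>\<xi>. complex_of_real \<xi> * fourier f \<xi>)"
proof -
 define X where "X n = 1 / real (Suc n)" for n
 have X: "X \<longlonglongrightarrow> 0" "X n \<noteq> 0" "0 < X n" for n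
  using LIMSEQ_inverse_real_of_nat by (auto simp: X_def[abs_def] inverse_eq_divide)
 have l: "ltame f" using f by (simp add: ltame_bcl)
 have [measurable]: "fourier f \<in> borel_measurable borel" using fourier_csq[OF l] by (simp add: csq_def)
 note T = has_fourier_transform_cdiff[OF l has_fourier_transform_exists[OF l]]
 have c: "csq (\<lambda>\<xi>. csym (X n) \<xi> * fourier f \<xi>)" for n
  using has_fourier_transform_csq[OF ltame_cdiff[OF l] T] .
 have b: "cnm (\<lambda>\<xi>. csym (X n) \<xi> * fourier f \<xi>) \<le> sqrt (2 * pi) * nm (deriv f)" for n
  unfolding Plancherel[OF ltame_cdiff[OF l] T] using nm_cdiff_le_deriv[OF f X(3)] by (intro mult_left_mono) auto
 have "csq (\<lambda>\<xi>. (\<i> * complex_of_real \<xi>) * fourier f \<xi>)"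
 proof (rule cnm_Fatou(1)[OF c b tendsto_const])
  show "AE \<xi> in lborel. (\<lambda>n. csym (X n) \<xi> * fourier f \<xi>) \<longlonglongrightarrow> (\<i> * complex_of_real \<xi>) * fourier f \<xi>"
   by (intro AE_I2 tendsto_intros csym_tendsto X)
 qed measurable
 from csq_cmult(1)[OF this, of "- \<i>"] show ?thesis by (simp add: mult.assoc[symmetric])
qed

lemma bsob_fourier_deriv:
 assumes f: "bsob (Suc 0) f"
 shows "AE \<xi> in lborel. fourier (deriv f) \<xi> = \<i> * complex_of_real \<xi> * fourier f \<xi>"
 by (rule fourier_deriv(2)[OF ltame_bcl _ _ bsob_fourier_weight[OF f]])
  (use f bcl_continuous in auto)

text \<open>One more factor 1 + \<xi>^2 splits the weighted integral into one for \<open>f\<close>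
  and one for \<open>deriv f\<close>. Each is bounded by the full norm of order
  \<open>Suc k\<close>, hence a factor 2 for each order.\<close>

lemma bsob_sobolev_weight:
 assumes "bsob k f"
 shows "integrable lborel (\<lambda>\<xi>. (1 + \<xi>\<^sup>2) ^ k * (cmod (fourier f \<xi>))\<^sup>2)"
  "sqrt (LINT \<xi>|lborel. (1 + \<xi>\<^sup>2) ^ k * (cmod (fourier f \<xi>))\<^sup>2) \<le> sqrt (2 * pi) * 2 ^ k * bnorm k f"
proof -
 have "integrable lborel (\<lambda>\<xi>. (1 + \<xi>\<^sup>2) ^ k * (cmod (fourier f \<xi>))\<^sup>2) \<and>
  sqrt (LINT \<xi>|lborel. (1 + \<xi>\<^sup>2) ^ k * (cmod (fourier f \<xi>))\<^sup>2) \<le> sqrt (2 * pi) * 2 ^ k * bnorm k f"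
  using assms
 proof (induction k arbitrary: f)
  case 0
  then have l: "ltame f" by (simp add: ltame_bcl)
  show ?case
   using fourier_csq[OF l] Plancherel[OF l has_fourier_transform_exists[OF l]]
   by (simp add: csq_def cnm_def nm_def)
 next
  case (Suc k)
  have f: "bsob (Suc 0) f" "bsob k f" "bsob k (deriv f)"
   using Suc.prems bsob_Suc[OF Suc.prems] bsob_bcl by auto
  define A B where "A = (LINT \<xi>|lborel. (1 + \<xi>\<^sup>2) ^ k * (cmod (fourier f \<xi>))\<^sup>2)"
   and "B = (LINT \<xi>|lborel. (1 + \<xi>\<^sup>2) ^ k * (cmod (fourier (deriv f) \<xi>))\<^sup>2)"
  have [measurable]: "fourier f \<in> borel_measurable borel" "fourier (deriv f) \<in> borel_measurable borel"
   using fourier_csq ltame_bcl bsob_bcl f by (auto simp: csq_def)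
  note I = conjunct1[OF Suc.IH[OF f(2)]] conjunct1[OF Suc.IH[OF f(3)]]
  have i: "integrable lborel (\<lambda>\<xi>. (1 + \<xi>\<^sup>2) ^ k * (cmod (fourier f \<xi>))\<^sup>2 + (1 + \<xi>\<^sup>2) ^ k * (cmod (fourier (deriv f) \<xi>))\<^sup>2)"
   using I by (rule Bochner_Integration.integrable_add)
  have ae: "AE \<xi> in lborel. (1 + \<xi>\<^sup>2) ^ k * (cmod (fourier f \<xi>))\<^sup>2 + (1 + \<xi>\<^sup>2) ^ k * (cmod (fourier (deriv f) \<xi>))\<^sup>2
    = (1 + \<xi>\<^sup>2) ^ Suc k * (cmod (fourier f \<xi>))\<^sup>2"
   using bsob_fourier_deriv[OF f(1)]
   by eventually_elim (simp add: norm_mult power_mult_distrib algebra_simps)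
  have 1: "integrable lborel (\<lambda>\<xi>. (1 + \<xi>\<^sup>2) ^ Suc k * (cmod (fourier f \<xi>))\<^sup>2)"
   by (rule integrable_cong_AE_imp[OF i]) (use ae in \<open>auto elim: eventually_mono\<close>)
  have "(LINT \<xi>|lborel. (1 + \<xi>\<^sup>2) ^ Suc k * (cmod (fourier f \<xi>))\<^sup>2) = A + B"
   unfolding A_def B_def Bochner_Integration.integral_add[OF I, symmetric]
   by (rule Bochner_Integration.integral_cong_AE) (use ae in \<open>auto elim: eventually_mono\<close>)
  then have "sqrt (LINT \<xi>|lborel. (1 + \<xi>\<^sup>2) ^ Suc k * (cmod (fourier f \<xi>))\<^sup>2) \<le> sqrt A + sqrt B"
   by (simp add: A_def B_def sqrt_add_le_add_sqrt del: power_Suc)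
  also have "... \<le> sqrt (2 * pi) * 2 ^ k * bnorm k f + sqrt (2 * pi) * 2 ^ k * bnorm k (deriv f)"
   using Suc.IH[OF f(2)] Suc.IH[OF f(3)] unfolding A_def B_def by (intro add_mono) auto
  also have "... \<le> sqrt (2 * pi) * 2 ^ k * bnorm (Suc k) f + sqrt (2 * pi) * 2 ^ k * bnorm (Suc k) f"
   using bnorm_Suc_mono[of k f] bnorm_deriv_le[of k f] by (intro add_mono mult_left_mono) auto
  finally show ?case using 1 by (auto simp del: power_Suc bnorm.simps simp: power_Suc[of "2::real"] algebra_simps)
 qed
 then show "integrable lborel (\<lambda>\<xi>. (1 + \<xi>\<^sup>2) ^ k * (cmod (fourier f \<xi>))\<^sup>2)"
  "sqrt (LINT \<xi>|lborel. (1 + \<xi>\<^sup>2) ^ k * (cmod (fourier f \<xi>))\<^sup>2) \<le> sqrt (2 * pi) * 2 ^ k * bnorm k f" by auto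
qed

theorem bsob_sobolev:
 assumes f: "bsob k f" and r: "r \<le> real k"
 shows "f \<in> sobolev r" "sobolev_norm r f \<le> sqrt (2 * pi) * 2 ^ k * bnorm k f"
proof -
 have b: "bcl f" using f by (rule bsob_bcl)
 have [measurable]: "fourier f \<in> borel_measurable borel" using fourier_csq[OF ltame_bcl[OF b]] by (simp add: csq_def)
 have le: "(1 + \<xi>\<^sup>2) powr r \<le> (1 + \<xi>\<^sup>2) ^ k" for \<xi> :: real
 proof -
  have "(1 + \<xi>\<^sup>2) powr r \<le> (1 + \<xi>\<^sup>2) powr real k" using r by (intro powr_mono) auto
  also have "... = (1 + \<xi>\<^sup>2) ^ k" by (subst powr_realpow) (auto intro: add_pos_nonneg)
  finally show ?thesis .
 qed
 have le2: "(1 + \<xi>\<^sup>2) powr r * (cmod (fourier f \<xi>))\<^sup>2 \<le> (1 + \<xi>\<^sup>2) ^ k * (cmod (fourier f \<xi>))\<^sup>2" for \<xi>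
  by (rule mult_right_mono[OF le]) simp
 note W = bsob_sobolev_weight[OF f]
 have i: "integrable lborel (\<lambda>\<xi>. (1 + \<xi>\<^sup>2) powr r * (cmod (fourier f \<xi>))\<^sup>2)"
  by (rule Bochner_Integration.integrable_bound[OF W(1)]) (use le2 in auto)
 show "f \<in> sobolev r" using b i by (simp add: sobolev_def bcl_def)
 have "sobolev_norm r f \<le> sqrt (LINT \<xi>|lborel. (1 + \<xi>\<^sup>2) ^ k * (cmod (fourier f \<xi>))\<^sup>2)"
  unfolding sobolev_norm_def by (intro real_sqrt_le_mono integral_mono i W(1) le2)
 then show "sobolev_norm r f \<le> sqrt (2 * pi) * 2 ^ k * bnorm k f" using W(2) by linarith
qed

section \<open>Fourier inversion and Sobolev embedding\<close>

lemma average_tendsto: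
 fixes F :: "real => 'b :: {banach, second_countable_topology}"
 assumes F: "continuous_on UNIV F" and h: "h \<longlonglongrightarrow> 0" "!!n. 0 < (h n :: real)"
 shows "(\<lambda>n. LINT y|lborel. (indicator {x - h n..x + h n} y * (1 / (2 * h n))) *\<^sub>R F y) \<longlonglongrightarrow> F x"
proof (rule LIMSEQ_I)
 fix e :: real assume e: "0 < e"
 obtain d where d: "d > 0" "!!y. dist y x < d ==> dist (F y) (F x) < e / 2"
  using F e unfolding continuous_on_iff by (metis UNIV_I half_gt_zero)
 obtain n0 where n0: "!!n. n \<ge> n0 ==> h n < d"
  using order_tendstoD(2)[OF h(1) d(1)] by (auto simp: eventually_sequentially)
 have "norm ((LINT y|lborel. (indicator {x - h n..x + h n} y * (1 / (2 * h n))) *\<^sub>R F y) - F x) < e" if n: "n \<ge> n0" for n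
 proof -
  define \<phi> :: "real => real" where "\<phi> y = indicator {x - h n..x + h n} y * (1 / (2 * h n))" for y
  have hn: "0 < h n" by (rule h)
  have i1: "integrable lborel \<phi>"
   unfolding \<phi>_def using hn by (intro integrable_mult_left) auto
  have one: "(LINT y|lborel. \<phi> y) = 1" unfolding \<phi>_def using hn by simp
  have i2: "integrable lborel (\<lambda>y. \<phi> y *\<^sub>R F y)"
  proof -
   have "integrable lborel (\<lambda>y. indicator {x - h n..x + h n} y *\<^sub>R F y)"
    by (intro borel_integrable_compact continuous_on_subset[OF F]) auto
   then have "integrable lborel (\<lambda>y. (1 / (2 * h n)) *\<^sub>R (indicator {x - h n..x + h n} y *\<^sub>R F y))"
    by (rule integrable_scaleR_right)
   then show ?thesis by (simp add: \<phi>_def mult.commute)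
  qed
  have "(LINT y|lborel. \<phi> y *\<^sub>R F y) - F x = (LINT y|lborel. \<phi> y *\<^sub>R F y) - (LINT y|lborel. \<phi> y *\<^sub>R F x)"
   using one i1 by simp
  also have "... = (LINT y|lborel. \<phi> y *\<^sub>R (F y - F x))"
   unfolding scaleR_diff_right using i1 i2 by (intro Bochner_Integration.integral_diff[symmetric]) auto
  finally have "norm ((LINT y|lborel. \<phi> y *\<^sub>R F y) - F x) \<le> (LINT y|lborel. norm (\<phi> y *\<^sub>R (F y - F x)))"
   by (metis integral_norm_bound)
  also have "... \<le> (LINT y|lborel. \<phi> y * (e / 2))"
  proof (rule integral_mono)
   show "integrable lborel (\<lambda>y. norm (\<phi> y *\<^sub>R (F y - F x)))"
    unfolding scaleR_diff_right using i1 i2 by (intro integrable_norm Bochner_Integration.integrable_diff) auto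
   show "integrable lborel (\<lambda>y. \<phi> y * (e / 2))" using i1 by simp
   show "norm (\<phi> y *\<^sub>R (F y - F x)) \<le> \<phi> y * (e / 2)" for y
   proof (cases "y \<in> {x - h n..x + h n}")
    case True
    then have "dist y x < d" using n0[OF n] by (auto simp: dist_real_def)
    then have "norm (F y - F x) \<le> e / 2" using d(2)[of y] by (simp add: dist_norm)
    moreover have "0 \<le> \<phi> y" using hn by (simp add: \<phi>_def)
    ultimately have "\<phi> y * norm (F y - F x) \<le> \<phi> y * (e / 2)" by (rule mult_left_mono)
    then show ?thesis using \<open>0 \<le> \<phi> y\<close> by simp
   qed (simp add: \<phi>_def)
  qed
  also have "... = e / 2" using one by simp
  finally show ?thesis using e by (simp add: \<phi>_def)
 qed
 then show "\<exists>n0. \<forall>n\<ge>n0. norm ((LINT y|lborel. (indicator {x - h n..x + h n} y * (1 / (2 * h n))) *\<^sub>R F y) - F x) < e"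
  by blast
qed

text \<open>Parseval against normalised indicators of intervals that shrink to \<open>x\<close>. On
  one side they average the continuous \<open>u\<close> to its value; on the other their transforms
  tend to the phase at \<open>x\<close> and have modulus at most 1, so the integrable transform of
  \<open>u\<close> dominates.\<close>

lemma fourier_inversion:
 assumes u: "continuous_on UNIV u" "integrable lborel (\<lambda>x. (u x)\<^sup>2)" and i: "integrable lborel (fourier u)"
 shows "u x = 1 / (2 * pi) * Re (LINT \<xi>|lborel. fourier u \<xi> * fexp \<xi> (- x))"
proof -
 have lu: "ltame u" using u by (rule ltame_continuous)
 define h where "h n = 1 / real (Suc n)" for n
 have h: "h \<longlonglongrightarrow> 0" "0 < h n" for n
  using LIMSEQ_inverse_real_of_nat by (auto simp: h_def[abs_def] inverse_eq_divide)
 define \<phi> :: "nat => real => real" where "\<phi> n y = indicator {x - h n..x + h n} y * (1 / (2 * h n))" for n y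
 have t: "tame (\<phi> n)" for n unfolding \<phi>_def by (rule tame_indicator) simp
 have lt: "ltame (\<phi> n)" for n
 proof -
  have "tame (\<lambda>y. indicator {max a (x - h n)..min b (x + h n)} y * (1 / (2 * h n)))" for a b
   by (rule tame_indicator) simp
  moreover have "(\<lambda>y. indicator {max a (x - h n)..min b (x + h n)} y * (1 / (2 * h n))) = (\<lambda>y. indicator {a..b} y * \<phi> n y)" for a b
   by (auto simp: \<phi>_def indicator_def)
  ultimately show ?thesis using tame_integrable(2)[OF t] by (simp add: ltame_def)
 qed
 have ht: "has_fourier_transform (\<phi> n) (ft (\<phi> n))" for n
 proof -
  have "\<forall>\<^sub>F R in at_top. R \<ge> \<bar>x\<bar> + h n" by (rule eventually_ge_at_top)
  then have "\<forall>\<^sub>F R in at_top. cnm (\<lambda>\<xi>. ft (trunc (- R) R (\<phi> n)) \<xi> - ft (\<phi> n) \<xi>) = 0"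
  proof eventually_elim
   case (elim R)
   have "trunc (- R) R (\<phi> n) = \<phi> n" using elim by (intro ext) (auto simp: \<phi>_def indicator_def)
   then show ?case by (simp add: cnm_def)
  qed
  then show ?thesis
   using ft_csq(1)[OF t] tendsto_eventually by (auto simp: has_fourier_transform_iff[OF lt])
 qed
 have ft_eq: "ft (\<phi> n) \<xi> = (LINT y|lborel. \<phi> n y *\<^sub>R fexp \<xi> y)" for n \<xi>
  by (simp add: ft_def scaleR_conv_of_real)
 have cf: "continuous_on UNIV (fexp \<xi>)" for \<xi> unfolding fexp_def[abs_def] by (intro continuous_intros)
 have ft_lim: "(\<lambda>n. ft (\<phi> n) \<xi>) \<longlonglongrightarrow> fexp \<xi> x" for \<xi>
  unfolding ft_eq \<phi>_def by (rule average_tendsto[OF cf h])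
 have ft_le: "cmod (ft (\<phi> n) \<xi>) \<le> 1" for n \<xi>
 proof -
  have "cmod (ft (\<phi> n) \<xi>) \<le> (LINT y|lborel. cmod (complex_of_real (\<phi> n y) * fexp \<xi> y))"
   unfolding ft_def by (rule integral_norm_bound)
  also have "... = (LINT y|lborel. \<phi> n y)"
  proof (intro Bochner_Integration.integral_cong refl)
   fix y
   have "0 \<le> \<phi> n y" using h(2)[of n] by (simp add: \<phi>_def)
   then show "cmod (complex_of_real (\<phi> n y) * fexp \<xi> y) = \<phi> n y" by (simp add: norm_mult)
  qed
  also have "... = 1" unfolding \<phi>_def using h(2)[of n] by simp
  finally show ?thesis .
 qed
 have [measurable]: "ft (\<phi> n) \<in> borel_measurable borel" for n by (rule ft_measurable[OF t])
 have [measurable]: "fourier u \<in> borel_measurable borel" using i by (simp add: borel_measurable_integrable)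
 have cnj_m: "(\<lambda>\<xi>. cnj (f \<xi>)) \<in> borel_measurable borel" if "f \<in> borel_measurable borel" for f :: "real => complex"
  by (rule borel_measurable_continuous_on[OF continuous_on_cnj[OF continuous_on_id] that])
 have "(\<lambda>n. LINT \<xi>|lborel. fourier u \<xi> * cnj (ft (\<phi> n) \<xi>)) \<longlonglongrightarrow> (LINT \<xi>|lborel. fourier u \<xi> * fexp \<xi> (- x))"
 proof (rule integral_dominated_convergence[where w = "\<lambda>\<xi>. cmod (fourier u \<xi>)"])
  have [measurable]: "(\<lambda>\<xi>. cnj (ft (\<phi> n) \<xi>)) \<in> borel_measurable borel" for n by (rule cnj_m) measurable
  show "(\<lambda>\<xi>. fourier u \<xi> * cnj (ft (\<phi> n) \<xi>)) \<in> borel_measurable lborel" for n by measurable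
  show "AE \<xi> in lborel. (\<lambda>n. fourier u \<xi> * cnj (ft (\<phi> n) \<xi>)) \<longlonglongrightarrow> fourier u \<xi> * fexp \<xi> (- x)"
   unfolding cnj_fexp[symmetric] by (intro AE_I2 tendsto_intros ft_lim)
  show "AE \<xi> in lborel. norm (fourier u \<xi> * cnj (ft (\<phi> n) \<xi>)) \<le> cmod (fourier u \<xi>)" for n
   using ft_le by (intro AE_I2) (simp add: norm_mult mult_left_le)
 qed (use i in auto)
 then have 1: "(\<lambda>n. Re (LINT \<xi>|lborel. fourier u \<xi> * cnj (ft (\<phi> n) \<xi>))) \<longlonglongrightarrow> Re (LINT \<xi>|lborel. fourier u \<xi> * fexp \<xi> (- x))"
  by (rule tendsto_Re)
 have "(\<lambda>n. 2 * pi * (LINT y|lborel. \<phi> n y *\<^sub>R u y)) \<longlonglongrightarrow> 2 * pi * u x"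
  unfolding \<phi>_def by (intro tendsto_mult tendsto_const average_tendsto[OF u(1) h])
 then have 2: "(\<lambda>n. Re (LINT \<xi>|lborel. fourier u \<xi> * cnj (ft (\<phi> n) \<xi>))) \<longlonglongrightarrow> 2 * pi * u x"
  unfolding Parseval[OF lu has_fourier_transform_exists[OF lu] lt ht] ip_def by (simp add: mult.commute)
 show ?thesis using LIMSEQ_unique[OF 1 2] by simp
qed

text \<open>Differentiation under the integral: difference quotients of the phase are bounded by
  \<open>\<bar>\<xi>\<bar>\<close>, and \<xi> times \<open>g\<close> is integrable.\<close>

lemma inverse_transform_has_derivative:
 assumes g: "integrable lborel g" and i: "integrable lborel (\<lambda>\<xi>. complex_of_real \<xi> * g \<xi>)"
 shows "((\<lambda>x. Re (LINT \<xi>|lborel. g \<xi> * fexp \<xi> (- x))) has_real_derivative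
   Re (LINT \<xi>|lborel. \<i> * complex_of_real \<xi> * g \<xi> * fexp \<xi> (- x))) (at x)"
  "isCont (\<lambda>x. Re (LINT \<xi>|lborel. g \<xi> * fexp \<xi> (- x))) x"
proof -
 have [measurable]: "g \<in> borel_measurable borel" using g by (simp add: borel_measurable_integrable)
 have ig: "integrable lborel (\<lambda>\<xi>. g \<xi> * fexp \<xi> (- x))" for x
  by (rule Bochner_Integration.integrable_bound[OF g]) (auto simp: norm_mult)
 show D: "((\<lambda>x. Re (LINT \<xi>|lborel. g \<xi> * fexp \<xi> (- x))) has_real_derivative
   Re (LINT \<xi>|lborel. \<i> * complex_of_real \<xi> * g \<xi> * fexp \<xi> (- x))) (at x)"
  unfolding has_field_derivative_iff tendsto_at_iff_sequentially
 proof (intro allI impI)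
  fix X assume X: "\<forall>i. X i \<in> UNIV - {x}" "X \<longlonglongrightarrow> x"
  define q where "q n \<xi> = g \<xi> * fexp \<xi> (- x) * ((fexp \<xi> (- (X n - x)) - 1) / complex_of_real (X n - x))" for n \<xi>
  have q: "q n \<xi> = (g \<xi> * fexp \<xi> (- X n) - g \<xi> * fexp \<xi> (- x)) / complex_of_real (X n - x)" for n \<xi>
   using fexp_add[of \<xi> "- x" "- (X n - x)"] by (simp add: q_def algebra_simps diff_divide_distrib)
  have b: "cmod ((fexp \<xi> (- z) - 1) / complex_of_real z) \<le> \<bar>\<xi>\<bar>" for \<xi> z
  proof (cases "z = 0")
   case False
   have "cmod (fexp \<xi> (- z) - 1) \<le> \<bar>\<xi> * z\<bar>"
    using iexp_approx1[of "\<xi> * z" 0] by (simp add: fexp_iexp)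
   then show ?thesis using False by (simp add: norm_divide divide_simps abs_mult)
  qed simp
  have l: "(\<lambda>n. (fexp \<xi> (- (X n - x)) - 1) / complex_of_real (X n - x)) \<longlonglongrightarrow> \<i> * complex_of_real \<xi>" for \<xi>
  proof -
   have "((\<lambda>z. exp (\<i> * complex_of_real \<xi> * z)) has_field_derivative \<i> * complex_of_real \<xi>) (at 0)"
    by (auto intro!: derivative_eq_intros)
   then have "((\<lambda>z. (exp (\<i> * complex_of_real \<xi> * z) - 1) / z) \<longlongrightarrow> \<i> * complex_of_real \<xi>) (at 0)"
    by (simp add: has_field_derivative_iff)
   moreover have "(\<lambda>n. complex_of_real (X n - x)) \<longlonglongrightarrow> complex_of_real (x - x)"
    by (intro tendsto_intros X)
   ultimately have "((\<lambda>z. (exp (\<i> * complex_of_real \<xi> * z) - 1) / z) \<circ> (\<lambda>n. complex_of_real (X n - x))) \<longlonglongrightarrow> \<i> * complex_of_real \<xi>"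
    using X(1) unfolding tendsto_at_iff_sequentially by auto
   moreover have "fexp \<xi> (- z) = exp (\<i> * complex_of_real \<xi> * complex_of_real z)" for z
    by (simp add: fexp_def mult.assoc)
   ultimately show ?thesis by (simp only: o_def)
  qed
  have m: "fexp \<xi> (- (X n - x)) = fexp \<xi> (x - X n)" for \<xi> n by simp
  have "(\<lambda>n. LINT \<xi>|lborel. q n \<xi>) \<longlonglongrightarrow> (LINT \<xi>|lborel. g \<xi> * fexp \<xi> (- x) * (\<i> * complex_of_real \<xi>))"
  proof (rule integral_dominated_convergence[where w = "\<lambda>\<xi>. cmod (complex_of_real \<xi> * g \<xi>)"])
   show "AE \<xi> in lborel. (\<lambda>n. q n \<xi>) \<longlonglongrightarrow> g \<xi> * fexp \<xi> (- x) * (\<i> * complex_of_real \<xi>)"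
    unfolding q_def by (intro AE_I2 tendsto_mult tendsto_const l)
   show "AE \<xi> in lborel. norm (q n \<xi>) \<le> cmod (complex_of_real \<xi> * g \<xi>)" for n
   proof (intro AE_I2)
    fix \<xi>
    show "norm (q n \<xi>) \<le> cmod (complex_of_real \<xi> * g \<xi>)"
     unfolding q_def norm_mult
     using mult_left_mono[OF b[of \<xi> "X n - x"], of "cmod (g \<xi>)"] by (simp add: mult.commute)
   qed
  qed (use i in \<open>auto simp: q_def\<close>)
  then have "(\<lambda>n. Re (LINT \<xi>|lborel. q n \<xi>)) \<longlonglongrightarrow> Re (LINT \<xi>|lborel. g \<xi> * fexp \<xi> (- x) * (\<i> * complex_of_real \<xi>))"
   by (rule tendsto_Re)
  moreover have "Re (LINT \<xi>|lborel. q n \<xi>) = (Re (LINT \<xi>|lborel. g \<xi> * fexp \<xi> (- X n)) - Re (LINT \<xi>|lborel. g \<xi> * fexp \<xi> (- x))) / (X n - x)" for n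
   unfolding q using ig by (simp add: Re_divide_of_real)
  moreover have "(LINT \<xi>|lborel. g \<xi> * fexp \<xi> (- x) * (\<i> * complex_of_real \<xi>)) = (LINT \<xi>|lborel. \<i> * complex_of_real \<xi> * g \<xi> * fexp \<xi> (- x))"
   by (intro Bochner_Integration.integral_cong refl) (simp add: ac_simps)
  ultimately show "((\<lambda>y. (Re (LINT \<xi>|lborel. g \<xi> * fexp \<xi> (- y)) - Re (LINT \<xi>|lborel. g \<xi> * fexp \<xi> (- x))) / (y - x)) \<circ> X)
    \<longlonglongrightarrow> Re (LINT \<xi>|lborel. \<i> * complex_of_real \<xi> * g \<xi> * fexp \<xi> (- x))"
   by (simp add: o_def)
 qed
 then show "isCont (\<lambda>x. Re (LINT \<xi>|lborel. g \<xi> * fexp \<xi> (- x))) x" by (rule DERIV_isCont)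
qed

lemma inverse_transform_isCont:
 assumes g: "integrable lborel g"
 shows "isCont (\<lambda>x. Re (LINT \<xi>|lborel. g \<xi> * fexp \<xi> (- x))) x"
proof -
 have [measurable]: "g \<in> borel_measurable borel" using g by (simp add: borel_measurable_integrable)
 show ?thesis
  unfolding continuous_at_sequentially o_def
 proof (intro allI impI tendsto_Re)
  fix X assume X: "X \<longlonglongrightarrow> x"
  show "(\<lambda>n. LINT \<xi>|lborel. g \<xi> * fexp \<xi> (- X n)) \<longlonglongrightarrow> (LINT \<xi>|lborel. g \<xi> * fexp \<xi> (- x))"
  proof (rule integral_dominated_convergence[where w = "\<lambda>\<xi>. cmod (g \<xi>)"])
   show "AE \<xi> in lborel. (\<lambda>n. g \<xi> * fexp \<xi> (- X n)) \<longlonglongrightarrow> g \<xi> * fexp \<xi> (- x)"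
    unfolding fexp_def by (intro AE_I2 tendsto_intros X)
  qed (use g in \<open>auto simp: norm_mult\<close>)
 qed
qed

lemma inverse_weight_integrable: "integrable lborel (\<lambda>\<xi>::real. inverse (1 + \<xi>\<^sup>2))"
proof -
 have "set_integrable lborel (einterval (-\<infinity>) \<infinity>) (\<lambda>x. inverse (1 + x\<^sup>2))"
  by (rule integrable_inverse_1_plus_square)
 then show ?thesis by (simp add: set_integrable_def)
qed

text \<open>The comparison function is 1 / (1 + \<xi>^2), which matches the order 1 of the weight.
  The order lost in \<open>sobolev_bsob\<close> originates here.\<close>

lemma weighted_integrable:
 assumes g: "g \<in> borel_measurable borel"
  and i: "integrable lborel (\<lambda>\<xi>. (1 + \<xi>\<^sup>2) powr r * (cmod (g \<xi>))\<^sup>2)" and r: "1 \<le> r"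
 shows "integrable lborel g"
proof (rule Bochner_Integration.integrable_bound)
 show "integrable lborel (\<lambda>\<xi>. inverse (1 + \<xi>\<^sup>2) + (1 + \<xi>\<^sup>2) powr r * (cmod (g \<xi>))\<^sup>2)"
  using inverse_weight_integrable i by (rule Bochner_Integration.integrable_add)
 show "g \<in> borel_measurable lborel" using g by simp
 show "AE \<xi> in lborel. norm (g \<xi>) \<le> norm (inverse (1 + \<xi>\<^sup>2) + (1 + \<xi>\<^sup>2) powr r * (cmod (g \<xi>))\<^sup>2)"
 proof (intro AE_I2)
  fix \<xi> :: real
  define w c where "w = 1 + \<xi>\<^sup>2" and "c = cmod (g \<xi>)"
  have w: "1 \<le> w" by (simp add: w_def)
  have "w powr 1 \<le> w powr r" using w r by (intro powr_mono) auto
  then have wr: "w \<le> w powr r" using w by simp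
  \<comment> \<open>After division by \<open>w\<close> this becomes
    \<open>c \<le> inverse w + w * c\<^sup>2\<close>, a pointwise substitute for the Cauchy-Schwarz
    inequality whose summands are both integrable.\<close>
  have "0 \<le> (1 - w * c)\<^sup>2 + (w * c)\<^sup>2 + 1" by simp
  then have "w * c \<le> 1 + w * (w * c\<^sup>2)" by (simp add: power2_eq_square algebra_simps)
  then have "c \<le> inverse w + w * c\<^sup>2" using w by (simp add: field_simps)
  also have "... \<le> inverse w + w powr r * c\<^sup>2" using wr by (intro add_left_mono mult_right_mono) auto
  finally show "norm (g \<xi>) \<le> norm (inverse (1 + \<xi>\<^sup>2) + (1 + \<xi>\<^sup>2) powr r * (cmod (g \<xi>))\<^sup>2)"
   unfolding w_def c_def by (simp add: abs_of_nonneg)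
 qed
qed

lemma sobolev_ltame: "f \<in> sobolev r ==> ltame f"
 by (simp add: sobolev_def ltame_continuous)

lemma sobolev_norm_squared:
 "(sobolev_norm r f)\<^sup>2 = (LINT \<xi>|lborel. (1 + \<xi>\<^sup>2) powr r * (cmod (fourier f \<xi>))\<^sup>2)"
 by (simp add: sobolev_norm_def)

lemma sobolev_norm_nonneg [simp]: "0 \<le> sobolev_norm r f"
 by (simp add: sobolev_norm_def)

lemma sobolev_bcl:
 assumes f: "f \<in> sobolev r" and r: "1 \<le> r"
 shows "bcl f" "nm f \<le> sobolev_norm r f" "integrable lborel (fourier f)"
proof -
 have l: "ltame f" by (rule sobolev_ltame[OF f])
 have c: "csq (fourier f)" by (rule fourier_csq[OF l])
 have i: "integrable lborel (\<lambda>\<xi>. (1 + \<xi>\<^sup>2) powr r * (cmod (fourier f \<xi>))\<^sup>2)" using f by (simp add: sobolev_def)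
 show fi: "integrable lborel (fourier f)" by (rule weighted_integrable[OF csq_measurable[OF c] i r])
 have inv: "f x = 1 / (2 * pi) * Re (LINT \<xi>|lborel. fourier f \<xi> * fexp \<xi> (- x))" for x
  by (rule fourier_inversion[OF _ _ fi]) (use f in \<open>auto simp: sobolev_def\<close>)
 have "\<bar>f x\<bar> \<le> 1 / (2 * pi) * (LINT \<xi>|lborel. cmod (fourier f \<xi>))" for x
 proof -
  have "\<bar>Re (LINT \<xi>|lborel. fourier f \<xi> * fexp \<xi> (- x))\<bar> \<le> cmod (LINT \<xi>|lborel. fourier f \<xi> * fexp \<xi> (- x))"
   by (rule abs_Re_le_cmod)
  also have "... \<le> (LINT \<xi>|lborel. cmod (fourier f \<xi> * fexp \<xi> (- x)))" by (rule integral_norm_bound)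
  finally have "\<bar>Re (LINT \<xi>|lborel. fourier f \<xi> * fexp \<xi> (- x))\<bar> \<le> (LINT \<xi>|lborel. cmod (fourier f \<xi>))" by (simp add: norm_mult)
  then show ?thesis by (subst inv) (simp add: abs_mult divide_right_mono)
 qed
 then show "bcl f" using f by (intro bclI) (auto simp: sobolev_def intro: ltame_sq[OF l])
 have "(cmod (fourier f \<xi>))\<^sup>2 \<le> (1 + \<xi>\<^sup>2) powr r * (cmod (fourier f \<xi>))\<^sup>2" for \<xi>
 proof -
  have "1 \<le> (1 + \<xi>\<^sup>2) powr r" using r by (intro ge_one_powr_ge_zero) auto
  from mult_right_mono[OF this, of "(cmod (fourier f \<xi>))\<^sup>2"] show ?thesis by simp
 qed
 then have "(cnm (fourier f))\<^sup>2 \<le> (sobolev_norm r f)\<^sup>2"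
  unfolding cnm_squared sobolev_norm_squared using c i by (intro integral_mono) (auto simp: csq_def)
 then have "cnm (fourier f) \<le> sobolev_norm r f" by (rule power2_le_imp_le) simp
 moreover have "1 \<le> sqrt (2 * pi)" using pi_gt3 by simp
 then have "1 * nm f \<le> sqrt (2 * pi) * nm f" by (rule mult_right_mono) simp
 ultimately show "nm f \<le> sobolev_norm r f"
  using Plancherel[OF l has_fourier_transform_exists[OF l]] by simp
qed

text \<open>From order 2 on, \<xi> times the transform is still integrable, so the inversion formula
  may be differentiated under the integral. The weight of order \<open>r - 1\<close> absorbs the
  factor \<xi>^2.\<close>

lemma sobolev_deriv:
 assumes f: "f \<in> sobolev r" and r: "2 \<le> r"
 shows "(f has_real_derivative deriv f x) (at x)" "deriv f \<in> sobolev (r - 1)"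
  "sobolev_norm (r - 1) (deriv f) \<le> sobolev_norm r f"
proof -
 have l: "ltame f" by (rule sobolev_ltame[OF f])
 define F where "F = fourier f"
 have c: "csq F" unfolding F_def by (rule fourier_csq[OF l])
 have Fm [measurable]: "F \<in> borel_measurable borel" using c by (simp add: csq_def)
 have i: "integrable lborel (\<lambda>\<xi>. (1 + \<xi>\<^sup>2) powr r * (cmod (F \<xi>))\<^sup>2)" using f by (simp add: sobolev_def F_def)
 have fi: "integrable lborel F" unfolding F_def using sobolev_bcl(3)[OF f] r by simp
 have le: "(1 + \<xi>\<^sup>2) powr (r - 1) * (cmod (complex_of_real \<xi> * F \<xi>))\<^sup>2 \<le> (1 + \<xi>\<^sup>2) powr r * (cmod (F \<xi>))\<^sup>2" for \<xi>
 proof -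
  have p: "0 < 1 + \<xi>\<^sup>2" by (simp add: add_pos_nonneg)
  have "(1 + \<xi>\<^sup>2) powr r = (1 + \<xi>\<^sup>2) powr ((r - 1) + 1)" by simp
  also have "... = (1 + \<xi>\<^sup>2) powr (r - 1) * (1 + \<xi>\<^sup>2)" using p unfolding powr_add by simp
  finally have e: "(1 + \<xi>\<^sup>2) powr r = (1 + \<xi>\<^sup>2) powr (r - 1) * (1 + \<xi>\<^sup>2)" .
  have "(1 + \<xi>\<^sup>2) powr (r - 1) * (\<xi>\<^sup>2 * (cmod (F \<xi>))\<^sup>2) \<le> (1 + \<xi>\<^sup>2) powr (r - 1) * ((1 + \<xi>\<^sup>2) * (cmod (F \<xi>))\<^sup>2)"
   by (intro mult_left_mono mult_right_mono) auto
  then show ?thesis by (simp add: norm_mult power_mult_distrib e mult.assoc)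
 qed
 have i1: "integrable lborel (\<lambda>\<xi>. (1 + \<xi>\<^sup>2) powr (r - 1) * (cmod (complex_of_real \<xi> * F \<xi>))\<^sup>2)"
  by (rule Bochner_Integration.integrable_bound[OF i]) (use le in auto)
 have wi: "integrable lborel (\<lambda>\<xi>. complex_of_real \<xi> * F \<xi>)"
  by (rule weighted_integrable[OF _ i1]) (use r in auto)
 have "(cmod (complex_of_real \<xi> * F \<xi>))\<^sup>2 \<le> (1 + \<xi>\<^sup>2) powr (r - 1) * (cmod (complex_of_real \<xi> * F \<xi>))\<^sup>2" for \<xi>
 proof -
  have "1 \<le> (1 + \<xi>\<^sup>2) powr (r - 1)" using r by (intro ge_one_powr_ge_zero) auto
  from mult_right_mono[OF this, of "(cmod (complex_of_real \<xi> * F \<xi>))\<^sup>2"] show ?thesis by simp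
 qed
 then have wq: "csq (\<lambda>\<xi>. complex_of_real \<xi> * F \<xi>)"
  unfolding csq_def by (intro conjI Bochner_Integration.integrable_bound[OF i1]) auto
 have inv: "f = (\<lambda>x. 1 / (2 * pi) * Re (LINT \<xi>|lborel. F \<xi> * fexp \<xi> (- x)))"
  unfolding F_def by (intro ext fourier_inversion) (use f fi in \<open>auto simp: sobolev_def F_def\<close>)
 define f' where "f' x = 1 / (2 * pi) * Re (LINT \<xi>|lborel. \<i> * complex_of_real \<xi> * F \<xi> * fexp \<xi> (- x))" for x
 have d: "(f has_real_derivative f' x) (at x)" for x
  unfolding inv f'_def by (rule DERIV_cmult[OF inverse_transform_has_derivative(1)[OF fi wi]])
 then have df: "deriv f = f'" by (auto intro: DERIV_imp_deriv)
 show "(f has_real_derivative deriv f x) (at x)" using d df by simp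
 have "integrable lborel (\<lambda>\<xi>. \<i> * complex_of_real \<xi> * F \<xi>)"
  using integrable_mult_right[OF wi, of \<i>] by (simp add: mult.assoc)
 then have cont: "continuous_on UNIV f'"
  unfolding f'_def continuous_on_eq_continuous_at[OF open_UNIV]
  by (intro ballI continuous_mult continuous_const inverse_transform_isCont)
 note FD = fourier_deriv[OF l cont d wq[unfolded F_def]]
 have ae: "AE \<xi> in lborel. (1 + \<xi>\<^sup>2) powr (r - 1) * (cmod (complex_of_real \<xi> * F \<xi>))\<^sup>2 = (1 + \<xi>\<^sup>2) powr (r - 1) * (cmod (fourier f' \<xi>))\<^sup>2"
  using FD(2) by eventually_elim (simp add: F_def norm_mult)
 have lf': "ltame f'" using cont FD(1) by (auto simp: sq_def intro: ltame_continuous)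
 have [measurable]: "fourier f' \<in> borel_measurable borel" using fourier_csq[OF lf'] by (simp add: csq_def)
 have i2: "integrable lborel (\<lambda>\<xi>. (1 + \<xi>\<^sup>2) powr (r - 1) * (cmod (fourier f' \<xi>))\<^sup>2)"
  by (rule integrable_cong_AE_imp[OF i1]) (use ae in auto)
 show "deriv f \<in> sobolev (r - 1)" using cont FD(1) i2 by (simp add: df sobolev_def sq_def)
 have "(LINT \<xi>|lborel. (1 + \<xi>\<^sup>2) powr (r - 1) * (cmod (fourier f' \<xi>))\<^sup>2)
   = (LINT \<xi>|lborel. (1 + \<xi>\<^sup>2) powr (r - 1) * (cmod (complex_of_real \<xi> * F \<xi>))\<^sup>2)"
  by (rule Bochner_Integration.integral_cong_AE) (use ae in auto)
 also have "... \<le> (LINT \<xi>|lborel. (1 + \<xi>\<^sup>2) powr r * (cmod (F \<xi>))\<^sup>2)"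
  by (rule integral_mono[OF i1 i le])
 finally show "sobolev_norm (r - 1) (deriv f) \<le> sobolev_norm r f"
  unfolding df sobolev_norm_def F_def by (rule real_sqrt_le_mono)
qed

text \<open>Each derivative lowers the order by one, and the last function must still have order 1
  to be bounded.\<close>

theorem sobolev_bsob:
 assumes "f \<in> sobolev r" "real k + 1 \<le> r"
 shows "bsob k f" "bnorm k f \<le> real (Suc k) * sobolev_norm r f"
proof -
 have "bsob k f \<and> bnorm k f \<le> real (Suc k) * sobolev_norm r f" using assms
 proof (induction k arbitrary: f r)
  case 0
  then show ?case using sobolev_bcl[of f r] by simp
 next
  case (Suc k)
  have r: "2 \<le> r" "1 \<le> r" using Suc.prems(2) by auto
  note d = sobolev_deriv[OF Suc.prems(1) r(1)] and b = sobolev_bcl[OF Suc.prems(1) r(2)]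
  have IH: "bsob k (deriv f)" "bnorm k (deriv f) \<le> real (Suc k) * sobolev_norm (r - 1) (deriv f)"
   using Suc.IH[OF d(2)] Suc.prems(2) by auto
  have "bnorm k (deriv f) \<le> real (Suc k) * sobolev_norm r f"
   using IH(2) mult_left_mono[OF d(3), of "real (Suc k)"] by linarith
  then show ?case using IH(1) b d(1) by (simp add: algebra_simps)
 qed
 then show "bsob k f" "bnorm k f \<le> real (Suc k) * sobolev_norm r f" by auto
qed

section \<open>Symmetry and coercivity of the nonlocal operator\<close>

lemma ip_mconv:
 assumes fin: "finite_measure \<mu>" and [measurable_cong]: "sets \<mu> = sets borel" and f: "bcl f" and g: "bcl g"
 shows "integrable lborel (\<lambda>\<xi>. char \<mu> (- \<xi>) * (fourier f \<xi> * cnj (fourier g \<xi>)))"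
  "2 * pi * ip (mconv \<mu> f) g = Re (LINT \<xi>|lborel. char \<mu> (- \<xi>) * (fourier f \<xi> * cnj (fourier g \<xi>)))"
proof -
 interpret finite_measure \<mu> by (rule fin)
 have psf: "pair_sigma_finite \<mu> (lborel :: real measure)"
  by (rule pair_sigma_finite.intro[OF sigma_finite_measure_axioms sigma_finite_lborel])
 have l: "ltame f" "ltame g" and s: "sq f" "sq g" using f g by (simp_all add: ltame_bcl bcl_sq)
 have [measurable]: "f \<in> borel_measurable borel" "g \<in> borel_measurable borel" using s by (auto simp: sq_def)
 have U: "space \<mu> = UNIV" using sets_eq_imp_space_eq[OF assms(2)] by simp
 define H where "H \<xi> = fourier f \<xi> * cnj (fourier g \<xi>)" for \<xi>
 have iH: "integrable lborel H" unfolding H_def using fourier_csq l by (intro csq_integrable_mult_cnj) auto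
 then have [measurable]: "H \<in> borel_measurable borel" by (simp add: borel_measurable_integrable)
 have int1: "integrable (\<mu> \<Otimes>\<^sub>M lborel) (\<lambda>(y, x). f (x - y) * g x)"
 proof (rule pair_sigma_finite.Fubini_integrable[OF psf])
  show m: "(\<lambda>(y, x). f (x - y) * g x) \<in> borel_measurable (\<mu> \<Otimes>\<^sub>M lborel)" by measurable
  have sh: "sq (\<lambda>x. f (x - y))" "nm (\<lambda>x. f (x - y)) = nm f" for y using sq_shift[OF s(1), of "- y"] by simp_all
  show "AE y in \<mu>. integrable lborel (\<lambda>x. case (y, x) of (y, x) => f (x - y) * g x)"
   using sq_integrable_mult[OF sh(1) s(2)] by simp
  have ab: "sq (\<lambda>x. \<bar>h x\<bar>)" "nm (\<lambda>x. \<bar>h x\<bar>) = nm h" if "sq h" for h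
   using that by (auto simp: sq_def nm_def)
  have bd: "norm (LINT x|lborel. norm (case (y, x) of (y, x) => f (x - y) * g x)) \<le> nm f * nm g" for y
   using Cauchy_Schwarz_ip[OF ab(1)[OF sh(1)[of y]] ab(1)[OF s(2)]] ab(2)[OF sh(1)] ab(2)[OF s(2)] sh(2)
   by (simp add: ip_def abs_mult)
  show "integrable \<mu> (\<lambda>y. LINT x|lborel. norm (case (y, x) of (y, x) => f (x - y) * g x))"
   by (rule integrable_const_bound[OF AE_I2[OF bd]]) measurable
 qed
 have int2: "integrable (\<mu> \<Otimes>\<^sub>M lborel) (\<lambda>(y, \<xi>). fexp \<xi> y * H \<xi>)"
 proof (rule pair_sigma_finite.Fubini_integrable[OF psf])
  show "(\<lambda>(y, \<xi>). fexp \<xi> y * H \<xi>) \<in> borel_measurable (\<mu> \<Otimes>\<^sub>M lborel)" by measurable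
  have "integrable lborel (\<lambda>\<xi>. fexp \<xi> y * H \<xi>)" for y
   by (rule Bochner_Integration.integrable_bound[OF iH]) (auto simp: norm_mult)
  then show "AE y in \<mu>. integrable lborel (\<lambda>\<xi>. case (y, \<xi>) of (y, \<xi>) => fexp \<xi> y * H \<xi>)" by simp
  show "integrable \<mu> (\<lambda>y. LINT \<xi>|lborel. norm (case (y, \<xi>) of (y, \<xi>) => fexp \<xi> y * H \<xi>))"
   by (simp add: norm_mult)
 qed
 have ch: "(LINT y|\<mu>. fexp \<xi> y * H \<xi>) = char \<mu> (- \<xi>) * H \<xi>" for \<xi>
  unfolding char_def fexp_iexp by simp
 show "integrable lborel (\<lambda>\<xi>. char \<mu> (- \<xi>) * (fourier f \<xi> * cnj (fourier g \<xi>)))"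
  using pair_sigma_finite.integrable_snd[OF psf int2] unfolding ch by (simp add: H_def)
 \<comment> \<open>Convolution averages translates, and Parseval treats each translate with its
   phase. Integrating the phases against \<open>\<mu>\<close> then produces
   \<open>char \<mu>\<close> at \<open>- \<xi>\<close>.\<close>
 have ipy: "(LINT x|lborel. f (x - y) * g x) = 1 / (2 * pi) * Re (LINT \<xi>|lborel. fexp \<xi> y * H \<xi>)" for y
 proof -
  have "has_fourier_transform (\<lambda>x. f (x + - y)) (\<lambda>\<xi>. fexp \<xi> (- (- y)) * fourier f \<xi>)"
   by (intro has_fourier_transform_shift l has_fourier_transform_exists)
  from Parseval[OF ltame_shift[OF l(1)] this l(2) has_fourier_transform_exists[OF l(2)]]
  show ?thesis by (simp add: ip_def H_def mult.assoc)
 qed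
 have "ip (mconv \<mu> f) g = (LINT x|lborel. LINT y|\<mu>. f (x - y) * g x)"
  unfolding ip_def mconv_def by simp
 also have "... = (LINT y|\<mu>. LINT x|lborel. f (x - y) * g x)"
  by (rule pair_sigma_finite.Fubini_integral[OF psf int1])
 also have "... = 1 / (2 * pi) * (LINT y|\<mu>. Re (LINT \<xi>|lborel. fexp \<xi> y * H \<xi>))"
  unfolding ipy by simp
 also have "(LINT y|\<mu>. Re (LINT \<xi>|lborel. fexp \<xi> y * H \<xi>)) = Re (LINT y|\<mu>. LINT \<xi>|lborel. fexp \<xi> y * H \<xi>)"
  using pair_sigma_finite.integrable_fst[OF psf int2] by (intro integral_Re) simp
 also have "(LINT y|\<mu>. LINT \<xi>|lborel. fexp \<xi> y * H \<xi>) = (LINT \<xi>|lborel. LINT y|\<mu>. fexp \<xi> y * H \<xi>)"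
  by (rule pair_sigma_finite.Fubini_integral[OF psf int2, symmetric])
 finally show "2 * pi * ip (mconv \<mu> f) g = Re (LINT \<xi>|lborel. char \<mu> (- \<xi>) * (fourier f \<xi> * cnj (fourier g \<xi>)))"
  unfolding ch by (simp add: H_def)
qed

lemma ip_kernel_conv:
 assumes ker: "is_kernel \<beta>" and ell: "elliptic \<beta> C1 C2" and f: "bcl f" and g: "bcl g"
 shows "integrable lborel (\<lambda>\<xi>. Re (kernel_fourier \<beta> \<xi>) * Re (fourier f \<xi> * cnj (fourier g \<xi>)))"
  "2 * pi * ip (kernel_conv \<beta> f) g = (LINT \<xi>|lborel. Re (kernel_fourier \<beta> \<xi>) * Re (fourier f \<xi> * cnj (fourier g \<xi>)))"
proof -
 note p = ker_parts[OF ker]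
 define H where "H \<xi> = fourier f \<xi> * cnj (fourier g \<xi>)" for \<xi>
 note 1 = ip_mconv[OF p(1,2) f g, folded H_def] and 2 = ip_mconv[OF p(3,4) f g, folded H_def]
 have eq: "char (fst \<beta>) (- \<xi>) * H \<xi> - char (snd \<beta>) (- \<xi>) * H \<xi> = kernel_fourier \<beta> \<xi> * H \<xi>" for \<xi>
  by (simp add: kernel_fourier_def left_diff_distrib)
 have i: "integrable lborel (\<lambda>\<xi>. kernel_fourier \<beta> \<xi> * H \<xi>)"
  using Bochner_Integration.integrable_diff[OF 1(1) 2(1)] unfolding eq .
 \<comment> \<open>A real symbol can be taken out of the real part.\<close>
 have Re: "Re (kernel_fourier \<beta> \<xi> * H \<xi>) = Re (kernel_fourier \<beta> \<xi>) * Re (H \<xi>)" for \<xi>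
  using ell by (simp add: elliptic_def complex_is_Real_iff)
 show "integrable lborel (\<lambda>\<xi>. Re (kernel_fourier \<beta> \<xi>) * Re (fourier f \<xi> * cnj (fourier g \<xi>)))"
  using integrable_Re[OF i] unfolding Re unfolding H_def .
 have "ip (kernel_conv \<beta> f) g = ip (mconv (fst \<beta>) f) g - ip (mconv (snd \<beta>) f) g"
  unfolding kernel_conv_mconv
  by (intro ip_diff_left bcl_sq bcl_mconv(1) p f g)
 then have "2 * pi * ip (kernel_conv \<beta> f) g
   = Re ((LINT \<xi>|lborel. char (fst \<beta>) (- \<xi>) * H \<xi>) - (LINT \<xi>|lborel. char (snd \<beta>) (- \<xi>) * H \<xi>))"
  using 1(2) 2(2) by (simp add: right_diff_distrib)
 also have "... = Re (LINT \<xi>|lborel. kernel_fourier \<beta> \<xi> * H \<xi>)"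
  using Bochner_Integration.integral_diff[OF 1(1) 2(1)] unfolding eq by simp
 also have "... = (LINT \<xi>|lborel. Re (kernel_fourier \<beta> \<xi> * H \<xi>))"
  by (rule integral_Re[OF i, symmetric])
 finally show "2 * pi * ip (kernel_conv \<beta> f) g = (LINT \<xi>|lborel. Re (kernel_fourier \<beta> \<xi>) * Re (fourier f \<xi> * cnj (fourier g \<xi>)))"
  unfolding Re unfolding H_def .
qed

text \<open>The symbol is real, and exchanging \<open>f\<close> and \<open>g\<close> conjugates the
  other factor, which leaves its real part unchanged.\<close>

lemma kernel_conv_symmetric:
 assumes "is_kernel \<beta>" "elliptic \<beta> C1 C2" "bcl f" "bcl g"
 shows "ip (kernel_conv \<beta> f) g = ip f (kernel_conv \<beta> g)"
proof -
 have "2 * pi * ip (kernel_conv \<beta> f) g = 2 * pi * ip (kernel_conv \<beta> g) f"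
  unfolding ip_kernel_conv(2)[OF assms(1,2,3,4)] ip_kernel_conv(2)[OF assms(1,2,4,3)]
  by (simp add: algebra_simps)
 then show ?thesis by (simp add: ip_commute)
qed

text \<open>Plancherel turns the lower bound of the symbol into a lower bound of the quadratic
  form.\<close>

lemma kernel_conv_coercive:
 assumes ker: "is_kernel \<beta>" and ell: "elliptic \<beta> C1 C2" and f: "bcl f"
 shows "C1 * (nm f)\<^sup>2 \<le> ip (kernel_conv \<beta> f) f"
proof -
 have l: "ltame f" using f by (rule ltame_bcl)
 have c: "csq (fourier f)" by (rule fourier_csq[OF l])
 have e: "Re (z * cnj z) = (cmod z)\<^sup>2" for z by (simp add: complex_mult_cnj cmod_power2)
 have "C1 * (2 * pi * (nm f)\<^sup>2) = C1 * (cnm (fourier f))\<^sup>2"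
  using Plancherel[OF l has_fourier_transform_exists[OF l]] by (simp add: power_mult_distrib)
 also have "... = (LINT \<xi>|lborel. C1 * (cmod (fourier f \<xi>))\<^sup>2)" by (simp add: cnm_squared)
 also have "... \<le> (LINT \<xi>|lborel. Re (kernel_fourier \<beta> \<xi>) * Re (fourier f \<xi> * cnj (fourier f \<xi>)))"
 proof (rule integral_mono)
  show "C1 * (cmod (fourier f \<xi>))\<^sup>2 \<le> Re (kernel_fourier \<beta> \<xi>) * Re (fourier f \<xi> * cnj (fourier f \<xi>))" for \<xi>
   unfolding e using ell by (intro mult_right_mono) (auto simp: elliptic_def)
 qed (use c ip_kernel_conv(1)[OF ker ell f f] in \<open>auto simp: csq_def\<close>)
 also have "... = 2 * pi * ip (kernel_conv \<beta> f) f"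
  by (rule ip_kernel_conv(2)[OF ker ell f f, symmetric])
 finally have "2 * pi * (C1 * (nm f)\<^sup>2) \<le> 2 * pi * ip (kernel_conv \<beta> f) f" by (simp add: ac_simps)
 then show ?thesis by simp
qed

section \<open>Inversion of the nonlocal operator\<close>

lemma bcl_bounded_mult:
 assumes "continuous_on UNIV a" "!!x. \<bar>a x\<bar> \<le> B" "bcl U"
 shows "bcl (\<lambda>x. a x * U x)"
proof -
 obtain C where C: "!!x. \<bar>U x\<bar> \<le> C" using bcl_bound[OF assms(3)] by metis
 show ?thesis
 proof (rule bclI)
  show "\<bar>a x * U x\<bar> \<le> B * C" for x using assms(2)[of x] C[of x] by (simp add: abs_mult mult_mono')
  show "sq (\<lambda>x. a x * U x)"
   by (rule sq_bounded_mult(1)[OF bcl_sq[OF assms(3)] borel_measurable_continuous_onI[OF assms(1)] assms(2)])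
 qed (intro continuous_on_mult assms(1) bcl_continuous assms(3))
qed

lemma nm_bounded_mult:
 assumes "continuous_on UNIV a" "!!x. \<bar>a x\<bar> \<le> B" "sq U"
 shows "nm (\<lambda>x. a x * U x) \<le> B * nm U" "sq (\<lambda>x. a x * U x)"
 using sq_bounded_mult[OF assms(3) borel_measurable_continuous_onI[OF assms(1)] assms(2)] by auto

text \<open>The commutator has order zero: differences of \<open>a\<close> over the distance
  \<open>h\<close> cancel the factor 1 / h. Up to sign it is the discrete counterpart of
  multiplication by the derivative of \<open>a\<close>.\<close>

lemma cdiff_commutator:
 assumes a: "continuous_on UNIV a" and L: "!!x. \<bar>a (x + h) - a x\<bar> \<le> L * h" and h: "h > 0" and U: "sq U"
 shows "nm (\<lambda>x. a x * cdiff h U x - cdiff h (\<lambda>y. a y * U y) x) \<le> L * nm U"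
proof -
 have L': "\<bar>a (x + - h) - a x\<bar> \<le> L * h" for x using L[of "x - h"] by (simp add: abs_minus_commute)
 have ca: "continuous_on UNIV (\<lambda>x. a (x + c) - a x)" for c
  by (intro continuous_on_diff a continuous_on_compose2[OF a]) (auto intro!: continuous_intros)
 note s = sq_shift[OF U]
 note 1 = nm_bounded_mult[OF ca[of h] L s(1)] and 2 = nm_bounded_mult[OF ca[of "- h"] L' s(1)]
 have "(\<lambda>x. a x * cdiff h U x - cdiff h (\<lambda>y. a y * U y) x)
   = (\<lambda>x. 1 / (2 * h) * ((a (x + - h) - a x) * U (x + - h) - (a (x + h) - a x) * U (x + h)))"
  using h by (auto simp: cdiff_def field_simps)
 then have "nm (\<lambda>x. a x * cdiff h U x - cdiff h (\<lambda>y. a y * U y) x)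
   = 1 / (2 * h) * nm (\<lambda>x. (a (x + - h) - a x) * U (x + - h) - (a (x + h) - a x) * U (x + h))"
  using h by (simp only: nm_cmult) simp
 also have "... \<le> 1 / (2 * h) * (L * h * nm U + L * h * nm U)"
  using nm_triangle_diff[OF 2(2) 1(2), of "- h" h] 1(1)[of h] 2(1)[of "- h"] h
  by (intro mult_left_mono) (simp_all only: s(2), auto)
 also have "... = L * nm U" using h by simp
 finally show ?thesis .
qed

text \<open>\<open>U\<close> and \<open>V\<close> are free so that the same form measures
  derivatives of an approximate solution and differences of two of them; \<open>a\<close> is the
  coefficient F'(u) at the current state. The weights are those that symmetrise the system
  \<open>U\<^sub>t = K V\<^sub>x\<close>, \<open>V\<^sub>t = a U\<^sub>x\<close>.\<close>

definition energy :: "kernel => (real => real) => (real => real) => (real => real) => real" where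
 "energy \<beta> a U V = ip (kernel_conv \<beta> V) V + ip (\<lambda>x. a x * U x) U"

context
 fixes \<beta> :: kernel and C1 C2 :: real
 assumes ker: "is_kernel \<beta>" and ell: "elliptic \<beta> C1 C2"
begin

lemma C1_pos: "0 < C1"
 using ell by (simp add: elliptic_def)

text \<open>In the expanded square coercivity contributes \<open>- 2 * \<theta> * C1\<close> and the
  operator bound contributes \<open>\<theta>\<^sup>2 * B\<^sup>2\<close>. The choice
  \<open>\<theta> = C1 / B\<^sup>2\<close> minimises their sum and leaves the factor
  \<open>1 - \<theta> * C1\<close>.\<close>

lemma kernel_contraction:
 obtains q where "0 \<le> q" "q < 1"
  "!!k f. bsob k f ==> bsob k (\<lambda>x. f x - C1 / (kmass \<beta>)\<^sup>2 * kernel_conv \<beta> f x)"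
  "!!k f. bsob k f ==> bnorm k (\<lambda>x. f x - C1 / (kmass \<beta>)\<^sup>2 * kernel_conv \<beta> f x) \<le> q * bnorm k f"
proof -
 define B \<theta> where "B = kmass \<beta>" and "\<theta> = C1 / (kmass \<beta>)\<^sup>2"
 have B: "1 \<le> B" using kmass_ge_1 by (simp add: B_def)
 have th: "0 < \<theta>" using C1_pos B by (simp add: \<theta>_def B_def[symmetric])
 \<comment> \<open>The maximum with 0 keeps the root meaningful without a comparison of
   \<open>C1\<close> with \<open>kmass \<beta>\<close>.\<close>
 define q where "q = sqrt (max 0 (1 - \<theta> * C1))"
 define T where "T f = (\<lambda>x. f x + (- \<theta>) * kernel_conv \<beta> f x)" for f :: "real => real"
 have Tb: "bcl (T f)" if "bcl f" for f
  unfolding T_def using that by (intro bcl_add bcl_cmult bcl_kernel_conv(1)[OF ker])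
 have Tn: "nm (T f) \<le> q * nm f" if f: "bcl f" for f
 proof -
  note K = bcl_kernel_conv[OF ker f]
  have "(nm (T f))\<^sup>2 = (nm f)\<^sup>2 - 2 * \<theta> * ip (kernel_conv \<beta> f) f + \<theta>\<^sup>2 * (nm (kernel_conv \<beta> f))\<^sup>2"
   unfolding T_def nm_add_squared[OF bcl_sq[OF f] sq_cmult[OF bcl_sq[OF K(1)]]]
   by (simp only: ip_cmult_right nm_cmult ip_commute[of f]) (simp add: power_mult_distrib)
  also have "... \<le> (nm f)\<^sup>2 - 2 * \<theta> * (C1 * (nm f)\<^sup>2) + \<theta>\<^sup>2 * (B * nm f)\<^sup>2"
   using kernel_conv_coercive[OF ker ell f] K(2) th unfolding B_def
   by (intro add_mono diff_mono mult_left_mono power_mono) auto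
  also have "... = (1 - \<theta> * C1) * (nm f)\<^sup>2"
   using B by (simp add: \<theta>_def B_def[symmetric] power_mult_distrib field_simps power2_eq_square)
  also have "... \<le> max 0 (1 - \<theta> * C1) * (nm f)\<^sup>2" by (intro mult_right_mono) auto
  also have "... = (q * nm f)\<^sup>2" by (simp add: q_def power_mult_distrib)
  finally show ?thesis by (rule power2_le_imp_le) (simp add: q_def)
 qed
 have Td: "(T f has_real_derivative T (deriv f) x) (at x)"
  if "bcl f" "bcl (deriv f)" "!!y. (f has_real_derivative deriv f y) (at y)" for f x
  unfolding T_def
  by (intro DERIV_add DERIV_cmult that(3) kernel_conv_has_derivative[OF ker that(1) that(3) that(2)])
 have op: "bsob k (T f)" "bnorm k (T f) \<le> q * bnorm k f" if "bsob k f" for k f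
  using bsob_operator(1,2)[of T q, OF Tb Tn Td] that by blast+
 have eq: "T f = (\<lambda>x. f x - C1 / (kmass \<beta>)\<^sup>2 * kernel_conv \<beta> f x)" for f
  by (simp add: T_def \<theta>_def)
 show thesis
 proof (rule that[of q])
  show "0 \<le> q" by (simp add: q_def)
  show "q < 1" using th C1_pos by (simp add: q_def real_sqrt_lt_1_iff)
  show "bsob k (\<lambda>x. f x - C1 / (kmass \<beta>)\<^sup>2 * kernel_conv \<beta> f x)" if "bsob k f" for k f
   using op(1)[OF that] unfolding eq .
  show "bnorm k (\<lambda>x. f x - C1 / (kmass \<beta>)\<^sup>2 * kernel_conv \<beta> f x) \<le> q * bnorm k f" if "bsob k f" for k f
   using op(2)[OF that] unfolding eq .
 qed
qed

text \<open>Neumann series \<open>\<theta> \<Sum>\<^sub>n (1 - \<theta> K)\<^sup>n\<close> with \<open>\<theta> = C1 / B\<^sup>2\<close>.\<close>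

lemma kernel_conv_inverse:
 obtains C where "0 \<le> C"
  "!!k w. bsob (k + 2) w ==> 1 \<le> k ==>
   \<exists>v. bsob k v \<and> kernel_conv \<beta> v = w \<and> bnorm k v \<le> C * bnorm (k + 2) w"
proof -
 obtain q where q: "0 \<le> q" "q < 1"
  and T1: "!!k f. bsob k f ==> bsob k (\<lambda>x. f x - C1 / (kmass \<beta>)\<^sup>2 * kernel_conv \<beta> f x)"
  and T2: "!!k f. bsob k f ==> bnorm k (\<lambda>x. f x - C1 / (kmass \<beta>)\<^sup>2 * kernel_conv \<beta> f x) \<le> q * bnorm k f"
  by (rule kernel_contraction) (rule that)
 define \<theta> where "\<theta> = C1 / (kmass \<beta>)\<^sup>2"
 have th: "0 < \<theta>" using C1_pos kmass_ge_1[of \<beta>] by (simp add: \<theta>_def)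
 define T where "T f = (\<lambda>x. f x - \<theta> * kernel_conv \<beta> f x)" for f :: "real => real"
 define C where "C = \<theta> / (1 - q)"
 have C0: "0 \<le> C" using th q by (simp add: C_def)
 have main: "\<exists>v. bsob k v \<and> kernel_conv \<beta> v = w \<and> bnorm k v \<le> C * bnorm (k + 2) w"
  if w: "bsob (k + 2) w" and k: "1 \<le> k" for k w
 proof -
  define f where "f n = (T ^^ n) w" for n
  have fb: "bsob (k + 2) (f n)" for n
  proof (induction n)
   case (Suc n)
   from T1[OF Suc.IH] show ?case by (simp add: f_def T_def \<theta>_def del: bsob.simps add_2_eq_Suc')
  qed (use w in \<open>simp add: f_def\<close>)
  have fn: "bnorm j (f n) \<le> q ^ n * bnorm j w" if j: "j \<le> k + 2" for j n
  proof (induction n)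
   case (Suc n)
   have "bnorm j (f (Suc n)) \<le> q * bnorm j (f n)"
    using T2[OF bsob_mono[OF fb j], of n] by (simp add: f_def T_def \<theta>_def)
   also have "... \<le> q * (q ^ n * bnorm j w)" using q Suc.IH by (intro mult_left_mono) auto
   finally show ?case by simp
  qed (simp add: f_def)
  define S where "S n = (\<lambda>x. \<Sum>i<n. \<theta> * f i x)" for n
  have Sb: "bsob (k + 2) (S n)" for n
   unfolding S_def by (intro bsob_sum(1) bsob_cmult(1) fb) auto
  \<comment> \<open>A geometric sum in telescoped form; \<open>C\<close> is chosen so that
    \<open>\<theta> = C * (1 - q)\<close>.\<close>
  have SS: "bdist j (S (n + m)) (S n) \<le> C * bnorm j w * (q ^ n - q ^ (n + m))" if j: "j \<le> k + 2" for j n m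
  proof (induction m)
   case (Suc m)
   have b: "bsob j (\<lambda>x. S (n + m) x - S n x)" "bsob j (\<lambda>x. \<theta> * f (n + m) x)"
    using bsob_mono[OF _ j] Sb fb bsob_diff(1) bsob_cmult(1) by blast+
   have "bdist j (S (n + Suc m)) (S n) = bnorm j (\<lambda>x. (S (n + m) x - S n x) + \<theta> * f (n + m) x)"
    by (rule arg_cong[of _ _ "bnorm j"]) (auto simp: S_def)
   also have "... \<le> C * bnorm j w * (q ^ n - q ^ (n + m)) + \<theta> * (q ^ (n + m) * bnorm j w)"
   proof -
    have "\<theta> * bnorm j (f (n + m)) \<le> \<theta> * (q ^ (n + m) * bnorm j w)"
     using th by (intro mult_left_mono fn j) simp
    moreover have "bnorm j (\<lambda>x. \<theta> * f (n + m) x) \<le> \<theta> * bnorm j (f (n + m))"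
     using bsob_cmult(2)[OF bsob_mono[OF fb j], of \<theta> "n + m"] th by simp
    ultimately show ?thesis using bsob_add(2)[OF b] Suc.IH by linarith
   qed
   also have "\<theta> = C * (1 - q)" using q by (simp add: C_def)
   finally show ?case by (simp add: algebra_simps)
  qed simp
  have Sn: "bnorm (k + 2) (S n) \<le> C * bnorm (k + 2) w" for n
  proof -
   have "bnorm (k + 2) (S n) \<le> C * bnorm (k + 2) w * (1 - q ^ n)"
    using SS[of "k + 2" 0 n] by (simp add: S_def del: bnorm.simps add_2_eq_Suc')
   also have "... \<le> C * bnorm (k + 2) w * 1"
    using q C0 by (intro mult_left_mono mult_nonneg_nonneg) auto
   finally show ?thesis by simp
  qed
  have SC: "ndist (S m) (S n) \<le> C * nm w * q ^ n" if "n \<le> m" for m n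
  proof -
   have "ndist (S m) (S n) \<le> C * nm w * (q ^ n - q ^ m)"
    using SS[of 0 n "m - n"] that by simp
   also have "... \<le> C * nm w * q ^ n" using C0 q by (intro mult_left_mono) auto
   finally show ?thesis .
  qed
  have "(\<lambda>n. C * nm w * q ^ n) \<longlonglongrightarrow> C * nm w * 0" using q by (intro tendsto_intros LIMSEQ_power_zero) auto
  then have lim: "(\<lambda>n. C * nm w * q ^ n) \<longlonglongrightarrow> 0" by simp
  have Cau: "\<exists>n0. \<forall>m\<ge>n0. \<forall>n\<ge>n0. ndist (S m) (S n) \<le> e" if e: "e > 0" for e
  proof -
   obtain n0 where n0: "!!n. n \<ge> n0 ==> C * nm w * q ^ n < e"
    using order_tendstoD(2)[OF lim e] by (auto simp: eventually_sequentially)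
   have "ndist (S m) (S n) \<le> e" if "m \<ge> n0" "n \<ge> n0" for m n
    using SC[of n m] SC[of m n] n0[OF that(1)] n0[OF that(2)] nm_minus_commute[of "S m" "S n"] by (cases "n \<le> m") auto
   then show ?thesis by blast
  qed
  \<comment> \<open>\<open>bsob_limit\<close> returns a limit two orders below the bound, hence the
    order \<open>k + 2\<close> asked of \<open>w\<close>.\<close>
  obtain v where v: "bsob k v" "(\<lambda>n. bdist k (S n) v) \<longlonglongrightarrow> 0"
   "bnorm k v \<le> C * bnorm (k + 2) w" "uniform_limit UNIV S v sequentially"
   by (rule bsob_limit[OF Sb Sn Cau]) (assumption, rule that)
  \<comment> \<open>The partial sums solve the equation up to the iterate \<open>f n\<close>, which
    decays like \<open>q ^ n\<close>.\<close>
  have KS: "kernel_conv \<beta> (S n) = (\<lambda>x. w x - f n x)" for n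
  proof (induction n)
   case 0
   show ?case by (simp add: S_def f_def kernel_conv_def)
  next
   case (Suc n)
   have "S (Suc n) = (\<lambda>x. S n x + \<theta> * f n x)" by (simp add: S_def)
   then have "kernel_conv \<beta> (S (Suc n)) = (\<lambda>x. kernel_conv \<beta> (S n) x + \<theta> * kernel_conv \<beta> (f n) x)"
    using kernel_conv_add[OF ker bsob_bcl[OF Sb] bcl_cmult[OF bsob_bcl[OF fb]]] by (simp add: kernel_conv_cmult[OF ker])
   also have "... = (\<lambda>x. w x - f (Suc n) x)"
    unfolding Suc.IH by (auto simp: f_def T_def)
   finally show ?case .
  qed
  have Sk: "bsob k (S n)" "bsob k (f n)" "bsob k w" for n using Sb fb w bsob_mono[of "k + 2" _ k] by auto
  have "bdist k (kernel_conv \<beta> v) w \<le> kmass \<beta> * bdist k (S n) v + q ^ n * bnorm k w" for n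
  proof -
   have 1: "bdist k (kernel_conv \<beta> (S n)) (kernel_conv \<beta> v) \<le> kmass \<beta> * bdist k (S n) v"
    using bsob_kernel_conv(2)[OF ker bsob_diff(1)[OF Sk(1) v(1)], of n]
    by (simp add: kernel_conv_diff[OF ker bsob_bcl[OF Sk(1)] bsob_bcl[OF v(1)]])
   have "(\<lambda>x. kernel_conv \<beta> v x - w x) = (\<lambda>x. (kernel_conv \<beta> v x - kernel_conv \<beta> (S n) x) - f n x)"
    by (auto simp: KS)
   then have "bdist k (kernel_conv \<beta> v) w \<le> bdist k (kernel_conv \<beta> v) (kernel_conv \<beta> (S n)) + bnorm k (f n)"
    using bsob_diff(2)[OF bsob_diff(1)[OF bsob_kernel_conv(1)[OF ker v(1)] bsob_kernel_conv(1)[OF ker Sk(1)]] Sk(2)] by simp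
   then show ?thesis
    using 1 fn[of k n] bnorm_minus_commute[OF bsob_kernel_conv(1)[OF ker v(1)] bsob_kernel_conv(1)[OF ker Sk(1)], of n] by simp
  qed
  moreover have "(\<lambda>n. kmass \<beta> * bdist k (S n) v + q ^ n * bnorm k w) \<longlonglongrightarrow> kmass \<beta> * 0 + 0 * bnorm k w"
   using q by (intro tendsto_intros v LIMSEQ_power_zero) auto
  ultimately have le: "bdist k (kernel_conv \<beta> v) w \<le> kmass \<beta> * 0 + 0 * bnorm k w"
   by (intro tendsto_lowerbound) auto
  have "\<bar>kernel_conv \<beta> v x - w x\<bar> \<le> 0" for x
   using sup_le_bnorm'[OF bsob_diff(1)[OF bsob_kernel_conv(1)[OF ker v(1)] Sk(3)] k, of x] le by simp
  then have "kernel_conv \<beta> v = w" by (intro ext) simp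
  then show ?thesis using v by blast
 qed
 show thesis using that C0 main by blast
qed

text \<open>The terms of first order in \<tau> that contain difference quotients cancel up to the
  commutator of \<open>a\<close> with \<open>cdiff h\<close>, by symmetry of the kernel and
  antisymmetry of \<open>cdiff h\<close>. The terms of second order contain (\<tau> / h)^2 and are
  absorbed by \<open>\<tau> \<le> \<delta> * h\<^sup>2\<close>. Passing from \<open>a\<close> to the
  new coefficient costs \<open>\<tau> * L'\<close>. The inputs \<open>f1\<close> and
  \<open>f2\<close> will carry Leibniz remainders in the a priori bound, and consistency errors in
  the comparison of two sequences.\<close>

lemma energy_step:
 assumes U: "bcl U" and V: "bcl V" and f1: "bcl f1" and f2: "bcl f2"
  and a: "continuous_on UNIV a" "!!x. \<bar>a x\<bar> \<le> 2" and a': "continuous_on UNIV a'" "!!x. \<bar>a' x\<bar> \<le> 2"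
  and L: "!!x. \<bar>a (x + h) - a x\<bar> \<le> L * h" and L': "!!x. \<bar>a' x - a x\<bar> \<le> \<tau> * L'"
  and h: "0 < h" and \<tau>: "0 < \<tau>" "\<tau> \<le> \<delta> * h\<^sup>2" "\<tau> * L' \<le> 1"
 defines "N \<equiv> nm U + nm V" and "F \<equiv> nm f1 + nm f2"
 shows "energy \<beta> a' (\<lambda>x. U x + \<tau> * (kernel_conv \<beta> (cdiff h V) x + f1 x)) (\<lambda>x. V x + \<tau> * (a x * cdiff h U x + f2 x))
  \<le> energy \<beta> a U V + \<tau> * (16 * (kmass \<beta>)\<^sup>2 * ((L + L' + \<delta>) * N\<^sup>2 + F * N + \<tau> * F\<^sup>2))"
proof -
 define B where "B = kmass \<beta>"
 have B: "1 \<le> B" using kmass_ge_1 by (simp add: B_def)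
 let ?K = "kernel_conv \<beta>"
 define q1 q2 where "q1 = (\<lambda>x. ?K (cdiff h V) x + f1 x)" and "q2 = (\<lambda>x. a x * cdiff h U x + f2 x)"
 define S W F1 F2 where "S = nm U" and "W = nm V" and "F1 = nm f1" and "F2 = nm f2"
 have pos: "0 \<le> S" "0 \<le> W" "0 \<le> F1" "0 \<le> F2" by (simp_all add: S_def W_def F1_def F2_def)
 have L0: "0 \<le> L" using order_trans[OF abs_ge_zero L[of 0]] h by (simp add: zero_le_mult_iff)
 have L'0: "0 \<le> L'" using order_trans[OF abs_ge_zero L'[of 0]] \<tau> by (simp add: zero_le_mult_iff)
 note K = bcl_kernel_conv[OF ker, folded B_def]
 have aU: "bcl (\<lambda>x. a x * g x)" if "bcl g" for g by (rule bcl_bounded_mult[OF a that])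
 have b: "bcl q1" "bcl q2" "bcl (?K V)" "bcl (\<lambda>x. a x * U x)" "bcl (\<lambda>x. a x * cdiff h U x)" "bcl (?K (cdiff h V))" "bcl (cdiff h (\<lambda>y. a y * U y))"
  unfolding q1_def q2_def by (intro bcl_add K(1) aU bcl_cdiff U V f1 f2)+
 note s = bcl_sq[OF b(1)] bcl_sq[OF b(2)] bcl_sq[OF b(3)] bcl_sq[OF b(4)] bcl_sq[OF b(5)] bcl_sq[OF b(6)] bcl_sq[OF b(7)]
  bcl_sq[OF U] bcl_sq[OF V] bcl_sq[OF f1] bcl_sq[OF f2]
 have q1n: "nm q1 \<le> B / h * W + F1"
 proof -
  have "nm q1 \<le> nm (?K (cdiff h V)) + F1" unfolding q1_def F1_def by (rule nm_triangle[OF s(6) s(10)])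
  moreover have "nm (?K (cdiff h V)) \<le> B * (1 / h * W)"
   using K(2)[OF bcl_cdiff[OF V], of h] mult_left_mono[OF nm_cdiff_le[OF s(9) h], of B] B by (simp add: W_def)
  ultimately show ?thesis by simp
 qed
 have q2n: "nm q2 \<le> 2 / h * S + F2"
 proof -
  have "nm q2 \<le> nm (\<lambda>x. a x * cdiff h U x) + F2" unfolding q2_def F2_def by (rule nm_triangle[OF s(5) s(11)])
  moreover have "nm (\<lambda>x. a x * cdiff h U x) \<le> 2 * (1 / h * S)"
   using nm_bounded_mult(1)[OF a bcl_sq[OF bcl_cdiff[OF U]], of h] nm_cdiff_le[OF s(8) h] by (simp add: S_def)
  ultimately show ?thesis by simp
 qed
 define Up Vp where "Up = (\<lambda>x. U x + \<tau> * q1 x)" and "Vp = (\<lambda>x. V x + \<tau> * q2 x)"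
 have bp: "bcl Up" "bcl Vp" unfolding Up_def Vp_def using U V b by auto
 have KVp: "?K Vp = (\<lambda>x. ?K V x + \<tau> * ?K q2 x)"
  unfolding Vp_def kernel_conv_add[OF ker V bcl_cmult[OF b(2)]] kernel_conv_cmult[OF ker] ..
 have e1: "ip (?K Vp) Vp = ip (?K V) V + 2 * \<tau> * ip (?K V) q2 + \<tau>\<^sup>2 * ip (?K q2) q2"
 proof -
  have "ip (?K q2) V = ip (?K V) q2"
   using kernel_conv_symmetric[OF ker ell b(2) V] by (simp add: ip_commute)
  then show ?thesis
   unfolding KVp unfolding Vp_def
   using s bcl_sq[OF K(1)[OF b(2)]] by (simp add: ip_linear sq_add sq_cmult power2_eq_square algebra_simps)
 qed
 have e2: "ip (\<lambda>x. a x * Up x) Up = ip (\<lambda>x. a x * U x) U + 2 * \<tau> * ip (\<lambda>x. a x * U x) q1 + \<tau>\<^sup>2 * ip (\<lambda>x. a x * q1 x) q1"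
 proof -
  have "ip (\<lambda>x. a x * q1 x) U = ip (\<lambda>x. a x * U x) q1" by (simp add: ip_def ac_simps)
  moreover have "(\<lambda>x. a x * Up x) = (\<lambda>x. a x * U x + \<tau> * (a x * q1 x))" by (auto simp: Up_def algebra_simps)
  ultimately show ?thesis
   unfolding Up_def
   using s bcl_sq[OF aU[OF b(1)]] by (simp add: ip_linear sq_add sq_cmult power2_eq_square algebra_simps)
 qed
 have e3: "ip (\<lambda>x. a' x * Up x) Up = ip (\<lambda>x. a x * Up x) Up + ip (\<lambda>x. (a' x - a x) * Up x) Up"
 proof -
  have "(\<lambda>x. (a' x - a x) * Up x) = (\<lambda>x. a' x * Up x - a x * Up x)" by (auto simp: algebra_simps)
  then show ?thesis
   using bcl_sq[OF aU[OF bp(1)]] bcl_sq[OF bcl_bounded_mult[OF a' bp(1)]] bcl_sq[OF bp(1)] by (simp add: ip_diff_left)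
 qed
 \<comment> \<open>The two pairings that contain difference quotients combine into one commutator;
   the other terms involve \<open>U\<close>, \<open>V\<close> and the inputs without
   quotients.\<close>
 have c1: "ip (?K V) q2 + ip (\<lambda>x. a x * U x) q1
   = ip (?K V) (\<lambda>x. a x * cdiff h U x - cdiff h (\<lambda>y. a y * U y) x) + ip (?K V) f2 + ip (\<lambda>x. a x * U x) f1"
 proof -
  have "ip (\<lambda>x. a x * U x) (?K (cdiff h V)) = - ip (?K V) (cdiff h (\<lambda>y. a y * U y))"
   unfolding kernel_conv_cdiff[OF ker V] ip_cdiff[OF s(4) s(3), symmetric]
   using ip_cdiff[OF s(4) s(3), of h] by (simp add: ip_commute)
  then show ?thesis unfolding q1_def q2_def using s by (simp add: ip_linear)
 qed
 have c2: "ip (?K V) (\<lambda>x. a x * cdiff h U x - cdiff h (\<lambda>y. a y * U y) x) \<le> B * W * (L * S)"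
 proof -
  have "ip (?K V) (\<lambda>x. a x * cdiff h U x - cdiff h (\<lambda>y. a y * U y) x)
    \<le> nm (?K V) * nm (\<lambda>x. a x * cdiff h U x - cdiff h (\<lambda>y. a y * U y) x)"
   using Cauchy_Schwarz_ip[OF s(3) sq_diff[OF s(5) s(7)]] by linarith
  also have "... \<le> (B * W) * (L * S)"
   using K(2)[OF V] cdiff_commutator[OF a(1) L h s(8)] B L0 by (intro mult_mono) (auto simp: W_def S_def)
  finally show ?thesis .
 qed
 have c3: "ip (?K V) f2 \<le> B * W * F2"
  using Cauchy_Schwarz_ip[OF s(3) s(11)] mult_right_mono[OF K(2)[OF V], of "nm f2"] by (simp add: W_def F2_def)
 have naU: "nm (\<lambda>x. a x * g x) \<le> 2 * nm g" if "sq g" for g by (rule nm_bounded_mult(1)[OF a that])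
 have c4: "ip (\<lambda>x. a x * U x) f1 \<le> 2 * S * F1"
  using Cauchy_Schwarz_ip[OF s(4) s(10)] mult_right_mono[OF naU[OF s(8)], of "nm f1"] by (simp add: S_def F1_def)
 have c5: "ip (?K q2) q2 \<le> B * (nm q2)\<^sup>2"
  using Cauchy_Schwarz_ip[OF bcl_sq[OF K(1)[OF b(2)]] s(2)] mult_right_mono[OF K(2)[OF b(2)], of "nm q2"]
  by (simp add: power2_eq_square)
 have c6: "ip (\<lambda>x. a x * q1 x) q1 \<le> 2 * (nm q1)\<^sup>2"
  using Cauchy_Schwarz_ip[OF bcl_sq[OF aU[OF b(1)]] s(1)] mult_right_mono[OF naU[OF s(1)], of "nm q1"]
  by (simp add: power2_eq_square)
 have Upn: "(nm Up)\<^sup>2 \<le> 2 * S\<^sup>2 + 2 * (\<tau>\<^sup>2 * (nm q1)\<^sup>2)"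
 proof -
  have "nm Up \<le> S + \<tau> * nm q1"
   unfolding Up_def S_def using nm_triangle[OF s(8) sq_cmult[OF s(1), of \<tau>]] nm_cmult[of \<tau> q1] \<tau> by simp
  then have "(nm Up)\<^sup>2 \<le> (S + \<tau> * nm q1)\<^sup>2" by (intro power_mono) auto
  also have "... \<le> 2 * S\<^sup>2 + 2 * (\<tau> * nm q1)\<^sup>2"
   using zero_le_power2[of "S - \<tau> * nm q1"] unfolding power2_sum power2_diff by linarith
  finally show ?thesis by (simp add: power_mult_distrib)
 qed
 \<comment> \<open>\<open>\<tau> * L' \<le> 1\<close> absorbs the contribution of the increment, so
   that only the part with \<open>S\<close> keeps the factor \<open>\<tau> * L'\<close>.\<close>
 have c7: "ip (\<lambda>x. (a' x - a x) * Up x) Up \<le> \<tau> * L' * (2 * S\<^sup>2) + 2 * (\<tau>\<^sup>2 * (nm q1)\<^sup>2)"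
 proof -
  have ca: "continuous_on UNIV (\<lambda>x. a' x - a x)" by (intro continuous_on_diff a a')
  note m = nm_bounded_mult[OF ca L' bcl_sq[OF bp(1)]]
  have "ip (\<lambda>x. (a' x - a x) * Up x) Up \<le> \<tau> * L' * (nm Up)\<^sup>2"
   using Cauchy_Schwarz_ip[OF m(2) bcl_sq[OF bp(1)]] mult_right_mono[OF m(1), of "nm Up"]
   by (simp add: power2_eq_square)
  also have "... \<le> \<tau> * L' * (2 * S\<^sup>2 + 2 * (\<tau>\<^sup>2 * (nm q1)\<^sup>2))"
   using Upn \<tau> L'0 by (intro mult_left_mono) auto
  also have "... \<le> \<tau> * L' * (2 * S\<^sup>2) + 1 * (2 * (\<tau>\<^sup>2 * (nm q1)\<^sup>2))"
   unfolding distrib_left using \<tau>(3) by (intro add_left_mono mult_right_mono) auto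
  finally show ?thesis by simp
 qed
 have sqb: "(x + y)\<^sup>2 \<le> 2 * x\<^sup>2 + 2 * y\<^sup>2" for x y :: real
  using zero_le_power2[of "x - y"] unfolding power2_sum power2_diff by linarith
 \<comment> \<open>The factor \<tau> / h^2 is traded for \<delta>; the other factor \<tau> remains
   as the length of the step.\<close>
 have th: "\<tau>\<^sup>2 * (c / h * x)\<^sup>2 \<le> \<tau> * \<delta> * (c\<^sup>2 * x\<^sup>2)" for c x
 proof -
  have "\<tau> / h\<^sup>2 \<le> \<delta>" using \<tau>(2) h by (simp add: divide_simps)
  then have "\<tau> * (\<tau> / h\<^sup>2) * (c\<^sup>2 * x\<^sup>2) \<le> \<tau> * \<delta> * (c\<^sup>2 * x\<^sup>2)" using \<tau>(1) by (intro mult_right_mono mult_left_mono) auto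
  then show ?thesis by (simp add: power2_eq_square ac_simps)
 qed
 have Q1: "\<tau>\<^sup>2 * (nm q1)\<^sup>2 \<le> 2 * (\<tau> * \<delta> * (B\<^sup>2 * W\<^sup>2)) + 2 * (\<tau>\<^sup>2 * F1\<^sup>2)"
 proof -
  have "(nm q1)\<^sup>2 \<le> (B / h * W + F1)\<^sup>2" using q1n by (intro power_mono) auto
  then have "(nm q1)\<^sup>2 \<le> 2 * (B / h * W)\<^sup>2 + 2 * F1\<^sup>2" using sqb[of "B / h * W" F1] by linarith
  then have "\<tau>\<^sup>2 * (nm q1)\<^sup>2 \<le> \<tau>\<^sup>2 * (2 * (B / h * W)\<^sup>2 + 2 * F1\<^sup>2)" by (intro mult_left_mono) auto
  then show ?thesis using th[of B W] unfolding distrib_left by linarith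
 qed
 have Q2: "\<tau>\<^sup>2 * (nm q2)\<^sup>2 \<le> 2 * (\<tau> * \<delta> * (2\<^sup>2 * S\<^sup>2)) + 2 * (\<tau>\<^sup>2 * F2\<^sup>2)"
 proof -
  have "(nm q2)\<^sup>2 \<le> (2 / h * S + F2)\<^sup>2" using q2n by (intro power_mono) auto
  then have "(nm q2)\<^sup>2 \<le> 2 * (2 / h * S)\<^sup>2 + 2 * F2\<^sup>2" using sqb[of "2 / h * S" F2] by linarith
  then have "\<tau>\<^sup>2 * (nm q2)\<^sup>2 \<le> \<tau>\<^sup>2 * (2 * (2 / h * S)\<^sup>2 + 2 * F2\<^sup>2)" by (intro mult_left_mono) auto
  then show ?thesis using th[of 2 S] unfolding distrib_left by linarith
 qed
 have "energy \<beta> a' Up Vp = energy \<beta> a U V + 2 * \<tau> * (ip (?K V) q2 + ip (\<lambda>x. a x * U x) q1)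
   + \<tau>\<^sup>2 * ip (?K q2) q2 + \<tau>\<^sup>2 * ip (\<lambda>x. a x * q1 x) q1 + ip (\<lambda>x. (a' x - a x) * Up x) Up"
  unfolding energy_def e3 e2 e1 by (simp add: algebra_simps)
 also have "... \<le> energy \<beta> a U V + 2 * \<tau> * (B * W * (L * S) + B * W * F2 + 2 * S * F1)
   + \<tau>\<^sup>2 * (B * (nm q2)\<^sup>2) + \<tau>\<^sup>2 * (2 * (nm q1)\<^sup>2) + (\<tau> * L' * (2 * S\<^sup>2) + 2 * (\<tau>\<^sup>2 * (nm q1)\<^sup>2))"
  unfolding c1 using \<tau> c2 c3 c4 c5 c6 c7 by (intro add_mono mult_left_mono order_refl) auto
 also have "... = energy \<beta> a U V + 2 * \<tau> * (B * W * (L * S) + B * W * F2 + 2 * S * F1)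
   + B * (\<tau>\<^sup>2 * (nm q2)\<^sup>2) + 4 * (\<tau>\<^sup>2 * (nm q1)\<^sup>2) + \<tau> * L' * (2 * S\<^sup>2)"
  by (simp add: algebra_simps)
 also have "... \<le> energy \<beta> a U V + 2 * \<tau> * (B * W * (L * S) + B * W * F2 + 2 * S * F1)
   + B * (2 * (\<tau> * \<delta> * (2\<^sup>2 * S\<^sup>2)) + 2 * (\<tau>\<^sup>2 * F2\<^sup>2)) + 4 * (2 * (\<tau> * \<delta> * (B\<^sup>2 * W\<^sup>2)) + 2 * (\<tau>\<^sup>2 * F1\<^sup>2)) + \<tau> * L' * (2 * S\<^sup>2)"
  using mult_left_mono[OF Q2, of B] Q1 B by (intro add_mono order_refl) auto
 also have "... = energy \<beta> a U V + \<tau> * (B * L * (2 * (W * S)) + 2 * B * (W * F2) + 4 * (S * F1) + 2 * L' * S\<^sup>2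
   + \<delta> * (8 * B * S\<^sup>2 + 8 * B\<^sup>2 * W\<^sup>2) + \<tau> * (2 * B * F2\<^sup>2 + 8 * F1\<^sup>2))"
  by (simp add: algebra_simps power2_eq_square)
 \<comment> \<open>Bookkeeping: 16 dominates every numerical factor and \<open>B\<^sup>2\<close>
   every power of \<open>B\<close>, since \<open>1 \<le> B\<close>.\<close>
 also have "... \<le> energy \<beta> a U V + \<tau> * (16 * B\<^sup>2 * ((L + L' + \<delta>) * N\<^sup>2 + F * N + \<tau> * F\<^sup>2))"
 proof -
  have NF: "N = S + W" "F = F1 + F2" by (simp_all add: N_def F_def S_def W_def F1_def F2_def)
  have d0: "0 \<le> \<delta>" using \<tau>(1,2) h by (meson less_le_not_le mult_neg_pos not_le order_trans zero_less_power)
  have BB: "B \<le> B\<^sup>2" "1 \<le> B\<^sup>2" using B self_le_power[of B 2] one_le_power[of B 2] by auto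
  have N2: "S\<^sup>2 \<le> N\<^sup>2" "W\<^sup>2 \<le> N\<^sup>2" "2 * (W * S) \<le> N\<^sup>2" "S\<^sup>2 + W\<^sup>2 \<le> N\<^sup>2"
   using pos by (auto simp: NF power2_eq_square algebra_simps)
  have F2': "F1\<^sup>2 + F2\<^sup>2 \<le> F\<^sup>2" using pos by (auto simp: NF power2_eq_square algebra_simps)
  have FN: "W * F2 + S * F1 \<le> F * N" using pos by (auto simp: NF algebra_simps)
  have t1: "B * L * (2 * (W * S)) \<le> 16 * B\<^sup>2 * (L * N\<^sup>2)"
  proof -
   have "B * L * (2 * (W * S)) \<le> B\<^sup>2 * L * N\<^sup>2"
    using BB N2 L0 B pos by (intro mult_mono) auto
   also have "... \<le> 16 * (B\<^sup>2 * L * N\<^sup>2)" using L0 by simp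
   finally show ?thesis by (simp add: mult.assoc)
  qed
  have t2: "2 * B * (W * F2) + 4 * (S * F1) \<le> 16 * B\<^sup>2 * (F * N)"
  proof -
   have "2 * B * (W * F2) + 4 * (S * F1) \<le> 16 * B\<^sup>2 * (W * F2) + 16 * B\<^sup>2 * (S * F1)"
    using BB B pos by (intro add_mono mult_right_mono) auto
   also have "... = 16 * B\<^sup>2 * (W * F2 + S * F1)" by (simp add: algebra_simps)
   also have "... \<le> 16 * B\<^sup>2 * (F * N)" using FN by (intro mult_left_mono) auto
   finally show ?thesis .
  qed
  have t3: "2 * L' * S\<^sup>2 \<le> 16 * B\<^sup>2 * (L' * N\<^sup>2)"
  proof -
   have "2 * (L' * S\<^sup>2) \<le> (16 * B\<^sup>2) * (L' * N\<^sup>2)"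
    using BB N2 L'0 by (intro mult_mono mult_left_mono) auto
   then show ?thesis by simp
  qed
  have t4: "\<delta> * (8 * B * S\<^sup>2 + 8 * B\<^sup>2 * W\<^sup>2) \<le> 16 * B\<^sup>2 * (\<delta> * N\<^sup>2)"
  proof -
   have "8 * B * S\<^sup>2 + 8 * B\<^sup>2 * W\<^sup>2 \<le> 8 * B\<^sup>2 * N\<^sup>2 + 8 * B\<^sup>2 * N\<^sup>2"
    using BB N2 B by (intro add_mono mult_mono) auto
   then have "\<delta> * (8 * B * S\<^sup>2 + 8 * B\<^sup>2 * W\<^sup>2) \<le> \<delta> * (8 * B\<^sup>2 * N\<^sup>2 + 8 * B\<^sup>2 * N\<^sup>2)" using d0 by (rule mult_left_mono)
   then show ?thesis by (simp add: algebra_simps)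
  qed
  have t5: "\<tau> * (2 * B * F2\<^sup>2 + 8 * F1\<^sup>2) \<le> 16 * B\<^sup>2 * (\<tau> * F\<^sup>2)"
  proof -
   have "2 * B * F2\<^sup>2 + 8 * F1\<^sup>2 \<le> 16 * B\<^sup>2 * F2\<^sup>2 + 16 * B\<^sup>2 * F1\<^sup>2"
    using BB B by (intro add_mono mult_right_mono) auto
   also have "... = 16 * B\<^sup>2 * (F1\<^sup>2 + F2\<^sup>2)" by (simp add: algebra_simps)
   also have "... \<le> 16 * B\<^sup>2 * F\<^sup>2" using F2' by (intro mult_left_mono) auto
   finally have "\<tau> * (2 * B * F2\<^sup>2 + 8 * F1\<^sup>2) \<le> \<tau> * (16 * B\<^sup>2 * F\<^sup>2)" using \<tau>(1) by (intro mult_left_mono) auto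
   then show ?thesis by (simp add: ac_simps)
  qed
  have "B * L * (2 * (W * S)) + 2 * B * (W * F2) + 4 * (S * F1) + 2 * L' * S\<^sup>2
   + \<delta> * (8 * B * S\<^sup>2 + 8 * B\<^sup>2 * W\<^sup>2) + \<tau> * (2 * B * F2\<^sup>2 + 8 * F1\<^sup>2)
   \<le> 16 * B\<^sup>2 * (L * N\<^sup>2) + 16 * B\<^sup>2 * (F * N) + 16 * B\<^sup>2 * (L' * N\<^sup>2) + 16 * B\<^sup>2 * (\<delta> * N\<^sup>2) + 16 * B\<^sup>2 * (\<tau> * F\<^sup>2)"
   using t1 t2 t3 t4 t5 by linarith
  also have "... = 16 * B\<^sup>2 * ((L + L' + \<delta>) * N\<^sup>2 + F * N + \<tau> * F\<^sup>2)" by (simp add: algebra_simps)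
  finally show ?thesis using \<tau>(1) by (intro add_left_mono mult_left_mono) auto
 qed
 finally show ?thesis unfolding Up_def Vp_def q1_def q2_def B_def .
qed

text \<open>\<open>min C1 (1 / 2)\<close> combines coercivity of the kernel with the lower bound of
  the coefficient; the factor 2 is that of
  \<open>(x + y)\<^sup>2 \<le> 2 * (x\<^sup>2 + y\<^sup>2)\<close>.\<close>

lemma energy_lower:
 assumes U: "bcl U" and V: "bcl V" and a: "continuous_on UNIV a" "!!x. 1 / 2 \<le> a x" "!!x. \<bar>a x\<bar> \<le> 2"
 shows "(nm U + nm V)\<^sup>2 \<le> 2 / min C1 (1 / 2) * energy \<beta> a U V"
proof -
 define m where "m = min C1 (1 / 2)"
 have m: "0 < m" using C1_pos by (simp add: m_def)
 have "m * (nm V)\<^sup>2 \<le> C1 * (nm V)\<^sup>2" by (intro mult_right_mono) (auto simp: m_def)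
 also have "... \<le> ip (kernel_conv \<beta> V) V" by (rule kernel_conv_coercive[OF ker ell V])
 finally have 1: "m * (nm V)\<^sup>2 \<le> ip (kernel_conv \<beta> V) V" .
 have "m * (nm U)\<^sup>2 = (LINT x|lborel. m * (U x)\<^sup>2)" by (simp add: nm_squared)
 also have "... \<le> (LINT x|lborel. a x * U x * U x)"
 proof (rule integral_mono)
  show "integrable lborel (\<lambda>x. m * (U x)\<^sup>2)" using bcl_sq[OF U] by (simp add: sq_def)
  show "integrable lborel (\<lambda>x. a x * U x * U x)"
   by (rule sq_integrable_mult[OF bcl_sq[OF bcl_bounded_mult[OF a(1,3) U]] bcl_sq[OF U]])
  show "m * (U x)\<^sup>2 \<le> a x * U x * U x" for x
   using mult_right_mono[of m "a x" "(U x)\<^sup>2"] a(2)[of x] by (simp add: m_def power2_eq_square mult.assoc)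
 qed
 finally have 2: "m * (nm U)\<^sup>2 \<le> ip (\<lambda>x. a x * U x) U" by (simp add: ip_def)
 have "m * (nm U + nm V)\<^sup>2 \<le> m * (2 * ((nm U)\<^sup>2 + (nm V)\<^sup>2))"
 proof (rule mult_left_mono)
  show "(nm U + nm V)\<^sup>2 \<le> 2 * ((nm U)\<^sup>2 + (nm V)\<^sup>2)"
   using zero_le_power2[of "nm U - nm V"] by (simp add: power2_eq_square algebra_simps)
 qed (use m in simp)
 also have "... \<le> 2 * energy \<beta> a U V" using 1 2 by (simp add: energy_def algebra_simps)
 finally show ?thesis using m by (simp add: m_def[symmetric] field_simps)
qed

lemma energy_upper:
 assumes U: "bcl U" and V: "bcl V" and a: "continuous_on UNIV a" "!!x. \<bar>a x\<bar> \<le> 2"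
 shows "energy \<beta> a U V \<le> 2 * kmass \<beta> * (nm U + nm V)\<^sup>2"
proof -
 note K = bcl_kernel_conv[OF ker V] and aU = bcl_bounded_mult[OF a U]
 have "ip (kernel_conv \<beta> V) V \<le> kmass \<beta> * (nm V)\<^sup>2"
  using Cauchy_Schwarz_ip[OF bcl_sq[OF K(1)] bcl_sq[OF V]] mult_right_mono[OF K(2), of "nm V"]
  by (simp add: power2_eq_square)
 moreover have "ip (\<lambda>x. a x * U x) U \<le> 2 * (nm U)\<^sup>2"
  using Cauchy_Schwarz_ip[OF bcl_sq[OF aU] bcl_sq[OF U]] mult_right_mono[OF nm_bounded_mult(1)[OF a bcl_sq[OF U]], of "nm U"]
  by (simp add: power2_eq_square)
 ultimately have "energy \<beta> a U V \<le> kmass \<beta> * (nm V)\<^sup>2 + 2 * (nm U)\<^sup>2" by (simp add: energy_def)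
 also have "... \<le> 2 * kmass \<beta> * (nm V)\<^sup>2 + 2 * kmass \<beta> * (nm U)\<^sup>2"
  using kmass_ge_1[of \<beta>] by (intro add_mono mult_right_mono) auto
 also have "... = 2 * kmass \<beta> * ((nm U)\<^sup>2 + (nm V)\<^sup>2)" by (simp add: algebra_simps)
 also have "... \<le> 2 * kmass \<beta> * (nm U + nm V)\<^sup>2"
  using kmass_ge_1[of \<beta>] by (intro mult_left_mono) (auto simp: power2_sum)
 finally show ?thesis .
qed

end

section \<open>Energy estimate for the Euler scheme\<close>

text \<open>With \<open>1 \<le> M\<close> the power \<open>M ^ p\<close> can stand for
  \<open>M ^ (p - 1)\<close>, so the case \<open>p = 0\<close> needs no separate form.\<close>

lemma power_diff_le:
 fixes x y M :: real
 assumes "\<bar>x\<bar> \<le> M" "\<bar>y\<bar> \<le> M" "1 \<le> M"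
 shows "\<bar>x ^ p - y ^ p\<bar> \<le> real p * M ^ p * \<bar>x - y\<bar>"
proof (induction p)
 case (Suc p)
 have M: "0 \<le> M" "M ^ p \<le> M ^ Suc p" using assms(3) by (auto simp: mult_le_cancel_right1)
 have "x ^ Suc p - y ^ Suc p = x * (x ^ p - y ^ p) + (x - y) * y ^ p" by (simp add: algebra_simps)
 then have "\<bar>x ^ Suc p - y ^ Suc p\<bar> \<le> \<bar>x\<bar> * \<bar>x ^ p - y ^ p\<bar> + \<bar>x - y\<bar> * \<bar>y\<bar> ^ p"
  by (metis abs_mult abs_triangle_ineq power_abs)
 also have "... \<le> M * (real p * M ^ p * \<bar>x - y\<bar>) + \<bar>x - y\<bar> * M ^ Suc p"
  using Suc.IH assms M order_trans[OF power_mono[OF assms(2), of p] M(2)]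
  by (intro add_mono mult_mono) auto
 also have "... = real (Suc p) * M ^ Suc p * \<bar>x - y\<bar>" by (simp add: algebra_simps)
 finally show ?case .
qed simp

lemma bsob_Lipschitz:
 assumes "bsob 2 f"
 shows "\<bar>f (x + h) - f x\<bar> \<le> \<bar>h\<bar> * bnorm 2 f"
proof -
 have f: "bsob (Suc (Suc 0)) f" using assms by (simp add: numeral_2_eq_2)
 have "\<bar>deriv f y\<bar> \<le> bnorm 2 f" for y
 proof -
  have "\<bar>deriv f y\<bar> \<le> bnorm (Suc 0) (deriv f)" by (rule sup_le_bnorm) (use f in simp)
  also have "... \<le> bnorm 2 f" unfolding numeral_2_eq_2 by (rule bnorm_deriv_le)
  finally show ?thesis .
 qed
 then have "norm (f (x + h) - f x) \<le> bnorm 2 f * norm (x + h - x)"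
  using bsob_SucD(2)[OF f]
  by (intro field_differentiable_bound[of UNIV f "deriv f"]) (auto simp: has_field_derivative_at_within)
 then show ?thesis by (simp add: mult.commute)
qed

lemma funpow_deriv_linear:
 assumes "bsob j f" "bsob j g"
 shows "(deriv ^^ j) (\<lambda>x. f x + c * g x) = (\<lambda>x. (deriv ^^ j) f x + c * (deriv ^^ j) g x)"
 using assms
proof (induction j arbitrary: f g)
 case (Suc j)
 have "deriv (\<lambda>x. f x + c * g x) = (\<lambda>x. deriv f x + c * deriv g x)"
  using deriv_add_bsob[OF Suc.prems(1) bsob_cmult(1)[OF Suc.prems(2)], of c] bsob_cmult(3)[OF Suc.prems(2), of c] by simp
 then show ?case using Suc.IH[of "deriv f" "deriv g"] Suc.prems
  by (simp add: funpow_Suc_right del: funpow.simps)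
qed simp

lemma funpow_deriv_cdiff:
 assumes "bsob j f" "h > 0"
 shows "(deriv ^^ j) (cdiff h f) = cdiff h ((deriv ^^ j) f)"
 using assms
proof (induction j arbitrary: f)
 case (Suc j)
 then show ?case using bsob_cdiff(3)[OF Suc.prems(2,1)]
  by (simp add: funpow_Suc_right del: funpow.simps)
qed simp

lemma funpow_deriv_kernel_conv:
 assumes ker: "is_kernel \<beta>" and "bsob j f"
 shows "(deriv ^^ j) (kernel_conv \<beta> f) = kernel_conv \<beta> ((deriv ^^ j) f)"
 using assms(2)
proof (induction j arbitrary: f)
 case (Suc j)
 then show ?case using bsob_kernel_conv(3)[OF ker Suc.prems]
  by (simp add: funpow_Suc_right del: funpow.simps)
qed simp

text \<open>The remainder obeys \<open>R (Suc j) = deriv (R j) + deriv b * G\<close> with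
  \<open>G\<close> the j-th derivative of \<open>g\<close>, so \<open>R j\<close> contains only
  derivatives of \<open>g\<close> of order below \<open>j\<close>. Thus order \<open>k - 1\<close>
  of \<open>g\<close> suffices, which matters for \<open>g = cdiff h u\<close>: at that order it is
  bounded by \<open>u\<close> at order \<open>k\<close>, independently of \<open>h\<close>. The
  spare index \<open>i\<close> holds the derivatives that later steps of the induction will
  take.\<close>

lemma Leibniz_remainder:
 fixes b g :: "real => real"
 assumes b: "bsob k b" and g: "bsob k g" and k: "2 \<le> k" and ij: "i + j \<le> k"
 defines "R \<equiv> \<lambda>j x. (deriv ^^ j) (\<lambda>x. b x * g x) x - b x * (deriv ^^ j) g x"
 shows "bsob i (R j)" "bnorm i (R j) \<le> real j * 2 ^ k * (bnorm k b * bnorm (k - 1) g)"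
proof -
 have "bsob i (R j) \<and> bnorm i (R j) \<le> real j * 2 ^ k * (bnorm k b * bnorm (k - 1) g)"
  using ij
 proof (induction j arbitrary: i)
  case 0
  show ?case by (simp add: R_def)
 next
  case (Suc j)
  have IH: "bsob (Suc i) (R j)" "bnorm (Suc i) (R j) \<le> real j * 2 ^ k * (bnorm k b * bnorm (k - 1) g)"
   using Suc.IH[of "Suc i"] Suc.prems by auto
  define G where "G = (deriv ^^ j) g"
  have G: "bsob (Suc i) G" "bnorm i G \<le> bnorm (k - 1) g"
  proof -
   show "bsob (Suc i) G" unfolding G_def
    by (rule bsob_funpow(1)[OF bsob_mono[OF g]]) (use Suc.prems in simp)
   have "bnorm i G \<le> bnorm (j + i) g" unfolding G_def
    by (rule bsob_funpow(2)[OF bsob_mono[OF g]]) (use Suc.prems in simp)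
   also have "... \<le> bnorm (k - 1) g" using Suc.prems by (intro bnorm_mono) simp
   finally show "bnorm i G \<le> bnorm (k - 1) g" .
  qed
  have bi: "bsob (Suc i) b" by (rule bsob_mono[OF b]) (use Suc.prems in simp)
  have k1: "k = Suc (k - 1)" using k by simp
  have db: "bsob (k - 1) (deriv b)" "bnorm (k - 1) (deriv b) \<le> bnorm k b"
   using b bnorm_deriv_le[of "k - 1" b] bsob_SucD(3)[of "k - 1" b] k1 by auto
  have dj: "(deriv ^^ j) (\<lambda>x. b x * g x) = (\<lambda>x. R j x + b x * G x)" by (auto simp: R_def G_def)
  have "R (Suc j) = (\<lambda>x. deriv (R j) x + deriv b x * G x)"
  proof
   fix x
   have "(deriv ^^ Suc j) (\<lambda>x. b x * g x) x = deriv (\<lambda>x. R j x + b x * G x) x" by (simp add: dj)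
   also have "... = deriv (R j) x + (deriv b x * G x + b x * deriv G x)"
    unfolding deriv_add_bsob[OF IH(1) bsob_mult[OF bi G(1)]] deriv_mult_bsob[OF bi G(1)] ..
   finally show "R (Suc j) x = deriv (R j) x + deriv b x * G x" by (simp add: R_def G_def)
  qed
  moreover have dR: "bsob i (deriv (R j))" using IH(1) by simp
  moreover have m: "bsob i (\<lambda>x. deriv b x * G x)"
   using bsob_mult[OF bsob_SucD(3)[OF bi] bsob_Suc[OF G(1)]] .
  moreover have "bnorm i (\<lambda>x. deriv b x * G x) \<le> 2 ^ k * (bnorm k b * bnorm (k - 1) g)"
  proof -
   have "bnorm i (\<lambda>x. deriv b x * G x) \<le> (2 ^ Suc i - 1) * (bnorm (k - 1) (deriv b) * bnorm i G)"
    using bnorm_mult_le[OF db(1) bsob_Suc[OF G(1)]] Suc.prems k by simp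
   also have "... \<le> 2 ^ k * (bnorm k b * bnorm (k - 1) g)"
   proof (intro mult_mono)
    have "(2::real) ^ Suc i \<le> 2 ^ k" using Suc.prems by (intro power_increasing) auto
    then show "(2::real) ^ Suc i - 1 \<le> 2 ^ k" by linarith
   qed (use db G in auto)
   finally show ?thesis .
  qed
  moreover have "bnorm i (deriv (R j)) \<le> real j * 2 ^ k * (bnorm k b * bnorm (k - 1) g)"
   using order_trans[OF bnorm_deriv_le IH(2)] .
  ultimately show ?case
   using bsob_add[OF dR m] by (simp add: algebra_simps)
 qed
 then show "bsob i (R j)" "bnorm i (R j) \<le> real j * 2 ^ k * (bnorm k b * bnorm (k - 1) g)" by auto
qed

abbreviation bpair :: "nat => real => (real => real) \<times> (real => real) => bool" where
 "bpair k \<Lambda> w \<equiv> bsob k (fst w) \<and> bsob k (snd w) \<and> bnorm k (fst w) + bnorm k (snd w) \<le> \<Lambda>"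

text \<open>The derivative F'(u). It differs from 1 by a multiple of \<delta>, so all its variations
  carry the factor \<delta>.\<close>

definition coef :: "nat => real => (real => real) => real => real" where
 "coef p \<delta> u x = 1 + \<delta> * real (p + 1) * u x ^ p"

text \<open>The second equation is discretised with the coefficient in front of the quotient, not as
  a quotient of the flux. Its derivatives then solve the linear system with the same coefficient up
  to Leibniz remainders.\<close>

definition euler_step :: "kernel => nat => real => real => real => (real => real) \<times> (real => real) => (real => real) \<times> (real => real)" where
 "euler_step \<beta> p \<delta> h \<tau> w =
  ((\<lambda>x. fst w x + \<tau> * kernel_conv \<beta> (cdiff h (snd w)) x),
   (\<lambda>x. snd w x + \<tau> * (coef p \<delta> (fst w) x * cdiff h (fst w) x)))"

definition euler :: "kernel => nat => real => real => real => (real => real) => (real => real) => nat => (real => real) \<times> (real => real)" where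
 "euler \<beta> p \<delta> h \<tau> u0 v0 n = (euler_step \<beta> p \<delta> h \<tau> ^^ n) (u0, v0)"

text \<open>One crude constant for three quantities, each divided by \<delta>: the norm of
  \<open>coef - 1\<close>, its Lipschitz constant in space and its rate of change in one time step.
  The factor \<open>1 + kmass \<beta>\<close> allows for the growth of the values of
  \<open>u\<close> in one step; the factor \<open>p\<close> comes from the Lipschitz bound for the
  power \<open>p\<close>, and the additional power from the increment that this bound
  multiplies.\<close>

definition growth :: "kernel => nat => nat => real => real" where
 "growth \<beta> k p \<Lambda> = real (p + 1) * real p * (2 ^ Suc k * (1 + kmass \<beta>) * \<Lambda>) ^ Suc p"

context
 fixes \<beta> :: kernel and C1 C2 :: real and p :: nat
 assumes ker: "is_kernel \<beta>" and ell: "elliptic \<beta> C1 C2" and p: "1 \<le> p"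
begin

section \<open>Bounds for the coefficient along the scheme\<close>

lemma growth_nonneg: "0 \<le> \<Lambda> ==> 0 \<le> growth \<beta> k p \<Lambda>"
 using kmass_ge_1[of \<beta>] by (simp add: growth_def)

lemma bsob_coef:
 assumes u: "bsob k u" and k: "1 \<le> k" and \<Lambda>: "bnorm k u \<le> \<Lambda>" "1 \<le> \<Lambda>" and \<delta>: "0 \<le> \<delta>"
 shows "bsob k (\<lambda>x. \<delta> * real (p + 1) * u x ^ p)"
  "bnorm k (\<lambda>x. \<delta> * real (p + 1) * u x ^ p) \<le> \<delta> * growth \<beta> k p \<Lambda>"
proof -
 note b = bsob_power[OF u p]
 show "bsob k (\<lambda>x. \<delta> * real (p + 1) * u x ^ p)" by (rule bsob_cmult(1)[OF b(1)])
 have L0: "0 \<le> \<Lambda>" using \<Lambda>(2) by simp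
 have base: "1 \<le> 2 ^ Suc k * (1 + kmass \<beta>) * \<Lambda>"
 proof -
  have "1 * 1 * 1 \<le> 2 ^ Suc k * (1 + kmass \<beta>) * \<Lambda>"
   using \<Lambda>(2) kmass_ge_1[of \<beta>] by (intro mult_mono one_le_power) auto
  then show ?thesis by simp
 qed
 have "bnorm k (\<lambda>x. \<delta> * real (p + 1) * u x ^ p) \<le> \<bar>\<delta> * real (p + 1)\<bar> * bnorm k (\<lambda>x. u x ^ p)"
  by (rule bsob_cmult(2)[OF b(1)])
 also have "... \<le> (\<delta> * real (p + 1)) * (2 ^ (Suc k * p) * bnorm k u ^ p)"
  using b(2)[OF k] \<delta> by (simp add: mult_left_mono)
 also have "... \<le> (\<delta> * real (p + 1)) * (real p * (2 ^ Suc k * (1 + kmass \<beta>) * \<Lambda>) ^ Suc p)"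
 proof (rule mult_left_mono)
  have "2 ^ (Suc k * p) * bnorm k u ^ p = (2 ^ Suc k * 1 * bnorm k u) ^ p"
   by (simp only: power_mult power_mult_distrib mult_1_right)
  also have "... \<le> (2 ^ Suc k * (1 + kmass \<beta>) * \<Lambda>) ^ p"
   using \<Lambda> L0 kmass_ge_1[of \<beta>] by (intro power_mono mult_mono) auto
  also have "... \<le> (2 ^ Suc k * (1 + kmass \<beta>) * \<Lambda>) ^ Suc p"
   using base by (intro power_increasing) auto
  also have "... \<le> real p * (2 ^ Suc k * (1 + kmass \<beta>) * \<Lambda>) ^ Suc p"
  proof -
   have "0 \<le> (2 ^ Suc k * (1 + kmass \<beta>) * \<Lambda>) ^ Suc p" using base by (intro zero_le_power) linarith
   from mult_right_mono[OF _ this, of 1 "real p"] show ?thesis using p by simp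
  qed
  finally show "2 ^ (Suc k * p) * bnorm k u ^ p \<le> real p * (2 ^ Suc k * (1 + kmass \<beta>) * \<Lambda>) ^ Suc p" .
 qed (use \<delta> in simp)
 finally show "bnorm k (\<lambda>x. \<delta> * real (p + 1) * u x ^ p) \<le> \<delta> * growth \<beta> k p \<Lambda>"
  by (simp add: growth_def ac_simps)
qed

lemma coef_bounds:
 assumes u: "bsob k u" and k: "1 \<le> k" and \<Lambda>: "bnorm k u \<le> \<Lambda>" "1 \<le> \<Lambda>" and \<delta>: "0 \<le> \<delta>" "\<delta> * growth \<beta> k p \<Lambda> \<le> 1 / 2"
 shows "continuous_on UNIV (coef p \<delta> u)" "1 / 2 \<le> coef p \<delta> u x" "\<bar>coef p \<delta> u x\<bar> \<le> 2"
proof -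
 note b = bsob_coef[OF u k \<Lambda> \<delta>(1)]
 show "continuous_on UNIV (coef p \<delta> u)"
  unfolding coef_def[abs_def] by (intro continuous_on_add continuous_on_const bcl_continuous[OF bsob_bcl[OF b(1)]])
 have "\<bar>\<delta> * real (p + 1) * u x ^ p\<bar> \<le> 1 / 2"
  using sup_le_bnorm'[OF b(1) k, of x] b(2) \<delta>(2) by linarith
 then show "1 / 2 \<le> coef p \<delta> u x" "\<bar>coef p \<delta> u x\<bar> \<le> 2" unfolding coef_def by linarith+
qed

lemma coef_Lipschitz:
 assumes u: "bsob k u" and k: "2 \<le> k" and \<Lambda>: "bnorm k u \<le> \<Lambda>" "1 \<le> \<Lambda>" and \<delta>: "0 \<le> \<delta>"
 shows "\<bar>coef p \<delta> u (x + h) - coef p \<delta> u x\<bar> \<le> \<delta> * growth \<beta> k p \<Lambda> * \<bar>h\<bar>"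
proof -
 have k1: "1 \<le> k" using k by simp
 note b = bsob_coef[OF u k1 \<Lambda> \<delta>]
 have "\<bar>coef p \<delta> u (x + h) - coef p \<delta> u x\<bar> \<le> \<bar>h\<bar> * bnorm 2 (\<lambda>x. \<delta> * real (p + 1) * u x ^ p)"
  using bsob_Lipschitz[OF bsob_mono[OF b(1) k], of x h] by (simp add: coef_def)
 also have "... \<le> \<bar>h\<bar> * (\<delta> * growth \<beta> k p \<Lambda>)"
  using order_trans[OF bnorm_mono[OF k] b(2)] by (intro mult_left_mono) auto
 finally show ?thesis by (simp add: ac_simps)
qed

lemma coef_diff_le:
 assumes "\<bar>u x\<bar> \<le> M" "\<bar>w x\<bar> \<le> M" "1 \<le> M" "0 \<le> \<delta>"
 shows "\<bar>coef p \<delta> w x - coef p \<delta> u x\<bar> \<le> \<delta> * real (p + 1) * (real p * M ^ p) * \<bar>w x - u x\<bar>"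
proof -
 have "\<bar>coef p \<delta> w x - coef p \<delta> u x\<bar> = \<delta> * real (p + 1) * \<bar>w x ^ p - u x ^ p\<bar>"
  using assms(4) by (simp add: coef_def right_diff_distrib[symmetric] abs_mult)
 also have "... \<le> \<delta> * real (p + 1) * (real p * M ^ p * \<bar>w x - u x\<bar>)"
  using power_diff_le[OF assms(2,1,3), of p] assms(4) by (intro mult_left_mono) auto
 finally show ?thesis by (simp add: ac_simps)
qed

lemma bsob_euler_step:
 assumes u: "bsob k u" and v: "bsob k v" and h: "0 < h"
 shows "bsob k (fst (euler_step \<beta> p \<delta> h \<tau> (u, v)))" "bsob k (snd (euler_step \<beta> p \<delta> h \<tau> (u, v)))"
proof -
 show "bsob k (fst (euler_step \<beta> p \<delta> h \<tau> (u, v)))"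
  unfolding euler_step_def fst_conv snd_conv
  by (intro bsob_add(1) bsob_cmult(1) bsob_kernel_conv(1)[OF ker] bsob_cdiff(1) u v h)
 have g: "bsob k (cdiff h u)" by (rule bsob_cdiff(1)[OF h u])
 have "bsob k (\<lambda>x. v x + \<tau> * (cdiff h u x + \<delta> * real (p + 1) * (u x ^ p * cdiff h u x)))"
  by (intro bsob_add(1) bsob_cmult(1) bsob_mult bsob_power(1) u v g p)
 then show "bsob k (snd (euler_step \<beta> p \<delta> h \<tau> (u, v)))"
  by (simp add: euler_step_def coef_def algebra_simps)
qed

lemma euler_increment_le:
 assumes v: "bsob 2 v" and h: "0 < h"
 shows "\<bar>kernel_conv \<beta> (cdiff h v) x\<bar> \<le> kmass \<beta> * bnorm 2 v"
proof -
 have v': "bsob (Suc (Suc 0)) v" using v by (simp add: numeral_2_eq_2)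
 have A: "bsob (Suc 0) (cdiff h v)" by (rule bsob_cdiff(1)[OF h bsob_Suc[OF v']])
 have "\<bar>kernel_conv \<beta> (cdiff h v) x\<bar> \<le> bnorm (Suc 0) (kernel_conv \<beta> (cdiff h v))"
  by (rule sup_le_bnorm[OF bsob_kernel_conv(1)[OF ker A]])
 also have "... \<le> kmass \<beta> * bnorm (Suc 0) (cdiff h v)" by (rule bsob_kernel_conv(2)[OF ker A])
 also have "... \<le> kmass \<beta> * bnorm 2 v"
  using bnorm_cdiff_le_Suc[OF v' h] kmass_ge_1[of \<beta>] by (intro mult_left_mono) (auto simp: numeral_2_eq_2)
 finally show ?thesis .
qed

text \<open>The bound 1 / 4 is spent twice, on the deviation of the old coefficient from 1 and on
  its change. So the new coefficient stays between 1 / 2 and 2 before anything is known about the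
  norm of the new state.\<close>

lemma coef_euler_step:
 assumes u: "bsob k u" and v: "bsob k v" and k: "2 \<le> k" and \<Lambda>: "bnorm k u \<le> \<Lambda>" "bnorm k v \<le> \<Lambda>" "1 \<le> \<Lambda>"
  and \<delta>: "0 \<le> \<delta>" "\<delta> * growth \<beta> k p \<Lambda> \<le> 1 / 4" and h: "0 < h" and \<tau>: "0 < \<tau>" "\<tau> \<le> 1"
 defines "u' \<equiv> fst (euler_step \<beta> p \<delta> h \<tau> (u, v))"
 shows "\<bar>coef p \<delta> u' x - coef p \<delta> u x\<bar> \<le> \<tau> * (\<delta> * growth \<beta> k p \<Lambda>)" "\<bar>coef p \<delta> u' x\<bar> \<le> 2"
  "continuous_on UNIV (coef p \<delta> u')" "1 / 2 \<le> coef p \<delta> u' x"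
proof -
 define B where "B = kmass \<beta>"
 have B: "1 \<le> B" using kmass_ge_1 by (simp add: B_def)
 have k1: "1 \<le> k" using k by simp
 \<comment> \<open>Bounds the values of \<open>u\<close> together with one increment, which is at
   most \<open>B * \<Lambda>\<close> because \<open>\<tau> \<le> 1\<close>.\<close>
 define M where "M = (1 + B) * \<Lambda>"
 have M: "1 \<le> M" "\<Lambda> \<le> M" "B * \<Lambda> \<le> M"
 proof -
  have "1 * \<Lambda> \<le> (1 + B) * \<Lambda>" "B * \<Lambda> \<le> (1 + B) * \<Lambda>" using B \<Lambda>(3) by (intro mult_right_mono; simp)+
  then show "1 \<le> M" "\<Lambda> \<le> M" "B * \<Lambda> \<le> M" using \<Lambda>(3) unfolding M_def by linarith+
 qed
 have d: "\<bar>u' x - u x\<bar> \<le> \<tau> * (B * \<Lambda>)" for x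
 proof -
  have "\<bar>u' x - u x\<bar> = \<tau> * \<bar>kernel_conv \<beta> (cdiff h v) x\<bar>" using \<tau>(1) by (simp add: u'_def euler_step_def abs_mult)
  also have "... \<le> \<tau> * (B * bnorm 2 v)"
   using euler_increment_le[OF bsob_mono[OF v k] h, of x] \<tau>(1) by (intro mult_left_mono) (auto simp: B_def)
  also have "... \<le> \<tau> * (B * \<Lambda>)"
   using bnorm_mono[OF k, of v] \<Lambda>(2) \<tau>(1) B by (intro mult_left_mono) auto
  finally show ?thesis .
 qed
 have ux: "\<bar>u x\<bar> \<le> \<Lambda>" for x using sup_le_bnorm'[OF u k1, of x] \<Lambda>(1) by linarith
 have u'x: "\<bar>u' x\<bar> \<le> M" for x
 proof -
  have "\<tau> * (B * \<Lambda>) \<le> 1 * (B * \<Lambda>)" using \<tau>(2) B \<Lambda>(3) by (intro mult_right_mono) auto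
  then show ?thesis using d[of x] ux[of x] by (simp add: M_def algebra_simps)
 qed
 have Mp: "M ^ Suc p \<le> (2 ^ Suc k * (1 + B) * \<Lambda>) ^ Suc p"
 proof (rule power_mono)
  have "1 * ((1 + B) * \<Lambda>) \<le> 2 ^ Suc k * ((1 + B) * \<Lambda>)" using B \<Lambda>(3) by (intro mult_right_mono one_le_power) auto
  then show "M \<le> 2 ^ Suc k * (1 + B) * \<Lambda>" by (simp add: M_def mult.assoc)
 qed (use M in simp)
 have G: "real (p + 1) * real p * M ^ Suc p \<le> growth \<beta> k p \<Lambda>"
  unfolding growth_def B_def[symmetric] by (intro mult_left_mono Mp) auto
 have "\<bar>coef p \<delta> u' x - coef p \<delta> u x\<bar> \<le> \<delta> * real (p + 1) * (real p * M ^ p) * \<bar>u' x - u x\<bar>"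
  using ux[of x] u'x[of x] M \<delta>(1) by (intro coef_diff_le) auto
 also have "... \<le> \<delta> * real (p + 1) * (real p * M ^ p) * (\<tau> * M)"
  using order_trans[OF d[of x] mult_left_mono[OF M(3), of \<tau>]] \<tau>(1) \<delta>(1) M(1) by (intro mult_left_mono) auto
 also have "... = \<tau> * (\<delta> * (real (p + 1) * real p * M ^ Suc p))" by (simp add: ac_simps)
 also have "... \<le> \<tau> * (\<delta> * growth \<beta> k p \<Lambda>)" using G \<tau>(1) \<delta>(1) by (intro mult_left_mono) auto
 finally show le: "\<bar>coef p \<delta> u' x - coef p \<delta> u x\<bar> \<le> \<tau> * (\<delta> * growth \<beta> k p \<Lambda>)" .
 also have "... \<le> 1 * (1 / 4)" using \<tau> \<delta> M(1) growth_nonneg[of \<Lambda> k] \<Lambda>(3) by (intro mult_mono) auto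
 finally have "\<bar>coef p \<delta> u' x - coef p \<delta> u x\<bar> \<le> 1 / 4" by simp
 moreover have "\<bar>coef p \<delta> u x - 1\<bar> \<le> 1 / 4"
 proof -
  note b = bsob_coef[OF u k1 \<Lambda>(1,3) \<delta>(1)]
  have "\<bar>\<delta> * real (p + 1) * u x ^ p\<bar> \<le> 1 / 4"
   using sup_le_bnorm'[OF b(1) k1, of x] b(2) \<delta>(2) by linarith
  then show ?thesis unfolding coef_def by linarith
 qed
 ultimately show "\<bar>coef p \<delta> u' x\<bar> \<le> 2" "1 / 2 \<le> coef p \<delta> u' x" by linarith+
 show "continuous_on UNIV (coef p \<delta> u')"
  unfolding coef_def[abs_def]
  by (intro continuous_intros bcl_continuous bsob_bcl) (use bsob_euler_step(1)[OF u v h] u'_def in auto)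
qed

definition total_energy :: "nat => real => (real => real) \<times> (real => real) => real" where
 "total_energy k \<delta> w = (\<Sum>j\<le>k. energy \<beta> (coef p \<delta> (fst w)) ((deriv ^^ j) (fst w)) ((deriv ^^ j) (snd w)))"

text \<open>What \<open>energy_step\<close> yields per unit of \<tau> \<delta>, summed over the
  orders: \<open>2 * growth + 1\<close> stems from the coefficient and the time step, the other two
  terms from the Leibniz remainder, once linearly and once squared.\<close>

definition cost :: "nat => real => real" where
 "cost k \<Lambda> = real (Suc k) * (16 * (kmass \<beta>)\<^sup>2 * (\<Lambda>\<^sup>2 * (2 * growth \<beta> k p \<Lambda> + 1
   + real k * 2 ^ k * growth \<beta> k p \<Lambda> + (real k * 2 ^ k)\<^sup>2 * growth \<beta> k p \<Lambda>)))"

section \<open>A priori bound for the scheme\<close>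

lemma nm_funpow_le:
 assumes "bsob k f" "j \<le> k"
 shows "nm ((deriv ^^ j) f) \<le> bnorm k f"
 using bsob_funpow(2)[of j 0 f] bsob_mono[OF assms] bnorm_mono[OF assms(2), of f] by simp

text \<open>The j-th derivative of an Euler step is a step of the linear system with input
  \<open>f1 = 0\<close> and the Leibniz remainder as \<open>f2\<close>. Since the coefficient is 1
  plus a multiple of \<delta>, and the constant 1 leaves no remainder, every term of the growth
  carries \<delta>.\<close>

lemma total_energy_step:
 assumes u: "bsob k u" and v: "bsob k v" and k: "2 \<le> k" and \<Lambda>: "bnorm k u + bnorm k v \<le> \<Lambda>" "1 \<le> \<Lambda>"
  and \<delta>: "0 < \<delta>" "\<delta> * growth \<beta> k p \<Lambda> \<le> 1 / 4" and h: "0 < h"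
  and \<tau>: "0 < \<tau>" "\<tau> \<le> 1" "\<tau> \<le> \<delta> * h\<^sup>2"
 shows "total_energy k \<delta> (euler_step \<beta> p \<delta> h \<tau> (u, v)) \<le> total_energy k \<delta> (u, v) + \<tau> * \<delta> * cost k \<Lambda>"
proof -
 define G where "G = growth \<beta> k p \<Lambda>"
 have G0: "0 \<le> G" unfolding G_def using \<Lambda>(2) by (intro growth_nonneg) simp
 have \<Lambda>': "bnorm k u \<le> \<Lambda>" "bnorm k v \<le> \<Lambda>" using \<Lambda>(1) bnorm_nonneg[of k u] bnorm_nonneg[of k v] by linarith+
 have k1: "1 \<le> k" using k by simp
 have \<delta>0: "0 \<le> \<delta>" using \<delta>(1) by simp
 define u' v' where "u' = fst (euler_step \<beta> p \<delta> h \<tau> (u, v))" and "v' = snd (euler_step \<beta> p \<delta> h \<tau> (u, v))"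
 note cs = coef_euler_step[OF u v k \<Lambda>' \<Lambda>(2) \<delta>0 \<delta>(2) h \<tau>(1,2), folded u'_def G_def]
 have \<delta>2: "\<delta> * growth \<beta> k p \<Lambda> \<le> 1 / 2" using \<delta>(2) by simp
 note cb = coef_bounds[OF u k1 \<Lambda>'(1) \<Lambda>(2) \<delta>0 \<delta>2]
 note cl = coef_Lipschitz[OF u k \<Lambda>'(1) \<Lambda>(2) \<delta>0, folded G_def]
 define b g where "b = (\<lambda>x. \<delta> * real (p + 1) * u x ^ p)" and "g = cdiff h u"
 note bb = bsob_coef[OF u k1 \<Lambda>'(1) \<Lambda>(2) \<delta>0, folded b_def G_def]
 have g: "bsob k g" unfolding g_def by (rule bsob_cdiff(1)[OF h u])
 have gn: "bnorm (k - 1) g \<le> \<Lambda>"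
  using bnorm_cdiff_le_Suc[of "k - 1" u h] u k h \<Lambda>'(1) unfolding g_def by simp
 define c where "c = real k * 2 ^ k"
 have c0: "0 \<le> c" by (simp add: c_def)
 define e where "e = 16 * (kmass \<beta>)\<^sup>2 * (\<Lambda>\<^sup>2 * (2 * G + 1 + c * G + c\<^sup>2 * G))"
 have main: "energy \<beta> (coef p \<delta> u') ((deriv ^^ j) u') ((deriv ^^ j) v')
   \<le> energy \<beta> (coef p \<delta> u) ((deriv ^^ j) u) ((deriv ^^ j) v) + \<tau> * \<delta> * e" if j: "j \<le> k" for j
 proof -
  define U V where "U = (deriv ^^ j) u" and "V = (deriv ^^ j) v"
  define R where "R = (\<lambda>x. (deriv ^^ j) (\<lambda>x. b x * g x) x - b x * (deriv ^^ j) g x)"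
  have uj: "bsob j u" "bsob j v" "bsob j g" "bsob j b" using u v g bb(1) j bsob_mono by blast+
  have UV: "bcl U" "bcl V"
   using bsob_funpow(1)[of j 0] uj unfolding U_def V_def by auto
  note LR = Leibniz_remainder[OF bb(1) g k, of 0 j, folded R_def]
  have R: "bcl R" using LR(1) j by simp
  have nR: "nm R \<le> c * (\<delta> * G) * \<Lambda>"
  proof -
   have "nm R \<le> real j * 2 ^ k * (bnorm k b * bnorm (k - 1) g)" using LR(2) j by simp
   also have "... \<le> real k * 2 ^ k * ((\<delta> * G) * \<Lambda>)"
    using j bb(2) gn G0 \<delta>0 by (intro mult_mono) auto
   finally show ?thesis by (simp add: c_def mult.assoc)
  qed
  have N: "nm U + nm V \<le> \<Lambda>"
   using nm_funpow_le[OF u j] nm_funpow_le[OF v j] \<Lambda>(1) by (simp add: U_def V_def)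
  have "u' = (\<lambda>x. u x + \<tau> * kernel_conv \<beta> (cdiff h v) x)" by (simp add: u'_def euler_step_def)
  then have u'j: "(deriv ^^ j) u' = (\<lambda>x. U x + \<tau> * (kernel_conv \<beta> (cdiff h V) x + 0))"
   using funpow_deriv_linear[OF uj(1) bsob_kernel_conv(1)[OF ker bsob_cdiff(1)[OF h uj(2)]], of \<tau>]
    funpow_deriv_kernel_conv[OF ker bsob_cdiff(1)[OF h uj(2)]] funpow_deriv_cdiff[OF uj(2) h]
   by (simp add: U_def V_def)
  \<comment> \<open>Only the part \<open>b\<close> of the coefficient leaves a remainder. The factor
    \<open>1 *\<close> gives the sum the shape required by
    \<open>funpow_deriv_linear\<close>.\<close>
  have "v' = (\<lambda>x. v x + \<tau> * (g x + 1 * (b x * g x)))"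
   by (auto simp: v'_def euler_step_def coef_def b_def g_def algebra_simps)
  then have "(deriv ^^ j) v' = (\<lambda>x. V x + \<tau> * ((deriv ^^ j) g x + 1 * (deriv ^^ j) (\<lambda>x. b x * g x) x))"
   using funpow_deriv_linear[OF uj(2) bsob_add(1)[OF uj(3) bsob_cmult(1)[OF bsob_mult[OF uj(4,3)], of 1]], of \<tau>]
    funpow_deriv_linear[OF uj(3) bsob_mult[OF uj(4,3)], of 1] by (simp add: V_def)
  then have v'j: "(deriv ^^ j) v' = (\<lambda>x. V x + \<tau> * (coef p \<delta> u x * cdiff h U x + R x))"
   using funpow_deriv_cdiff[OF uj(1) h]
   by (auto simp: R_def coef_def b_def g_def U_def algebra_simps)
  have lip: "\<bar>coef p \<delta> u (x + h) - coef p \<delta> u x\<bar> \<le> (\<delta> * G) * h" for x using cl[of x h] h by simp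
  have tl: "\<tau> * (\<delta> * G) \<le> 1"
   using mult_mono[OF \<tau>(2) \<delta>2] \<delta> \<tau> G0 by (simp add: G_def)
  have z: "bcl (\<lambda>x. 0)" by (rule bsob_zero(1)[of 0, unfolded bsob.simps])
  define N F where "N = nm U + nm V" and "F = nm (\<lambda>x. 0) + nm R"
  have F: "F \<le> c * (\<delta> * G) * \<Lambda>" "0 \<le> F" and N0: "0 \<le> N" "N \<le> \<Lambda>" using nR N by (auto simp: F_def N_def)
  have "energy \<beta> (coef p \<delta> u') ((deriv ^^ j) u') ((deriv ^^ j) v')
    \<le> energy \<beta> (coef p \<delta> u) U V + \<tau> * (16 * (kmass \<beta>)\<^sup>2 * ((\<delta> * G + \<delta> * G + \<delta>) * N\<^sup>2 + F * N + \<tau> * F\<^sup>2))"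
   unfolding u'j v'j N_def F_def
   by (rule energy_step[OF ker ell UV z R cb(1,3) cs(3,2) lip cs(1) h \<tau>(1,3) tl])
  also have "... \<le> energy \<beta> (coef p \<delta> u) U V + \<tau> * (16 * (kmass \<beta>)\<^sup>2 * (\<delta> * (\<Lambda>\<^sup>2 * (2 * G + 1 + c * G + c\<^sup>2 * G))))"
  proof (intro add_left_mono mult_left_mono)
   have 1: "(\<delta> * G + \<delta> * G + \<delta>) * N\<^sup>2 \<le> (\<delta> * G + \<delta> * G + \<delta>) * \<Lambda>\<^sup>2"
    using N0 G0 \<delta>(1) by (intro mult_left_mono power_mono) auto
   have 2: "F * N \<le> (c * (\<delta> * G) * \<Lambda>) * \<Lambda>" using F N0 by (intro mult_mono) auto
   have "F\<^sup>2 \<le> (c * (\<delta> * G) * \<Lambda>)\<^sup>2" using F by (intro power_mono) auto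
   also have "... = (c\<^sup>2 * \<Lambda>\<^sup>2 * (\<delta> * G)) * (\<delta> * G)" by (simp add: power2_eq_square ac_simps)
   \<comment> \<open>Of the two factors \<open>\<delta> * G\<close> in the square one is bounded by
     1; the other supplies the \<delta> of the claim.\<close>
   also have "... \<le> (c\<^sup>2 * \<Lambda>\<^sup>2 * (\<delta> * G)) * 1"
    using \<delta>2 \<delta>(1) G0 by (intro mult_left_mono) (auto simp: G_def)
   finally have "\<tau> * F\<^sup>2 \<le> 1 * (c\<^sup>2 * \<Lambda>\<^sup>2 * (\<delta> * G))" using \<tau> by (intro mult_mono) auto
   with 1 2 have "(\<delta> * G + \<delta> * G + \<delta>) * N\<^sup>2 + F * N + \<tau> * F\<^sup>2
     \<le> (\<delta> * G + \<delta> * G + \<delta>) * \<Lambda>\<^sup>2 + (c * (\<delta> * G) * \<Lambda>) * \<Lambda> + 1 * (c\<^sup>2 * \<Lambda>\<^sup>2 * (\<delta> * G))" by linarith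
   also have "... = \<delta> * (\<Lambda>\<^sup>2 * (2 * G + 1 + c * G + c\<^sup>2 * G))" by (simp add: algebra_simps power2_eq_square)
   finally show "(\<delta> * G + \<delta> * G + \<delta>) * N\<^sup>2 + F * N + \<tau> * F\<^sup>2
     \<le> \<delta> * (\<Lambda>\<^sup>2 * (2 * G + 1 + c * G + c\<^sup>2 * G))" .
  qed (use \<tau> in auto)
  also have "... = energy \<beta> (coef p \<delta> u) U V + \<tau> * \<delta> * e" by (simp add: e_def)
  finally show ?thesis by (simp add: U_def V_def)
 qed
 have "total_energy k \<delta> (euler_step \<beta> p \<delta> h \<tau> (u, v))
   = (\<Sum>j\<le>k. energy \<beta> (coef p \<delta> u') ((deriv ^^ j) u') ((deriv ^^ j) v'))"
  by (simp add: total_energy_def u'_def v'_def)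
 also have "... \<le> (\<Sum>j\<le>k. energy \<beta> (coef p \<delta> u) ((deriv ^^ j) u) ((deriv ^^ j) v) + \<tau> * \<delta> * e)"
  by (intro sum_mono main) simp
 also have "... = total_energy k \<delta> (u, v) + \<tau> * \<delta> * cost k \<Lambda>"
  by (simp add: total_energy_def cost_def e_def c_def G_def sum.distrib)
 finally show ?thesis .
qed

lemma total_energy_lower:
 assumes u: "bsob k u" and v: "bsob k v"
  and cb: "continuous_on UNIV (coef p \<delta> u)" "!!x. 1 / 2 \<le> coef p \<delta> u x" "!!x. \<bar>coef p \<delta> u x\<bar> \<le> 2"
 shows "(bnorm k u + bnorm k v)\<^sup>2 \<le> real (Suc k) * (2 / min C1 (1 / 2)) * total_energy k \<delta> (u, v)"
proof -
 have b: "bcl ((deriv ^^ j) u)" "bcl ((deriv ^^ j) v)" if "j \<le> k" for j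
  using bsob_funpow(1)[of j 0] bsob_mono[OF u that] bsob_mono[OF v that] by auto
 have "(bnorm k u + bnorm k v)\<^sup>2 = (\<Sum>j\<le>k. nm ((deriv ^^ j) u) + nm ((deriv ^^ j) v))\<^sup>2"
  by (simp add: bnorm_sum sum.distrib)
 also have "... \<le> (\<Sum>j\<le>k. (nm ((deriv ^^ j) u) + nm ((deriv ^^ j) v))\<^sup>2) * real (card {..k})"
  by (rule sum_squared_le_sum_of_squares)
 also have "... \<le> (\<Sum>j\<le>k. 2 / min C1 (1 / 2) * energy \<beta> (coef p \<delta> u) ((deriv ^^ j) u) ((deriv ^^ j) v)) * real (card {..k})"
  using b by (intro mult_right_mono sum_mono energy_lower[OF ker ell _ _ cb]) auto
 also have "... = real (Suc k) * (2 / min C1 (1 / 2)) * total_energy k \<delta> (u, v)"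
  by (simp only: total_energy_def sum_distrib_left[symmetric] card_atMost fst_conv snd_conv mult_ac)
 finally show ?thesis .
qed

lemma total_energy_upper:
 assumes u: "bsob k u" and v: "bsob k v" and k: "1 \<le> k" and \<Lambda>: "bnorm k u \<le> \<Lambda>" "1 \<le> \<Lambda>"
  and \<delta>: "0 \<le> \<delta>" "\<delta> * growth \<beta> k p \<Lambda> \<le> 1 / 2"
 shows "total_energy k \<delta> (u, v) \<le> real (Suc k) * (2 * kmass \<beta> * (bnorm k u + bnorm k v)\<^sup>2)"
proof -
 note cb = coef_bounds[OF u k \<Lambda> \<delta>]
 have "energy \<beta> (coef p \<delta> u) ((deriv ^^ j) u) ((deriv ^^ j) v) \<le> 2 * kmass \<beta> * (bnorm k u + bnorm k v)\<^sup>2" if j: "j \<le> k" for j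
 proof -
  have "bcl ((deriv ^^ j) u)" "bcl ((deriv ^^ j) v)"
   using bsob_funpow(1)[of j 0] bsob_mono[OF u j] bsob_mono[OF v j] by auto
  then have "energy \<beta> (coef p \<delta> u) ((deriv ^^ j) u) ((deriv ^^ j) v) \<le> 2 * kmass \<beta> * (nm ((deriv ^^ j) u) + nm ((deriv ^^ j) v))\<^sup>2"
   by (rule energy_upper[OF ker ell _ _ cb(1,3)])
  also have "... \<le> 2 * kmass \<beta> * (bnorm k u + bnorm k v)\<^sup>2"
   using nm_funpow_le[OF u j] nm_funpow_le[OF v j] kmass_ge_1[of \<beta>] by (intro mult_left_mono power_mono add_mono) auto
  finally show ?thesis .
 qed
 then have "total_energy k \<delta> (u, v) \<le> (\<Sum>j\<le>k. 2 * kmass \<beta> * (bnorm k u + bnorm k v)\<^sup>2)"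
  unfolding total_energy_def fst_conv snd_conv by (intro sum_mono) simp
 then show ?thesis by simp
qed

text \<open>A bootstrap: \<Lambda> is fixed so that energy at most \<open>E0 + 1\<close> forces the
  norm below \<Lambda>, and \<open>T = 1 / cost k \<Lambda>\<close> is the scaled time in which the
  energy grows by at most 1 while the norm is below \<Lambda>. Neither depends on \<delta>,
  \<open>h\<close> or \<tau>, which gives a life span T / \<delta> with a uniform bound.\<close>

theorem euler_bound:
 assumes k: "2 \<le> k"
 obtains \<Lambda> \<delta>0 T where "1 \<le> \<Lambda>" "0 < \<delta>0" "\<delta>0 \<le> 1" "0 < T" "\<delta>0 * growth \<beta> k p \<Lambda> \<le> 1 / 4"
  "!!\<delta> h \<tau> u0 v0 n. [|0 < \<delta>; \<delta> \<le> \<delta>0; 0 < h; 0 < \<tau>; \<tau> \<le> 1; \<tau> \<le> \<delta> * h\<^sup>2; bsob k u0; bsob k v0;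
    bnorm k u0 + bnorm k v0 \<le> \<Lambda>0; real n * \<tau> * \<delta> \<le> T|] ==>
    bpair k \<Lambda> (euler \<beta> p \<delta> h \<tau> u0 v0 n)"
proof -
 define E0 where "E0 = real (Suc k) * (2 * kmass \<beta> * \<Lambda>0\<^sup>2)"
 define m where "m = real (Suc k) * (2 / min C1 (1 / 2))"
 \<comment> \<open>The first two summands give \<open>1 \<le> \<Lambda>\<close> and
   \<open>\<Lambda>0 \<le> \<Lambda>\<close>; the root is the norm that energy \<open>E0 + 1\<close>
   allows.\<close>
 define \<Lambda> where "\<Lambda> = 1 + \<bar>\<Lambda>0\<bar> + sqrt (m * (E0 + 1))"
 have E00: "0 \<le> E0" using kmass_ge_1[of \<beta>] by (simp add: E0_def)
 have m0: "0 < m" using C1_pos[OF ker ell] by (simp add: m_def)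
 have L1: "1 \<le> \<Lambda>" using m0 E00 by (simp add: \<Lambda>_def)
 have L2: "sqrt (m * (E0 + 1)) \<le> \<Lambda>" by (simp add: \<Lambda>_def)
 have L3: "\<Lambda>0 \<le> \<Lambda>" using m0 E00 by (simp add: \<Lambda>_def add_increasing2)
 define G where "G = growth \<beta> k p \<Lambda>"
 have G: "0 \<le> G" unfolding G_def using L1 by (intro growth_nonneg) simp
 \<comment> \<open>Small enough for the coefficient to stay within 1 / 4 of 1 while the norm is at
   most \<Lambda>.\<close>
 define \<delta>0 where "\<delta>0 = 1 / (4 * (G + 1))"
 have d0: "0 < \<delta>0" "\<delta>0 \<le> 1" "\<delta>0 * G \<le> 1 / 4" using G by (auto simp: \<delta>0_def divide_simps)
 have cost: "0 < cost k \<Lambda>"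
 proof -
  have "0 \<le> real k * 2 ^ k * G" "0 \<le> (real k * 2 ^ k)\<^sup>2 * G" using G by simp_all
  then have "0 < 2 * G + 1 + real k * 2 ^ k * G + (real k * 2 ^ k)\<^sup>2 * G" using G by linarith
  then have "0 < \<Lambda>\<^sup>2 * (2 * G + 1 + real k * 2 ^ k * G + (real k * 2 ^ k)\<^sup>2 * G)"
   using L1 by (intro mult_pos_pos) auto
  then show ?thesis using kmass_ge_1[of \<beta>] by (simp add: cost_def G_def)
 qed
 define T where "T = 1 / cost k \<Lambda>"
 show thesis
 proof (rule that[OF L1 d0(1,2) _ d0(3)[unfolded G_def]])
  show "0 < T" using cost by (simp add: T_def)
  fix \<delta> h \<tau> u0 v0 n
  assume \<delta>: "0 < \<delta>" "\<delta> \<le> \<delta>0" and h: "0 < h" and \<tau>: "0 < \<tau>" "\<tau> \<le> 1" "\<tau> \<le> \<delta> * h\<^sup>2"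
   and u0: "bsob k u0" and v0: "bsob k v0" and init: "bnorm k u0 + bnorm k v0 \<le> \<Lambda>0"
   and nT: "real n * \<tau> * \<delta> \<le> T"
  have dG: "\<delta> * growth \<beta> k p \<Lambda> \<le> 1 / 4"
   using mult_right_mono[OF \<delta>(2) G] d0(3) by (simp add: G_def)
  have k1: "1 \<le> k" using k by simp
  define P where "P n \<longleftrightarrow> bpair k \<Lambda> (euler \<beta> p \<delta> h \<tau> u0 v0 n)" for n
  have "P n \<and> total_energy k \<delta> (euler \<beta> p \<delta> h \<tau> u0 v0 n) \<le> E0 + real n * \<tau> * \<delta> * cost k \<Lambda>"
   using nT
  proof (induction n)
   case 0
   have b: "bnorm k u0 \<le> \<Lambda>" using init L3 bnorm_nonneg[of k v0] by linarith
   have "total_energy k \<delta> (u0, v0) \<le> real (Suc k) * (2 * kmass \<beta> * (bnorm k u0 + bnorm k v0)\<^sup>2)"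
    using \<delta>(1) dG by (intro total_energy_upper[OF u0 v0 k1 b L1]) auto
   also have "... \<le> E0" unfolding E0_def
    using init kmass_ge_1[of \<beta>] by (intro mult_left_mono power_mono add_nonneg_nonneg) auto
   finally show ?case using u0 v0 init L3 by (simp add: P_def euler_def)
  next
   case (Suc n)
   define u v where "u = fst (euler \<beta> p \<delta> h \<tau> u0 v0 n)" and "v = snd (euler \<beta> p \<delta> h \<tau> u0 v0 n)"
   have uv: "euler \<beta> p \<delta> h \<tau> u0 v0 n = (u, v)" by (simp add: u_def v_def)
   have eq: "euler \<beta> p \<delta> h \<tau> u0 v0 (Suc n) = euler_step \<beta> p \<delta> h \<tau> (u, v)" by (simp add: euler_def uv[unfolded euler_def])
   have "real n * \<tau> * \<delta> \<le> real (Suc n) * \<tau> * \<delta>" using \<tau>(1) \<delta>(1) by (intro mult_right_mono) auto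
   then have IH: "bsob k u" "bsob k v" "bnorm k u + bnorm k v \<le> \<Lambda>"
    "total_energy k \<delta> (u, v) \<le> E0 + real n * \<tau> * \<delta> * cost k \<Lambda>"
    using Suc.IH Suc.prems by (auto simp: P_def uv)
   have Lu: "bnorm k u \<le> \<Lambda>" "bnorm k v \<le> \<Lambda>" using IH(3) bnorm_nonneg[of k u] bnorm_nonneg[of k v] by linarith+
   have E: "total_energy k \<delta> (euler_step \<beta> p \<delta> h \<tau> (u, v)) \<le> E0 + real (Suc n) * \<tau> * \<delta> * cost k \<Lambda>"
    using total_energy_step[OF IH(1,2) k IH(3) L1 \<delta>(1) dG h \<tau>] IH(4) by (simp add: algebra_simps)
   have "real (Suc n) * \<tau> * \<delta> * cost k \<Lambda> \<le> T * cost k \<Lambda>" using Suc.prems cost by (intro mult_right_mono) auto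
   also have "... = 1" using cost by (simp add: T_def)
   finally have E1: "total_energy k \<delta> (euler_step \<beta> p \<delta> h \<tau> (u, v)) \<le> E0 + 1" using E by linarith
   define u' v' where "u' = fst (euler_step \<beta> p \<delta> h \<tau> (u, v))" and "v' = snd (euler_step \<beta> p \<delta> h \<tau> (u, v))"
   have uv': "euler_step \<beta> p \<delta> h \<tau> (u, v) = (u', v')" by (simp add: u'_def v'_def)
   have b: "bsob k u'" "bsob k v'" unfolding u'_def v'_def by (intro bsob_euler_step IH h)+
   have \<delta>': "0 \<le> \<delta>" using \<delta>(1) by simp
   \<comment> \<open>Bounds for the new coefficient follow from the old state, so the energy can be
     converted back into a norm of the new state.\<close>
   note cs = coef_euler_step[OF IH(1,2) k Lu L1 \<delta>' dG h \<tau>(1,2), folded u'_def]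
   have "(bnorm k u' + bnorm k v')\<^sup>2 \<le> m * total_energy k \<delta> (u', v')"
    unfolding m_def by (rule total_energy_lower[OF b cs(3,4,2)])
   also have "... \<le> m * (E0 + 1)" using E1 m0 by (intro mult_left_mono) (auto simp: uv')
   finally have "bnorm k u' + bnorm k v' \<le> sqrt (m * (E0 + 1))" by (rule real_le_rsqrt)
   then have "bnorm k u' + bnorm k v' \<le> \<Lambda>" using L2 by linarith
   then show ?case using E b by (simp add: P_def eq uv')
  qed
  then show "bpair k \<Lambda> (euler \<beta> p \<delta> h \<tau> u0 v0 n)" by (simp add: P_def)
 qed
qed

end

section \<open>Stability and consistency\<close>

definition flux :: "nat => real => (real => real) => real => real" where
 "flux p \<delta> u x = u x + \<delta> * u x ^ (p + 1)"

lemma bsob_flux: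
 assumes "bsob k u" shows "bsob k (flux p \<delta> u)"
 unfolding flux_def[abs_def] by (intro bsob_add(1) bsob_cmult(1) bsob_power(1) assms) simp

lemma flux_has_derivative:
 assumes "bsob (Suc k) u"
 shows "(flux p \<delta> u has_real_derivative coef p \<delta> u x * deriv u x) (at x)"
 unfolding flux_def[abs_def] coef_def
 by (rule derivative_eq_intros bsob_SucD(2)[OF assms] refl)+ (simp add: algebra_simps)

lemma deriv_flux:
 assumes "bsob (Suc k) u"
 shows "deriv (flux p \<delta> u) = (\<lambda>x. coef p \<delta> u x * deriv u x)"
 using flux_has_derivative[OF assms] by (auto intro!: DERIV_imp_deriv)

text \<open>Induction through \<open>u * (u ^ n - w ^ n) + (u - w) * w ^ n\<close> for the
  difference of the powers \<open>Suc n\<close>.\<close>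

lemma bnorm_power_diff:
 assumes k: "1 \<le> k"
 shows "\<exists>C\<ge>0. \<forall>u w. bsob k u \<and> bsob k w \<and> bnorm k u \<le> \<Lambda> \<and> bnorm k w \<le> \<Lambda> \<longrightarrow>
  bnorm k (\<lambda>x. u x ^ Suc q - w x ^ Suc q) \<le> C * bdist k u w"
proof (induction q)
 case 0
 show ?case by (auto intro!: exI[of _ 1])
next
 case (Suc q)
 then obtain C where C: "0 \<le> C" "!!u w. bsob k u ==> bsob k w ==> bnorm k u \<le> \<Lambda> ==> bnorm k w \<le> \<Lambda> ==>
  bnorm k (\<lambda>x. u x ^ Suc q - w x ^ Suc q) \<le> C * bdist k u w" by metis
 define A where "A = 2 ^ Suc k * (\<bar>\<Lambda>\<bar> * C + 2 ^ (Suc k * Suc q) * \<bar>\<Lambda>\<bar> ^ Suc q)"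
 have "bnorm k (\<lambda>x. u x ^ Suc (Suc q) - w x ^ Suc (Suc q)) \<le> A * bdist k u w"
  if u: "bsob k u" "bnorm k u \<le> \<Lambda>" and w: "bsob k w" "bnorm k w \<le> \<Lambda>" for u w
 proof -
  define d where "d = bdist k u w"
  have d: "0 \<le> d" by (simp add: d_def)
  have b: "bsob k (\<lambda>x. u x ^ Suc q - w x ^ Suc q)" "bsob k (\<lambda>x. u x - w x)" "bsob k (\<lambda>x. w x ^ Suc q)"
   using u w by (auto intro!: bsob_diff(1) bsob_power(1) simp del: power_Suc)
  have wq: "bnorm k (\<lambda>x. w x ^ Suc q) \<le> 2 ^ (Suc k * Suc q) * \<bar>\<Lambda>\<bar> ^ Suc q"
  proof -
   have "bnorm k (\<lambda>x. w x ^ Suc q) \<le> 2 ^ (Suc k * Suc q) * bnorm k w ^ Suc q" by (rule bsob_power(2)[OF w(1) _ k]) simp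
   also have "... \<le> 2 ^ (Suc k * Suc q) * \<bar>\<Lambda>\<bar> ^ Suc q" using w(2) by (intro mult_left_mono power_mono) auto
   finally show ?thesis .
  qed
  have "(\<lambda>x. u x ^ Suc (Suc q) - w x ^ Suc (Suc q)) = (\<lambda>x. u x * (u x ^ Suc q - w x ^ Suc q) + (u x - w x) * w x ^ Suc q)"
   by (auto simp: algebra_simps)
  then have "bnorm k (\<lambda>x. u x ^ Suc (Suc q) - w x ^ Suc (Suc q))
    \<le> bnorm k (\<lambda>x. u x * (u x ^ Suc q - w x ^ Suc q)) + bnorm k (\<lambda>x. (u x - w x) * w x ^ Suc q)"
   using bsob_add(2)[OF bsob_mult[OF u(1) b(1)] bsob_mult[OF b(2,3)]] by simp
  also have "... \<le> 2 ^ Suc k * (bnorm k u * bnorm k (\<lambda>x. u x ^ Suc q - w x ^ Suc q)) + 2 ^ Suc k * (d * bnorm k (\<lambda>x. w x ^ Suc q))"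
   unfolding d_def by (intro add_mono bnorm_mult_le' u b k)
  also have "... \<le> 2 ^ Suc k * (\<bar>\<Lambda>\<bar> * (C * d)) + 2 ^ Suc k * (d * (2 ^ (Suc k * Suc q) * \<bar>\<Lambda>\<bar> ^ Suc q))"
   using u(2) C(2)[OF u(1) w(1) u(2) w(2)] wq d unfolding d_def
   by (intro add_mono mult_left_mono mult_mono) auto
  also have "... = A * d" by (simp add: A_def algebra_simps)
  finally show ?thesis by (simp add: d_def)
 qed
 moreover have "0 \<le> A" using C(1) by (simp add: A_def)
 ultimately show ?case by blast
qed

lemma bnorm_flux_diff:
 assumes k: "1 \<le> k"
 obtains C where "1 \<le> C" "!!u w. bsob k u ==> bsob k w ==> bnorm k u \<le> \<Lambda> ==> bnorm k w \<le> \<Lambda> ==>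
  bdist k (flux p \<delta> u) (flux p \<delta> w) \<le> C * bdist k u w"
proof -
 obtain C where C: "0 \<le> C" "!!u w. bsob k u ==> bsob k w ==> bnorm k u \<le> \<Lambda> ==> bnorm k w \<le> \<Lambda> ==>
  bnorm k (\<lambda>x. u x ^ Suc p - w x ^ Suc p) \<le> C * bdist k u w" using bnorm_power_diff[OF k, of \<Lambda> p] by metis
 show thesis
 proof (rule that[of "1 + \<bar>\<delta>\<bar> * C"])
  show "1 \<le> 1 + \<bar>\<delta>\<bar> * C" using C(1) by simp
  fix u w assume u: "bsob k u" and w: "bsob k w" and L: "bnorm k u \<le> \<Lambda>" "bnorm k w \<le> \<Lambda>"
  have b: "bsob k (\<lambda>x. u x ^ Suc p - w x ^ Suc p)" "bsob k (\<lambda>x. u x - w x)"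
   using u w by (auto intro!: bsob_diff(1) bsob_power(1) simp del: power_Suc)
  have "(\<lambda>x. flux p \<delta> u x - flux p \<delta> w x) = (\<lambda>x. (u x - w x) + \<delta> * (u x ^ Suc p - w x ^ Suc p))"
   by (auto simp: flux_def algebra_simps)
  then have "bdist k (flux p \<delta> u) (flux p \<delta> w) \<le> bdist k u w + \<bar>\<delta>\<bar> * bnorm k (\<lambda>x. u x ^ Suc p - w x ^ Suc p)"
   using bsob_add(2)[OF b(2) bsob_cmult(1)[OF b(1), of \<delta>]] bsob_cmult(2)[OF b(1), of \<delta>] by simp
  also have "... \<le> bdist k u w + \<bar>\<delta>\<bar> * (C * bdist k u w)"
   using C(2)[OF u w L] by (intro add_left_mono mult_left_mono) auto
  finally show "bdist k (flux p \<delta> u) (flux p \<delta> w) \<le> (1 + \<bar>\<delta>\<bar> * C) * bdist k u w"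
   by (simp add: algebra_simps)
 qed
qed

section \<open>Stability\<close>

lemma discrete_Gronwall:
 fixes e :: "nat => real"
 assumes step: "!!n. n < N ==> e (Suc n) \<le> (1 + \<tau> * c) * e n + \<tau> * r"
  and e0: "e 0 \<le> 0" and c: "0 \<le> c" and r: "0 \<le> r" and \<tau>: "0 \<le> \<tau>" and n: "n \<le> N"
 shows "e n \<le> exp (c * (real n * \<tau>)) * (real n * \<tau> * r)"
 using n
proof (induction n)
 case (Suc n)
 have IH: "e n \<le> exp (c * (real n * \<tau>)) * (real n * \<tau> * r)" using Suc by simp
 have 1: "1 \<le> exp (c * (real (Suc n) * \<tau>))" using c \<tau> by simp
 have "e (Suc n) \<le> (1 + \<tau> * c) * e n + \<tau> * r" using step Suc.prems by simp
 also have "... \<le> (1 + \<tau> * c) * (exp (c * (real n * \<tau>)) * (real n * \<tau> * r)) + \<tau> * r"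
  using IH c \<tau> by (intro add_right_mono mult_left_mono) auto
 also have "... \<le> exp (\<tau> * c) * (exp (c * (real n * \<tau>)) * (real n * \<tau> * r)) + \<tau> * r"
  using \<tau> r exp_ge_add_one_self[of "\<tau> * c"] by (intro add_right_mono mult_right_mono) auto
 also have "... = exp (c * (real (Suc n) * \<tau>)) * (real n * \<tau> * r) + 1 * (\<tau> * r)"
 proof -
  have "exp (\<tau> * c) * exp (c * (real n * \<tau>)) = exp (c * (real (Suc n) * \<tau>))"
   by (simp add: exp_add[symmetric] algebra_simps)
  then show ?thesis by (simp only: mult.assoc[symmetric] mult_1_left)
 qed
 also have "... \<le> exp (c * (real (Suc n) * \<tau>)) * (real n * \<tau> * r) + exp (c * (real (Suc n) * \<tau>)) * (\<tau> * r)"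
  using 1 \<tau> r by (intro add_left_mono mult_right_mono) auto
 also have "... = exp (c * (real (Suc n) * \<tau>)) * (real (Suc n) * \<tau> * r)" by (simp add: algebra_simps)
 finally show ?case .
qed (use e0 in simp)

context
 fixes \<beta> :: kernel and C1 C2 :: real and p :: nat
 assumes ker: "is_kernel \<beta>" and ell: "elliptic \<beta> C1 C2" and p: "1 \<le> p"
begin

theorem euler_comparison:
 assumes k: "2 \<le> k" and \<Lambda>: "1 \<le> \<Lambda>" and M: "\<Lambda> \<le> M" and \<delta>: "0 < \<delta>" "\<delta> * growth \<beta> k p \<Lambda> \<le> 1 / 4" and a: "0 \<le> a"
 obtains C where "0 \<le> C"
  "!!h \<tau> u0 v0 N y z \<eta>. [|0 < h; 0 < \<tau>; \<tau> \<le> 1; \<tau> \<le> \<delta> * h\<^sup>2; 0 \<le> \<eta>; real N * \<tau> \<le> a;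
    !!n. n \<le> N ==> bpair k \<Lambda> (euler \<beta> p \<delta> h \<tau> u0 v0 n);
    !!n. n \<le> N ==> bsob 2 (y n) \<and> bsob 2 (z n) \<and> bnorm 2 (y n) \<le> M \<and> bnorm 2 (z n) \<le> M;
    y 0 = u0; z 0 = v0;
    !!n. n < N ==> nm (\<lambda>x. y (Suc n) x - y n x - \<tau> * kernel_conv \<beta> (deriv (z n)) x) \<le> \<tau> * \<eta>;
    !!n. n < N ==> nm (\<lambda>x. z (Suc n) x - z n x - \<tau> * deriv (flux p \<delta> (y n)) x) \<le> \<tau> * \<eta>|] ==>
    \<forall>n\<le>N. ndist (y n) (fst (euler \<beta> p \<delta> h \<tau> u0 v0 n)) + ndist (z n) (snd (euler \<beta> p \<delta> h \<tau> u0 v0 n))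
     \<le> C * (h + \<eta>)"
proof -
 define B G where "B = kmass \<beta>" and "G = growth \<beta> k p \<Lambda>"
 have B: "1 \<le> B" using kmass_ge_1 by (simp add: B_def)
 have M1: "1 \<le> M" using M \<Lambda> by simp
 have G0: "0 \<le> G" unfolding G_def using \<Lambda> by (intro growth_nonneg[OF ker ell p]) simp
 have \<delta>0: "0 \<le> \<delta>" and \<delta>2: "\<delta> * growth \<beta> k p \<Lambda> \<le> 1 / 2" using \<delta> by auto
 \<comment> \<open>\<open>c1\<close> is for the difference of coefficients times the derivative of
   \<open>y n\<close>, \<open>c2\<close> for the errors of size \<open>h\<close> and
   \<open>\<eta>\<close>, and \<open>c3\<close> is the Gronwall rate after the squared norm has been
   replaced by \<open>m\<close> times the energy.\<close>
 define c1 where "c1 = \<delta> * real (p + 1) * (real p * M ^ p) * M"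
 define c2 where "c2 = (B + 2) * M + 2"
 define m where "m = 2 / min C1 (1 / 2)"
 define c3 where "c3 = 16 * B\<^sup>2 * (2 * (\<delta> * G) + \<delta> + c1 + 1 + 2 * c1\<^sup>2) * m"
 define c4 where "c4 = 48 * B\<^sup>2 * c2\<^sup>2"
 have pos: "0 \<le> c1" "0 \<le> c2" "0 < m" using \<delta>0 M1 B C1_pos[OF ker ell] by (auto simp: c1_def c2_def m_def)
 have c34: "0 \<le> c3" "0 \<le> c4" using pos \<delta>0 G0 by (auto simp: c3_def c4_def intro!: mult_nonneg_nonneg)
 define C where "C = sqrt (m * (exp (c3 * a) * (a * c4)))"
 show thesis
 proof (rule that[of C])
  show "0 \<le> C" using pos c34 a by (simp add: C_def)
  fix h \<tau> u0 v0 N \<eta> and y z :: "nat => real => real"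
  assume h: "0 < h" and \<tau>: "0 < \<tau>" "\<tau> \<le> 1" "\<tau> \<le> \<delta> * h\<^sup>2" and \<eta>: "0 \<le> \<eta>" and Na: "real N * \<tau> \<le> a"
   and E: "!!n. n \<le> N ==> bpair k \<Lambda> (euler \<beta> p \<delta> h \<tau> u0 v0 n)"
   and Y: "!!n. n \<le> N ==> bsob 2 (y n) \<and> bsob 2 (z n) \<and> bnorm 2 (y n) \<le> M \<and> bnorm 2 (z n) \<le> M"
   and init: "y 0 = u0" "z 0 = v0"
   and R1: "!!n. n < N ==> nm (\<lambda>x. y (Suc n) x - y n x - \<tau> * kernel_conv \<beta> (deriv (z n)) x) \<le> \<tau> * \<eta>"
   and R2: "!!n. n < N ==> nm (\<lambda>x. z (Suc n) x - z n x - \<tau> * deriv (flux p \<delta> (y n)) x) \<le> \<tau> * \<eta>"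
  define U V where "U n = fst (euler \<beta> p \<delta> h \<tau> u0 v0 n)" and "V n = snd (euler \<beta> p \<delta> h \<tau> u0 v0 n)" for n
  have UV: "bsob k (U n)" "bsob k (V n)" "bnorm k (U n) \<le> \<Lambda>" "bnorm k (V n) \<le> \<Lambda>" if "n \<le> N" for n
   using E[OF that] bnorm_nonneg[of k "U n"] bnorm_nonneg[of k "V n"] unfolding U_def V_def by linarith+
  have st: "U (Suc n) = fst (euler_step \<beta> p \<delta> h \<tau> (U n, V n))" "V (Suc n) = snd (euler_step \<beta> p \<delta> h \<tau> (U n, V n))" for n
   by (simp_all add: U_def V_def euler_def)
  have k1: "1 \<le> k" using k by simp
  define w \<zeta> where "w n = (\<lambda>x. y n x - U n x)" and "\<zeta> n = (\<lambda>x. z n x - V n x)" for n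
  define e where "e n = energy \<beta> (coef p \<delta> (U n)) (w n) (\<zeta> n)" for n
  define H where "H = c2 * (h + \<eta>)"
  have H0: "0 \<le> H" using pos h \<eta> by (simp add: H_def)
  have wb: "bcl (w n)" "bcl (\<zeta> n)" if "n \<le> N" for n
   unfolding w_def \<zeta>_def using UV[OF that] Y[OF that] bsob_diff(1)[of 0] bsob_bcl by auto
  have lower: "(nm (w n) + nm (\<zeta> n))\<^sup>2 \<le> m * e n" if n: "n \<le> N" for n
   unfolding m_def e_def
   by (rule energy_lower[OF ker ell wb[OF n] coef_bounds[OF ker ell p UV(1)[OF n] k1 UV(3)[OF n] \<Lambda> \<delta>0 \<delta>2]])
  have step: "e (Suc n) \<le> (1 + \<tau> * c3) * e n + \<tau> * (c4 * (h + \<eta>)\<^sup>2)" if nN: "n < N" for n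
  proof -
   have n: "n \<le> N" "Suc n \<le> N" using nN by auto
   have y: "bsob (Suc (Suc 0)) (y n)" "bsob (Suc (Suc 0)) (z n)" "bnorm (Suc (Suc 0)) (y n) \<le> M" "bnorm (Suc (Suc 0)) (z n) \<le> M"
    using Y[OF n(1)] by (auto simp: numeral_2_eq_2)
   have yS: "bcl (y (Suc n))" "bcl (z (Suc n))" using Y[OF n(2)] bsob_bcl by auto
   have dy: "bcl (deriv (y n))" "bcl (deriv (z n))" using y by auto
   have yz: "bcl (y n)" "bcl (z n)" using y bsob_bcl by blast+
   \<comment> \<open>Residuals are divided by \<tau> so that they enter as inputs of one
     step.\<close>
   define r1 r2 where "r1 = (\<lambda>x. 1 / \<tau> * (y (Suc n) x - y n x - \<tau> * kernel_conv \<beta> (deriv (z n)) x))"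
    and "r2 = (\<lambda>x. 1 / \<tau> * (z (Suc n) x - z n x - \<tau> * deriv (flux p \<delta> (y n)) x))"
   have Kdz: "bcl (kernel_conv \<beta> (deriv (z n)))" by (rule bcl_kernel_conv(1)[OF ker dy(2)])
   have dfl: "bcl (deriv (flux p \<delta> (y n)))" using bsob_flux[OF y(1), of p \<delta>] by simp
   have bd: "bcl (\<lambda>x. f x - g x)" if "bcl f" "bcl g" for f g
    using bcl_add[OF that(1) bcl_cmult[OF that(2), of "-1"]] by simp
   have rb: "bcl r1" "bcl r2" unfolding r1_def r2_def by (intro bcl_cmult bd yS yz Kdz dfl)+
   have rn: "nm r1 \<le> \<eta>" "nm r2 \<le> \<eta>"
    unfolding r1_def r2_def nm_cmult using R1[OF nN] R2[OF nN] \<tau>(1) by (auto simp: divide_simps mult.commute)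
   define A where "A = coef p \<delta> (U n)"
   define f1 where "f1 = (\<lambda>x. kernel_conv \<beta> (\<lambda>x. deriv (z n) x - cdiff h (z n) x) x + r1 x)"
   define f2 where "f2 = (\<lambda>x. (A x * (deriv (y n) x - cdiff h (y n) x) + (coef p \<delta> (y n) x - A x) * deriv (y n) x) + r2 x)"
   have dz: "bcl (\<lambda>x. deriv (z n) x - cdiff h (z n) x)" "bcl (\<lambda>x. deriv (y n) x - cdiff h (y n) x)"
    by (intro bd dy bcl_cdiff yz)+
   note cb = coef_bounds[OF ker ell p UV(1)[OF n(1)] k1 UV(3)[OF n(1)] \<Lambda> \<delta>0 \<delta>2, folded A_def]
   have Adz: "bcl (\<lambda>x. A x * (deriv (y n) x - cdiff h (y n) x))" by (rule bcl_bounded_mult[OF cb(1,3) dz(2)])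
   have cd: "bcl (\<lambda>x. coef p \<delta> (y n) x - A x)"
   proof -
    have "bcl (\<lambda>x. \<delta> * real (p + 1) * (y n x ^ p - U n x ^ p))"
     using bsob_bcl[OF bsob_power(1)[OF y(1) p]] bsob_bcl[OF bsob_power(1)[OF UV(1)[OF n(1)] p]]
     by (intro bcl_cmult bd)
    then show ?thesis by (simp add: A_def coef_def algebra_simps)
   qed
   have fb: "bcl f1" "bcl f2" unfolding f1_def f2_def
    by (intro bcl_add bcl_kernel_conv(1)[OF ker] dz rb Adz bcl_mult cd dy)+
   have wS: "w (Suc n) = (\<lambda>x. w n x + \<tau> * (kernel_conv \<beta> (cdiff h (\<zeta> n)) x + f1 x))"
   proof -
    have cV: "bcl (cdiff h (V n))" "bcl (cdiff h (z n))" using bsob_bcl[OF UV(2)[OF n(1)]] yz by auto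
    have "cdiff h (\<zeta> n) = (\<lambda>x. cdiff h (z n) x - cdiff h (V n) x)"
     by (auto simp: \<zeta>_def cdiff_def diff_divide_distrib)
    then have "kernel_conv \<beta> (cdiff h (\<zeta> n)) = (\<lambda>x. kernel_conv \<beta> (cdiff h (z n)) x - kernel_conv \<beta> (cdiff h (V n)) x)"
     by (simp only: kernel_conv_diff[OF ker cV(2,1)])
    then show ?thesis
     using \<tau>(1) by (auto simp: w_def f1_def r1_def st euler_step_def kernel_conv_diff[OF ker dy(2) cV(2)] field_simps)
   qed
   have \<zeta>S: "\<zeta> (Suc n) = (\<lambda>x. \<zeta> n x + \<tau> * (A x * cdiff h (w n) x + f2 x))"
   proof -
    have "cdiff h (w n) = (\<lambda>x. cdiff h (y n) x - cdiff h (U n) x)"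
     by (auto simp: w_def cdiff_def diff_divide_distrib)
    moreover have "r2 = (\<lambda>x. 1 / \<tau> * (z (Suc n) x - z n x - \<tau> * (coef p \<delta> (y n) x * deriv (y n) x)))"
     unfolding r2_def deriv_flux[OF y(1)] ..
    ultimately show ?thesis
     using \<tau>(1) by (auto simp: \<zeta>_def f2_def st euler_step_def A_def[symmetric] field_simps)
   qed
   define Nn F where "Nn = nm (w n) + nm (\<zeta> n)" and "F = nm f1 + nm f2"
   have dd: "nm (deriv (deriv f)) \<le> M" if "bnorm (Suc (Suc 0)) f \<le> M" for f
    using that nm_nonneg[of f] nm_nonneg[of "deriv f"] unfolding bnorm.simps by linarith
   have cdd: "ndist (deriv f) (cdiff h f) \<le> h * M"
    if "bsob (Suc (Suc 0)) f" "bnorm (Suc (Suc 0)) f \<le> M" for f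
    using nm_cdiff_diff_le[OF that(1) h] mult_left_mono[OF dd[OF that(2)] less_imp_le[OF h]]
    unfolding nm_minus_commute[of "deriv f"] by linarith
   have f1n: "nm f1 \<le> B * (h * M) + \<eta>"
   proof -
    have "nm f1 \<le> nm (kernel_conv \<beta> (\<lambda>x. deriv (z n) x - cdiff h (z n) x)) + nm r1"
     unfolding f1_def by (intro nm_triangle bcl_sq bcl_kernel_conv(1)[OF ker] dz rb)
    also have "nm (kernel_conv \<beta> (\<lambda>x. deriv (z n) x - cdiff h (z n) x)) \<le> B * ndist (deriv (z n)) (cdiff h (z n))"
     unfolding B_def by (rule bcl_kernel_conv(2)[OF ker dz(1)])
    also have "ndist (deriv (z n)) (cdiff h (z n)) \<le> h * M"
     by (rule cdd[OF y(2,4)])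
    finally show ?thesis using rn(1) B by (simp add: mult_left_mono)
   qed
   have f2n: "nm f2 \<le> 2 * (h * M) + c1 * nm (w n) + \<eta>"
   proof -
    have "nm f2 \<le> (nm (\<lambda>x. A x * (deriv (y n) x - cdiff h (y n) x)) + nm (\<lambda>x. (coef p \<delta> (y n) x - A x) * deriv (y n) x)) + nm r2"
    proof -
     have s: "sq (\<lambda>x. A x * (deriv (y n) x - cdiff h (y n) x))" "sq (\<lambda>x. (coef p \<delta> (y n) x - A x) * deriv (y n) x)" "sq r2"
      by (intro bcl_sq Adz bcl_mult cd dy rb)+
     show ?thesis
      unfolding f2_def using nm_triangle[OF sq_add[OF s(1,2)] s(3)] nm_triangle[OF s(1,2)] by linarith
    qed
    moreover have "nm (\<lambda>x. A x * (deriv (y n) x - cdiff h (y n) x)) \<le> 2 * (h * M)"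
    proof -
     have "nm (\<lambda>x. A x * (deriv (y n) x - cdiff h (y n) x)) \<le> 2 * ndist (deriv (y n)) (cdiff h (y n))"
      by (rule nm_bounded_mult(1)[OF cb(1,3) bcl_sq[OF dz(2)]])
     also have "ndist (deriv (y n)) (cdiff h (y n)) \<le> h * M"
      by (rule cdd[OF y(1,3)])
     finally show ?thesis by simp
    qed
    moreover have "nm (\<lambda>x. (coef p \<delta> (y n) x - A x) * deriv (y n) x) \<le> c1 * nm (w n)"
    proof -
     have "nm (\<lambda>x. (coef p \<delta> (y n) x - A x) * deriv (y n) x) \<le> nm (\<lambda>x. c1 * w n x)"
     proof (rule nm_mono(2))
      show "sq (\<lambda>x. c1 * w n x)" by (intro sq_cmult bcl_sq wb n)
      show "(\<lambda>x. (coef p \<delta> (y n) x - A x) * deriv (y n) x) \<in> borel_measurable borel"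
       by (intro sq_measurable bcl_sq bcl_mult cd dy)
      fix x
      have uM: "\<bar>U n x\<bar> \<le> M" using sup_le_bnorm'[OF UV(1)[OF n(1)] k1, of x] UV(3)[OF n(1)] M by linarith
      have yM: "\<bar>y n x\<bar> \<le> M" using sup_le_bnorm'[OF y(1), of x] y(3) by linarith
      have dM: "\<bar>deriv (y n) x\<bar> \<le> M"
       using sup_le_bnorm[of "deriv (y n)" x] order_trans[OF bnorm_deriv_le y(3)] bsob_SucD(3)[OF y(1)] by linarith
      have "\<bar>coef p \<delta> (y n) x - A x\<bar> * \<bar>deriv (y n) x\<bar> \<le> (\<delta> * real (p + 1) * (real p * M ^ p) * \<bar>y n x - U n x\<bar>) * M"
       unfolding A_def using coef_diff_le[where u = "U n" and w = "y n" and x = x, OF ker ell p uM yM M1 \<delta>0] dM \<delta>0 M1 by (intro mult_mono) auto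
      also have "... = c1 * \<bar>w n x\<bar>" by (simp add: c1_def w_def ac_simps)
      finally show "\<bar>(coef p \<delta> (y n) x - A x) * deriv (y n) x\<bar> \<le> \<bar>c1 * w n x\<bar>" using pos(1) by (simp add: abs_mult)
     qed
     then show ?thesis using pos(1) by (simp add: nm_cmult)
    qed
    ultimately show ?thesis using rn(2) by linarith
   qed
   have Nn0: "0 \<le> Nn" "0 \<le> F" by (simp_all add: Nn_def F_def)
   have F: "F \<le> c1 * Nn + H"
   proof -
    have "c1 * nm (w n) \<le> c1 * Nn" using pos(1) by (intro mult_left_mono) (auto simp: Nn_def)
    moreover have "B * (h * M) + \<eta> + (2 * (h * M) + \<eta>) \<le> H"
    proof -
     have "0 \<le> (B + 2) * M * \<eta>" "0 \<le> 2 * h" using B M1 \<eta> h by auto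
     then show ?thesis by (simp add: H_def c2_def algebra_simps)
    qed
    ultimately show ?thesis using f1n f2n by (simp add: F_def)
   qed
   \<comment> \<open>Young's inequality separates the unknown \<open>Nn\<close> from the error
     \<open>H\<close>; \<open>\<tau> \<le> 1\<close> removes the factor in front of the
     square.\<close>
   have FN: "F * Nn + \<tau> * F\<^sup>2 \<le> (c1 + 1 + 2 * c1\<^sup>2) * Nn\<^sup>2 + 3 * H\<^sup>2"
   proof -
    have 1: "F * Nn \<le> (c1 * Nn + H) * Nn" using F Nn0 by (intro mult_right_mono) auto
    have 2: "F\<^sup>2 \<le> (c1 * Nn + H)\<^sup>2" using F Nn0 by (intro power_mono) auto
    have 3: "(c1 * Nn + H)\<^sup>2 \<le> 2 * (c1 * Nn)\<^sup>2 + 2 * H\<^sup>2"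
     using zero_le_power2[of "c1 * Nn - H"] by (simp add: power2_eq_square algebra_simps)
    have 4: "H * Nn \<le> Nn\<^sup>2 + H\<^sup>2"
    proof -
     have "2 * (H * Nn) \<le> Nn\<^sup>2 + H\<^sup>2"
      using zero_le_power2[of "Nn - H"] by (simp add: power2_eq_square algebra_simps)
     moreover have "0 \<le> Nn\<^sup>2 + H\<^sup>2" by simp
     ultimately show ?thesis by linarith
    qed
    have 5: "\<tau> * F\<^sup>2 \<le> 1 * F\<^sup>2" using \<tau> by (intro mult_right_mono) auto
    have "F * Nn + \<tau> * F\<^sup>2 \<le> c1 * Nn\<^sup>2 + H * Nn + (2 * (c1 * Nn)\<^sup>2 + 2 * H\<^sup>2)"
     using 1 2 3 5 by (simp add: power2_eq_square algebra_simps)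
    also have "... \<le> c1 * Nn\<^sup>2 + (Nn\<^sup>2 + H\<^sup>2) + (2 * (c1 * Nn)\<^sup>2 + 2 * H\<^sup>2)" using 4 by simp
    also have "... = (c1 + 1 + 2 * c1\<^sup>2) * Nn\<^sup>2 + 3 * H\<^sup>2" by (simp add: power_mult_distrib algebra_simps)
    finally show ?thesis .
   qed
   note cs = coef_euler_step[OF ker ell p UV(1,2)[OF n(1)] k UV(3,4)[OF n(1)] \<Lambda> \<delta>0 \<delta>(2) h \<tau>(1,2), folded st A_def G_def]
   have lip: "\<bar>A (x + h) - A x\<bar> \<le> (\<delta> * G) * h" for x
    using coef_Lipschitz[OF ker ell p UV(1)[OF n(1)] k UV(3)[OF n(1)] \<Lambda> \<delta>0, of x h] h by (simp add: A_def G_def)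
   have tl: "\<tau> * (\<delta> * G) \<le> 1" using mult_mono[OF \<tau>(2) \<delta>2] \<delta>0 \<tau> G0 by (simp add: G_def)
   have "e (Suc n) \<le> e n + \<tau> * (16 * B\<^sup>2 * ((\<delta> * G + \<delta> * G + \<delta>) * Nn\<^sup>2 + F * Nn + \<tau> * F\<^sup>2))"
    unfolding e_def wS \<zeta>S A_def[symmetric] Nn_def F_def B_def
    by (rule energy_step[OF ker ell wb[OF n(1)] fb cb(1,3) cs(3,2) lip cs(1) h \<tau>(1,3) tl])
   also have "... \<le> e n + \<tau> * (16 * B\<^sup>2 * ((\<delta> * G + \<delta> * G + \<delta>) * Nn\<^sup>2 + ((c1 + 1 + 2 * c1\<^sup>2) * Nn\<^sup>2 + 3 * H\<^sup>2)))"
    using FN \<tau>(1) by (intro add_left_mono mult_left_mono) auto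
   also have "... = e n + \<tau> * (16 * B\<^sup>2 * (2 * (\<delta> * G) + \<delta> + c1 + 1 + 2 * c1\<^sup>2) * Nn\<^sup>2) + \<tau> * (48 * B\<^sup>2 * H\<^sup>2)"
    by (simp add: algebra_simps)
   also have "... \<le> e n + \<tau> * (16 * B\<^sup>2 * (2 * (\<delta> * G) + \<delta> + c1 + 1 + 2 * c1\<^sup>2) * (m * e n)) + \<tau> * (48 * B\<^sup>2 * H\<^sup>2)"
    using lower[OF n(1)] \<tau>(1) pos \<delta>0 G0 unfolding Nn_def
    by (intro add_mono order_refl mult_left_mono mult_nonneg_nonneg add_nonneg_nonneg) auto
   also have "... = (1 + \<tau> * c3) * e n + \<tau> * (c4 * (h + \<eta>)\<^sup>2)"
   proof -
    have HH: "H\<^sup>2 = c2\<^sup>2 * (h + \<eta>)\<^sup>2" by (simp add: H_def power_mult_distrib)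
    show ?thesis unfolding c3_def c4_def HH by (simp add: algebra_simps)
   qed
   finally show ?thesis .
  qed
  have "w 0 = (\<lambda>x. 0)" "\<zeta> 0 = (\<lambda>x. 0)" by (simp_all add: w_def \<zeta>_def U_def V_def euler_def init)
  then have e0: "e 0 \<le> 0" by (simp add: e_def energy_def ip_def)
  have r0: "0 \<le> c4 * (h + \<eta>)\<^sup>2" using c34 by simp
  have "nm (w n) + nm (\<zeta> n) \<le> C * (h + \<eta>)" if n: "n \<le> N" for n
  proof -
   have "real n * \<tau> \<le> real N * \<tau>" using n \<tau> by (intro mult_right_mono) auto
   then have na: "real n * \<tau> \<le> a" using Na by linarith
   have "e n \<le> exp (c3 * (real n * \<tau>)) * (real n * \<tau> * (c4 * (h + \<eta>)\<^sup>2))"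
    using discrete_Gronwall[of N e \<tau> c3 "c4 * (h + \<eta>)\<^sup>2", OF step e0 c34(1) r0 _ n] \<tau> by simp
   also have "... \<le> exp (c3 * a) * (a * (c4 * (h + \<eta>)\<^sup>2))"
    using na c34 r0 \<tau> a by (intro mult_mono) (auto intro!: mult_left_mono)
   finally have "m * e n \<le> m * (exp (c3 * a) * (a * (c4 * (h + \<eta>)\<^sup>2)))" using pos by (intro mult_left_mono) auto
   then have "(nm (w n) + nm (\<zeta> n))\<^sup>2 \<le> m * (exp (c3 * a) * (a * (c4 * (h + \<eta>)\<^sup>2)))" using lower[OF n] by linarith
   also have "... = (C * (h + \<eta>))\<^sup>2"
    using pos c34 a by (simp add: C_def power_mult_distrib)
   finally show ?thesis by (rule power2_le_imp_le) (use h \<eta> pos c34 a in \<open>simp add: C_def\<close>)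
  qed
  then show "\<forall>n\<le>N. ndist (y n) (fst (euler \<beta> p \<delta> h \<tau> u0 v0 n)) + ndist (z n) (snd (euler \<beta> p \<delta> h \<tau> u0 v0 n))
     \<le> C * (h + \<eta>)"
   by (simp add: w_def \<zeta>_def U_def V_def)
 qed
qed

end

section \<open>Consistency\<close>

lemma bnorm_telescope:
 fixes x d :: "nat => real => real"
 assumes step: "!!i. m \<le> i ==> i < n ==> x (Suc i) = (\<lambda>y. x i y + \<tau> * d i y)"
  and d: "!!i. m \<le> i ==> i < n ==> bsob l (d i)" and t: "bsob l t"
  and le: "!!i. m \<le> i ==> i < n ==> bnorm l (\<lambda>y. d i y - t y) \<le> E"
  and \<tau>: "0 \<le> \<tau>" and mn: "m \<le> n"
 shows "bsob l (\<lambda>y. x n y - x m y - real (n - m) * \<tau> * t y)"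
  "bnorm l (\<lambda>y. x n y - x m y - real (n - m) * \<tau> * t y) \<le> real (n - m) * \<tau> * E"
proof -
 have "bsob l (\<lambda>y. x (m + i) y - x m y - real i * \<tau> * t y) \<and>
   bnorm l (\<lambda>y. x (m + i) y - x m y - real i * \<tau> * t y) \<le> real i * \<tau> * E" if "m + i \<le> n" for i
  using that
 proof (induction i)
  case (Suc i)
  have i: "m \<le> m + i" "m + i < n" using Suc.prems by auto
  have b: "bsob l (\<lambda>y. \<tau> * (d (m + i) y - t y))" by (intro bsob_cmult(1) bsob_diff(1) d i t)
  have bn: "bnorm l (\<lambda>y. \<tau> * (d (m + i) y - t y)) \<le> \<tau> * E"
   using bsob_cmult(2)[OF bsob_diff(1)[OF d[OF i] t], of \<tau>] mult_left_mono[OF le[OF i] \<tau>] \<tau> by simp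
  have eq: "(\<lambda>y. x (m + Suc i) y - x m y - real (Suc i) * \<tau> * t y)
    = (\<lambda>y. (x (m + i) y - x m y - real i * \<tau> * t y) + \<tau> * (d (m + i) y - t y))"
   using step[OF i] by (auto simp: algebra_simps)
  have IH: "bsob l (\<lambda>y. x (m + i) y - x m y - real i * \<tau> * t y)"
   "bnorm l (\<lambda>y. x (m + i) y - x m y - real i * \<tau> * t y) \<le> real i * \<tau> * E" using Suc by auto
  show ?case unfolding eq using bsob_add[OF IH(1) b] IH(2) bn by (auto simp: algebra_simps)
 qed simp
 from this[of "n - m"] mn show "bsob l (\<lambda>y. x n y - x m y - real (n - m) * \<tau> * t y)"
  "bnorm l (\<lambda>y. x n y - x m y - real (n - m) * \<tau> * t y) \<le> real (n - m) * \<tau> * E" by simp_all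
qed

text \<open>Serves the passage to the limit twice: with the right hand sides as directions
  \<open>W\<close> it preserves first order estimates, with direction 0 it preserves Lipschitz
  bounds.\<close>

lemma bnorm_limit_difference:
 fixes P P' W :: "nat => real => real"
 assumes b: "!!m. bsob J (P m)" "!!m. bsob J (P' m)" "!!m. bsob J (W m)" "bsob J p" "bsob J p'" "bsob J w"
  and lim: "(\<lambda>m. bdist J (P m) p) \<longlonglongrightarrow> 0" "(\<lambda>m. bdist J (P' m) p') \<longlonglongrightarrow> 0"
   "(\<lambda>m. bdist J (W m) w) \<longlonglongrightarrow> 0" "s \<longlonglongrightarrow> s'" "E \<longlonglongrightarrow> E'"
  and le: "!!m. bnorm J (\<lambda>x. P' m x - P m x - s m * W m x) \<le> E m"
 shows "bnorm J (\<lambda>x. p' x - p x - s' * w x) \<le> E'"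
proof (rule bnorm_tendsto_le[OF _ _ _ le lim(5)])
 show bm: "bsob J (\<lambda>x. P' m x - P m x - s m * W m x)" for m by (intro bsob_diff(1) bsob_cmult(1) b)
 show bl: "bsob J (\<lambda>x. p' x - p x - s' * w x)" by (intro bsob_diff(1) bsob_cmult(1) b)
 let ?D = "\<lambda>m. bdist J (P' m) p' + bdist J (P m) p
   + (\<bar>s m\<bar> * bdist J (W m) w + \<bar>s m - s'\<bar> * bnorm J w)"
 have up: "bnorm J (\<lambda>x. (P' m x - P m x - s m * W m x) - (p' x - p x - s' * w x)) \<le> ?D m" for m
 proof -
  have b1: "bsob J (\<lambda>x. P' m x - p' x)" "bsob J (\<lambda>x. P m x - p x)" "bsob J (\<lambda>x. W m x - w x)"
   by (intro bsob_diff(1) b)+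
  have b2: "bsob J (\<lambda>x. s m * (W m x - w x))" "bsob J (\<lambda>x. (s m - s') * w x)" by (intro bsob_cmult(1) b1 b)+
  have "(\<lambda>x. (P' m x - P m x - s m * W m x) - (p' x - p x - s' * w x))
    = (\<lambda>x. ((P' m x - p' x) - (P m x - p x)) - (s m * (W m x - w x) + (s m - s') * w x))"
   by (auto simp: algebra_simps)
  then have "bnorm J (\<lambda>x. (P' m x - P m x - s m * W m x) - (p' x - p x - s' * w x))
    \<le> (bdist J (P' m) p' + bdist J (P m) p)
     + (bnorm J (\<lambda>x. s m * (W m x - w x)) + bnorm J (\<lambda>x. (s m - s') * w x))"
   using bsob_diff(2)[OF bsob_diff(1)[OF b1(1,2)] bsob_add(1)[OF b2]] bsob_diff(2)[OF b1(1,2)] bsob_add(2)[OF b2] by simp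
  also have "... \<le> ?D m" by (intro add_mono order_refl bsob_cmult(2) b1 b)
  finally show ?thesis .
 qed
 have "?D \<longlonglongrightarrow> 0 + 0 + (\<bar>s'\<bar> * 0 + \<bar>s' - s'\<bar> * bnorm J w)"
  by (intro tendsto_intros lim)
 then have D: "?D \<longlonglongrightarrow> 0" by simp
 show "(\<lambda>m. bnorm J (\<lambda>x. (P' m x - P m x - s m * W m x) - (p' x - p x - s' * w x))) \<longlonglongrightarrow> 0"
  by (rule tendsto_sandwich[OF _ _ tendsto_const D]) (use up in auto)
qed

text \<open>The last two parts are Taylor estimates of first order over the elapsed time
  \<open>s\<close>; as \<open>h\<close> tends to 0 their bound becomes
  \<open>D * s\<^sup>2\<close>.\<close>

abbreviation increment_bound :: "kernel => nat => real => nat => real => real => real => (real => real) => (real => real) => (real => real) => (real => real) => bool" where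
 "increment_bound \<beta> p \<delta> j D h s u v u' v' \<equiv>
  bdist (Suc j) u' u \<le> D * s \<and> bdist (Suc j) v' v \<le> D * s \<and>
  bnorm j (\<lambda>x. u' x - u x - s * kernel_conv \<beta> (deriv v) x) \<le> D * s * (h + s) \<and>
  bnorm j (\<lambda>x. v' x - v x - s * deriv (flux p \<delta> u) x) \<le> D * s * (h + s)"

context
 fixes \<beta> :: kernel and C1 C2 :: real and p :: nat
 assumes ker: "is_kernel \<beta>" and ell: "elliptic \<beta> C1 C2" and p: "1 \<le> p"
begin

text \<open>Over many steps the direction of the scheme departs from the right hand side at index
  \<open>m\<close> by the error \<open>h\<close> of the quotient and by the elapsed time, because
  the states are Lipschitz in time. Order \<open>j + 2\<close> of the bound leaves order
  \<open>j + 1\<close> for the increments and order \<open>j\<close> for the directions.\<close>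

theorem euler_consistency:
 assumes j: "1 \<le> j" and \<Lambda>: "1 \<le> \<Lambda>" and \<delta>: "0 \<le> \<delta>"
 obtains D where "1 \<le> D"
  "!!h \<tau> u0 v0 N. [|0 < h; 0 < \<tau>;
   !!n. n \<le> N ==> bpair (j + 2) \<Lambda> (euler \<beta> p \<delta> h \<tau> u0 v0 n)|] ==>
   \<forall>n\<le>N. \<forall>m\<le>n.
    increment_bound \<beta> p \<delta> j D h (real (n - m) * \<tau>) (fst (euler \<beta> p \<delta> h \<tau> u0 v0 m)) (snd (euler \<beta> p \<delta> h \<tau> u0 v0 m)) (fst (euler \<beta> p \<delta> h \<tau> u0 v0 n)) (snd (euler \<beta> p \<delta> h \<tau> u0 v0 n))"
proof -
 define B G where "B = kmass \<beta>" and "G = \<delta> * growth \<beta> (j + 2) p \<Lambda>"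
 have B: "1 \<le> B" using kmass_ge_1 by (simp add: B_def)
 have G0: "0 \<le> G" unfolding G_def using \<Lambda> \<delta> growth_nonneg[OF ker ell p, of \<Lambda> "j + 2"] by simp
 have j1: "1 \<le> Suc j" "1 \<le> j + 2" by simp_all
 obtain CF where CF: "1 \<le> CF" "!!u w. bsob (Suc j) u ==> bsob (Suc j) w ==> bnorm (Suc j) u \<le> \<Lambda> ==> bnorm (Suc j) w \<le> \<Lambda> ==>
  bdist (Suc j) (flux p \<delta> u) (flux p \<delta> w) \<le> CF * bdist (Suc j) u w"
  by (rule bnorm_flux_diff[OF j1(1)]) (rule that)
 define c where "c = 1 + 2 ^ (j + 2) * G"
 have c: "1 \<le> c" using G0 by (simp add: c_def)
 define D1 where "D1 = (B + c) * \<Lambda>"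
 have D1: "1 \<le> D1" "B * \<Lambda> \<le> D1" "c * \<Lambda> \<le> D1"
 proof -
  have "1 * 1 \<le> (B + c) * \<Lambda>" using B c \<Lambda> by (intro mult_mono) auto
  moreover have "B * \<Lambda> \<le> (B + c) * \<Lambda>" "c * \<Lambda> \<le> (B + c) * \<Lambda>" using B c \<Lambda> by (intro mult_right_mono; simp)+
  ultimately show "1 \<le> D1" "B * \<Lambda> \<le> D1" "c * \<Lambda> \<le> D1" by (simp_all add: D1_def)
 qed
 \<comment> \<open>A product of two sums dominates all products of constants that occur
   below.\<close>
 define D where "D = (B + c + CF) * (D1 + \<Lambda>)"
 have D: "1 \<le> D" "D1 \<le> D" "B * \<Lambda> \<le> D" "B * D1 \<le> D" "c * \<Lambda> \<le> D" "CF * D1 \<le> D"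
 proof -
  have *: "x * y \<le> D" if "0 \<le> x" "0 \<le> y" "x \<le> B + c + CF" "y \<le> D1 + \<Lambda>" for x y
   unfolding D_def using that B c CF(1) by (intro mult_mono) auto
  show "1 \<le> D" "D1 \<le> D" using *[of 1 1] *[of 1 D1] B c CF(1) D1 \<Lambda> by auto
  show "B * \<Lambda> \<le> D" "B * D1 \<le> D" "c * \<Lambda> \<le> D" "CF * D1 \<le> D" using B c CF(1) D1 \<Lambda> by (auto intro!: *)
 qed
 show thesis
 proof (rule that[OF D(1)], intro allI impI)
  fix h \<tau> u0 v0 N n m
  assume h: "0 < h" and \<tau>: "0 < \<tau>"
   and E: "!!n. n \<le> N ==> bpair (j + 2) \<Lambda> (euler \<beta> p \<delta> h \<tau> u0 v0 n)"
   and n: "n \<le> N" and m: "m \<le> n"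
  define U V where "U n = fst (euler \<beta> p \<delta> h \<tau> u0 v0 n)" and "V n = snd (euler \<beta> p \<delta> h \<tau> u0 v0 n)" for n
  have UV: "bsob (j + 2) (U i)" "bsob (j + 2) (V i)" "bnorm (j + 2) (U i) \<le> \<Lambda>" "bnorm (j + 2) (V i) \<le> \<Lambda>" if "i \<le> N" for i
   using E[OF that] bnorm_nonneg[of "j + 2" "U i"] bnorm_nonneg[of "j + 2" "V i"] unfolding U_def V_def by linarith+
  have k2: "Suc (Suc j) = j + 2" by simp
  define a b where "a i = kernel_conv \<beta> (cdiff h (V i))" and "b i = (\<lambda>x. coef p \<delta> (U i) x * cdiff h (U i) x)" for i
  have st: "U (Suc i) = (\<lambda>x. U i x + \<tau> * a i x)" "V (Suc i) = (\<lambda>x. V i x + \<tau> * b i x)" for i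
   by (simp_all add: U_def V_def a_def b_def euler_def euler_step_def)
  define q where "q i = (\<lambda>x. \<delta> * real (p + 1) * U i x ^ p)" for i
  have q: "bsob (j + 2) (q i)" "bnorm (j + 2) (q i) \<le> G" if "i \<le> N" for i
   using bsob_coef[OF ker ell p UV(1)[OF that] j1(2) UV(3)[OF that] \<Lambda> \<delta>] unfolding q_def G_def by blast+
  have mult: "bsob l (\<lambda>x. coef p \<delta> (U i) x * g x) \<and> bnorm l (\<lambda>x. coef p \<delta> (U i) x * g x) \<le> c * bnorm l g"
   if i: "i \<le> N" and g: "bsob l g" and l: "1 \<le> l" "l \<le> Suc j" for i l g
  proof -
   have ql: "bsob l (q i)" "bnorm l (q i) \<le> G"
    using bsob_mono[OF q(1)[OF i]] order_trans[OF bnorm_mono q(2)[OF i]] l by auto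
   have eq: "(\<lambda>x. coef p \<delta> (U i) x * g x) = (\<lambda>x. g x + q i x * g x)" by (auto simp: coef_def q_def algebra_simps)
   have "bnorm l (\<lambda>x. q i x * g x) \<le> 2 ^ Suc l * (bnorm l (q i) * bnorm l g)" by (rule bnorm_mult_le'[OF ql(1) g l(1)])
   also have "... \<le> 2 ^ (j + 2) * (G * bnorm l g)"
    using ql(2) l G0 by (intro mult_mono power_increasing) auto
   finally have "bnorm l (\<lambda>x. q i x * g x) \<le> 2 ^ (j + 2) * G * bnorm l g" by (simp add: mult.assoc)
   then show ?thesis
    unfolding eq c_def using bsob_add[OF g bsob_mult[OF ql(1) g]] by (auto simp: distrib_right)
  qed
  have g: "bsob (Suc j) (cdiff h f)" "bnorm (Suc j) (cdiff h f) \<le> bnorm (j + 2) f" if "bsob (j + 2) f" for f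
   using bsob_cdiff(1)[OF h bsob_mono[OF that, of "Suc j"]] bnorm_cdiff_le_Suc[of "Suc j" f h] that h by (simp_all del: bsob.simps bnorm.simps)
  have ai: "bsob (Suc j) (a i)" "bnorm (Suc j) (a i) \<le> D1" if i: "i \<le> N" for i
  proof -
   show "bsob (Suc j) (a i)" unfolding a_def by (intro bsob_kernel_conv(1)[OF ker] g UV i)
   have "bnorm (Suc j) (a i) \<le> B * bnorm (Suc j) (cdiff h (V i))"
    unfolding a_def B_def by (intro bsob_kernel_conv(2)[OF ker] g UV i)
   also have "... \<le> B * \<Lambda>" using g(2)[OF UV(2)[OF i]] UV(4)[OF i] B by (intro mult_left_mono) auto
   finally show "bnorm (Suc j) (a i) \<le> D1" using D1 by linarith
  qed
  have bi: "bsob (Suc j) (b i)" "bnorm (Suc j) (b i) \<le> D1" if i: "i \<le> N" for i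
  proof -
   note mm = mult[OF i g(1)[OF UV(1)[OF i]] j1(1) order_refl]
   show "bsob (Suc j) (b i)" using mm by (simp add: b_def del: bsob.simps)
   have "bnorm (Suc j) (b i) \<le> c * bnorm (Suc j) (cdiff h (U i))" using mm by (simp add: b_def del: bnorm.simps)
   also have "... \<le> c * \<Lambda>" using g(2)[OF UV(1)[OF i]] UV(3)[OF i] c by (intro mult_left_mono) auto
   finally show "bnorm (Suc j) (b i) \<le> D1" using D1 by linarith
  qed
  have inc: "bdist (Suc j) (U i) (U m) \<le> real (i - m) * \<tau> * D1 \<and> bdist (Suc j) (V i) (V m) \<le> real (i - m) * \<tau> * D1"
   if i: "m \<le> i" "i \<le> n" for i
  proof
   have l: "l \<le> N" if "l < i" for l using that i n by simp
   \<comment> \<open>With direction 0 the telescoping lemma is a Lipschitz bound in time.\<close>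
   show "bdist (Suc j) (U i) (U m) \<le> real (i - m) * \<tau> * D1"
    using bnorm_telescope(2)[of m i U \<tau> a "Suc j" "\<lambda>x. 0" D1, OF st(1) ai(1)[OF l] _ _ _ i(1)] ai(2)[OF l] \<tau> by (simp del: bnorm.simps bsob.simps)
   show "bdist (Suc j) (V i) (V m) \<le> real (i - m) * \<tau> * D1"
    using bnorm_telescope(2)[of m i V \<tau> b "Suc j" "\<lambda>x. 0" D1, OF st(2) bi(1)[OF l] _ _ _ i(1)] bi(2)[OF l] \<tau> by (simp del: bnorm.simps bsob.simps)
  qed
  define s where "s = real (n - m) * \<tau>"
  have s0: "0 \<le> s" using \<tau> by (simp add: s_def)
  have inc': "bdist (Suc j) (U i) (U m) \<le> s * D1" "bdist (Suc j) (V i) (V m) \<le> s * D1" if i: "m \<le> i" "i \<le> n" for i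
  proof -
   have "real (i - m) * \<tau> * D1 \<le> s * D1" using i \<tau> D1(1) unfolding s_def by (intro mult_right_mono) auto
   then show "bdist (Suc j) (U i) (U m) \<le> s * D1" "bdist (Suc j) (V i) (V m) \<le> s * D1"
    using inc[OF i] by linarith+
  qed
  have mN: "m \<le> N" using m n by simp
  have Sj: "bsob (Suc j) (U i)" "bsob (Suc j) (V i)" if "i \<le> N" for i
   using bsob_mono[OF UV(1)[OF that], of "Suc j"] bsob_mono[OF UV(2)[OF that], of "Suc j"] by auto
  have SjL: "bnorm (Suc j) (U i) \<le> \<Lambda>" if "i \<le> N" for i
   using order_trans[OF bnorm_mono UV(3)[OF that], of "Suc j"] by simp
  have cd: "bdist j (cdiff h f) (deriv f) \<le> h * \<Lambda>" "bsob j (\<lambda>x. cdiff h f x - deriv f x)"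
   if "bsob (j + 2) f" "bnorm (j + 2) f \<le> \<Lambda>" for f
  proof -
   have "bsob j (cdiff h f)" by (rule bsob_Suc[OF g(1)[OF that(1)]])
   moreover have "bsob j (deriv f)" using bsob_mono[OF that(1), of "Suc j"] by simp
   ultimately show "bsob j (\<lambda>x. cdiff h f x - deriv f x)" by (rule bsob_diff(1))
   show "bdist j (cdiff h f) (deriv f) \<le> h * \<Lambda>"
    using bnorm_cdiff_diff_le[of j f h] that h mult_left_mono[OF that(2), of h] unfolding k2 by linarith
  qed
  have dV: "bsob j (deriv (V i))" "bsob j (deriv (flux p \<delta> (U i)))" if "i \<le> N" for i
   using Sj[OF that] bsob_flux[OF Sj(1)[OF that], of p \<delta>] by auto
  have ea: "bdist j (a i) (kernel_conv \<beta> (deriv (V m))) \<le> D * (h + s)" if i: "m \<le> i" "i < n" for i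
  proof -
   have iN: "i \<le> N" using i n by simp
   have ib: "bsob j (cdiff h (V i))" by (rule bsob_Suc[OF g(1)[OF UV(2)[OF iN]]])
   have d1: "bsob j (\<lambda>x. cdiff h (V i) x - deriv (V i) x)" "bsob j (\<lambda>x. deriv (V i) x - deriv (V m) x)"
    by (intro cd UV iN bsob_diff(1) dV mN)+
   have "(\<lambda>x. a i x - kernel_conv \<beta> (deriv (V m)) x) = kernel_conv \<beta> (\<lambda>x. cdiff h (V i) x - deriv (V m) x)"
    unfolding a_def by (simp add: kernel_conv_diff[OF ker bsob_bcl[OF ib] bsob_bcl[OF dV(1)[OF mN]]])
   then have "bdist j (a i) (kernel_conv \<beta> (deriv (V m))) \<le> B * bdist j (cdiff h (V i)) (deriv (V m))"
    using bsob_kernel_conv(2)[OF ker bsob_diff(1)[OF ib dV(1)[OF mN]]] by (simp add: B_def)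
   also have "bdist j (cdiff h (V i)) (deriv (V m)) \<le> h * \<Lambda> + s * D1"
   proof -
    have "bdist j (deriv (V i)) (deriv (V m)) \<le> s * D1"
     using order_trans[OF bnorm_deriv_le inc'(2)[of i]] i unfolding deriv_diff_bsob[OF Sj(2)[OF iN] Sj(2)[OF mN]] by simp
    then show ?thesis using bsob_add(2)[OF d1] cd(1)[OF UV(2,4)[OF iN]] by simp
   qed
   also have "B * (h * \<Lambda> + s * D1) = h * (B * \<Lambda>) + s * (B * D1)" by (simp add: algebra_simps)
   also have "... \<le> h * D + s * D" using D h s0 by (intro add_mono mult_left_mono) auto
   finally show ?thesis using B by (simp add: algebra_simps)
  qed
  have eb: "bdist j (b i) (deriv (flux p \<delta> (U m))) \<le> D * (h + s)" if i: "m \<le> i" "i < n" for i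
  proof -
   have iN: "i \<le> N" using i n by simp
   note mm = mult[OF iN cd(2)[OF UV(1,3)[OF iN]] j, simplified]
   have d2: "bsob j (\<lambda>x. deriv (flux p \<delta> (U i)) x - deriv (flux p \<delta> (U m)) x)" by (intro bsob_diff(1) dV iN mN)
   have "(\<lambda>x. b i x - deriv (flux p \<delta> (U m)) x) = (\<lambda>x. coef p \<delta> (U i) x * (cdiff h (U i) x - deriv (U i) x)
     + (deriv (flux p \<delta> (U i)) x - deriv (flux p \<delta> (U m)) x))"
    unfolding b_def deriv_flux[OF Sj(1)[OF iN]] by (auto simp: algebra_simps)
   then have "bdist j (b i) (deriv (flux p \<delta> (U m))) \<le> bnorm j (\<lambda>x. coef p \<delta> (U i) x * (cdiff h (U i) x - deriv (U i) x))
     + bdist j (deriv (flux p \<delta> (U i))) (deriv (flux p \<delta> (U m)))"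
    using bsob_add(2)[OF conjunct1[OF mm] d2] by simp
   also have "... \<le> c * (h * \<Lambda>) + CF * (s * D1)"
   proof (rule add_mono)
    show "bnorm j (\<lambda>x. coef p \<delta> (U i) x * (cdiff h (U i) x - deriv (U i) x)) \<le> c * (h * \<Lambda>)"
     using mm mult_left_mono[OF cd(1)[OF UV(1,3)[OF iN]], of c] c by linarith
    have "bdist j (deriv (flux p \<delta> (U i))) (deriv (flux p \<delta> (U m))) \<le> bdist (Suc j) (flux p \<delta> (U i)) (flux p \<delta> (U m))"
     using bnorm_deriv_le[of j "\<lambda>x. flux p \<delta> (U i) x - flux p \<delta> (U m) x"]
     unfolding deriv_diff_bsob[OF bsob_flux[OF Sj(1)[OF iN]] bsob_flux[OF Sj(1)[OF mN]]] .
    also have "... \<le> CF * bdist (Suc j) (U i) (U m)" by (rule CF(2)[OF Sj(1)[OF iN] Sj(1)[OF mN] SjL[OF iN] SjL[OF mN]])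
    also have "... \<le> CF * (s * D1)" using inc'(1)[of i] i CF(1) by (intro mult_left_mono) auto
    finally show "bdist j (deriv (flux p \<delta> (U i))) (deriv (flux p \<delta> (U m))) \<le> CF * (s * D1)" .
   qed
   also have "... = h * (c * \<Lambda>) + s * (CF * D1)" by (simp add: algebra_simps)
   also have "... \<le> h * D + s * D" using D h s0 by (intro add_mono mult_left_mono) auto
   finally show ?thesis by (simp add: algebra_simps)
  qed
  have l: "l \<le> N" if "l < n" for l using that n by simp
  have Kd: "bsob j (kernel_conv \<beta> (deriv (V m)))" by (rule bsob_kernel_conv(1)[OF ker dV(1)[OF mN]])
  have 1: "bdist (Suc j) (U n) (U m) \<le> D * s" "bdist (Suc j) (V n) (V m) \<le> D * s"
   using inc'[OF m order_refl] mult_left_mono[OF D(2) s0] by (simp_all add: mult.commute)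
  have 2: "bnorm j (\<lambda>x. U n x - U m x - real (n - m) * \<tau> * kernel_conv \<beta> (deriv (V m)) x) \<le> real (n - m) * \<tau> * (D * (h + s))"
   by (rule bnorm_telescope(2)[of m n U \<tau> a j, OF st(1) bsob_Suc[OF ai(1)[OF l]] Kd ea _ m]) (use \<tau> in auto)
  have 3: "bnorm j (\<lambda>x. V n x - V m x - real (n - m) * \<tau> * deriv (flux p \<delta> (U m)) x) \<le> real (n - m) * \<tau> * (D * (h + s))"
   by (rule bnorm_telescope(2)[of m n V \<tau> b j, OF st(2) bsob_Suc[OF bi(1)[OF l]] dV(2)[OF mN] eb _ m]) (use \<tau> in auto)
  show "increment_bound \<beta> p \<delta> j D h (real (n - m) * \<tau>) (fst (euler \<beta> p \<delta> h \<tau> u0 v0 m)) (snd (euler \<beta> p \<delta> h \<tau> u0 v0 m)) (fst (euler \<beta> p \<delta> h \<tau> u0 v0 n)) (snd (euler \<beta> p \<delta> h \<tau> u0 v0 n))"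
   using 1 2 3 unfolding U_def[symmetric] V_def[symmetric] s_def by (simp add: ac_simps del: bnorm.simps)
 qed
qed

end

section \<open>Convergence of the scheme\<close>

text \<open>Interpolation makes the norm of order 1 smaller than every \<open>e\<close>, and that
  norm bounds the supremum.\<close>

lemma nm_zero_imp_zero:
 assumes f: "bsob 2 f" and n: "nm f = 0"
 shows "f x = 0"
proof -
 have f2: "bsob (Suc (Suc 0)) f" using f by (simp add: numeral_2_eq_2)
 have "\<bar>f x\<bar> \<le> e" if e: "e > 0" for e
 proof -
  obtain d where d: "d > 0" "\<forall>g. bsob (Suc (Suc 0)) g \<and> bnorm (Suc (Suc 0)) g \<le> bnorm (Suc (Suc 0)) f \<and> nm g \<le> d \<longrightarrow> bnorm (Suc 0) g \<le> e"
   using bnorm_interpolation[OF e, where k = "Suc 0" and M = "bnorm (Suc (Suc 0)) f"] by (elim exE conjE) (rule that)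
  have "bnorm (Suc 0) f \<le> e" by (rule d(2)[rule_format]) (use f2 n d(1) in \<open>simp del: bsob.simps bnorm.simps\<close>)
  then show ?thesis using sup_le_bnorm[OF bsob_Suc[OF f2], of x] by linarith
 qed
 then have "\<bar>f x\<bar> \<le> 0" by (rule dense_ge)
 then show ?thesis by simp
qed

section \<open>Time grids\<close>

definition grid_index :: "real => real => nat" where
 "grid_index \<tau> t = nat \<lfloor>t / \<tau>\<rfloor>"

lemma grid_index_bounds:
 assumes "0 < \<tau>" "0 \<le> t"
 shows "real (grid_index \<tau> t) * \<tau> \<le> t" "t < real (grid_index \<tau> t) * \<tau> + \<tau>"
proof -
 have q: "0 \<le> t / \<tau>" using assms by simp
 have r: "real (grid_index \<tau> t) = of_int \<lfloor>t / \<tau>\<rfloor>" unfolding grid_index_def using q by simp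
 have "of_int \<lfloor>t / \<tau>\<rfloor> \<le> t / \<tau>" "t / \<tau> < of_int \<lfloor>t / \<tau>\<rfloor> + 1" by linarith+
 then show "real (grid_index \<tau> t) * \<tau> \<le> t" "t < real (grid_index \<tau> t) * \<tau> + \<tau>"
  unfolding r pos_le_divide_eq[OF assms(1)] pos_divide_less_eq[OF assms(1)] by (simp_all only: distrib_right mult_1_left)
qed

lemma grid_index_ge:
 assumes "0 < \<tau>" "real n * \<tau> \<le> t"
 shows "n \<le> grid_index \<tau> t"
proof -
 have "real n \<le> t / \<tau>" using assms by (simp add: field_simps)
 then have "int n \<le> \<lfloor>t / \<tau>\<rfloor>" by (simp add: le_floor_iff)
 then show ?thesis by (simp add: grid_index_def le_nat_iff)
qed

lemma grid_index_eq:
 assumes "0 < \<tau>" shows "grid_index \<tau> (real n * \<tau>) = n"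
 using assms by (simp add: grid_index_def)

lemma grid_index_mono:
 assumes "0 < \<tau>" "0 \<le> t" "t \<le> t'" shows "grid_index \<tau> t \<le> grid_index \<tau> t'"
 using grid_index_ge[OF assms(1)] grid_index_bounds(1)[OF assms(1,2)] assms(3) by force

text \<open>
 Only \<open>y\<close> is prescribed: the second component of the approximate Euler orbit may depend on the grid.
\<close>

abbreviation step_error :: "kernel => nat => real => real => real => (real => real) => (real => real) => (real => real) => (real => real) => bool" where
 "step_error \<beta> p \<delta> \<tau> e y z y' z' \<equiv> nm (\<lambda>x. y' x - y x - \<tau> * kernel_conv \<beta> (deriv z) x) \<le> e \<and>
   nm (\<lambda>x. z' x - z x - \<tau> * deriv (flux p \<delta> y) x) \<le> e"

text \<open>A solution seen through its samples. The bound \<open>M\<close> does not depend on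
  \<open>\<eta>\<close>, so the constant of the comparison stays fixed while \<open>\<eta>\<close>
  tends to 0.\<close>

definition grid_solution :: "kernel => nat => real => real => (real => real) => real => (real => real => real) => bool" where
 "grid_solution \<beta> p \<delta> a v0 M y \<longleftrightarrow> (\<forall>\<eta>>0. \<exists>\<tau>0>0. \<forall>\<tau> N. 0 < \<tau> \<longrightarrow> \<tau> < \<tau>0 \<longrightarrow> real N * \<tau> \<le> a \<longrightarrow>
   (\<exists>z. z 0 = v0 \<and>
    (\<forall>n\<le>N. bsob 2 (y (real n * \<tau>)) \<and> bsob 2 (z n) \<and> bnorm 2 (y (real n * \<tau>)) \<le> M \<and> bnorm 2 (z n) \<le> M) \<and>
    (\<forall>n<N. step_error \<beta> p \<delta> \<tau> (\<tau> * \<eta>) (y (real n * \<tau>)) (z n) (y (real (Suc n) * \<tau>)) (z (Suc n)))))"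

context
 fixes \<beta> :: kernel and C1 C2 :: real and p :: nat
 assumes ker: "is_kernel \<beta>" and ell: "elliptic \<beta> C1 C2" and p: "1 \<le> p"
begin

text \<open>The grids are nested with ratio 4, since \<open>h\<close> is halved and \<tau> is of
  order h^2. Samples of a fine orbit on a coarse grid obey the coarse scheme up to an error of order
  \<open>h\<close>, so the comparison makes the orbits a Cauchy sequence in L2, and the uniform
  bound at order \<open>Suc J + 2\<close> lifts convergence to order \<open>Suc J\<close>.
  Uniqueness is part of the statement because it compares an arbitrary solution with these same
  orbits.\<close>

theorem euler_limit:
 assumes J: "1 \<le> J" and \<Lambda>: "1 \<le> \<Lambda>" and \<delta>: "0 < \<delta>" "\<delta> \<le> 1" "\<delta> * growth \<beta> (Suc J + 2) p \<Lambda> \<le> 1 / 4" and a: "0 < a"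
  and SB: "!!h \<tau> n. [|0 < h; 0 < \<tau>; \<tau> \<le> 1; \<tau> \<le> \<delta> * h\<^sup>2; real n * \<tau> \<le> a|] ==>
    bpair (Suc J + 2) \<Lambda> (euler \<beta> p \<delta> h \<tau> u0 v0 n)"
 obtains u v C where "0 \<le> C" "u 0 = u0" "v 0 = v0"
  "!!t. t \<in> {0..a} ==> bsob (Suc J) (u t) \<and> bsob (Suc J) (v t) \<and> bnorm (Suc J) (u t) \<le> \<Lambda> \<and> bnorm (Suc J) (v t) \<le> \<Lambda>"
  "!!t t'. [|0 \<le> t; t \<le> t'; t' \<le> a|] ==>
    bnorm J (\<lambda>x. u t' x - u t x - (t' - t) * kernel_conv \<beta> (deriv (v t)) x) \<le> C * (t' - t)\<^sup>2 \<and>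
    bnorm J (\<lambda>x. v t' x - v t x - (t' - t) * deriv (flux p \<delta> (u t)) x) \<le> C * (t' - t)\<^sup>2"
  "!!t t'. [|0 \<le> t; t \<le> t'; t' \<le> a|] ==>
    bdist (Suc J) (u t') (u t) \<le> C * (t' - t) \<and> bdist (Suc J) (v t') (v t) \<le> C * (t' - t)"
  "!!y M. [|y 0 = u0; !!x. continuous_on {0..a} (\<lambda>t. y t x);
    grid_solution \<beta> p \<delta> a v0 M y|] ==>
    \<forall>t\<in>{0..a}. y t = u t"
proof -
 define k where "k = Suc J + 2"
 have k: "2 \<le> k" "Suc J \<le> k" "1 \<le> k" by (simp_all add: k_def)
 \<comment> \<open>A large \<open>q\<close> gives the coarsest grid the step
   \<open>a / q \<le> \<delta>\<close>, while \<open>a\<close> is a grid point of every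
   grid.\<close>
 obtain q :: nat where q: "a / \<delta> + 1 \<le> real q" using real_arch_simple by blast
 have q0: "0 < real q" "a / \<delta> \<le> real q" using q a \<delta>(1) divide_pos_pos[OF a \<delta>(1)] by linarith+
 define h \<tau> where "h m = (1 / 2 :: real) ^ m" and "\<tau> m = a / (real q * 4 ^ m)" for m :: nat
 have h: "0 < h m" "h m \<le> 1" for m by (simp_all add: h_def power_le_one)
 have h_mono: "m \<le> m' ==> h m' \<le> h m" for m m' unfolding h_def by (intro power_decreasing) auto
 have h_lim: "h \<longlonglongrightarrow> 0" unfolding h_def by (intro LIMSEQ_power_zero) auto
 have \<tau>0: "0 < \<tau> m" for m using a q0 by (simp add: \<tau>_def)
 have \<tau>h: "\<tau> m \<le> \<delta> * (h m)\<^sup>2" for m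
 proof -
  have "a / real q \<le> \<delta>" using q0 \<delta>(1) by (simp add: field_simps)
  then have "a / real q * (1 / 4) ^ m \<le> \<delta> * (1 / 4) ^ m" by (intro mult_right_mono) auto
  moreover have "(h m)\<^sup>2 = (1 / 4) ^ m" using power_even_eq[of "1 / 2 :: real" m] by (simp add: h_def power_mult_distrib[symmetric] power2_eq_square)
  ultimately show ?thesis by (simp add: \<tau>_def power_divide)
 qed
 have \<tau>_le_h: "\<tau> m \<le> h m" for m
 proof -
  have "\<delta> * (h m)\<^sup>2 \<le> 1 * (h m * 1)" unfolding power2_eq_square using \<delta> h[of m] by (intro mult_mono) auto
  then show ?thesis using \<tau>h[of m] by simp
 qed
 have \<tau>1: "\<tau> m \<le> 1" for m using \<tau>_le_h[of m] h(2)[of m] by linarith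
 have \<tau>_lim: "\<tau> \<longlonglongrightarrow> 0"
  by (rule tendsto_sandwich[OF _ _ tendsto_const h_lim]) (auto intro!: always_eventually less_imp_le[OF \<tau>0] \<tau>_le_h)
 have \<tau>r: "real (4 ^ (m' - m)) * \<tau> m' = \<tau> m" if mm: "m \<le> m'" for m m'
 proof -
  obtain i where "m' = m + i" using le_Suc_ex[OF mm] by blast
  then show ?thesis using q0 by (simp add: \<tau>_def power_add)
 qed
 define N where "N m = q * 4 ^ m" for m
 have N: "real (N m) * \<tau> m = a" for m using q0 by (simp add: N_def \<tau>_def)
 define U V where "U m n = fst (euler \<beta> p \<delta> (h m) (\<tau> m) u0 v0 n)" and "V m n = snd (euler \<beta> p \<delta> (h m) (\<tau> m) u0 v0 n)" for m n
 have nN: "real n * \<tau> m \<le> a" if "n \<le> N m" for n m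
 proof -
  have "real n * \<tau> m \<le> real (N m) * \<tau> m" using that \<tau>0[of m] by (intro mult_right_mono) auto
  then show ?thesis using N by simp
 qed
 have SBm: "bsob k (U m n) \<and> bsob k (V m n) \<and> bnorm k (U m n) + bnorm k (V m n) \<le> \<Lambda>" if "n \<le> N m" for n m
  unfolding U_def V_def k_def by (rule SB[OF h(1) \<tau>0 \<tau>1 \<tau>h nN[OF that]])
 have UV: "bsob k (U m n)" "bsob k (V m n)" "bnorm k (U m n) \<le> \<Lambda>" "bnorm k (V m n) \<le> \<Lambda>" if "n \<le> N m" for m n
  using SBm[OF that] bnorm_nonneg[of k "U m n"] bnorm_nonneg[of k "V m n"] by linarith+
 have j: "1 \<le> Suc J" by simp
 have \<delta>0: "0 \<le> \<delta>" using \<delta>(1) by simp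
 obtain D where D: "1 \<le> D"
  and DD: "!!m. \<forall>n\<le>N m. \<forall>l\<le>n.
    increment_bound \<beta> p \<delta> (Suc J) D (h m) (real (n - l) * \<tau> m) (U m l) (V m l) (U m n) (V m n)"
 proof (rule euler_consistency[OF ker ell p j \<Lambda> \<delta>0])
  fix D assume D: "1 \<le> D" and DD: "!!h \<tau> u0 v0 N. [|0 < h; 0 < \<tau>;
   !!n. n \<le> N ==> bpair (Suc J + 2) \<Lambda> (euler \<beta> p \<delta> h \<tau> u0 v0 n)|] ==>
   \<forall>n\<le>N. \<forall>m\<le>n.
    increment_bound \<beta> p \<delta> (Suc J) D h (real (n - m) * \<tau>) (fst (euler \<beta> p \<delta> h \<tau> u0 v0 m)) (snd (euler \<beta> p \<delta> h \<tau> u0 v0 m)) (fst (euler \<beta> p \<delta> h \<tau> u0 v0 n)) (snd (euler \<beta> p \<delta> h \<tau> u0 v0 n))"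
  show thesis
   by (rule that[OF D]) (unfold U_def V_def, rule DD[OF h(1) \<tau>0], rule SBm[unfolded U_def V_def k_def])
 qed
 have comparison: "\<exists>C\<ge>0. \<forall>m y z \<eta>. 0 \<le> \<eta> \<longrightarrow> y 0 = u0 \<longrightarrow> z 0 = v0 \<longrightarrow>
   (\<forall>n\<le>N m. bsob 2 (y n) \<and> bsob 2 (z n) \<and> bnorm 2 (y n) \<le> M \<and> bnorm 2 (z n) \<le> M) \<longrightarrow>
   (\<forall>n<N m. step_error \<beta> p \<delta> (\<tau> m) (\<tau> m * \<eta>) (y n) (z n) (y (Suc n)) (z (Suc n))) \<longrightarrow>
   (\<forall>n\<le>N m. ndist (y n) (U m n) + ndist (z n) (V m n) \<le> C * (h m + \<eta>))" if M: "\<Lambda> \<le> M" for M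
 proof -
  have a0: "0 \<le> a" using a by simp
  show ?thesis
  proof (rule euler_comparison[OF ker ell p k(1) \<Lambda> M \<delta>(1) \<delta>(3)[folded k_def] a0])
   fix C :: real
   assume C: "0 \<le> C" and CC: "!!h \<tau> u0 v0 N y z \<eta>. [|0 < h; 0 < \<tau>; \<tau> \<le> 1; \<tau> \<le> \<delta> * h\<^sup>2; 0 \<le> \<eta>; real N * \<tau> \<le> a;
    !!n. n \<le> N ==> bpair k \<Lambda> (euler \<beta> p \<delta> h \<tau> u0 v0 n);
    !!n. n \<le> N ==> bsob 2 (y n) \<and> bsob 2 (z n) \<and> bnorm 2 (y n) \<le> M \<and> bnorm 2 (z n) \<le> M;
    y 0 = u0; z 0 = v0;
    !!n. n < N ==> nm (\<lambda>x. y (Suc n) x - y n x - \<tau> * kernel_conv \<beta> (deriv (z n)) x) \<le> \<tau> * \<eta>;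
    !!n. n < N ==> nm (\<lambda>x. z (Suc n) x - z n x - \<tau> * deriv (flux p \<delta> (y n)) x) \<le> \<tau> * \<eta>|] ==>
    \<forall>n\<le>N. ndist (y n) (fst (euler \<beta> p \<delta> h \<tau> u0 v0 n)) + ndist (z n) (snd (euler \<beta> p \<delta> h \<tau> u0 v0 n))
     \<le> C * (h + \<eta>)"
   have Na: "real (N m) * \<tau> m \<le> a" for m using N by simp
   show ?thesis
   proof (intro exI[of _ C] conjI C allI impI)
    fix m y z \<eta> n
    assume "0 \<le> \<eta>" "y 0 = u0" "z 0 = v0"
     and Y: "\<forall>n\<le>N m. bsob 2 (y n) \<and> bsob 2 (z n) \<and> bnorm 2 (y n) \<le> M \<and> bnorm 2 (z n) \<le> M"
     and R: "\<forall>n<N m. step_error \<beta> p \<delta> (\<tau> m) (\<tau> m * \<eta>) (y n) (z n) (y (Suc n)) (z (Suc n))"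
     and n: "n \<le> N m"
    have "\<forall>n\<le>N m. ndist (y n) (fst (euler \<beta> p \<delta> (h m) (\<tau> m) u0 v0 n)) + ndist (z n) (snd (euler \<beta> p \<delta> (h m) (\<tau> m) u0 v0 n))
     \<le> C * (h m + \<eta>)"
    proof (rule CC[OF h(1) \<tau>0 \<tau>1 \<tau>h \<open>0 \<le> \<eta>\<close> Na])
     show "bpair k \<Lambda> (euler \<beta> p \<delta> (h m) (\<tau> m) u0 v0 n)" if "n \<le> N m" for n
      using SBm[OF that] unfolding U_def V_def .
    qed (use Y R \<open>y 0 = u0\<close> \<open>z 0 = v0\<close> in auto)
    then show "ndist (y n) (U m n) + ndist (z n) (V m n) \<le> C * (h m + \<eta>)"
     using n unfolding U_def V_def by blast
   qed
  qed
 qed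
 define iu where "iu m t = grid_index (\<tau> m) t" for m t
 have iN: "iu m t \<le> N m" if "t \<in> {0..a}" for m t
 proof -
  have "real (iu m t) * \<tau> m \<le> real (N m) * \<tau> m"
   using grid_index_bounds(1)[OF \<tau>0[of m], of t] that N[of m] by (simp add: iu_def)
  then show ?thesis using \<tau>0[of m] by simp
 qed
 have ib: "real (iu m t) * \<tau> m \<le> t" "t < real (iu m t) * \<tau> m + \<tau> m" if "t \<in> {0..a}" for m t
  using grid_index_bounds[OF \<tau>0[of m], of t] that by (auto simp: iu_def)
 have ilim: "(\<lambda>m. real (iu m t) * \<tau> m) \<longlonglongrightarrow> t" if t: "t \<in> {0..a}" for t
 proof -
  have "(\<lambda>m. real (iu m t) * \<tau> m - t) \<longlonglongrightarrow> 0"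
  proof (rule Lim_null_comparison[OF _ \<tau>_lim], intro always_eventually allI)
   show "norm (real (iu m t) * \<tau> m - t) \<le> \<tau> m" for m using ib[OF t, of m] by (simp add: abs_le_iff)
  qed
  then show ?thesis by (rule LIM_zero_cancel)
 qed
 have b2: "bsob 2 (U m n)" "bsob 2 (V m n)" "bnorm 2 (U m n) \<le> \<Lambda>" "bnorm 2 (V m n) \<le> \<Lambda>" if "n \<le> N m" for m n
  using UV[OF that] bsob_mono[OF _ k(1)] bnorm_mono[OF k(1), of "U m n"] bnorm_mono[OF k(1), of "V m n"] by auto
 obtain CL where CL: "0 \<le> CL" "!!m y z \<eta> n. [|0 \<le> \<eta>; y 0 = u0; z 0 = v0;
   \<forall>n\<le>N m. bsob 2 (y n) \<and> bsob 2 (z n) \<and> bnorm 2 (y n) \<le> \<Lambda> \<and> bnorm 2 (z n) \<le> \<Lambda>;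
   \<forall>n<N m. step_error \<beta> p \<delta> (\<tau> m) (\<tau> m * \<eta>) (y n) (z n) (y (Suc n)) (z (Suc n)); n \<le> N m|] ==>
   ndist (y n) (U m n) + ndist (z n) (V m n) \<le> CL * (h m + \<eta>)"
  using comparison[OF order_refl] by blast
 \<comment> \<open>The comparison on the coarse grid, plus the motion of the fine orbit between the
   coarse and the fine grid point below \<open>t\<close>.\<close>
 define CC where "CC = CL * (1 + 2 * D) + D"
 have CC0: "0 \<le> CC" using CL D by (simp add: CC_def)
 have Cauchy: "ndist (U m' (iu m' t)) (U m (iu m t)) \<le> CC * h m \<and> ndist (V m' (iu m' t)) (V m (iu m t)) \<le> CC * h m"
  if mm: "m \<le> m'" and t: "t \<in> {0..a}" for m m' t
 proof -
  define r where "r = (4::nat) ^ (m' - m)"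
  have r: "real r * \<tau> m' = \<tau> m" "r * N m = N m'" using \<tau>r[OF mm] mm unfolding r_def N_def
   by (simp_all add: power_add[symmetric] mult.left_commute)
  have rn: "r * n \<le> N m'" if "n \<le> N m" for n using that r(2) by (metis mult_le_mono2)
  have res: "\<forall>n<N m. step_error \<beta> p \<delta> (\<tau> m) (\<tau> m * (2 * D * h m)) (U m' (r * n)) (V m' (r * n)) (U m' (r * Suc n)) (V m' (r * Suc n))"
  proof (intro allI impI)
   fix n assume n: "n < N m"
   have 1: "r * Suc n \<le> N m'" "r * n \<le> r * Suc n" "r * Suc n - r * n = r" using rn[of "Suc n"] n by auto
   \<comment> \<open>Between two coarse grid points the elapsed time is
     \<open>\<tau> m \<le> h m\<close>, so the residual of the fine orbit is of order
     \<open>h m\<close> per unit of time.\<close>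
   have "h m' + \<tau> m \<le> 2 * h m" using h_mono[OF mm] \<tau>_le_h[of m] by linarith
   then have 2: "D * \<tau> m * (h m' + \<tau> m) \<le> \<tau> m * (2 * D * h m)"
    using mult_left_mono[of "h m' + \<tau> m" "2 * h m" "D * \<tau> m"] D \<tau>0[of m] by (simp add: ac_simps)
   from DD[of m', rule_format, OF 1(1,2)] have
    "bnorm (Suc J) (\<lambda>x. U m' (r * Suc n) x - U m' (r * n) x - \<tau> m * kernel_conv \<beta> (deriv (V m' (r * n))) x) \<le> D * \<tau> m * (h m' + \<tau> m)"
    "bnorm (Suc J) (\<lambda>x. V m' (r * Suc n) x - V m' (r * n) x - \<tau> m * deriv (flux p \<delta> (U m' (r * n))) x) \<le> D * \<tau> m * (h m' + \<tau> m)"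
    unfolding 1(3) r(1) by blast+
   then show "step_error \<beta> p \<delta> (\<tau> m) (\<tau> m * (2 * D * h m)) (U m' (r * n)) (V m' (r * n)) (U m' (r * Suc n)) (V m' (r * Suc n))"
    using 2 nm_le_bnorm order_trans by meson
  qed
  have init: "U m' (r * 0) = u0" "V m' (r * 0) = v0" by (simp_all add: U_def V_def euler_def)
  have cmp: "ndist (U m' (r * iu m t)) (U m (iu m t)) + ndist (V m' (r * iu m t)) (V m (iu m t)) \<le> CL * (h m + 2 * D * h m)"
   by (rule CL(2)[of "2 * D * h m" "\<lambda>n. U m' (r * n)" "\<lambda>n. V m' (r * n)" m "iu m t"])
    (use D h[of m] init res iN[OF t] b2 rn in \<open>auto intro!: mult_nonneg_nonneg\<close>)
  have ge: "r * iu m t \<le> iu m' t"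
   unfolding iu_def[of m'] using ib(1)[OF t, of m] r(1) by (intro grid_index_ge[OF \<tau>0]) (simp add: mult.commute[of "real r"] mult.assoc)
  have gap: "real (iu m' t - r * iu m t) * \<tau> m' \<le> h m"
  proof -
   have "real (iu m' t - r * iu m t) * \<tau> m' = real (iu m' t) * \<tau> m' - real (iu m t) * (real r * \<tau> m')"
    using ge by (simp add: of_nat_diff algebra_simps)
   also have "... \<le> \<tau> m" using ib(1)[OF t, of m'] ib(2)[OF t, of m] unfolding r(1) by linarith
   finally show ?thesis using \<tau>_le_h[of m] by linarith
  qed
  have inc: "ndist (U m' (iu m' t)) (U m' (r * iu m t)) \<le> D * h m" "ndist (V m' (iu m' t)) (V m' (r * iu m t)) \<le> D * h m"
   using DD[of m', rule_format, OF iN[OF t] ge] nm_le_bnorm order_trans mult_left_mono[OF gap, of D] D by (meson le_numeral_extra(1) order_trans)+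
  have rI: "r * iu m t \<le> N m'" by (rule rn[OF iN[OF t]])
  have tri: "ndist f g \<le> ndist f e + ndist e g" if "bsob 2 f" "bsob 2 e" "bsob 2 g" for f e g
   using nm_triangle[OF sq_diff[OF bsob_sq[OF that(1)] bsob_sq[OF that(2)]] sq_diff[OF bsob_sq[OF that(2)] bsob_sq[OF that(3)]]] by simp
  have e: "CL * (h m + 2 * D * h m) + D * h m = CC * h m" by (simp add: CC_def algebra_simps)
  have "ndist (U m' (iu m' t)) (U m (iu m t)) \<le> CC * h m"
   using tri[OF b2(1)[OF iN[OF t, of m']] b2(1)[OF rI] b2(1)[OF iN[OF t, of m]]] inc(1) cmp
    nm_nonneg[of "\<lambda>x. V m' (r * iu m t) x - V m (iu m t) x"] e by linarith
  moreover have "ndist (V m' (iu m' t)) (V m (iu m t)) \<le> CC * h m"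
   using tri[OF b2(2)[OF iN[OF t, of m']] b2(2)[OF rI] b2(2)[OF iN[OF t, of m]]] inc(2) cmp
    nm_nonneg[of "\<lambda>x. U m' (r * iu m t) x - U m (iu m t) x"] e by linarith
  ultimately show ?thesis ..
 qed
 have CauchyE: "\<exists>n0. \<forall>m\<ge>n0. \<forall>n\<ge>n0. ndist (W m) (W n) \<le> e"
  if e: "e > 0" and W: "!!m m'. m \<le> m' ==> ndist (W m') (W m) \<le> CC * h m" for W :: "nat => real => real" and e
 proof -
  have "(\<lambda>m. CC * h m) \<longlonglongrightarrow> CC * 0" by (intro tendsto_intros h_lim)
  then obtain n0 where n0: "!!m. m \<ge> n0 ==> CC * h m < e"
   using order_tendstoD(2)[of "\<lambda>m. CC * h m" 0 sequentially e] e by (auto simp: eventually_sequentially)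
  have "ndist (W m) (W n) \<le> e" if "m \<ge> n0" "n \<ge> n0" for m n
   using W[of n m] W[of m n] n0[OF that(1)] n0[OF that(2)] nm_minus_commute[of "W m" "W n"]
   by (cases "n \<le> m") auto
  then show ?thesis by blast
 qed
 have lims: "\<exists>u v. bsob (Suc J) u \<and> (\<lambda>m. bdist (Suc J) (U m (iu m t)) u) \<longlonglongrightarrow> 0 \<and> bnorm (Suc J) u \<le> \<Lambda> \<and>
   bsob (Suc J) v \<and> (\<lambda>m. bdist (Suc J) (V m (iu m t)) v) \<longlonglongrightarrow> 0 \<and> bnorm (Suc J) v \<le> \<Lambda>" if t: "t \<in> {0..a}" for t
 proof -
  note UVt = UV[OF iN[OF t], unfolded k_def]
  obtain u where u: "bsob (Suc J) u" "(\<lambda>m. bdist (Suc J) (U m (iu m t)) u) \<longlonglongrightarrow> 0" "bnorm (Suc J) u \<le> \<Lambda>"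
   using bsob_limit[of "Suc J" "\<lambda>m. U m (iu m t)" \<Lambda>, OF UVt(1,3) CauchyE[of _ "\<lambda>m. U m (iu m t)"]] Cauchy[OF _ t] by blast
  obtain v where v: "bsob (Suc J) v" "(\<lambda>m. bdist (Suc J) (V m (iu m t)) v) \<longlonglongrightarrow> 0" "bnorm (Suc J) v \<le> \<Lambda>"
   using bsob_limit[of "Suc J" "\<lambda>m. V m (iu m t)" \<Lambda>, OF UVt(2,4) CauchyE[of _ "\<lambda>m. V m (iu m t)"]] Cauchy[OF _ t] by blast
  show ?thesis using u v by blast
 qed
 define P where "P t w \<longleftrightarrow> bsob (Suc J) (fst w) \<and> (\<lambda>m. bdist (Suc J) (U m (iu m t)) (fst w)) \<longlonglongrightarrow> 0 \<and> bnorm (Suc J) (fst w) \<le> \<Lambda> \<and>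
   bsob (Suc J) (snd w) \<and> (\<lambda>m. bdist (Suc J) (V m (iu m t)) (snd w)) \<longlonglongrightarrow> 0 \<and> bnorm (Suc J) (snd w) \<le> \<Lambda>" for t and w :: "(real => real) \<times> (real => real)"
 have "\<exists>w. P t w" if "t \<in> {0..a}" for t
  using lims[OF that] unfolding P_def split_paired_Ex fst_conv snd_conv .
 then obtain w where w: "!!t. t \<in> {0..a} ==> P t (w t)" by metis
 define u v where "u t = fst (w t)" and "v t = snd (w t)" for t
 have uv: "bsob (Suc J) (u t)" "(\<lambda>m. bdist (Suc J) (U m (iu m t)) (u t)) \<longlonglongrightarrow> 0" "bnorm (Suc J) (u t) \<le> \<Lambda>"
  "bsob (Suc J) (v t)" "(\<lambda>m. bdist (Suc J) (V m (iu m t)) (v t)) \<longlonglongrightarrow> 0" "bnorm (Suc J) (v t) \<le> \<Lambda>" if "t \<in> {0..a}" for t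
  using w[OF that] unfolding P_def u_def v_def by auto
 have lJ: "(\<lambda>m. bnorm J (f m)) \<longlonglongrightarrow> 0" if "(\<lambda>m. bnorm (Suc J) (f m)) \<longlonglongrightarrow> 0" for f :: "nat => real => real"
  by (rule tendsto_sandwich[OF _ _ tendsto_const that]) (auto simp del: bnorm.simps intro!: always_eventually bnorm_Suc_mono)
 have bJ: "bsob (Suc J) (U m (iu m t))" "bsob (Suc J) (V m (iu m t))" if "t \<in> {0..a}" for m t
  using bsob_mono[OF _ k(2)] UV[OF iN[OF that]] by blast+
 have start: "u 0 = u0" "v 0 = v0"
 proof -
  have z: "0 \<in> {0..a}" using a by simp
  have i0: "iu m 0 = 0" for m by (simp add: iu_def grid_index_def)
  have c: "U m (iu m 0) = u0" "V m (iu m 0) = v0" for m by (simp_all add: i0 U_def V_def euler_def)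
  have b: "bsob (Suc J) u0" "bsob (Suc J) v0" using bJ[OF z] unfolding c by auto
  have "bdist (Suc J) u0 (u 0) = 0" "bdist (Suc J) v0 (v 0) = 0"
   using uv(2,5)[OF z] unfolding c by (simp_all add: LIMSEQ_const_iff del: bnorm.simps)
  then have "\<bar>u0 x - u 0 x\<bar> \<le> 0" "\<bar>v0 x - v 0 x\<bar> \<le> 0" for x
   using sup_le_bnorm'[OF bsob_diff(1)[OF b(1) uv(1)[OF z]], of x] sup_le_bnorm'[OF bsob_diff(1)[OF b(2) uv(4)[OF z]], of x] by simp_all
  then have "u0 x = u 0 x" "v0 x = v 0 x" for x by simp_all
  then show "u 0 = u0" "v 0 = v0" unfolding fun_eq_iff by simp_all
 qed
 obtain CF where CF: "1 \<le> CF" "!!u w. bsob (Suc J) u ==> bsob (Suc J) w ==> bnorm (Suc J) u \<le> \<Lambda> ==> bnorm (Suc J) w \<le> \<Lambda> ==>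
  bdist (Suc J) (flux p \<delta> u) (flux p \<delta> w) \<le> CF * bdist (Suc J) u w"
  by (rule bnorm_flux_diff[OF j]) (rule that)
 \<comment> \<open>In the limit the elapsed time tends to \<open>t' - t\<close> and
   \<open>h m\<close> to 0, so the bounds of \<open>increment_bound\<close> become quadratic and
   linear in \<open>t' - t\<close>.\<close>
 have quad: "bnorm J (\<lambda>x. u t' x - u t x - (t' - t) * kernel_conv \<beta> (deriv (v t)) x) \<le> D * (t' - t)\<^sup>2 \<and>
    bnorm J (\<lambda>x. v t' x - v t x - (t' - t) * deriv (flux p \<delta> (u t)) x) \<le> D * (t' - t)\<^sup>2 \<and>
    bdist (Suc J) (u t') (u t) \<le> D * (t' - t) \<and> bdist (Suc J) (v t') (v t) \<le> D * (t' - t)"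
  if tt: "0 \<le> t" "t \<le> t'" "t' \<le> a" for t t'
 proof -
  have t: "t \<in> {0..a}" and t': "t' \<in> {0..a}" using tt by auto
  have im: "iu m t \<le> iu m t'" for m unfolding iu_def by (rule grid_index_mono[OF \<tau>0 tt(1,2)])
  define s where "s m = real (iu m t' - iu m t) * \<tau> m" for m
  have s: "s \<longlonglongrightarrow> t' - t"
  proof -
   have "s m = real (iu m t') * \<tau> m - real (iu m t) * \<tau> m" for m using im[of m] by (simp add: s_def of_nat_diff algebra_simps)
   then have "s = (\<lambda>m. real (iu m t') * \<tau> m - real (iu m t) * \<tau> m)" by (rule ext)
   then show ?thesis using tendsto_diff[OF ilim[OF t'] ilim[OF t]] by (simp only:)
  qed
  note DDm = DD[rule_format, OF iN[OF t'] im, folded s_def]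
  have E: "(\<lambda>m. D * s m * (h m + s m)) \<longlonglongrightarrow> D * (t' - t) * (0 + (t' - t))" by (intro tendsto_intros s h_lim)
  then have E: "(\<lambda>m. D * s m * (h m + s m)) \<longlonglongrightarrow> D * (t' - t)\<^sup>2" by (simp add: power2_eq_square mult.assoc)
  have Es: "(\<lambda>m. D * s m) \<longlonglongrightarrow> D * (t' - t)" by (intro tendsto_intros s)
  have bs: "bsob J (U m (iu m t))" "bsob J (U m (iu m t'))" "bsob J (V m (iu m t))" "bsob J (V m (iu m t'))" for m
   using bJ[OF t] bJ[OF t'] bsob_Suc by blast+
  have bl: "bsob J (u t)" "bsob J (u t')" "bsob J (v t)" "bsob J (v t')"
   using uv(1,4)[OF t] uv(1,4)[OF t'] bsob_Suc by blast+
  have W1: "bsob J (kernel_conv \<beta> (deriv (V m (iu m t))))" "bsob J (kernel_conv \<beta> (deriv (v t)))" for m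
   using bJ[OF t] uv(4)[OF t] by (auto intro!: bsob_kernel_conv(1)[OF ker])
  have W2: "bsob J (deriv (flux p \<delta> (U m (iu m t))))" "bsob J (deriv (flux p \<delta> (u t)))" for m
   using bsob_SucD(3)[OF bsob_flux[OF bJ(1)[OF t]]] bsob_SucD(3)[OF bsob_flux[OF uv(1)[OF t]]] by auto
  have W1l: "(\<lambda>m. bdist J (kernel_conv \<beta> (deriv (V m (iu m t)))) (kernel_conv \<beta> (deriv (v t)))) \<longlonglongrightarrow> 0"
  proof (rule tendsto_sandwich[OF _ _ tendsto_const tendsto_mult_right_zero[OF uv(5)[OF t], of "kmass \<beta>"]])
   show "\<forall>\<^sub>F m in sequentially. bdist J (kernel_conv \<beta> (deriv (V m (iu m t)))) (kernel_conv \<beta> (deriv (v t)))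
     \<le> kmass \<beta> * bdist (Suc J) (V m (iu m t)) (v t)"
   proof (intro always_eventually allI)
    fix m
    have d: "bsob J (deriv (V m (iu m t)))" "bsob J (deriv (v t))" using bJ(2)[OF t, of m] uv(4)[OF t] by auto
    have "bdist J (kernel_conv \<beta> (deriv (V m (iu m t)))) (kernel_conv \<beta> (deriv (v t)))
      \<le> kmass \<beta> * bdist J (deriv (V m (iu m t))) (deriv (v t))"
     using bsob_kernel_conv(2)[OF ker bsob_diff(1)[OF d]] by (simp add: kernel_conv_diff[OF ker bsob_bcl[OF d(1)] bsob_bcl[OF d(2)]])
    also have "... \<le> kmass \<beta> * bdist (Suc J) (V m (iu m t)) (v t)"
     using bnorm_deriv_le[of J "\<lambda>x. V m (iu m t) x - v t x"] kmass_ge_1[of \<beta>]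
     unfolding deriv_diff_bsob[OF bJ(2)[OF t] uv(4)[OF t]] by (intro mult_left_mono) auto
    finally show "bdist J (kernel_conv \<beta> (deriv (V m (iu m t)))) (kernel_conv \<beta> (deriv (v t)))
      \<le> kmass \<beta> * bdist (Suc J) (V m (iu m t)) (v t)" .
   qed
  qed auto
  have W2l: "(\<lambda>m. bdist J (deriv (flux p \<delta> (U m (iu m t)))) (deriv (flux p \<delta> (u t)))) \<longlonglongrightarrow> 0"
  proof (rule tendsto_sandwich[OF _ _ tendsto_const tendsto_mult_right_zero[OF uv(2)[OF t], of CF]])
   show "\<forall>\<^sub>F m in sequentially. bdist J (deriv (flux p \<delta> (U m (iu m t)))) (deriv (flux p \<delta> (u t)))
     \<le> CF * bdist (Suc J) (U m (iu m t)) (u t)"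
   proof (intro always_eventually allI)
    fix m
    have L: "bnorm (Suc J) (U m (iu m t)) \<le> \<Lambda>" using order_trans[OF bnorm_mono[OF k(2)] UV(3)[OF iN[OF t]]] .
    have "bdist J (deriv (flux p \<delta> (U m (iu m t)))) (deriv (flux p \<delta> (u t)))
      \<le> bdist (Suc J) (flux p \<delta> (U m (iu m t))) (flux p \<delta> (u t))"
     using bnorm_deriv_le[of J "\<lambda>x. flux p \<delta> (U m (iu m t)) x - flux p \<delta> (u t) x"]
     unfolding deriv_diff_bsob[OF bsob_flux[OF bJ(1)[OF t]] bsob_flux[OF uv(1)[OF t]]] .
    also have "... \<le> CF * bdist (Suc J) (U m (iu m t)) (u t)" by (rule CF(2)[OF bJ(1)[OF t] uv(1)[OF t] L uv(3)[OF t]])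
    finally show "bdist J (deriv (flux p \<delta> (U m (iu m t)))) (deriv (flux p \<delta> (u t)))
      \<le> CF * bdist (Suc J) (U m (iu m t)) (u t)" .
   qed
  qed auto
  have 1: "bnorm J (\<lambda>x. u t' x - u t x - (t' - t) * kernel_conv \<beta> (deriv (v t)) x) \<le> D * (t' - t)\<^sup>2"
   by (rule bnorm_limit_difference[OF bs(1,2) W1(1) bl(1,2) W1(2) lJ[OF uv(2)[OF t]] lJ[OF uv(2)[OF t']] W1l s E])
    (use DDm order_trans[OF bnorm_Suc_mono] in blast)
  have 2: "bnorm J (\<lambda>x. v t' x - v t x - (t' - t) * deriv (flux p \<delta> (u t)) x) \<le> D * (t' - t)\<^sup>2"
   by (rule bnorm_limit_difference[OF bs(3,4) W2(1) bl(3,4) W2(2) lJ[OF uv(5)[OF t]] lJ[OF uv(5)[OF t']] W2l s E])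
    (use DDm order_trans[OF bnorm_Suc_mono] in blast)
  \<comment> \<open>Constant 0 as direction turns the same limit lemma into a Lipschitz
    bound.\<close>
  have z: "bsob (Suc J) (\<lambda>x. 0)" "(\<lambda>m::nat. bnorm (Suc J) (\<lambda>x. 0 - 0)) \<longlonglongrightarrow> 0" by (simp_all del: bnorm.simps bsob.simps)
  have 3: "bnorm (Suc J) (\<lambda>x. u t' x - u t x - (t' - t) * 0) \<le> D * (t' - t)"
   by (rule bnorm_limit_difference[OF bJ(1)[OF t] bJ(1)[OF t'] z(1) uv(1)[OF t] uv(1)[OF t'] z(1) uv(2)[OF t] uv(2)[OF t'] z(2) s Es])
    (use DDm order_trans[OF bnorm_Suc_mono] in \<open>simp del: bnorm.simps; blast\<close>)
  have 4: "bnorm (Suc J) (\<lambda>x. v t' x - v t x - (t' - t) * 0) \<le> D * (t' - t)"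
   by (rule bnorm_limit_difference[OF bJ(2)[OF t] bJ(2)[OF t'] z(1) uv(4)[OF t] uv(4)[OF t'] z(1) uv(5)[OF t] uv(5)[OF t'] z(2) s Es])
    (use DDm order_trans[OF bnorm_Suc_mono] in \<open>simp del: bnorm.simps; blast\<close>)
  show ?thesis using 1 2 3 4 by (simp del: bnorm.simps)
 qed
 have ucont: "continuous_on {0..a} (\<lambda>t. u t x)" for x
 proof -
  have le: "\<bar>u t' x - u t x\<bar> \<le> D * \<bar>t' - t\<bar>" if "t \<in> {0..a}" "t' \<in> {0..a}" "t \<le> t'" for t t'
   using sup_le_bnorm'[OF bsob_diff(1)[OF uv(1)[OF that(2)] uv(1)[OF that(1)]] j, of x] quad[of t t'] that by auto
  have "D-lipschitz_on {0..a} (\<lambda>t. u t x)"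
  proof (rule lipschitz_onI)
   show "dist (u t x) (u t' x) \<le> D * dist t t'" if "t \<in> {0..a}" "t' \<in> {0..a}" for t t'
    using le[OF that] le[OF that(2,1)] by (cases "t \<le> t'") (auto simp: dist_real_def abs_minus_commute)
  qed (use D in simp)
  then show ?thesis by (rule lipschitz_on_continuous_on)
 qed
 show thesis
 proof (rule that[of D u v])
  show "0 \<le> D" using D by simp
  show "u 0 = u0" "v 0 = v0" by (rule start)+
  show "bsob (Suc J) (u t) \<and> bsob (Suc J) (v t) \<and> bnorm (Suc J) (u t) \<le> \<Lambda> \<and> bnorm (Suc J) (v t) \<le> \<Lambda>" if "t \<in> {0..a}" for t
   using uv[OF that] by blast
  show "bnorm J (\<lambda>x. u t' x - u t x - (t' - t) * kernel_conv \<beta> (deriv (v t)) x) \<le> D * (t' - t)\<^sup>2 \<and>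
    bnorm J (\<lambda>x. v t' x - v t x - (t' - t) * deriv (flux p \<delta> (u t)) x) \<le> D * (t' - t)\<^sup>2" if "0 \<le> t" "t \<le> t'" "t' \<le> a" for t t'
   using quad[OF that] by blast
  show "bdist (Suc J) (u t') (u t) \<le> D * (t' - t) \<and> bdist (Suc J) (v t') (v t) \<le> D * (t' - t)" if "0 \<le> t" "t \<le> t'" "t' \<le> a" for t t'
   using quad[OF that] by blast
  fix y M
  assume y0: "y 0 = u0" and ycont: "!!x. continuous_on {0..a} (\<lambda>t. y t x)"
   and approx: "grid_solution \<beta> p \<delta> a v0 M y"
  \<comment> \<open>One bound for the samples and for the orbits, as the comparison asks for
    \<open>\<Lambda> \<le> M'\<close>.\<close>
  define M' where "M' = max M \<Lambda>"
  have M': "\<Lambda> \<le> M'" "M \<le> M'" by (simp_all add: M'_def)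
  obtain C where C: "0 \<le> C" "!!m y z \<eta> n. [|0 \<le> \<eta>; y 0 = u0; z 0 = v0;
   \<forall>n\<le>N m. bsob 2 (y n) \<and> bsob 2 (z n) \<and> bnorm 2 (y n) \<le> M' \<and> bnorm 2 (z n) \<le> M';
   \<forall>n<N m. step_error \<beta> p \<delta> (\<tau> m) (\<tau> m * \<eta>) (y n) (z n) (y (Suc n)) (z (Suc n)); n \<le> N m|] ==>
   ndist (y n) (U m n) + ndist (z n) (V m n) \<le> C * (h m + \<eta>)"
   using comparison[OF M'(1)] by blast
  have key: "\<exists>m1. \<forall>m\<ge>m1. \<forall>n\<le>N m. bsob 2 (y (real n * \<tau> m)) \<and> ndist (y (real n * \<tau> m)) (U m n) \<le> C * (h m + \<eta>)" if \<eta>: "0 < \<eta>" for \<eta>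
  proof -
   obtain \<tau>1 where t1: "0 < \<tau>1" "!!\<tau> N. 0 < \<tau> ==> \<tau> < \<tau>1 ==> real N * \<tau> \<le> a ==> (\<exists>z. z 0 = v0 \<and>
      (\<forall>n\<le>N. bsob 2 (y (real n * \<tau>)) \<and> bsob 2 (z n) \<and> bnorm 2 (y (real n * \<tau>)) \<le> M \<and> bnorm 2 (z n) \<le> M) \<and>
      (\<forall>n<N. step_error \<beta> p \<delta> \<tau> (\<tau> * \<eta>) (y (real n * \<tau>)) (z n) (y (real (Suc n) * \<tau>)) (z (Suc n))))"
    using approx \<eta> unfolding grid_solution_def by blast
   obtain m1 where m1: "!!m. m \<ge> m1 ==> \<tau> m < \<tau>1"
    using order_tendstoD(2)[OF \<tau>_lim t1(1)] by (auto simp: eventually_sequentially)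
   have "bsob 2 (y (real n * \<tau> m)) \<and> ndist (y (real n * \<tau> m)) (U m n) \<le> C * (h m + \<eta>)" if m: "m \<ge> m1" and n: "n \<le> N m" for m n
   proof -
    obtain z where z: "z 0 = v0"
     "\<forall>n\<le>N m. bsob 2 (y (real n * \<tau> m)) \<and> bsob 2 (z n) \<and> bnorm 2 (y (real n * \<tau> m)) \<le> M \<and> bnorm 2 (z n) \<le> M"
     "\<forall>n<N m. step_error \<beta> p \<delta> (\<tau> m) (\<tau> m * \<eta>) (y (real n * \<tau> m)) (z n) (y (real (Suc n) * \<tau> m)) (z (Suc n))"
     using t1(2)[OF \<tau>0[of m] m1[OF m], of "N m"] N[of m] by auto
    have z2: "\<forall>n\<le>N m. bsob 2 (y (real n * \<tau> m)) \<and> bsob 2 (z n) \<and> bnorm 2 (y (real n * \<tau> m)) \<le> M' \<and> bnorm 2 (z n) \<le> M'"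
     using z(2) M'(2) order_trans by blast
    have y00: "y (real 0 * \<tau> m) = u0" using y0 by simp
    have "ndist (y (real n * \<tau> m)) (U m n) + ndist (z n) (V m n) \<le> C * (h m + \<eta>)"
     by (rule C(2)[of \<eta> "\<lambda>n. y (real n * \<tau> m)" z m n, OF less_imp_le[OF \<eta>] y00 z(1) z2 z(3) n])
    then have "ndist (y (real n * \<tau> m)) (U m n) \<le> C * (h m + \<eta>)"
     using nm_nonneg[of "\<lambda>x. z n x - V m n x"] by linarith
    then show ?thesis using z(2) n by blast
   qed
   then show ?thesis by blast
  qed
  \<comment> \<open>A grid point of level \<open>m0\<close> lies on all finer grids, with its index
    multiplied by a power of 4. There the distance to the orbits is at most
    \<open>C * (h m + \<eta>)\<close>; first \<open>m\<close> tends to infinity, then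
    \<open>\<eta>\<close> to 0.\<close>
  have grid: "y t = u t" if t: "t = real i * \<tau> m0" and i: "i \<le> N m0" for t i m0
  proof -
   have ta: "t \<in> {0..a}" using t nN[OF i] \<tau>0[of m0] by simp
   have tm: "t = real (4 ^ (m - m0) * i) * \<tau> m" "4 ^ (m - m0) * i \<le> N m" if m: "m \<ge> m0" for m
   proof -
    show t2: "t = real (4 ^ (m - m0) * i) * \<tau> m" unfolding t using \<tau>r[OF m] by (simp add: mult.assoc mult.left_commute[of "real i"] mult.commute)
    have "real (4 ^ (m - m0) * i) * \<tau> m \<le> real (N m) * \<tau> m" unfolding t2[symmetric] N using ta by simp
    then have "real (4 ^ (m - m0) * i) \<le> real (N m)" using \<tau>0[of m] mult_le_cancel_right_pos by blast
    then show "4 ^ (m - m0) * i \<le> N m" unfolding of_nat_le_iff .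
   qed
   have idx: "iu m t = 4 ^ (m - m0) * i" if "m \<ge> m0" for m
    unfolding iu_def tm(1)[OF that] by (rule grid_index_eq[OF \<tau>0])
   have yb: "bsob 2 (y t)"
   proof -
    obtain m1 where "\<forall>m\<ge>m1. \<forall>n\<le>N m. bsob 2 (y (real n * \<tau> m)) \<and> ndist (y (real n * \<tau> m)) (U m n) \<le> C * (h m + 1)"
     using key[of 1] by auto
    then show ?thesis using tm[of "max m0 m1"] by (metis max.cobounded1 max.cobounded2)
   qed
   have ub: "bsob 2 (u t)" using bsob_mono[OF uv(1)[OF ta], of 2] J by simp
   have "ndist (y t) (u t) \<le> C * \<eta>" if \<eta>: "0 < \<eta>" for \<eta>
   proof -
    obtain m1 where m1: "\<forall>m\<ge>m1. \<forall>n\<le>N m. bsob 2 (y (real n * \<tau> m)) \<and> ndist (y (real n * \<tau> m)) (U m n) \<le> C * (h m + \<eta>)"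
     using key[OF \<eta>] by auto
    have le: "ndist (y t) (u t) \<le> C * (h m + \<eta>) + bdist (Suc J) (U m (iu m t)) (u t)" if m: "m \<ge> max m0 m1" for m
    proof -
     have m': "m \<ge> m0" "m \<ge> m1" using m by auto
     have "ndist (y t) (U m (iu m t)) \<le> C * (h m + \<eta>)"
      using m1[rule_format, OF m'(2) tm(2)[OF m'(1)]] unfolding tm(1)[OF m'(1), symmetric] idx[OF m'(1)] by blast
     moreover have "ndist (y t) (u t) \<le> ndist (y t) (U m (iu m t)) + ndist (U m (iu m t)) (u t)"
      using nm_triangle[OF sq_diff[OF bsob_sq[OF yb] bsob_sq[OF b2(1)[OF iN[OF ta, of m]]]] sq_diff[OF bsob_sq[OF b2(1)[OF iN[OF ta, of m]]] bsob_sq[OF ub]]] by simp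
     ultimately show ?thesis using nm_le_bnorm[of "\<lambda>x. U m (iu m t) x - u t x" "Suc J"] by linarith
    qed
    have "(\<lambda>m. C * (h m + \<eta>) + bdist (Suc J) (U m (iu m t)) (u t)) \<longlonglongrightarrow> C * (0 + \<eta>) + 0"
     by (intro tendsto_intros h_lim uv(2)[OF ta])
    then have "ndist (y t) (u t) \<le> C * (0 + \<eta>) + 0"
     by (rule tendsto_lowerbound) (use le in \<open>auto simp: eventually_sequentially simp del: bnorm.simps intro!: exI[of _ "max m0 m1"]\<close>)
    then show ?thesis by simp
   qed
   then have le: "ndist (y t) (u t) \<le> e" if "0 < e" for e
   proof -
    have "C * (e / (C + 1)) \<le> e" using that C(1) by (simp add: field_simps)
    moreover have "0 < e / (C + 1)" using that C(1) by simp
    ultimately show ?thesis using \<open>!!\<eta>. 0 < \<eta> ==> ndist (y t) (u t) \<le> C * \<eta>\<close> order_trans by blast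
   qed
   have "ndist (y t) (u t) \<le> 0" by (rule dense_ge) (rule le)
   then have "ndist (y t) (u t) = 0" by (intro order_antisym) auto
   then have "y t x - u t x = 0" for x using nm_zero_imp_zero[OF bsob_diff(1)[OF yb ub]] by blast
   then show ?thesis by (intro ext) simp
  qed
  \<comment> \<open>Grid points are dense, and both functions are continuous in time at each
    \<open>x\<close>.\<close>
  show "\<forall>t\<in>{0..a}. y t = u t"
  proof (intro ballI ext)
   fix t x assume t: "t \<in> {0..a}"
   have ta: "real (iu m t) * \<tau> m \<in> {0..a}" for m using nN[OF iN[OF t]] \<tau>0[of m] by simp
   have e: "y (real (iu m t) * \<tau> m) x = u (real (iu m t) * \<tau> m) x" for m using grid[OF refl iN[OF t]] by simp
   have "(\<lambda>m. y (real (iu m t) * \<tau> m) x) \<longlonglongrightarrow> y t x"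
    using continuous_on_tendsto_compose[OF ycont ilim[OF t] t] ta by simp
   moreover have "(\<lambda>m. u (real (iu m t) * \<tau> m) x) \<longlonglongrightarrow> u t x"
    using continuous_on_tendsto_compose[OF ucont ilim[OF t] t] ta by simp
   ultimately show "y t x = u t x" unfolding e using LIMSEQ_unique by blast
  qed
 qed
qed

end

section \<open>Solutions of the nonlocal wave equation\<close>

lemma sobolev_linear:
 assumes f: "f \<in> sobolev r" and g: "g \<in> sobolev r"
 shows "(\<lambda>x. a * f x + b * g x) \<in> sobolev r"
proof -
 let ?h = "\<lambda>x. a * f x + b * g x"
 let ?w = "\<lambda>\<xi>::real. (1 + \<xi>\<^sup>2) powr r"
 have l: "ltame f" "ltame g" "ltame ?h" using sobolev_ltame[OF f] sobolev_ltame[OF g] by (auto intro: ltame_add ltame_cmult)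
 have [measurable]: "fourier f \<in> borel_measurable borel" "fourier g \<in> borel_measurable borel" "fourier ?h \<in> borel_measurable borel"
  using fourier_csq[OF l(1)] fourier_csq[OF l(2)] fourier_csq[OF l(3)] by (auto simp: csq_def)
 \<comment> \<open>\<open>fourier\<close> is a choice among transforms and therefore linear only
   almost everywhere.\<close>
 have ae: "AE \<xi> in lborel. fourier ?h \<xi> = complex_of_real a * fourier f \<xi> + complex_of_real b * fourier g \<xi>"
  by (rule fourier_AE[OF l(3)]) (rule has_fourier_transform_linear[OF l(1) has_fourier_transform_exists[OF l(1)] l(2) has_fourier_transform_exists[OF l(2)]])
 have i: "integrable lborel (\<lambda>\<xi>. ?w \<xi> * (cmod (fourier f \<xi>))\<^sup>2)" "integrable lborel (\<lambda>\<xi>. ?w \<xi> * (cmod (fourier g \<xi>))\<^sup>2)"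
  using f g by (auto simp: sobolev_def)
 have "integrable lborel (\<lambda>\<xi>. ?w \<xi> * (cmod (fourier ?h \<xi>))\<^sup>2)"
 proof (rule Bochner_Integration.integrable_bound)
  show "integrable lborel (\<lambda>\<xi>. 2 * a\<^sup>2 * (?w \<xi> * (cmod (fourier f \<xi>))\<^sup>2) + 2 * b\<^sup>2 * (?w \<xi> * (cmod (fourier g \<xi>))\<^sup>2))"
   by (intro Bochner_Integration.integrable_add integrable_mult_right i)
  show "AE \<xi> in lborel. norm (?w \<xi> * (cmod (fourier ?h \<xi>))\<^sup>2)
    \<le> norm (2 * a\<^sup>2 * (?w \<xi> * (cmod (fourier f \<xi>))\<^sup>2) + 2 * b\<^sup>2 * (?w \<xi> * (cmod (fourier g \<xi>))\<^sup>2))"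
   using ae
  proof eventually_elim
   case (elim \<xi>)
   have "cmod (fourier ?h \<xi>) \<le> \<bar>a\<bar> * cmod (fourier f \<xi>) + \<bar>b\<bar> * cmod (fourier g \<xi>)"
    unfolding elim by (rule order_trans[OF norm_triangle_ineq]) (simp add: norm_mult)
   then have "(cmod (fourier ?h \<xi>))\<^sup>2 \<le> (\<bar>a\<bar> * cmod (fourier f \<xi>) + \<bar>b\<bar> * cmod (fourier g \<xi>))\<^sup>2"
    by (rule power_mono) simp
   also have "... \<le> 2 * (\<bar>a\<bar> * cmod (fourier f \<xi>))\<^sup>2 + 2 * (\<bar>b\<bar> * cmod (fourier g \<xi>))\<^sup>2"
    using sum_squares_bound[of "\<bar>a\<bar> * cmod (fourier f \<xi>)" "\<bar>b\<bar> * cmod (fourier g \<xi>)"] unfolding power2_sum by linarith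
   also have "... = 2 * a\<^sup>2 * (cmod (fourier f \<xi>))\<^sup>2 + 2 * b\<^sup>2 * (cmod (fourier g \<xi>))\<^sup>2" by (simp add: power_mult_distrib)
   finally have "?w \<xi> * (cmod (fourier ?h \<xi>))\<^sup>2 \<le> ?w \<xi> * (2 * a\<^sup>2 * (cmod (fourier f \<xi>))\<^sup>2 + 2 * b\<^sup>2 * (cmod (fourier g \<xi>))\<^sup>2)"
    by (rule mult_left_mono) simp
   then show ?case by (simp add: algebra_simps)
  qed
 qed measurable
 moreover have "continuous_on UNIV ?h" "integrable lborel (\<lambda>x. (?h x)\<^sup>2)"
  using f ltame_sq[OF l(3)] g by (auto simp: sobolev_def sq_def intro!: continuous_intros)
 ultimately show ?thesis by (simp add: sobolev_def)
qed

section \<open>Continuous curves of functions\<close>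

definition bsob_curve :: "nat => real => (real => real => real) => bool" where
 "bsob_curve k a f \<longleftrightarrow> (\<forall>t\<in>{0..a}. bsob k (f t) \<and> ((\<lambda>s. bdist k (f s) (f t)) \<longlongrightarrow> 0) (at t within {0..a}))"

lemma bsob_curve_mono:
 assumes "bsob_curve k a f" "j \<le> k"
 shows "bsob_curve j a f"
 unfolding bsob_curve_def
proof (intro ballI conjI)
 fix t assume t: "t \<in> {0..a}"
 then have f: "bsob k (f t)" "((\<lambda>s. bdist k (f s) (f t)) \<longlongrightarrow> 0) (at t within {0..a})"
  using assms(1) by (auto simp: bsob_curve_def)
 show "bsob j (f t)" by (rule bsob_mono[OF f(1) assms(2)])
 show "((\<lambda>s. bdist j (f s) (f t)) \<longlongrightarrow> 0) (at t within {0..a})"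
  by (rule tendsto_sandwich[OF _ _ tendsto_const f(2)]) (auto intro!: always_eventually bnorm_mono assms(2))
qed

lemma bsob_curve_transform:
 assumes f: "bsob_curve k a f" and C: "0 \<le> C"
  and g: "!!t. t \<in> {0..a} ==> bsob j (g t)"
  and le: "!!s t. s \<in> {0..a} ==> t \<in> {0..a} ==> bdist j (g s) (g t) \<le> C * bdist k (f s) (f t)"
 shows "bsob_curve j a g"
 unfolding bsob_curve_def
proof (intro ballI conjI)
 fix t assume t: "t \<in> {0..a}"
 then have lim: "((\<lambda>s. bdist k (f s) (f t)) \<longlongrightarrow> 0) (at t within {0..a})"
  using f by (auto simp: bsob_curve_def)
 show "bsob j (g t)" by (rule g[OF t])
 show "((\<lambda>s. bdist j (g s) (g t)) \<longlongrightarrow> 0) (at t within {0..a})"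
 proof (rule tendsto_sandwich[OF _ _ tendsto_const tendsto_mult_right_zero[OF lim, of C]])
  show "\<forall>\<^sub>F s in at t within {0..a}. bdist j (g s) (g t) \<le> C * bdist k (f s) (f t)"
   unfolding eventually_at using le t by (intro exI[of _ 1]) auto
 qed auto
qed

text \<open>Compactness of the interval, through a Lebesgue number of the cover by balls of radius
  \<open>d t\<close>.\<close>

lemma bsob_curve_uniform:
 assumes f: "bsob_curve k a f" and e: "0 < e"
 shows "\<exists>d>0. \<forall>s\<in>{0..a}. \<forall>t\<in>{0..a}. \<bar>s - t\<bar> < d \<longrightarrow> bdist k (f s) (f t) \<le> e"
proof -
 have bs: "bsob k (f t)" if "t \<in> {0..a}" for t using f that by (auto simp: bsob_curve_def)
 have "\<exists>d>0. \<forall>s\<in>{0..a}. \<bar>s - t\<bar> < d \<longrightarrow> bdist k (f s) (f t) \<le> e / 2" if t: "t \<in> {0..a}" for t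
 proof -
  have lim: "((\<lambda>s. bdist k (f s) (f t)) \<longlongrightarrow> 0) (at t within {0..a})"
   using f t by (auto simp: bsob_curve_def)
  have "\<forall>\<^sub>F s in at t within {0..a}. bdist k (f s) (f t) < e / 2"
   by (rule order_tendstoD(2)[OF lim]) (use e in simp)
  then obtain d where d: "d > 0" "!!s. s \<in> {0..a} ==> s \<noteq> t ==> dist s t < d ==> bdist k (f s) (f t) < e / 2"
   unfolding eventually_at by blast
  have "bdist k (f s) (f t) \<le> e / 2" if "s \<in> {0..a}" "\<bar>s - t\<bar> < d" for s
   using d(2)[OF that(1)] that(2) e by (cases "s = t") (auto simp: dist_real_def less_imp_le simp del: bnorm.simps)
  then show ?thesis using d(1) by blast
 qed
 then obtain d where d: "!!t. t \<in> {0..a} ==> d t > 0"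
  "!!s t. t \<in> {0..a} ==> s \<in> {0..a} ==> \<bar>s - t\<bar> < d t ==> bdist k (f s) (f t) \<le> e / 2"
  by metis
 have cover: "{0..a} \<subseteq> \<Union> ((\<lambda>t. ball t (d t)) ` {0..a})" using d(1) by force
 obtain c where c: "0 < c" "!!x. x \<in> {0..a} ==> \<exists>G\<in>(\<lambda>t. ball t (d t)) ` {0..a}. ball x c \<subseteq> G"
  by (rule Heine_Borel_lemma[OF compact_Icc cover]) auto
 have "bdist k (f s) (f t) \<le> e" if s: "s \<in> {0..a}" and t: "t \<in> {0..a}" and st: "\<bar>s - t\<bar> < c" for s t
 proof -
  obtain r where r: "r \<in> {0..a}" "ball s c \<subseteq> ball r (d r)" using c(2)[OF s] by auto
  have "s \<in> ball r (d r)" "t \<in> ball r (d r)" using r(2) c(1) st by (auto simp: subset_iff dist_real_def)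
  then have "\<bar>s - r\<bar> < d r" "\<bar>t - r\<bar> < d r" by (auto simp: dist_real_def abs_minus_commute)
  then have "bdist k (f s) (f r) \<le> e / 2" "bdist k (f t) (f r) \<le> e / 2"
   using d(2)[OF r(1) s] d(2)[OF r(1) t] by blast+
  then show ?thesis
   using bnorm_diff_triangle[OF bs[OF s] bs[OF r(1)] bs[OF t]] bnorm_minus_commute[OF bs[OF t] bs[OF r(1)]] by linarith
 qed
 then show ?thesis using c(1) by blast
qed

lemma bsob_curve_bounded:
 assumes f: "bsob_curve k a f"
 shows "\<exists>M. \<forall>t\<in>{0..a}. bnorm k (f t) \<le> M"
proof -
 have bs: "bsob k (f t)" if "t \<in> {0..a}" for t using f that by (auto simp: bsob_curve_def)
 have "continuous_on {0..a} (\<lambda>t. bnorm k (f t))"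
  unfolding continuous_on_iff
 proof (intro ballI allI impI)
  fix t e :: real assume t: "t \<in> {0..a}" and e: "0 < e"
  obtain d where d: "d > 0" "\<forall>s\<in>{0..a}. \<forall>t\<in>{0..a}. \<bar>s - t\<bar> < d \<longrightarrow> bdist k (f s) (f t) \<le> e / 2"
   using bsob_curve_uniform[OF f, of "e / 2"] e by auto
  have "dist (bnorm k (f s)) (bnorm k (f t)) < e" if s: "s \<in> {0..a}" and st: "dist s t < d" for s
  proof -
   have "bdist k (f s) (f t) \<le> e / 2" using d(2) s t st by (auto simp: dist_real_def simp del: bnorm.simps)
   then show ?thesis
    using bnorm_le_add_diff[OF bs[OF s] bs[OF t]] bnorm_le_add_diff[OF bs[OF t] bs[OF s]] bnorm_minus_commute[OF bs[OF t] bs[OF s]] e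
    unfolding dist_real_def abs_less_iff by linarith
  qed
  then show "\<exists>d>0. \<forall>s\<in>{0..a}. dist s t < d \<longrightarrow> dist (bnorm k (f s)) (bnorm k (f t)) < e" using d(1) by blast
 qed
 then have "bounded ((\<lambda>t. bnorm k (f t)) ` {0..a})" by (intro compact_imp_bounded compact_continuous_image compact_Icc)
 then show ?thesis by (auto simp: bounded_iff simp del: bnorm.simps intro: order_trans[OF abs_ge_self])
qed

lemma bsob_curve_continuous:
 assumes f: "bsob_curve k a f" and k: "1 \<le> k"
 shows "continuous_on ({0..a} \<times> UNIV) (\<lambda>(t, x). f t x)"
 unfolding continuous_on_iff
proof (intro ballI allI impI)
 fix z :: "real \<times> real" and e :: real assume z: "z \<in> {0..a} \<times> UNIV" and e: "0 < e"
 obtain t x where zt: "z = (t, x)" "t \<in> {0..a}" using z by (cases z) auto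
 have bs: "bsob k (f t)" if "t \<in> {0..a}" for t using f that by (auto simp: bsob_curve_def)
 obtain d where d: "d > 0" "\<forall>s\<in>{0..a}. \<forall>t\<in>{0..a}. \<bar>s - t\<bar> < d \<longrightarrow> bdist k (f s) (f t) \<le> e / 3"
  using bsob_curve_uniform[OF f, of "e / 3"] e by auto
 obtain d' where d': "d' > 0" "!!y. dist y x < d' ==> dist (f t y) (f t x) < e / 3"
  using bcl_isCont[OF bsob_bcl[OF bs[OF zt(2)]], of x] e unfolding continuous_at_eps_delta by (metis divide_pos_pos zero_less_numeral)
 have "dist (f s y) (f t x) < e" if s: "s \<in> {0..a}" and sy: "dist (s, y) (t, x) < min d d'" for s y
 proof -
  have 1: "\<bar>s - t\<bar> < d" "dist y x < d'"
   using sy dist_fst_le[of "(s, y)" "(t, x)"] dist_snd_le[of "(s, y)" "(t, x)"] by (auto simp: dist_real_def)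
  have "\<bar>f s y - f t y\<bar> \<le> e / 3"
   using sup_le_bnorm'[OF bsob_diff(1)[OF bs[OF s] bs[OF zt(2)]] k, of y] d(2) s zt(2) 1(1) by (meson order_trans)
  then show ?thesis using d'(2)[OF 1(2)] e unfolding dist_real_def by linarith
 qed
 then show "\<exists>d>0. \<forall>w\<in>{0..a} \<times> UNIV. dist w z < d \<longrightarrow> dist (case w of (t, x) => f t x) (case z of (t, x) => f t x) < e"
  using d(1) d'(1) unfolding zt(1) by (intro exI[of _ "min d d'"]) auto
qed

text \<open>Subtracting the tangent at \<open>t\<close> makes \<open>g r - g t\<close> the
  derivative in time. Uniform continuity of \<open>g\<close> bounds it, and the L2 mean value
  inequality integrates the bound. The modulus \<open>d\<close> is uniform in \<open>t\<close>, as
  all steps of a grid must satisfy the same estimate.\<close>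

lemma bsob_curve_first_order:
 assumes der: "!!t x. t \<in> {0..a} ==> ((\<lambda>s. f s x) has_real_derivative g t x) (at t within {0..a})"
  and g: "bsob_curve k a g" and k: "1 \<le> k" and e: "0 < e"
 shows "\<exists>d>0. \<forall>t s. 0 \<le> t \<longrightarrow> t \<le> s \<longrightarrow> s \<le> a \<longrightarrow> s < t + d \<longrightarrow>
  sq (\<lambda>x. f s x - f t x - (s - t) * g t x) \<and> nm (\<lambda>x. f s x - f t x - (s - t) * g t x) \<le> (s - t) * e"
proof -
 have bs: "bsob k (g t)" if "t \<in> {0..a}" for t using g that by (auto simp: bsob_curve_def)
 obtain d where d: "d > 0" "\<forall>s\<in>{0..a}. \<forall>t\<in>{0..a}. \<bar>s - t\<bar> < d \<longrightarrow> bdist k (g s) (g t) \<le> e"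
  using bsob_curve_uniform[OF g e] by auto
 have "sq (\<lambda>x. f s x - f t x - (s - t) * g t x) \<and> nm (\<lambda>x. f s x - f t x - (s - t) * g t x) \<le> (s - t) * e"
  if ts: "0 \<le> t" "t \<le> s" "s \<le> a" "s < t + d" for t s
 proof -
  have t: "t \<in> {0..a}" using ts by auto
  have sub: "{t..s} \<subseteq> {0..a}" using ts by auto
  have *: "sq (\<lambda>x. (f s x - s * g t x) - (f t x - t * g t x))" "nm (\<lambda>x. (f s x - s * g t x) - (f t x - t * g t x)) \<le> (s - t) * e"
  proof (rule_tac [!] nm_mean_value[where \<phi> = "\<lambda>r x. f r x - r * g t x" and \<psi> = "\<lambda>r x. g r x - g t x", OF ts(2)])
   show "((\<lambda>r. f r x - r * g t x) has_real_derivative g r x - g t x) (at r within {t..s})" if "r \<in> {t..s}" for r x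
    using DERIV_subset[OF der[of r x] sub] sub that by (auto intro!: derivative_eq_intros)
   then show "((\<lambda>r. f r x - r * g t x) has_real_derivative g r x - g t x) (at r within {t..s})" if "r \<in> {t..s}" for r x
    using that by blast
   have "continuous_on ({t..s} \<times> UNIV) (\<lambda>z. (\<lambda>(r, x). g r x) z - g t (snd z))"
    by (intro continuous_on_diff continuous_on_subset[OF bsob_curve_continuous[OF g k]] continuous_on_compose2[OF bcl_continuous[OF bsob_bcl[OF bs[OF t]]]] continuous_intros)
     (use sub in auto)
   then show "continuous_on ({t..s} \<times> UNIV) (\<lambda>(r, x). g r x - g t x)"
    by (simp add: case_prod_unfold)
   then show "continuous_on ({t..s} \<times> UNIV) (\<lambda>(r, x). g r x - g t x)" .
   show sqd: "sq (\<lambda>x. g r x - g t x)" if "r \<in> {t..s}" for r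
    by (rule bsob_sq[OF bsob_diff(1)[OF bs bs[OF t]]]) (use that sub in auto)
   then show "sq (\<lambda>x. g r x - g t x)" if "r \<in> {t..s}" for r using that by blast
   show "ndist (g r) (g t) \<le> e" if "r \<in> {t..s}" for r
    by (rule order_trans[OF nm_le_bnorm d(2)[rule_format]]) (use that ts t in auto)
   then show "ndist (g r) (g t) \<le> e" if "r \<in> {t..s}" for r using that by blast
  qed
  have "(\<lambda>x. (f s x - s * g t x) - (f t x - t * g t x)) = (\<lambda>x. f s x - f t x - (s - t) * g t x)" by (intro ext) (simp add: algebra_simps)
  then show ?thesis using * by (simp only:)
 qed
 then show ?thesis using d(1) by blast
qed

section \<open>Curves in Sobolev spaces and their samples\<close>

lemma C0_sobolev_curve:
 assumes f: "f \<in> C0_sobolev a r" and k: "real k + 1 \<le> r"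
 shows "bsob_curve k a f"
 unfolding bsob_curve_def
proof (intro ballI conjI)
 fix t assume t: "t \<in> {0..a}"
 then have ft: "f t \<in> sobolev r" and lim: "((\<lambda>s. sobolev_norm r (\<lambda>x. f s x - f t x)) \<longlongrightarrow> 0) (at t within {0..a})"
  using f by (auto simp: C0_sobolev_def)
 show "bsob k (f t)" by (rule sobolev_bsob(1)[OF ft k])
 show "((\<lambda>s. bdist k (f s) (f t)) \<longlongrightarrow> 0) (at t within {0..a})"
 proof (rule tendsto_sandwich[OF _ _ tendsto_const tendsto_mult_right_zero[OF lim, of "real (Suc k)"]])
  have "bdist k (f s) (f t) \<le> real (Suc k) * sobolev_norm r (\<lambda>x. f s x - f t x)" if "s \<in> {0..a}" for s
  proof -
   have "f s \<in> sobolev r" using f that by (auto simp: C0_sobolev_def)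
   then show ?thesis using sobolev_bsob(2)[OF sobolev_linear[of "f s" r "f t" 1 "-1"] k] ft by simp
  qed
  then show "\<forall>\<^sub>F s in at t within {0..a}. bdist k (f s) (f t) \<le> real (Suc k) * sobolev_norm r (\<lambda>x. f s x - f t x)"
   unfolding eventually_at by (intro exI[of _ 1]) auto
 qed auto
qed

lemma C1_sobolev_has_derivative:
 assumes f: "f \<in> C1_sobolev a r" and r: "2 \<le> r" and t: "t \<in> {0..a}"
 shows "((\<lambda>s. f s x) has_real_derivative time_deriv a f t x) (at t within {0..a})"
proof -
 let ?q = "\<lambda>s x. (f s x - f t x) / (s - t) - time_deriv a f t x"
 have lim: "((\<lambda>s. sobolev_norm r (?q s)) \<longlongrightarrow> 0) (at t within {0..a})" using f t by (auto simp: C1_sobolev_def)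
 have fs: "f s \<in> sobolev r" "time_deriv a f s \<in> sobolev r" if "s \<in> {0..a}" for s
  using f that by (auto simp: C1_sobolev_def C0_sobolev_def)
 have q: "?q s \<in> sobolev r" if s: "s \<in> {0..a}" for s
  using sobolev_linear[OF sobolev_linear[OF fs(1)[OF s] fs(1)[OF t], of "1 / (s - t)" "- 1 / (s - t)"] fs(2)[OF t], of 1 "-1"]
  by (simp add: diff_divide_distrib)
 have le: "\<bar>?q s x\<bar> \<le> 2 * sobolev_norm r (?q s)" if "s \<in> {0..a}" for s
  using sup_le_bnorm[OF sobolev_bsob(1)[OF q[OF that]], of x] sobolev_bsob(2)[OF q[OF that], of "Suc 0"] r by simp
 have "((\<lambda>s. ?q s x) \<longlongrightarrow> 0) (at t within {0..a})"
 proof (rule Lim_null_comparison[OF _ tendsto_mult_right_zero[OF lim, of 2]])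
  show "\<forall>\<^sub>F s in at t within {0..a}. norm (?q s x) \<le> 2 * sobolev_norm r (?q s)"
   unfolding eventually_at using le by (intro exI[of _ 1]) (auto simp: real_norm_def)
 qed
 then show ?thesis unfolding has_field_derivative_iff by (rule LIM_zero_cancel)
qed

lemma bsob_curve_deriv:
 assumes "bsob_curve (Suc k) a f" shows "bsob_curve k a (\<lambda>t. deriv (f t))"
proof (rule bsob_curve_transform[OF assms, of 1])
 have bs: "bsob (Suc k) (f t)" if "t \<in> {0..a}" for t using assms that by (auto simp: bsob_curve_def)
 show "bsob k (deriv (f t))" if "t \<in> {0..a}" for t using bs[OF that] by simp
 show "bdist k (deriv (f s)) (deriv (f t)) \<le> 1 * bdist (Suc k) (f s) (f t)" if "s \<in> {0..a}" "t \<in> {0..a}" for s t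
  using bnorm_deriv_le[of k "\<lambda>x. f s x - f t x"] unfolding deriv_diff_bsob[OF bs[OF that(1)] bs[OF that(2)]] mult_1_left .
qed simp

lemma bsob_curve_kernel_conv:
 assumes ker: "is_kernel \<beta>" and f: "bsob_curve k a f" shows "bsob_curve k a (\<lambda>t. kernel_conv \<beta> (f t))"
proof (rule bsob_curve_transform[OF f, of "kmass \<beta>"])
 have bs: "bsob k (f t)" if "t \<in> {0..a}" for t using f that by (auto simp: bsob_curve_def)
 show "0 \<le> kmass \<beta>" using kmass_ge_1[of \<beta>] by simp
 show "bsob k (kernel_conv \<beta> (f t))" if "t \<in> {0..a}" for t by (rule bsob_kernel_conv(1)[OF ker bs[OF that]])
 show "bdist k (kernel_conv \<beta> (f s)) (kernel_conv \<beta> (f t)) \<le> kmass \<beta> * bdist k (f s) (f t)" if "s \<in> {0..a}" "t \<in> {0..a}" for s t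
  using bsob_kernel_conv(2)[OF ker bsob_diff(1)[OF bs[OF that(1)] bs[OF that(2)]]]
  unfolding kernel_conv_diff[OF ker bsob_bcl[OF bs[OF that(1)]] bsob_bcl[OF bs[OF that(2)]]] .
qed

lemma bsob_curve_flux:
 assumes f: "bsob_curve k a f" and k: "1 \<le> k" shows "bsob_curve k a (\<lambda>t. flux p \<delta> (f t))"
proof -
 have bs: "bsob k (f t)" if "t \<in> {0..a}" for t using f that by (auto simp: bsob_curve_def)
 obtain M where M: "\<forall>t\<in>{0..a}. bnorm k (f t) \<le> M" using bsob_curve_bounded[OF f] by blast
 show ?thesis
 proof (rule bnorm_flux_diff[OF k, where \<Lambda> = M and p = p and \<delta> = \<delta>])
  fix C assume C: "1 \<le> C" "!!u w. bsob k u ==> bsob k w ==> bnorm k u \<le> M ==> bnorm k w \<le> M ==>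
   bdist k (flux p \<delta> u) (flux p \<delta> w) \<le> C * bdist k u w"
  show ?thesis
  proof (rule bsob_curve_transform[OF f, of C])
   show "0 \<le> C" using C(1) by simp
   show "bsob k (flux p \<delta> (f t))" if "t \<in> {0..a}" for t by (rule bsob_flux[OF bs[OF that]])
   show "bdist k (flux p \<delta> (f s)) (flux p \<delta> (f t)) \<le> C * bdist k (f s) (f t)" if "s \<in> {0..a}" "t \<in> {0..a}" for s t
    by (rule C(2)[OF bs[OF that(1)] bs[OF that(2)]]) (use M that in blast)+
  qed
 qed
qed

text \<open>An arbitrary solution comes without a function \<open>v\<close> such that
  \<open>y\<^sub>t = K v\<^sub>x\<close>. The partner \<open>z\<close> is therefore built from
  \<open>y\<close> by summing the fluxes, which makes the second equation of the scheme exact. For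
  the first one the velocity \<open>q\<close> has to stay close to \<open>W n\<close>, the convolved
  derivative of \<open>z n\<close>: both start from the same value by \<open>q0\<close>, and both
  have the increment \<open>\<tau> * G\<close> in each step, up to a small error for
  \<open>q\<close>.\<close>

lemma grid_solution_exact:
 assumes ker: "is_kernel \<beta>" and a: "0 \<le> a" and y: "bsob_curve 3 a y" and q: "bsob_curve 1 a q" and v0: "bsob 2 v0"
  and yq: "!!t x. t \<in> {0..a} ==> ((\<lambda>s. y s x) has_real_derivative q t x) (at t within {0..a})"
  and qf: "!!t x. t \<in> {0..a} ==>
   ((\<lambda>s. q s x) has_real_derivative kernel_conv \<beta> (deriv (deriv (flux p \<delta> (y t)))) x) (at t within {0..a})"
  and q0: "q 0 = kernel_conv \<beta> (deriv v0)"
 shows "\<exists>M. grid_solution \<beta> p \<delta> a v0 M y"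
proof -
 define F where "F t = deriv (flux p \<delta> (y t))" for t
 define G where "G t = kernel_conv \<beta> (deriv (F t))" for t
 have "bsob_curve (Suc 2) a (\<lambda>t. flux p \<delta> (y t))" using bsob_curve_flux[OF y] by (simp add: numeral_3_eq_3)
 then have F: "bsob_curve 2 a F" unfolding F_def by (rule bsob_curve_deriv)
 then have "bsob_curve (Suc 1) a F" by (simp add: numeral_2_eq_2)
 then have G: "bsob_curve 1 a G" unfolding G_def by (intro bsob_curve_kernel_conv[OF ker] bsob_curve_deriv)
 have y2: "bsob_curve 2 a y" by (rule bsob_curve_mono[OF y]) simp
 have bs: "bsob 2 (y t)" "bsob 2 (F t)" "bsob 1 (G t)" "bsob 1 (q t)" if "t \<in> {0..a}" for t
  using y2 F G q that unfolding bsob_curve_def by blast+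
 obtain My MF where M: "!!t. t \<in> {0..a} ==> bnorm 2 (y t) \<le> My" "!!t. t \<in> {0..a} ==> bnorm 2 (F t) \<le> MF"
  using bsob_curve_bounded[OF y2] bsob_curve_bounded[OF F] by blast
 have MF: "0 \<le> MF" using M(2)[of 0] bnorm_nonneg[of 2 "F 0"] a by (meson atLeastAtMost_iff order_refl order_trans)
 \<comment> \<open>The sums \<open>z n\<close> grow by at most \<open>MF\<close> per unit of
   time.\<close>
 define M where "M = max My (bnorm 2 v0 + a * MF)"
 have "\<exists>\<tau>0>0. \<forall>\<tau> N. 0 < \<tau> \<longrightarrow> \<tau> < \<tau>0 \<longrightarrow> real N * \<tau> \<le> a \<longrightarrow>
   (\<exists>z. z 0 = v0 \<and>
    (\<forall>n\<le>N. bsob 2 (y (real n * \<tau>)) \<and> bsob 2 (z n) \<and> bnorm 2 (y (real n * \<tau>)) \<le> M \<and> bnorm 2 (z n) \<le> M) \<and>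
    (\<forall>n<N. step_error \<beta> p \<delta> \<tau> (\<tau> * \<eta>) (y (real n * \<tau>)) (z n) (y (real (Suc n) * \<tau>)) (z (Suc n))))" if \<eta>: "0 < \<eta>" for \<eta>
 proof -
  \<comment> \<open>The error of \<open>q\<close> accumulates over the time \<open>a\<close>, so
    half of \<open>\<eta>\<close> is divided by \<open>a + 1\<close>, where the summand 1 covers
    \<open>a = 0\<close>. The other half serves the increments of \<open>y\<close>.\<close>
  define e where "e = \<eta> / (2 * (a + 1))"
  have e: "0 < e" "a * e \<le> \<eta> / 2" using \<eta> a by (simp_all add: e_def field_simps)
  have \<eta>2: "0 < \<eta> / 2" using \<eta> by simp
  have "\<exists>d>0. \<forall>t s. 0 \<le> t \<longrightarrow> t \<le> s \<longrightarrow> s \<le> a \<longrightarrow> s < t + d \<longrightarrow>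
   sq (\<lambda>x. y s x - y t x - (s - t) * q t x) \<and> nm (\<lambda>x. y s x - y t x - (s - t) * q t x) \<le> (s - t) * (\<eta> / 2)"
   by (rule bsob_curve_first_order[OF yq q order_refl \<eta>2])
  then obtain d1 where d1: "d1 > 0" "\<forall>t s. 0 \<le> t \<longrightarrow> t \<le> s \<longrightarrow> s \<le> a \<longrightarrow> s < t + d1 \<longrightarrow>
   sq (\<lambda>x. y s x - y t x - (s - t) * q t x) \<and> nm (\<lambda>x. y s x - y t x - (s - t) * q t x) \<le> (s - t) * (\<eta> / 2)"
   by blast
  have "\<exists>d>0. \<forall>t s. 0 \<le> t \<longrightarrow> t \<le> s \<longrightarrow> s \<le> a \<longrightarrow> s < t + d \<longrightarrow>
   sq (\<lambda>x. q s x - q t x - (s - t) * G t x) \<and> nm (\<lambda>x. q s x - q t x - (s - t) * G t x) \<le> (s - t) * e"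
   by (rule bsob_curve_first_order[OF qf[folded F_def, folded G_def] G order_refl e(1)])
  then obtain d2 where d2: "d2 > 0" "\<forall>t s. 0 \<le> t \<longrightarrow> t \<le> s \<longrightarrow> s \<le> a \<longrightarrow> s < t + d2 \<longrightarrow>
   sq (\<lambda>x. q s x - q t x - (s - t) * G t x) \<and> nm (\<lambda>x. q s x - q t x - (s - t) * G t x) \<le> (s - t) * e"
   by blast
  show ?thesis
  proof (intro exI[of _ "min d1 d2"] conjI allI impI)
   show "0 < min d1 d2" using d1 d2 by simp
   fix \<tau> :: real and N :: nat
   assume \<tau>: "0 < \<tau>" "\<tau> < min d1 d2" and N: "real N * \<tau> \<le> a"
   \<comment> \<open>A left Riemann sum of \<open>F\<close>, started at \<open>v0\<close>.\<close>
   define z where "z n x = v0 x + (\<Sum>i<n. \<tau> * F (real i * \<tau>) x)" for n x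
   have t: "real n * \<tau> \<in> {0..a}" if "n \<le> N" for n
   proof -
    have "real n * \<tau> \<le> real N * \<tau>" using that \<tau>(1) by (intro mult_right_mono) auto
    then have "real n * \<tau> \<le> a" using N by (rule order_trans)
    then show ?thesis using \<tau>(1) by simp
   qed
   have step: "real (Suc n) * \<tau> - real n * \<tau> = \<tau>" "real n * \<tau> \<le> real (Suc n) * \<tau>" "real (Suc n) * \<tau> < real n * \<tau> + min d1 d2" for n
    using \<tau> by (simp_all add: algebra_simps)
   have z: "bsob 2 (z n) \<and> bnorm 2 (z n) \<le> bnorm 2 v0 + real n * \<tau> * MF" if "n \<le> N" for n
    using that
   proof (induction n)
    case 0
    have "z 0 = v0" by (intro ext) (simp add: z_def)
    then show ?case using v0 by simp
   next
    case (Suc n)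
    have zS: "z (Suc n) = (\<lambda>x. z n x + \<tau> * F (real n * \<tau>) x)" by (intro ext) (simp add: z_def)
    have Fn: "bsob 2 (F (real n * \<tau>))" "\<tau> * bnorm 2 (F (real n * \<tau>)) \<le> \<tau> * MF"
     using bs(2)[OF t[of n]] M(2)[OF t[of n]] Suc.prems \<tau>(1) by (auto intro: mult_left_mono)
    have IH: "bsob 2 (z n)" "bnorm 2 (z n) \<le> bnorm 2 v0 + real n * \<tau> * MF" using Suc by simp_all
    have "real (Suc n) * \<tau> * MF = real n * \<tau> * MF + \<tau> * MF" "\<bar>\<tau>\<bar> = \<tau>" using \<tau>(1) by (simp_all add: algebra_simps)
    then have "bnorm 2 (z (Suc n)) \<le> bnorm 2 v0 + real (Suc n) * \<tau> * MF"
     using bsob_add(2)[OF IH(1) bsob_cmult(1)[OF Fn(1), of \<tau>]] bsob_cmult(2)[OF Fn(1), of \<tau>] Fn(2) IH(2) unfolding zS by simp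
    then show ?case using bsob_add(1)[OF IH(1) bsob_cmult(1)[OF Fn(1), of \<tau>]] unfolding zS by simp
   qed
   define W where "W n = kernel_conv \<beta> (deriv (z n))" for n
   have W_Suc: "W (Suc n) = (\<lambda>x. W n x + \<tau> * G (real n * \<tau>) x)" if n: "n < N" for n
   proof -
    have zn: "bsob (Suc 1) (z n)" and Fn: "bsob (Suc 1) (F (real n * \<tau>))"
     using z[of n] bs(2)[OF t[of n]] n by (simp_all only: Suc_1 less_imp_le)
    have "z (Suc n) = (\<lambda>x. z n x + \<tau> * F (real n * \<tau>) x)" by (intro ext) (simp add: z_def)
    then have "deriv (z (Suc n)) = (\<lambda>x. deriv (z n) x + \<tau> * deriv (F (real n * \<tau>)) x)"
     using deriv_add_bsob[OF zn bsob_cmult(1)[OF Fn, of \<tau>]] bsob_cmult(3)[OF Fn, of \<tau>] by (simp only:)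
    then show ?thesis
     unfolding W_def G_def
     using kernel_conv_add[OF ker bsob_bcl[OF bsob_SucD(3)[OF zn]] bsob_bcl[OF bsob_cmult(1)[OF bsob_SucD(3)[OF Fn], of \<tau>]]]
      kernel_conv_cmult[OF ker, of \<tau> "deriv (F (real n * \<tau>))"] by (simp only:)
   qed
   have qW: "sq (\<lambda>x. q (real n * \<tau>) x - W n x) \<and> ndist (q (real n * \<tau>)) (W n) \<le> real n * \<tau> * e" if "n \<le> N" for n
    using that
   proof (induction n)
    case 0
    have "z 0 = v0" by (intro ext) (simp add: z_def)
    then have "W 0 = q 0" by (simp add: W_def q0)
    then show ?case by simp
   next
    case (Suc n)
    let ?r = "\<lambda>x. q (real (Suc n) * \<tau>) x - q (real n * \<tau>) x - \<tau> * G (real n * \<tau>) x"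
    have r: "sq ?r" "nm ?r \<le> \<tau> * e"
     using d2(2)[rule_format, of "real n * \<tau>" "real (Suc n) * \<tau>"] t[of "Suc n"] t[of n] step[of n] Suc.prems unfolding step(1) by auto
    have IH: "sq (\<lambda>x. q (real n * \<tau>) x - W n x)" "ndist (q (real n * \<tau>)) (W n) \<le> real n * \<tau> * e" using Suc by simp_all
    have eq: "(\<lambda>x. q (real (Suc n) * \<tau>) x - W (Suc n) x) = (\<lambda>x. ?r x + (q (real n * \<tau>) x - W n x))"
     using W_Suc[of n] Suc.prems by (intro ext) simp
    have "real (Suc n) * \<tau> * e = \<tau> * e + real n * \<tau> * e" by (simp add: algebra_simps)
    then show ?case using sq_add[OF r(1) IH(1)] nm_triangle[OF r(1) IH(1)] r(2) IH(2) unfolding eq by linarith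
   qed
   show "\<exists>z. z 0 = v0 \<and>
    (\<forall>n\<le>N. bsob 2 (y (real n * \<tau>)) \<and> bsob 2 (z n) \<and> bnorm 2 (y (real n * \<tau>)) \<le> M \<and> bnorm 2 (z n) \<le> M) \<and>
    (\<forall>n<N. step_error \<beta> p \<delta> \<tau> (\<tau> * \<eta>) (y (real n * \<tau>)) (z n) (y (real (Suc n) * \<tau>)) (z (Suc n)))"
   proof (intro exI[of _ z] conjI allI impI)
    show "z 0 = v0" by (intro ext) (simp add: z_def)
    show "bsob 2 (y (real n * \<tau>))" "bsob 2 (z n)" "bnorm 2 (y (real n * \<tau>)) \<le> M" if "n \<le> N" for n
     using bs(1)[OF t[OF that]] z[OF that] order_trans[OF M(1)[OF t[OF that]]] by (auto simp: M_def)
    show "bnorm 2 (z n) \<le> M" if "n \<le> N" for n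
    proof -
     have "real n * \<tau> * MF \<le> a * MF" using t[OF that] MF by (intro mult_right_mono) auto
     then show ?thesis using z[OF that] unfolding M_def by linarith
    qed
    fix n assume n: "n < N"
    have nN: "n \<le> N" using n by simp
    have Y: "sq (\<lambda>x. y (real (Suc n) * \<tau>) x - y (real n * \<tau>) x - \<tau> * q (real n * \<tau>) x)"
     "nm (\<lambda>x. y (real (Suc n) * \<tau>) x - y (real n * \<tau>) x - \<tau> * q (real n * \<tau>) x) \<le> \<tau> * (\<eta> / 2)"
     using d1(2)[rule_format, of "real n * \<tau>" "real (Suc n) * \<tau>"] t[of "Suc n"] t[of n] step[of n] n unfolding step(1) by auto
    have "real n * \<tau> * e \<le> a * e" using t[OF nN] e(1) by (intro mult_right_mono) auto
    then have "ndist (q (real n * \<tau>)) (W n) \<le> \<eta> / 2" using qW[OF nN] e(2) by linarith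
    then have Q: "sq (\<lambda>x. \<tau> * (q (real n * \<tau>) x - W n x))" "nm (\<lambda>x. \<tau> * (q (real n * \<tau>) x - W n x)) \<le> \<tau> * (\<eta> / 2)"
     using qW[OF nN] \<tau>(1) unfolding nm_cmult by (auto intro: mult_left_mono)
    have eq: "(\<lambda>x. y (real (Suc n) * \<tau>) x - y (real n * \<tau>) x - \<tau> * kernel_conv \<beta> (deriv (z n)) x) =
     (\<lambda>x. (y (real (Suc n) * \<tau>) x - y (real n * \<tau>) x - \<tau> * q (real n * \<tau>) x) + \<tau> * (q (real n * \<tau>) x - W n x))"
     unfolding W_def by (intro ext) (simp add: algebra_simps)
    show "nm (\<lambda>x. y (real (Suc n) * \<tau>) x - y (real n * \<tau>) x - \<tau> * kernel_conv \<beta> (deriv (z n)) x) \<le> \<tau> * \<eta>"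
     unfolding eq using nm_triangle[OF Y(1) Q(1)] Y(2) Q(2) by (simp add: algebra_simps)
    have eq0: "(\<lambda>x. z (Suc n) x - z n x - \<tau> * deriv (flux p \<delta> (y (real n * \<tau>))) x) = (\<lambda>x. 0)"
     by (intro ext) (simp add: z_def F_def)
    show "nm (\<lambda>x. z (Suc n) x - z n x - \<tau> * deriv (flux p \<delta> (y (real n * \<tau>))) x) \<le> \<tau> * \<eta>"
     unfolding eq0 using \<tau>(1) \<eta> by simp
   qed
  qed
 qed
 then show ?thesis unfolding grid_solution_def by blast
qed

text \<open>For \<open>s < t\<close> the estimate at base point \<open>s\<close> is moved to base
  point \<open>t\<close>. The directions differ by at most \<open>L * (t - s)\<close>, and this is
  multiplied by \<open>t - s\<close>. Two-sided derivatives need this case.\<close>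

lemma quadratic_symmetric:
 assumes bs: "!!t. t \<in> {0..a} ==> bsob j (f t)" "!!t. t \<in> {0..a} ==> bsob j (g t)"
  and q: "!!t s. 0 \<le> t ==> t \<le> s ==> s \<le> a ==> bnorm j (\<lambda>x. f s x - f t x - (s - t) * g t x) \<le> C * (s - t)\<^sup>2"
  and l: "!!t s. 0 \<le> t ==> t \<le> s ==> s \<le> a ==> bdist j (g s) (g t) \<le> L * (s - t)"
  and L: "0 \<le> L" and t: "t \<in> {0..a}" and s: "s \<in> {0..a}"
 shows "bnorm j (\<lambda>x. f s x - f t x - (s - t) * g t x) \<le> (C + L) * (s - t)\<^sup>2"
proof (cases "t \<le> s")
 case True
 then have "bnorm j (\<lambda>x. f s x - f t x - (s - t) * g t x) \<le> C * (s - t)\<^sup>2" using q t s by simp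
 then show ?thesis using mult_nonneg_nonneg[OF L zero_le_power2[of "s - t"]] unfolding distrib_right by linarith
next
 case False
 have b: "bsob j (\<lambda>x. g t x - g s x)" "bsob j (\<lambda>x. f t x - f s x - (t - s) * g s x)"
  by (intro bsob_diff(1) bsob_cmult(1) bs s t)+
 have eq: "(\<lambda>x. f s x - f t x - (s - t) * g t x) = (\<lambda>x. (t - s) * (g t x - g s x) - (f t x - f s x - (t - s) * g s x))"
  by (intro ext) (simp add: algebra_simps)
 have 1: "bnorm j (\<lambda>x. (t - s) * (g t x - g s x)) \<le> (t - s) * (L * (t - s))"
 proof -
  have "(t - s) * bdist j (g t) (g s) \<le> (t - s) * (L * (t - s))"
   using l[of s t] False s t by (intro mult_left_mono) auto
  moreover have "\<bar>t - s\<bar> = t - s" using False by simp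
  ultimately show ?thesis using bsob_cmult(2)[OF b(1), of "t - s"] by (simp only:)
 qed
 have 2: "bnorm j (\<lambda>x. f t x - f s x - (t - s) * g s x) \<le> C * (t - s)\<^sup>2" using q[of s t] False s t by simp
 have e: "(C + L) * (s - t)\<^sup>2 = (t - s) * (L * (t - s)) + C * (t - s)\<^sup>2" by (simp add: power2_eq_square algebra_simps)
 show ?thesis unfolding eq e using bsob_diff(2)[OF bsob_cmult(1)[OF b(1), of "t - s"] b(2)] 1 2 by linarith
qed

lemma quadratic_imp_derivative:
 assumes bs: "!!t. t \<in> {0..a} ==> bsob j (f t)" "!!t. t \<in> {0..a} ==> bsob j (g t)"
  and q: "!!t s. t \<in> {0..a} ==> s \<in> {0..a} ==> bnorm j (\<lambda>x. f s x - f t x - (s - t) * g t x) \<le> B * (s - t)\<^sup>2"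
  and j: "1 \<le> j" and t: "t \<in> {0..a}"
 shows "((\<lambda>s. bnorm j (\<lambda>x. (f s x - f t x) / (s - t) - g t x)) \<longlongrightarrow> 0) (at t within {0..a})"
  "((\<lambda>s. f s x) has_real_derivative g t x) (at t within {0..a})"
proof -
 let ?q = "\<lambda>s x. (f s x - f t x) / (s - t) - g t x"
 have b: "bsob j (?q s)" if "s \<in> {0..a}" for s
  using bsob_diff(1)[OF bsob_cmult(1)[OF bsob_diff(1)[OF bs(1)[OF that] bs(1)[OF t]], of "1 / (s - t)"] bs(2)[OF t]] by simp
 have le: "bnorm j (?q s) \<le> B * \<bar>s - t\<bar>" if s: "s \<in> {0..a}" "s \<noteq> t" for s
 proof -
  have d: "bsob j (\<lambda>x. f s x - f t x - (s - t) * g t x)" by (intro bsob_diff(1) bsob_cmult(1) bs s t)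
  have eq: "?q s = (\<lambda>x. 1 / (s - t) * (f s x - f t x - (s - t) * g t x))" using s(2) by (intro ext) (simp add: field_simps)
  have "bnorm j (?q s) \<le> \<bar>1 / (s - t)\<bar> * (B * (s - t)\<^sup>2)"
   unfolding eq by (rule order_trans[OF bsob_cmult(2)[OF d]]) (intro mult_left_mono q t s; simp)
  also have "... = B * \<bar>s - t\<bar>"
  proof -
   define r where "r = \<bar>s - t\<bar>"
   have "r \<noteq> 0" "(s - t)\<^sup>2 = r * r" using s(2) by (simp_all add: r_def power2_eq_square)
   then show ?thesis by (simp add: abs_divide flip: r_def)
  qed
  finally show ?thesis .
 qed
 have lim: "((\<lambda>s. B * \<bar>s - t\<bar>) \<longlongrightarrow> 0) (at t within {0..a})"
  by (rule tendsto_eq_intros refl | simp)+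
 show 1: "((\<lambda>s. bnorm j (?q s)) \<longlongrightarrow> 0) (at t within {0..a})"
 proof (rule tendsto_sandwich[OF _ _ tendsto_const lim])
  show "\<forall>\<^sub>F s in at t within {0..a}. bnorm j (?q s) \<le> B * \<bar>s - t\<bar>"
   unfolding eventually_at using le by (intro exI[of _ 1]) auto
 qed auto
 have "((\<lambda>s. ?q s x) \<longlongrightarrow> 0) (at t within {0..a})"
 proof (rule Lim_null_comparison[OF _ 1])
  show "\<forall>\<^sub>F s in at t within {0..a}. norm (?q s x) \<le> bnorm j (?q s)"
   unfolding eventually_at real_norm_def using sup_le_bnorm'[OF b j] by (intro exI[of _ 1]) auto
 qed
 then show "((\<lambda>s. f s x) has_real_derivative g t x) (at t within {0..a})"
  unfolding has_field_derivative_iff by (rule LIM_zero_cancel)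
qed

lemma time_deriv_eq:
 assumes "0 < a" "t \<in> {0..a}" "((\<lambda>s. f s x) has_real_derivative d) (at t within {0..a})"
 shows "time_deriv a f t x = d"
 unfolding time_deriv_def
 by (rule vector_derivative_within_closed_interval) (use assms in \<open>auto simp: has_real_derivative_iff_has_vector_derivative\<close>)

lemma C0_sobolevI:
 assumes f: "!!t. t \<in> {0..a} ==> bsob k (f t)" and r: "r \<le> real k"
  and l: "!!t s. 0 \<le> t ==> t \<le> s ==> s \<le> a ==> bdist k (f s) (f t) \<le> L * (s - t)"
 shows "f \<in> C0_sobolev a r"
proof -
 have "((\<lambda>s. sobolev_norm r (\<lambda>x. f s x - f t x)) \<longlongrightarrow> 0) (at t within {0..a})" if t: "t \<in> {0..a}" for t
 proof (rule tendsto_sandwich[OF _ _ tendsto_const])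
  have le: "sobolev_norm r (\<lambda>x. f s x - f t x) \<le> sqrt (2 * pi) * 2 ^ k * (L * \<bar>s - t\<bar>)" if s: "s \<in> {0..a}" for s
  proof -
   have "bdist k (f s) (f t) \<le> L * \<bar>s - t\<bar>"
    using l[of t s] l[of s t] s t bnorm_minus_commute[OF f[OF s] f[OF t]] by (cases "t \<le> s") auto
   then have "sqrt (2 * pi) * 2 ^ k * bdist k (f s) (f t) \<le> sqrt (2 * pi) * 2 ^ k * (L * \<bar>s - t\<bar>)"
    by (intro mult_left_mono) auto
   then show ?thesis using bsob_sobolev(2)[OF bsob_diff(1)[OF f[OF s] f[OF t]] r] by linarith
  qed
  show "\<forall>\<^sub>F s in at t within {0..a}. sobolev_norm r (\<lambda>x. f s x - f t x) \<le> sqrt (2 * pi) * 2 ^ k * (L * \<bar>s - t\<bar>)"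
   unfolding eventually_at using le by (intro exI[of _ 1]) auto
  show "((\<lambda>s. sqrt (2 * pi) * 2 ^ k * (L * \<bar>s - t\<bar>)) \<longlongrightarrow> 0) (at t within {0..a})"
   by (rule tendsto_eq_intros refl | simp)+
 qed simp
 then show ?thesis unfolding C0_sobolev_def using bsob_sobolev(1)[OF f r] by auto
qed

lemma kernel_conv_deriv:
 assumes ker: "is_kernel \<beta>" and f: "bsob (Suc k) f"
 shows "bsob k (kernel_conv \<beta> (deriv f))" "bnorm k (kernel_conv \<beta> (deriv f)) \<le> kmass \<beta> * bnorm (Suc k) f"
proof -
 have d: "bsob k (deriv f)" by (rule bsob_SucD(3)[OF f])
 show "bsob k (kernel_conv \<beta> (deriv f))" by (rule bsob_kernel_conv(1)[OF ker d])
 have "kmass \<beta> * bnorm k (deriv f) \<le> kmass \<beta> * bnorm (Suc k) f"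
  using kmass_ge_1[of \<beta>] by (intro mult_left_mono bnorm_deriv_le) simp
 then show "bnorm k (kernel_conv \<beta> (deriv f)) \<le> kmass \<beta> * bnorm (Suc k) f"
  using bsob_kernel_conv(2)[OF ker d] by linarith
qed

lemma kernel_conv_deriv_diff:
 assumes ker: "is_kernel \<beta>" and f: "bsob (Suc k) f" and g: "bsob (Suc k) g"
 shows "kernel_conv \<beta> (deriv (\<lambda>x. f x - g x)) = (\<lambda>x. kernel_conv \<beta> (deriv f) x - kernel_conv \<beta> (deriv g) x)"
 unfolding deriv_diff_bsob[OF f g]
 by (rule kernel_conv_diff[OF ker bsob_bcl[OF bsob_SucD(3)[OF f]] bsob_bcl[OF bsob_SucD(3)[OF g]]])

section \<open>The solution for a fixed parameter\<close>

context
 fixes \<beta> :: kernel and C1 C2 :: real and p :: nat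
 assumes ker: "is_kernel \<beta>" and ell: "elliptic \<beta> C1 C2" and p: "1 \<le> p"
begin

text \<open>The first order system gives \<open>u\<^sub>t = w\<close> with
  \<open>w = K v\<^sub>x\<close> at order \<open>J\<close>. Applying K and one derivative to the
  Taylor estimate for \<open>v\<close> yields the Taylor estimate for \<open>w\<close>, one order
  lower, with the right hand side of the wave equation as direction. The bound depends on
  \<open>J\<close>, \<Lambda> and \<open>kmass \<beta>\<close>, but neither on \<epsilon> nor on
  \<open>a\<close>.\<close>

lemma wave_solution:
 fixes r \<epsilon> \<Lambda> a :: real and u0 v0 w0 :: "real => real" and J :: nat
 assumes J: "2 \<le> J" and r: "r \<le> real (Suc J)" "5 \<le> r" and \<Lambda>: "1 \<le> \<Lambda>"
  and \<delta>: "0 < \<epsilon> ^ p" "\<epsilon> ^ p \<le> 1" "\<epsilon> ^ p * growth \<beta> (Suc J + 2) p \<Lambda> \<le> 1 / 4" and a: "0 < a"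
  and SB: "!!h \<tau> n. [|0 < h; 0 < \<tau>; \<tau> \<le> 1; \<tau> \<le> \<epsilon> ^ p * h\<^sup>2; real n * \<tau> \<le> a|] ==>
    bpair (Suc J + 2) \<Lambda> (euler \<beta> p (\<epsilon> ^ p) h \<tau> u0 v0 n)"
  and v0: "bsob 2 v0" "kernel_conv \<beta> v0 = w0"
 shows "\<exists>u. u \<in> C0_sobolev a r \<inter> C1_sobolev a (r - 1) \<and>
  C0_C1_norm a r u \<le> sqrt (2 * pi) * 2 ^ Suc J * \<Lambda> + sqrt (2 * pi) * 2 ^ J * (kmass \<beta> * \<Lambda>) \<and>
  solves_nonlocal_wave \<beta> p \<epsilon> a u \<and> (\<forall>x. u 0 x = u0 x) \<and> (\<forall>x. time_deriv a u 0 x = deriv w0 x) \<and>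
  (\<forall>y. y \<in> C0_sobolev a r \<inter> C1_sobolev a (r - 1) \<and> solves_nonlocal_wave \<beta> p \<epsilon> a y \<and>
   (\<forall>x. y 0 x = u0 x) \<and> (\<forall>x. time_deriv a y 0 x = deriv w0 x) \<longrightarrow> (\<forall>t\<in>{0..a}. y t = u t))"
proof -
 have J1: "1 \<le> J" using J by simp
 \<comment> \<open>\<open>j\<close> is the order at which the velocity \<open>w\<close> is
   differentiated in time.\<close>
 obtain j where j: "J = Suc j" "1 \<le> j" using J by (cases J) auto
 have v0': "bsob (Suc 1) v0" using v0(1) by (simp only: Suc_1)
 have w0': "deriv w0 = kernel_conv \<beta> (deriv v0)" using bsob_kernel_conv(3)[OF ker v0'] v0(2) by simp
 have wave: "kernel_conv \<beta> (deriv (deriv (\<lambda>y. f y + \<epsilon> ^ p * f y ^ (p + 1)))) = kernel_conv \<beta> (deriv (deriv (flux p (\<epsilon> ^ p) f)))" for f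
  by (simp add: flux_def[abs_def])
 have K1: "0 \<le> kmass \<beta>" using kmass_ge_1[of \<beta>] by simp
 show ?thesis
 proof (rule euler_limit[OF ker ell p J1 \<Lambda> \<delta> a SB])
  fix u v C
  assume C: "0 \<le> C" and init: "u 0 = u0" "v 0 = v0"
   and uv: "!!t. t \<in> {0..a} ==> bsob (Suc J) (u t) \<and> bsob (Suc J) (v t) \<and> bnorm (Suc J) (u t) \<le> \<Lambda> \<and> bnorm (Suc J) (v t) \<le> \<Lambda>"
   and quad: "!!t t'. [|0 \<le> t; t \<le> t'; t' \<le> a|] ==>
    bnorm J (\<lambda>x. u t' x - u t x - (t' - t) * kernel_conv \<beta> (deriv (v t)) x) \<le> C * (t' - t)\<^sup>2 \<and>
    bnorm J (\<lambda>x. v t' x - v t x - (t' - t) * deriv (flux p (\<epsilon> ^ p) (u t)) x) \<le> C * (t' - t)\<^sup>2"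
   and lip: "!!t t'. [|0 \<le> t; t \<le> t'; t' \<le> a|] ==>
    bdist (Suc J) (u t') (u t) \<le> C * (t' - t) \<and> bdist (Suc J) (v t') (v t) \<le> C * (t' - t)"
   and uniq: "!!y M. [|y 0 = u0; !!x. continuous_on {0..a} (\<lambda>t. y t x); grid_solution \<beta> p (\<epsilon> ^ p) a v0 M y|] ==> \<forall>t\<in>{0..a}. y t = u t"
  define w where "w t = kernel_conv \<beta> (deriv (v t))" for t
  define F where "F t = deriv (flux p (\<epsilon> ^ p) (u t))" for t
  define g where "g t = kernel_conv \<beta> (deriv (F t))" for t
  have us: "bsob (Suc J) (u t)" "bsob (Suc J) (v t)" "bnorm (Suc J) (u t) \<le> \<Lambda>" "bnorm (Suc J) (v t) \<le> \<Lambda>"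
   "bsob J (u t)" "bsob J (v t)" if "t \<in> {0..a}" for t
   using uv[OF that] bsob_Suc by blast+
  have Fb: "bsob (Suc J) (flux p (\<epsilon> ^ p) (u t))" "bsob J (F t)" if "t \<in> {0..a}" for t
   using bsob_flux[OF us(1)[OF that]] bsob_SucD(3) unfolding F_def by blast+
  have wb: "bsob J (w t)" "bnorm J (w t) \<le> kmass \<beta> * \<Lambda>" if "t \<in> {0..a}" for t
   using kernel_conv_deriv[OF ker us(2)[OF that]] mult_left_mono[OF us(4)[OF that] K1] unfolding w_def by linarith+
  have gb: "bsob j (g t)" if "t \<in> {0..a}" for t
   unfolding g_def by (rule kernel_conv_deriv(1)[OF ker Fb(2)[OF that, unfolded j(1)]])
  have wl: "bdist J (w s) (w t) \<le> kmass \<beta> * C * (s - t)" if "0 \<le> t" "t \<le> s" "s \<le> a" for t s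
  proof -
   have t: "t \<in> {0..a}" "s \<in> {0..a}" using that by auto
   have "bdist J (w s) (w t) \<le> kmass \<beta> * bdist (Suc J) (v s) (v t)"
    using kernel_conv_deriv(2)[OF ker bsob_diff(1)[OF us(2)[OF t(2)] us(2)[OF t(1)]]]
    unfolding kernel_conv_deriv_diff[OF ker us(2)[OF t(2)] us(2)[OF t(1)]] w_def .
   also have "... \<le> kmass \<beta> * (C * (s - t))" using lip[OF that] K1 by (intro mult_left_mono) auto
   finally show ?thesis by (simp only: mult.assoc)
  qed
  have wl': "bdist j (w s) (w t) \<le> kmass \<beta> * C * (s - t)" if "0 \<le> t" "t \<le> s" "s \<le> a" for t s
   using order_trans[OF bnorm_Suc_mono wl[OF that, unfolded j(1)]] .
  obtain L where L: "0 \<le> L" "!!t s. 0 \<le> t ==> t \<le> s ==> s \<le> a ==> bdist j (g s) (g t) \<le> L * (s - t)"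
  proof (rule bnorm_flux_diff[where k = "Suc J" and \<Lambda> = \<Lambda> and p = p and \<delta> = "\<epsilon> ^ p"])
   fix CF assume CF: "1 \<le> CF" "!!u w. bsob (Suc J) u ==> bsob (Suc J) w ==> bnorm (Suc J) u \<le> \<Lambda> ==> bnorm (Suc J) w \<le> \<Lambda> ==>
    bdist (Suc J) (flux p (\<epsilon> ^ p) u) (flux p (\<epsilon> ^ p) w) \<le> CF * bdist (Suc J) u w"
   have "bdist j (g s) (g t) \<le> kmass \<beta> * (CF * C) * (s - t)" if ts: "0 \<le> t" "t \<le> s" "s \<le> a" for t s
   proof -
    have t: "t \<in> {0..a}" "s \<in> {0..a}" using ts by auto
    have b: "bsob (Suc j) (F t)" "bsob (Suc j) (F s)" using Fb(2)[OF t(1)] Fb(2)[OF t(2)] unfolding j(1) .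
    have "bdist J (F s) (F t) \<le> bdist (Suc J) (flux p (\<epsilon> ^ p) (u s)) (flux p (\<epsilon> ^ p) (u t))"
     using bnorm_deriv_le[of J "\<lambda>x. flux p (\<epsilon> ^ p) (u s) x - flux p (\<epsilon> ^ p) (u t) x"]
     unfolding deriv_diff_bsob[OF Fb(1)[OF t(2)] Fb(1)[OF t(1)]] F_def .
    also have "... \<le> CF * bdist (Suc J) (u s) (u t)" by (rule CF(2)[OF us(1)[OF t(2)] us(1)[OF t(1)] us(3)[OF t(2)] us(3)[OF t(1)]])
    also have "... \<le> CF * (C * (s - t))" using lip[OF ts] CF(1) by (intro mult_left_mono) auto
    finally have "kmass \<beta> * bdist (Suc j) (F s) (F t) \<le> kmass \<beta> * (CF * (C * (s - t)))"
     unfolding j(1) by (intro mult_left_mono K1)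
    then show ?thesis
     using kernel_conv_deriv(2)[OF ker bsob_diff(1)[OF b(2,1)]] unfolding kernel_conv_deriv_diff[OF ker b(2,1)] g_def
     by (simp only: mult.assoc)
   qed
   moreover have "0 \<le> kmass \<beta> * (CF * C)" using K1 CF(1) C by simp
   ultimately show thesis using that by blast
  qed simp
  have uq: "bnorm J (\<lambda>x. u s x - u t x - (s - t) * w t x) \<le> (C + kmass \<beta> * C) * (s - t)\<^sup>2" if "t \<in> {0..a}" "s \<in> {0..a}" for t s
   by (rule quadratic_symmetric[OF us(5) wb(1) _ wl _ that]) (use quad K1 C in \<open>simp_all add: w_def del: bnorm.simps\<close>)
  have wq: "bnorm j (\<lambda>x. w s x - w t x - (s - t) * g t x) \<le> (kmass \<beta> * C + L) * (s - t)\<^sup>2" if "t \<in> {0..a}" "s \<in> {0..a}" for t s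
  proof (rule quadratic_symmetric[OF _ gb _ L(2) L(1) that])
   show "bsob j (w t)" if "t \<in> {0..a}" for t using bsob_Suc wb(1)[OF that] unfolding j(1) by blast
   fix t s :: real assume ts: "0 \<le> t" "t \<le> s" "s \<le> a"
   have t: "t \<in> {0..a}" "s \<in> {0..a}" using ts by auto
   have V: "bsob (Suc j) (v t)" "bsob (Suc j) (v s)" "bsob (Suc j) (\<lambda>x. (s - t) * F t x)"
    using us(6)[OF t(1)] us(6)[OF t(2)] bsob_cmult(1)[OF Fb(2)[OF t(1)]] unfolding j(1) by blast+
   have Ft: "bsob (Suc j) (F t)" using Fb(2)[OF t(1)] unfolding j(1) .
   \<comment> \<open>Convolution after differentiation is linear, so it maps the Taylor remainder of
     \<open>v\<close> to that of \<open>w\<close>.\<close>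
   have eq: "(\<lambda>x. w s x - w t x - (s - t) * g t x) = kernel_conv \<beta> (deriv (\<lambda>x. v s x - v t x - (s - t) * F t x))"
    unfolding kernel_conv_deriv_diff[OF ker bsob_diff(1)[OF V(2,1)] V(3)] kernel_conv_deriv_diff[OF ker V(2,1)]
     bsob_cmult(3)[OF Ft] kernel_conv_cmult[OF ker] w_def g_def ..
   have "bnorm j (\<lambda>x. w s x - w t x - (s - t) * g t x) \<le> kmass \<beta> * bnorm J (\<lambda>x. v s x - v t x - (s - t) * F t x)"
    unfolding eq j(1) by (rule kernel_conv_deriv(2)[OF ker bsob_diff(1)[OF bsob_diff(1)[OF V(2,1)] V(3)]])
   also have "... \<le> kmass \<beta> * (C * (s - t)\<^sup>2)" using quad[OF ts] K1 unfolding F_def by (intro mult_left_mono) auto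
   finally show "bnorm j (\<lambda>x. w s x - w t x - (s - t) * g t x) \<le> kmass \<beta> * C * (s - t)\<^sup>2" by (simp only: mult.assoc)
  qed
  have td: "time_deriv a u t = w t" if t: "t \<in> {0..a}" for t
   by (intro ext time_deriv_eq[OF a t] quadratic_imp_derivative(2)[OF us(5) wb(1) uq J1 t])
  have r1: "r - 1 \<le> real J" "r - 1 \<le> real (Suc J)" using r(1) by simp_all
  have lu: "bdist (Suc J) (u s) (u t) \<le> C * (s - t)" if "0 \<le> t" "t \<le> s" "s \<le> a" for t s using lip[OF that] by blast
  have u0r: "u \<in> C0_sobolev a r" "u \<in> C0_sobolev a (r - 1)"
   by (rule C0_sobolevI[OF us(1) r(1) lu] C0_sobolevI[OF us(1) r1(2) lu]; assumption)+
  have tdr: "time_deriv a u \<in> C0_sobolev a (r - 1)"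
  proof (rule C0_sobolevI[OF _ r1(1)])
   show "bsob J (time_deriv a u t)" if "t \<in> {0..a}" for t using wb(1)[OF that] td[OF that] by simp
   show "bdist J (time_deriv a u s) (time_deriv a u t) \<le> kmass \<beta> * C * (s - t)" if "0 \<le> t" "t \<le> s" "s \<le> a" for t s
    using wl[OF that] td[of t] td[of s] that by simp
  qed
  have "((\<lambda>s. sobolev_norm (r - 1) (\<lambda>x. (u s x - u t x) / (s - t) - time_deriv a u t x)) \<longlongrightarrow> 0) (at t within {0..a})"
   if t: "t \<in> {0..a}" for t
  proof (rule tendsto_sandwich[OF _ _ tendsto_const
     tendsto_mult_right_zero[OF quadratic_imp_derivative(1)[OF us(5) wb(1) uq J1 t], of "sqrt (2 * pi) * 2 ^ J"]])
   have "sobolev_norm (r - 1) (\<lambda>x. (u s x - u t x) / (s - t) - w t x)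
     \<le> sqrt (2 * pi) * 2 ^ J * bnorm J (\<lambda>x. (u s x - u t x) / (s - t) - w t x)" if s: "s \<in> {0..a}" for s
    using bsob_sobolev(2)[OF bsob_diff(1)[OF bsob_cmult(1)[OF bsob_diff(1)[OF us(5)[OF s] us(5)[OF t]], of "1 / (s - t)"] wb(1)[OF t]] r1(1)]
    by (simp del: bnorm.simps)
   then show "\<forall>\<^sub>F s in at t within {0..a}. sobolev_norm (r - 1) (\<lambda>x. (u s x - u t x) / (s - t) - time_deriv a u t x)
     \<le> sqrt (2 * pi) * 2 ^ J * bnorm J (\<lambda>x. (u s x - u t x) / (s - t) - w t x)"
    unfolding eventually_at td[OF t] by (intro exI[of _ 1]) auto
  qed auto
  then have u1r: "u \<in> C1_sobolev a (r - 1)" using u0r tdr unfolding C1_sobolev_def by blast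
  have bound: "C0_C1_norm a r u \<le> sqrt (2 * pi) * 2 ^ Suc J * \<Lambda> + sqrt (2 * pi) * 2 ^ J * (kmass \<beta> * \<Lambda>)"
   unfolding C0_C1_norm_def
  proof (rule cSUP_least)
   show "{0..a} \<noteq> {}" using a by simp
   fix t assume t: "t \<in> {0..a}"
   have "sqrt (2 * pi) * 2 ^ Suc J * bnorm (Suc J) (u t) \<le> sqrt (2 * pi) * 2 ^ Suc J * \<Lambda>"
    "sqrt (2 * pi) * 2 ^ J * bnorm J (w t) \<le> sqrt (2 * pi) * 2 ^ J * (kmass \<beta> * \<Lambda>)"
    using us(3)[OF t] wb(2)[OF t] by (intro mult_left_mono; simp del: bnorm.simps)+
   then show "sobolev_norm r (u t) + sobolev_norm (r - 1) (time_deriv a u t) \<le> sqrt (2 * pi) * 2 ^ Suc J * \<Lambda> + sqrt (2 * pi) * 2 ^ J * (kmass \<beta> * \<Lambda>)"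
    unfolding td[OF t] using bsob_sobolev(2)[OF us(1)[OF t] r(1)] bsob_sobolev(2)[OF wb(1)[OF t] r1(1)] by linarith
  qed
  have sol: "solves_nonlocal_wave \<beta> p \<epsilon> a u"
   unfolding solves_nonlocal_wave_def wave
  proof (intro allI ballI)
   fix x t assume t: "t \<in> {0..a}"
   have wj: "bsob j (w t)" if "t \<in> {0..a}" for t using bsob_Suc wb(1)[OF that] unfolding j(1) by blast
   have d: "((\<lambda>s. w s x) has_real_derivative g t x) (at t within {0..a})"
    by (rule quadratic_imp_derivative(2)[OF wj gb wq j(2) t])
   have "((\<lambda>s. time_deriv a u s x) has_real_derivative g t x) (at t within {0..a})"
    by (rule has_field_derivative_transform_within[OF d zero_less_one t]) (simp add: td)
   then show "((\<lambda>s. time_deriv a u s x) has_real_derivative kernel_conv \<beta> (deriv (deriv (flux p (\<epsilon> ^ p) (u t)))) x) (at t within {0..a})"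
    unfolding g_def F_def .
  qed
  have z: "0 \<in> {0..a}" using a by simp
  have unique: "\<forall>t\<in>{0..a}. y t = u t" if y: "y \<in> C0_sobolev a r" "y \<in> C1_sobolev a (r - 1)" "solves_nonlocal_wave \<beta> p \<epsilon> a y"
   "\<forall>x. y 0 x = u0 x" "\<forall>x. time_deriv a y 0 x = deriv w0 x" for y
  proof -
   \<comment> \<open>A competitor of order \<open>r\<close> is a curve of order 3 and its time
     derivative is one of order 1, as \<open>grid_solution_exact\<close> asks.\<close>
   have r2: "2 \<le> r - 1" "real 3 + 1 \<le> r" "real 1 + 1 \<le> r - 1" using r(2) by simp_all
   have yd: "((\<lambda>s. y s x) has_real_derivative time_deriv a y t x) (at t within {0..a})" if "t \<in> {0..a}" for t x
    by (rule C1_sobolev_has_derivative[OF y(2) r2(1) that])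
   have q: "time_deriv a y \<in> C0_sobolev a (r - 1)" using y(2) by (simp add: C1_sobolev_def)
   have qd: "((\<lambda>s. time_deriv a y s x) has_real_derivative kernel_conv \<beta> (deriv (deriv (flux p (\<epsilon> ^ p) (y t)))) x) (at t within {0..a})"
    if "t \<in> {0..a}" for t x using y(3) that unfolding solves_nonlocal_wave_def wave by blast
   have q0: "time_deriv a y 0 = kernel_conv \<beta> (deriv v0)" using y(5) unfolding w0'[symmetric] by (intro ext) simp
   have "\<exists>M. grid_solution \<beta> p (\<epsilon> ^ p) a v0 M y"
    by (rule grid_solution_exact[OF ker less_imp_le[OF a] C0_sobolev_curve[OF y(1) r2(2)] C0_sobolev_curve[OF q r2(3)] v0(1) yd qd q0])
   then obtain M where M: "grid_solution \<beta> p (\<epsilon> ^ p) a v0 M y" ..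
   have y0: "y 0 = u0" using y(4) by (intro ext) simp
   have "continuous_on {0..a} (\<lambda>t. y t x)" for x
    using DERIV_continuous_on[of "{0..a}" "\<lambda>t. y t x" "\<lambda>t. time_deriv a y t x"] yd by blast
   then show ?thesis using uniq[OF y0 _ M] by blast
  qed
  show ?thesis
  proof (intro exI[of _ u] conjI IntI u0r(1) u1r bound sol)
   show "\<forall>x. u 0 x = u0 x" "\<forall>x. time_deriv a u 0 x = deriv w0 x"
    using init td[OF z] w0' by (simp_all add: w_def)
  qed (intro allI impI, elim conjE IntE, rule unique)
 qed
qed

end

section \<open>Uniformity in the parameter\<close>

theorem theorem5p2:
  fixes s0 s D P C1 C2 :: real
    and p :: nat
    and \<beta> :: kernel
    and I :: "real set"
    and u0 w0 :: "real \<Rightarrow> real \<Rightarrow> real"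
  assumes "s0 > 1 / 2"
    and "p \<ge> 1"
    and "is_kernel \<beta>"
    and "elliptic \<beta> C1 C2"
    and "D > 3"
    and "P > 3 + D / (D - 3) * (sqrt 3 + sqrt (2 * D))\<^sup>2"
    and "s \<ge> s0 + 3"
    and "is_interval I" "I \<noteq> {}" "I \<subseteq> {0<..}" "Inf I = 0"
    and "\<And>\<epsilon>. \<epsilon> \<in> I \<Longrightarrow> u0 \<epsilon> \<in> sobolev (s + P) \<and> w0 \<epsilon> \<in> sobolev (s + P)"
    and "\<exists>M. \<forall>\<epsilon>\<in>I. sobolev_norm (s + P) (u0 \<epsilon>) \<le> M \<and> sobolev_norm (s + P) (w0 \<epsilon>) \<le> M"
  shows "\<exists>\<epsilon>0 T. \<epsilon>0 > 0 \<and> T > 0 \<and> {0<..<\<epsilon>0} \<subseteq> I \<and>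
           (\<exists>u. bounded_solution_family \<beta> p (s + D) u0 w0 \<epsilon>0 T u \<and>
                (\<forall>v. bounded_solution_family \<beta> p (s + D) u0 w0 \<epsilon>0 T v \<longrightarrow>
                     (\<forall>\<epsilon>\<in>{0<..<\<epsilon>0}. \<forall>t\<in>{0..T / \<epsilon> ^ p}. v \<epsilon> t = u \<epsilon> t)))"
proof -
 note p = assms(2) and ker = assms(3) and ell = assms(4)
 define r where "r = s + D"
 \<comment> \<open>Rounding up to an integer order costs less than one derivative.\<close>
 define J where "J = nat \<lceil>r\<rceil>"
 have r: "13 / 2 < r" using assms(1,5,7) by (simp add: r_def)
 have Jr: "r \<le> real J" "real J < r + 1" unfolding J_def using r by linarith+
 have J: "2 \<le> J" using Jr(1) r by linarith
 have k2: "2 \<le> Suc J + 2" "1 \<le> Suc J + 2" by simp_all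
 \<comment> \<open>The quotient \<open>D / (D - 3)\<close> is at least 1 and the square at least
   \<open>3 + 2 * D\<close>, so \<open>P - D\<close> exceeds \<open>6 + D\<close>, which is more
   than 9.\<close>
 have P: "r + 9 \<le> s + P"
 proof -
  have "3 + 2 * D \<le> (sqrt 3 + sqrt (2 * D))\<^sup>2" using assms(5) by (simp add: power2_sum)
  moreover have "1 \<le> D / (D - 3)" using assms(5) by (simp add: field_simps)
  ultimately have "1 * (3 + 2 * D) \<le> D / (D - 3) * (sqrt 3 + sqrt (2 * D))\<^sup>2" using assms(5) by (intro mult_mono) auto
  then show ?thesis using assms(5,6) by (simp add: r_def)
 qed
 \<comment> \<open>The scheme carries order \<open>Suc J + 2\<close>; the inversion of the kernel on
   \<open>w0\<close> spends two more orders, and the passage from Sobolev norms to classical ones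
   spends one.\<close>
 have lev: "real (Suc J + 2) + 1 \<le> s + P" "real (Suc J + 2 + 2) + 1 \<le> s + P" using Jr(2) P by simp_all
 obtain M where M: "!!\<epsilon>. \<epsilon> \<in> I ==> sobolev_norm (s + P) (u0 \<epsilon>) \<le> M" "!!\<epsilon>. \<epsilon> \<in> I ==> sobolev_norm (s + P) (w0 \<epsilon>) \<le> M"
  using assms(13) by blast
 show ?thesis
 proof (rule kernel_conv_inverse[OF ker ell])
  fix Ci assume Ci: "0 \<le> Ci" and inv: "!!k w. bsob (k + 2) w ==> 1 \<le> k ==>
   \<exists>v. bsob k v \<and> kernel_conv \<beta> v = w \<and> bnorm k v \<le> Ci * bnorm (k + 2) w"
  \<comment> \<open>Bounds the data of the first order system for all \<epsilon> in \<open>I\<close>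
    at once.\<close>
  define \<Lambda>0 where "\<Lambda>0 = real (Suc (Suc J + 2)) * M + Ci * (real (Suc (Suc J + 2 + 2)) * M)"
  have "\<exists>v. bsob (Suc J + 2) v \<and> kernel_conv \<beta> v = w0 \<epsilon> \<and> bnorm (Suc J + 2) (u0 \<epsilon>) + bnorm (Suc J + 2) v \<le> \<Lambda>0" if \<epsilon>: "\<epsilon> \<in> I" for \<epsilon>
  proof -
   have S: "u0 \<epsilon> \<in> sobolev (s + P)" "w0 \<epsilon> \<in> sobolev (s + P)" using assms(12)[OF \<epsilon>] by auto
   obtain v where v: "bsob (Suc J + 2) v" "kernel_conv \<beta> v = w0 \<epsilon>" "bnorm (Suc J + 2) v \<le> Ci * bnorm (Suc J + 2 + 2) (w0 \<epsilon>)"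
    using inv[OF sobolev_bsob(1)[OF S(2) lev(2)] k2(2)] by blast
   have "bnorm (Suc J + 2 + 2) (w0 \<epsilon>) \<le> real (Suc (Suc J + 2 + 2)) * M" "bnorm (Suc J + 2) (u0 \<epsilon>) \<le> real (Suc (Suc J + 2)) * M"
    using sobolev_bsob(2)[OF S(2) lev(2)] sobolev_bsob(2)[OF S(1) lev(1)]
     mult_left_mono[OF M(2)[OF \<epsilon>], of "real (Suc (Suc J + 2 + 2))"] mult_left_mono[OF M(1)[OF \<epsilon>], of "real (Suc (Suc J + 2))"] by linarith+
   then have "bnorm (Suc J + 2) (u0 \<epsilon>) + bnorm (Suc J + 2) v \<le> \<Lambda>0"
    using v(3) mult_left_mono[OF _ Ci] unfolding \<Lambda>0_def by (meson add_mono order_trans)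
   then show ?thesis using v by blast
  qed
  then obtain v0 where v0: "!!\<epsilon>. \<epsilon> \<in> I ==> bsob (Suc J + 2) (v0 \<epsilon>)" "!!\<epsilon>. \<epsilon> \<in> I ==> kernel_conv \<beta> (v0 \<epsilon>) = w0 \<epsilon>"
   "!!\<epsilon>. \<epsilon> \<in> I ==> bnorm (Suc J + 2) (u0 \<epsilon>) + bnorm (Suc J + 2) (v0 \<epsilon>) \<le> \<Lambda>0" by metis
  show ?thesis
  proof (rule euler_bound[OF ker ell p k2(1), where ?\<Lambda>0.0 = \<Lambda>0])
   fix \<Lambda> \<delta>0 T :: real
   assume \<Lambda>: "1 \<le> \<Lambda>" and \<delta>0: "0 < \<delta>0" "\<delta>0 \<le> 1" and T: "0 < T" and gr: "\<delta>0 * growth \<beta> (Suc J + 2) p \<Lambda> \<le> 1 / 4"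
    and EB: "!!\<delta> h \<tau> u0 v0 n. [|0 < \<delta>; \<delta> \<le> \<delta>0; 0 < h; 0 < \<tau>; \<tau> \<le> 1; \<tau> \<le> \<delta> * h\<^sup>2; bsob (Suc J + 2) u0; bsob (Suc J + 2) v0;
    bnorm (Suc J + 2) u0 + bnorm (Suc J + 2) v0 \<le> \<Lambda>0; real n * \<tau> * \<delta> \<le> T|] ==>
    bpair (Suc J + 2) \<Lambda> (euler \<beta> p \<delta> h \<tau> u0 v0 n)"
   obtain \<epsilon>1 where \<epsilon>1: "\<epsilon>1 \<in> I" using assms(9) by blast
   \<comment> \<open>From \<open>\<epsilon> < \<delta>0 \<le> 1\<close> follows
     \<open>\<epsilon> ^ p \<le> \<delta>0\<close>, while \<open>\<epsilon>1\<close> keeps the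
     parameters inside \<open>I\<close>.\<close>
   define \<epsilon>0 where "\<epsilon>0 = min \<delta>0 \<epsilon>1"
   have \<epsilon>0: "0 < \<epsilon>0" using \<epsilon>1 assms(10) \<delta>0 by (auto simp: \<epsilon>0_def)
   have sub: "{0<..<\<epsilon>0} \<subseteq> I"
   proof
    fix \<epsilon> assume \<epsilon>: "\<epsilon> \<in> {0<..<\<epsilon>0}"
    \<comment> \<open>As the infimum is 0, some member of \<open>I\<close> lies below \<epsilon>,
      and \<open>\<epsilon>1\<close> lies above; an interval contains what is between.\<close>
    then have "Inf I < \<epsilon>" using assms(11) by simp
    then obtain y where y: "y \<in> I" "y < \<epsilon>" using cInf_lessD[OF assms(9)] by blast
    have "\<epsilon> \<le> \<epsilon>1" using \<epsilon> by (simp add: \<epsilon>0_def)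
    then show "\<epsilon> \<in> I" by (rule mem_is_interval_1_I[OF assms(8) y(1) \<epsilon>1 less_imp_le[OF y(2)]])
   qed
   define B where "B = sqrt (2 * pi) * 2 ^ Suc J * \<Lambda> + sqrt (2 * pi) * 2 ^ J * (kmass \<beta> * \<Lambda>)"
   have "\<exists>u. u \<in> C0_sobolev (T / \<epsilon> ^ p) r \<inter> C1_sobolev (T / \<epsilon> ^ p) (r - 1) \<and> C0_C1_norm (T / \<epsilon> ^ p) r u \<le> B \<and>
    solves_nonlocal_wave \<beta> p \<epsilon> (T / \<epsilon> ^ p) u \<and> (\<forall>x. u 0 x = u0 \<epsilon> x) \<and> (\<forall>x. time_deriv (T / \<epsilon> ^ p) u 0 x = deriv (w0 \<epsilon>) x) \<and>
    (\<forall>y. y \<in> C0_sobolev (T / \<epsilon> ^ p) r \<inter> C1_sobolev (T / \<epsilon> ^ p) (r - 1) \<and> solves_nonlocal_wave \<beta> p \<epsilon> (T / \<epsilon> ^ p) y \<and>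
     (\<forall>x. y 0 x = u0 \<epsilon> x) \<and> (\<forall>x. time_deriv (T / \<epsilon> ^ p) y 0 x = deriv (w0 \<epsilon>) x) \<longrightarrow> (\<forall>t\<in>{0..T / \<epsilon> ^ p}. y t = u t))"
    if \<epsilon>: "\<epsilon> \<in> {0<..<\<epsilon>0}" for \<epsilon>
   proof -
    have \<epsilon>I: "\<epsilon> \<in> I" using sub \<epsilon> by blast
    have e: "0 < \<epsilon>" "\<epsilon> \<le> \<delta>0" "\<epsilon> \<le> 1" using \<epsilon> \<delta>0 by (auto simp: \<epsilon>0_def)
    have d: "0 < \<epsilon> ^ p" "\<epsilon> ^ p \<le> \<delta>0" "\<epsilon> ^ p \<le> 1"
     using e power_decreasing[OF p, of \<epsilon>] by auto
    have g: "\<epsilon> ^ p * growth \<beta> (Suc J + 2) p \<Lambda> \<le> 1 / 4"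
     using mult_right_mono[OF d(2) growth_nonneg[OF ker ell p, of \<Lambda> "Suc J + 2"]] \<Lambda> gr by simp
    have a: "0 < T / \<epsilon> ^ p" using T d(1) by simp
    have r': "r \<le> real (Suc J)" "5 \<le> r" using Jr(1) r by simp_all
    have b2: "bsob 2 (v0 \<epsilon>)" by (rule bsob_mono[OF v0(1)[OF \<epsilon>I]]) simp
    show ?thesis unfolding B_def
    proof (rule wave_solution[OF ker ell p J r' \<Lambda> d(1,3) g a _ b2 v0(2)[OF \<epsilon>I]])
     fix h \<tau> :: real and n :: nat
     assume h: "0 < h" "0 < \<tau>" "\<tau> \<le> 1" "\<tau> \<le> \<epsilon> ^ p * h\<^sup>2" "real n * \<tau> \<le> T / \<epsilon> ^ p"
     have n: "real n * \<tau> * \<epsilon> ^ p \<le> T" using h(5) d(1) by (simp add: pos_le_divide_eq)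
     show "bpair (Suc J + 2) \<Lambda> (euler \<beta> p (\<epsilon> ^ p) h \<tau> (u0 \<epsilon>) (v0 \<epsilon>) n)"
      by (rule EB[OF d(1,2) h(1-4) _ v0(1)[OF \<epsilon>I] v0(3)[OF \<epsilon>I] n])
       (use assms(12)[OF \<epsilon>I] sobolev_bsob(1)[OF _ lev(1)] in blast)
    qed
   qed
   then obtain u where u: "\<forall>\<epsilon>\<in>{0<..<\<epsilon>0}. u \<epsilon> \<in> C0_sobolev (T / \<epsilon> ^ p) r \<inter> C1_sobolev (T / \<epsilon> ^ p) (r - 1) \<and> C0_C1_norm (T / \<epsilon> ^ p) r (u \<epsilon>) \<le> B \<and>
    solves_nonlocal_wave \<beta> p \<epsilon> (T / \<epsilon> ^ p) (u \<epsilon>) \<and> (\<forall>x. u \<epsilon> 0 x = u0 \<epsilon> x) \<and> (\<forall>x. time_deriv (T / \<epsilon> ^ p) (u \<epsilon>) 0 x = deriv (w0 \<epsilon>) x) \<and>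
    (\<forall>y. y \<in> C0_sobolev (T / \<epsilon> ^ p) r \<inter> C1_sobolev (T / \<epsilon> ^ p) (r - 1) \<and> solves_nonlocal_wave \<beta> p \<epsilon> (T / \<epsilon> ^ p) y \<and>
     (\<forall>x. y 0 x = u0 \<epsilon> x) \<and> (\<forall>x. time_deriv (T / \<epsilon> ^ p) y 0 x = deriv (w0 \<epsilon>) x) \<longrightarrow> (\<forall>t\<in>{0..T / \<epsilon> ^ p}. y t = u \<epsilon> t))"
    by metis
   show ?thesis unfolding r_def[symmetric]
   proof (rule exI[of _ \<epsilon>0], rule exI[of _ T], intro conjI \<epsilon>0 T sub exI[of _ u] allI impI ballI)
    show "bounded_solution_family \<beta> p r u0 w0 \<epsilon>0 T u"
     unfolding bounded_solution_family_def using u by blast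
    fix v \<epsilon> t assume v: "bounded_solution_family \<beta> p r u0 w0 \<epsilon>0 T v" and \<epsilon>: "\<epsilon> \<in> {0<..<\<epsilon>0}" and t: "t \<in> {0..T / \<epsilon> ^ p}"
    show "v \<epsilon> t = u \<epsilon> t" using bspec[OF u \<epsilon>] v \<epsilon> t unfolding bounded_solution_family_def by blast
   qed
  qed
 qed
qed

end
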